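(* Let $(\Lambda,\le)$ be a directed poset and let $(X,\Sigma,\mu)$ be a locally measure space. For each $p\in X$ assign a quantized domain $\{\mathcal{H}_p;\ \mathcal{E}_p=\{\mathcal{H}_{\alpha,p}\}_{\alpha\in\Lambda};\ \mathcal{D}_p\}$, and let $\mathcal{D}=\int^{\oplus_{\mathrm{loc}}}_{X_{\mathrm{loc}}}\mathcal{D}_p\,\mathrm{d}\mu(p)$. Suppose that either $\Lambda$ is a countable set or $\mu$ is the counting measure on $X$. Then: (a) the set $C^\ast_{\mathcal{E},\mathrm{DEC}}(\mathcal{D})$ of all decomposable locally bounded operators on $\mathcal{D}$ is a locally von Neumann algebra; (b) the set $C^\ast_{\mathcal{E},\mathrm{DIAG}}(\mathcal{D})$ of all diagonalizable locally bounded operators on $\mathcal{D}$ is an abelian locally von Neumann algebra.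
   Context: Throughout, $(\Lambda,\le)$ is a directed poset. Locally Hilbert space and quantized domain: a strictly inductive system of Hilbert spaces is a family $\{\mathcal{H}_\alpha\}_{\alpha\in\Lambda}$ of Hilbert spaces such that for $\alpha\le\beta$ one has $\mathcal{H}_\alpha\subseteq\mathcal{H}_\beta$ with isometric inclusion. A locally Hilbert space is the union $\mathcal{D}=\varinjlim_\alpha\mathcal{H}_\alpha=\bigcup_\alpha\mathcal{H}_\alpha$ of such a system. A quantized domain $\{\mathcal{H};\mathcal{F}=\{\mathcal{H}_\alpha\}_{\alpha\in\Lambda};\mathcal{D}\}$ consists of a strictly inductive system $\mathcal{F}$, its union $\mathcal{D}$, and the Hilbert space completion $\mathcal{H}=\overline{\mathcal{D}}$. Locally bounded operators: for a quantized domain $\{\mathcal{H};\mathcal{F}=\{\mathcal{H}_\alpha\}_{\alpha\in\Lambda};\mathcal{D}\}$, $C^\ast_{\mathcal{F}}(\mathcal{D})$ is the set of linear operators $T:\mathcal{D}\to\mathcal{D}$ such that for each $\alpha$: $T(\mathcal{H}_\alpha)\subseteq\mathcal{H}_\alpha$, $T(\mathcal{H}_\alpha^\perp\cap\mathcal{D})\subseteq\mathcal{H}_\alpha^\perp\cap\mathcal{D}$ and $T|_{\mathcal{H}_\alpha}$ is bounded. It is a unital $\ast$-algebra (with $T^\ast$ the restriction to $\mathcal{D}$ of the Hilbert space adjoint), and a locally $C^\ast$-algebra for the topology given by the $C^\ast$-seminorms $T\mapsto\|T|_{\mathcal{H}_\alpha}\|$, $\alpha\in\Lambda$. Locally von Neumann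 algebra: an algebra that is the projective limit of a projective system of von Neumann algebras. For $\ast$-subalgebras of $C^\ast_{\mathcal{F}}(\mathcal{D})$, this is known to coincide with being a unital (same unit) locally $C^\ast$-algebra contained in $C^\ast_{\mathcal{F}}(\mathcal{D})$ that is closed in the strong operator topology, i.e. the topology given by the seminorms $T\mapsto\|Tu\|$, $u\in\mathcal{D}$. Locally measure space: let $\{(X_\alpha,\Sigma_\alpha,\mu_\alpha)\}_{\alpha\in\Lambda}$ be measure spaces such that for $\alpha\le\beta$: $X_\alpha\subseteq X_\beta$, $\Sigma_\alpha=\{E\cap X_\alpha:E\in\Sigma_\beta\}$ and $\Sigma_\alpha\subseteq\Sigma_\beta$, and $\mu_\alpha(E)=\mu_\beta(E)$ for all $E\in\Sigma_\alpha$. Put $X=\bigcup_\alpha X_\alpha$, $\Sigma=\{E\subseteq X: E\cap X_\alpha\in\Sigma_\alpha\ \forall\alpha\}$, and $\mu(E)=\lim_\alpha\mu_\alpha(E\cap X_\alpha)$ if this net converges, $\mu(E)=\infty$ otherwise. Then $(X,\Sigma,\mu)$ is a measure space, called a locally measure space. Standing assumption: each $X_\alpha$ is a $\sigma$-compact locally compact space, $\Sigma_\alpha$ is a Borel $\sigma$-algebra on $X_\alpha$, and $\mu_\alpha$ is the completion of a positive Borel measure on $X_\alpha$. Direct integral of locally Hilbert spaces: given quantized domains $\{\mathcal{H}_p;\mathcal{E}_p=\{\mathcal{H}_{\alpha,p}\}_{\alpha\in\Lambda};\mathcal{D}_p\}$, $p\in X$, the direct integral $\int^{\oplus_{\mathrm{loc}}}_{X_{\mathrm{loc}}}\mathcal{D}_p\,\mathrm{d}\mu(p)$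 is a space $\mathcal{D}$ of maps $u:X\to\bigcup_{p}\mathcal{D}_p$ with $u(p)\in\mathcal{D}_p$ for all $p$ (maps agreeing $\mu$-a.e. are identified), such that: (1) for each $u\in\mathcal{D}$ there is $\alpha_u\in\Lambda$ with $u(p)\in\mathcal{H}_{\alpha_u,p}$ for a.e. $p\in X_{\alpha_u}$ and $\mathrm{supp}(u):=\{p:u(p)\ne0\}\subseteq X_{\alpha_u}$; (2) for all $u,v\in\mathcal{D}$ the function $\zeta_{u,v}(p):=\langle u(p),v(p)\rangle_{\mathcal{D}_p}$ belongs to $L^1(X,\mu)$; (3) if $v:X\to\bigcup_p\mathcal{D}_p$ is such that there exists $\alpha\in\Lambda$ with $v(p)\in\mathcal{H}_{\alpha,p}$ for all $p\in X_\alpha$ and $v(p)=0$ for all $p\in X\setminus X_\alpha$, and if $\zeta_{u,v}\in L^1(X,\mu)$ for every $u\in\mathcal{D}$, then $v\in\mathcal{D}$. For $\alpha\in\Lambda$ put $\mathcal{H}_\alpha:=\{u\in\mathcal{D}: u(p)\in\mathcal{H}_{\alpha,p}\text{ for a.e. }p\in X_\alpha,\ \mathrm{supp}(u)\subseteq X_\alpha\}$ with $\langle u,v\rangle_{\mathcal{H}_\alpha}=\int_{X_\alpha}\langle u(p),v(p)\rangle\,\mathrm{d}\mu_\alpha$. These form a strictly inductive system of Hilbert spaces with union $\mathcal{D}$, giving the quantized domain $\{\overline{\mathcal{D}};\mathcal{E}=\{\mathcal{H}_\alpha\}_{\alpha\in\Lambda};\mathcal{D}\}$. Each $\mathcal{H}_\alpha$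 is identified, by restricting maps to $X_\alpha$, with the Hilbert space direct integral $\int^\oplus_{X_\alpha}\mathcal{H}_{\alpha,p}\,\mathrm{d}\mu_\alpha(p)$ in the sense of Kadison–Ringrose (Definition 14.1.1), a notion in which the fibres $\mathcal{H}_{\alpha,p}$ and the direct integral are separable Hilbert spaces. Decomposable and diagonalizable operators: $T\in C^\ast_{\mathcal{E}}(\mathcal{D})$ is decomposable if there is a family $\{T_p\in C^\ast_{\mathcal{E}_p}(\mathcal{D}_p)\}_{p\in X}$ such that for every $u\in\mathcal{D}$, $(Tu)(p)=T_pu(p)$ for $\mu$-a.e. $p$. It is diagonalizable if it is decomposable and there is a measurable $f:X\to\mathbb{C}$ such that for every $u\in\mathcal{D}$, $(Tu)(p)=f(p)u(p)$ for $\mu$-a.e. $p$. The sets of all such operators are $C^\ast_{\mathcal{E},\mathrm{DEC}}(\mathcal{D})$ and $C^\ast_{\mathcal{E},\mathrm{DIAG}}(\mathcal{D})$ respectively, with the operations and seminorms inherited from $C^\ast_{\mathcal{E}}(\mathcal{D})$. *)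

theory Defs
  imports "HOL-Analysis.Analysis" "HOL-Algebra.Module"
begin

section \<open>Complex inner product spaces on explicit carriers\<close>

definition complex_ring :: "complex ring" where
  "complex_ring = \<lparr>carrier = UNIV, mult = (*), one = 1, zero = 0, add = (+)\<rparr>"

text \<open>The fields \<open>mult\<close> and \<open>one\<close> that the library's record of modules inherits from rings
  play no role.\<close>

record 'a ip_space = "(complex, 'a) module" +
  ip :: "'a \<Rightarrow> 'a \<Rightarrow> complex"

locale inner_product_space = Module.module complex_ring V for V :: "'a ip_space" +
  assumes ip_add_left: "\<lbrakk>x \<in> carrier V; y \<in> carrier V; z \<in> carrier V\<rbrakk>
      \<Longrightarrow> ip V (x \<oplus>\<^bsub>V\<^esub> y) z = ip V x z + ip V y z"
    and ip_smult_left: "\<lbrakk>x \<in> carrier V; z \<in> carrier V\<rbrakk>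
      \<Longrightarrow> ip V (c \<odot>\<^bsub>V\<^esub> x) z = c * ip V x z"
    and ip_commute: "\<lbrakk>x \<in> carrier V; y \<in> carrier V\<rbrakk> \<Longrightarrow> ip V x y = cnj (ip V y x)"
    and ip_pos: "\<lbrakk>x \<in> carrier V; x \<noteq> \<zero>\<^bsub>V\<^esub>\<rbrakk> \<Longrightarrow> Re (ip V x x) > 0"

definition ip_norm :: "'a ip_space \<Rightarrow> 'a \<Rightarrow> real" where
  "ip_norm V x = sqrt (Re (ip V x x))"

text \<open>The value 0 off the carrier is there because \<^locale>\<open>Metric_space\<close> asks for nonnegativity
  and symmetry without relativisation.\<close>

definition ip_dist :: "'a ip_space \<Rightarrow> 'a \<Rightarrow> 'a \<Rightarrow> real" where
  "ip_dist V x y =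
     (if x \<in> carrier V \<and> y \<in> carrier V then ip_norm V (x \<ominus>\<^bsub>V\<^esub> y) else 0)"

abbreviation norm_topology :: "'a ip_space \<Rightarrow> 'a set \<Rightarrow> 'a topology" where
  "norm_topology V S \<equiv> Metric_space.mtopology S (ip_dist V)"

definition hilbert_space :: "'a ip_space \<Rightarrow> bool" where
  "hilbert_space V \<longleftrightarrow>
     inner_product_space V \<and> Metric_space.mcomplete (carrier V) (ip_dist V)"

definition separable_hilbert_space :: "'a ip_space \<Rightarrow> bool" where
  "separable_hilbert_space V \<longleftrightarrow>
     hilbert_space V \<and> separable_space (norm_topology V (carrier V))"


section \<open>Quantized domains and locally bounded operators\<close>

text \<open>A quantized domain is given by its ambient Hilbert space \<open>V\<close> and the family \<open>F\<close>; the
  domain is the union of the family.  The members of \<open>F\<close> carry the restricted inner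
  product, so all inclusions are isometric.  Density of the union says that \<open>V\<close> is its
  completion.\<close>

abbreviation (input) dom_of :: "('i \<Rightarrow> 'a set) \<Rightarrow> 'a set" where
  "dom_of F \<equiv> (\<Union>\<alpha>. F \<alpha>)"

definition quantized_domain :: "'a ip_space \<Rightarrow> ('i::order \<Rightarrow> 'a set) \<Rightarrow> bool" where
  "quantized_domain V F \<longleftrightarrow>
     hilbert_space V \<and>
     (\<forall>\<alpha>. submodule (F \<alpha>) complex_ring V \<and> Metric_space.mcomplete (F \<alpha>) (ip_dist V)) \<and>
     mono F \<and>
     Abstract_Topology.closure_of (norm_topology V (carrier V)) (dom_of F) = carrier V"

definition linear_op :: "'a ip_space \<Rightarrow> 'a set \<Rightarrow> ('a \<Rightarrow> 'a) \<Rightarrow> bool" where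
  "linear_op V D T \<longleftrightarrow>
     (\<forall>x\<in>D. \<forall>y\<in>D. T (x \<oplus>\<^bsub>V\<^esub> y) = T x \<oplus>\<^bsub>V\<^esub> T y) \<and>
     (\<forall>c. \<forall>x\<in>D. T (c \<odot>\<^bsub>V\<^esub> x) = c \<odot>\<^bsub>V\<^esub> T x)"

definition bounded_on :: "'a ip_space \<Rightarrow> 'a set \<Rightarrow> ('a \<Rightarrow> 'a) \<Rightarrow> bool" where
  "bounded_on V S T \<longleftrightarrow> (\<exists>C. \<forall>x\<in>S. ip_norm V (T x) \<le> C * ip_norm V x)"

definition orth_in :: "'a ip_space \<Rightarrow> 'a set \<Rightarrow> 'a set \<Rightarrow> 'a set" where
  "orth_in V D S = {x \<in> D. \<forall>y\<in>S. ip V x y = 0}"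

text \<open>Operators on a set \<open>D\<close> are extensional functions, so that equality of operators is
  equality in HOL.  Since only vectors of the domain enter (the orthogonal complements are
  intersected with it), \<open>V\<close> may be the ambient Hilbert space or just the domain with its
  inner product.\<close>

definition loc_bounded_ops :: "'a ip_space \<Rightarrow> ('i \<Rightarrow> 'a set) \<Rightarrow> ('a \<Rightarrow> 'a) set" where
  "loc_bounded_ops V F =
     {T \<in> dom_of F \<rightarrow>\<^sub>E dom_of F. linear_op V (dom_of F) T \<and>
        (\<forall>\<alpha>. T ` F \<alpha> \<subseteq> F \<alpha> \<and>
             T ` orth_in V (dom_of F) (F \<alpha>) \<subseteq> orth_in V (dom_of F) (F \<alpha>) \<and>
             bounded_on V (F \<alpha>) T)}"

definition bounded_ops :: "'a ip_space \<Rightarrow> 'a set \<Rightarrow> ('a \<Rightarrow> 'a) set" where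
  "bounded_ops V D = {T \<in> D \<rightarrow>\<^sub>E D. linear_op V D T \<and> bounded_on V D T}"

text \<open>For \<open>T\<close> in \<^const>\<open>loc_bounded_ops\<close> and \<open>D\<close> its domain, this is the restriction to \<open>D\<close> of
  the adjoint of the densely defined operator \<open>T\<close>.\<close>

definition adjoint_op :: "'a ip_space \<Rightarrow> 'a set \<Rightarrow> ('a \<Rightarrow> 'a) \<Rightarrow> 'a \<Rightarrow> 'a" where
  "adjoint_op V D T =
     (THE S. S \<in> D \<rightarrow>\<^sub>E D \<and> (\<forall>x\<in>D. \<forall>y\<in>D. ip V (T x) y = ip V x (S y)))"

definition unital_star_subalgebra ::
    "'a ip_space \<Rightarrow> 'a set \<Rightarrow> ('a \<Rightarrow> 'a) set \<Rightarrow> ('a \<Rightarrow> 'a) set \<Rightarrow> bool" where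
  "unital_star_subalgebra V D B A \<longleftrightarrow>
     A \<subseteq> B \<and>
     (\<lambda>x\<in>D. x) \<in> A \<and>
     (\<forall>S\<in>A. \<forall>T\<in>A. (\<lambda>x\<in>D. S x \<oplus>\<^bsub>V\<^esub> T x) \<in> A) \<and>
     (\<forall>c. \<forall>T\<in>A. (\<lambda>x\<in>D. c \<odot>\<^bsub>V\<^esub> T x) \<in> A) \<and>
     (\<forall>S\<in>A. \<forall>T\<in>A. compose D S T \<in> A) \<and>
     (\<forall>T\<in>A. adjoint_op V D T \<in> A)"

text \<open>The topology of the seminorms \<open>T \<mapsto> \<parallel>T u\<parallel>\<close>, \<open>u \<in> D\<close>, is that of pointwise convergence in
  norm.\<close>

definition strong_op_topology ::
    "'a ip_space \<Rightarrow> 'a set \<Rightarrow> ('a \<Rightarrow> 'a) set \<Rightarrow> ('a \<Rightarrow> 'a) topology" where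
  "strong_op_topology V D B =
     subtopology (product_topology (\<lambda>_. norm_topology V D) D) B"

definition von_neumann_algebra :: "'a ip_space \<Rightarrow> 'a set \<Rightarrow> ('a \<Rightarrow> 'a) set \<Rightarrow> bool" where
  "von_neumann_algebra V D A \<longleftrightarrow>
     unital_star_subalgebra V D (bounded_ops V D) A \<and>
     closedin (strong_op_topology V D (bounded_ops V D)) A"

text \<open>A *-subalgebra that is closed for the seminorms \<open>T \<mapsto> \<parallel>T|F \<alpha>\<parallel>\<close>; the whole algebra is
  complete, so closed means complete.  One index \<open>\<alpha>\<close> at a time suffices because the index set
  is directed.\<close>

definition locally_Cstar_subalgebra ::
    "'a ip_space \<Rightarrow> ('i \<Rightarrow> 'a set) \<Rightarrow> ('a \<Rightarrow> 'a) set \<Rightarrow> bool" where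
  "locally_Cstar_subalgebra V F A \<longleftrightarrow>
     unital_star_subalgebra V (dom_of F) (loc_bounded_ops V F) A \<and>
     (\<forall>T\<in>loc_bounded_ops V F.
        (\<forall>\<alpha>. \<forall>\<epsilon>>0. \<exists>S\<in>A. \<forall>x\<in>F \<alpha>. ip_norm V (T x \<ominus>\<^bsub>V\<^esub> S x) \<le> \<epsilon> * ip_norm V x)
        \<longrightarrow> T \<in> A)"

text \<open>\<open>A\<close> is the projective limit of von Neumann algebras \<open>N \<alpha>\<close> on \<open>F \<alpha>\<close>.  The connecting maps
  are the restrictions, which are unital *-homomorphisms.  The canonical map to the coherent
  families is a *-homomorphism that carries the seminorm \<open>T \<mapsto> \<parallel>T|F \<alpha>\<parallel>\<close> to the norm of the
  component \<open>\<alpha>\<close>, so it is a topological *-isomorphism as soon as it is bijective.\<close>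

definition projective_limit_of_vN ::
    "'a ip_space \<Rightarrow> ('i::order \<Rightarrow> 'a set) \<Rightarrow> ('a \<Rightarrow> 'a) set \<Rightarrow> bool" where
  "projective_limit_of_vN V F A \<longleftrightarrow>
     (\<exists>N. (\<forall>\<alpha>. von_neumann_algebra V (F \<alpha>) (N \<alpha>)) \<and>
          (\<forall>\<alpha> \<beta>. \<alpha> \<le> \<beta> \<longrightarrow> (\<forall>T\<in>N \<beta>. restrict T (F \<alpha>) \<in> N \<alpha>)) \<and>
          bij_betw (\<lambda>T \<alpha>. restrict T (F \<alpha>)) A
            {t. (\<forall>\<alpha>. t \<alpha> \<in> N \<alpha>) \<and> (\<forall>\<alpha> \<beta>. \<alpha> \<le> \<beta> \<longrightarrow> restrict (t \<beta>) (F \<alpha>) = t \<alpha>)})"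

text \<open>For *-subalgebras of \<open>loc_bounded_ops V F\<close> the last two conditions are known to be
  equivalent; both usual descriptions of the notion are recorded.\<close>

definition locally_von_neumann_algebra ::
    "'a ip_space \<Rightarrow> ('i::order \<Rightarrow> 'a set) \<Rightarrow> ('a \<Rightarrow> 'a) set \<Rightarrow> bool" where
  "locally_von_neumann_algebra V F A \<longleftrightarrow>
     locally_Cstar_subalgebra V F A \<and>
     projective_limit_of_vN V F A \<and>
     closedin (strong_op_topology V (dom_of F) (loc_bounded_ops V F)) A"

definition abelian_ops :: "'a set \<Rightarrow> ('a \<Rightarrow> 'a) set \<Rightarrow> bool" where
  "abelian_ops D A \<longleftrightarrow> (\<forall>S\<in>A. \<forall>T\<in>A. compose D S T = compose D T S)"


section \<open>Locally measure spaces\<close>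

definition sigma_compact_space :: "'x topology \<Rightarrow> bool" where
  "sigma_compact_space T \<longleftrightarrow>
     (\<exists>\<C>. countable \<C> \<and> (\<forall>C\<in>\<C>. compactin T C) \<and> \<Union>\<C> = topspace T)"

definition completed_borel_measure :: "'x measure \<Rightarrow> bool" where
  "completed_borel_measure M \<longleftrightarrow>
     (\<exists>T N. topspace T = space M \<and> locally_compact_space T \<and> sigma_compact_space T \<and>
        space N = topspace T \<and> sets N = sigma_sets (topspace T) {U. openin T U} \<and>
        M = completion N)"

definition locally_measure_system :: "('i::order \<Rightarrow> 'x measure) \<Rightarrow> bool" where
  "locally_measure_system M \<longleftrightarrow>
     (\<forall>\<alpha>. completed_borel_measure (M \<alpha>)) \<and>
     (\<forall>\<alpha> \<beta>. \<alpha> \<le> \<beta> \<longrightarrow>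
        space (M \<alpha>) \<subseteq> space (M \<beta>) \<and>
        sets (M \<alpha>) = {E \<inter> space (M \<alpha>) |E. E \<in> sets (M \<beta>)} \<and>
        sets (M \<alpha>) \<subseteq> sets (M \<beta>) \<and>
        (\<forall>E\<in>sets (M \<alpha>). emeasure (M \<alpha>) E = emeasure (M \<beta>) E))"

definition loc_space :: "('i \<Rightarrow> 'x measure) \<Rightarrow> 'x set" where
  "loc_space M = (\<Union>\<alpha>. space (M \<alpha>))"

definition loc_sets :: "('i \<Rightarrow> 'x measure) \<Rightarrow> 'x set set" where
  "loc_sets M = {E. E \<subseteq> loc_space M \<and> (\<forall>\<alpha>. E \<inter> space (M \<alpha>) \<in> sets (M \<alpha>))}"

definition loc_emeasure :: "('i::order \<Rightarrow> 'x measure) \<Rightarrow> 'x set \<Rightarrow> ennreal" where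
  "loc_emeasure M E =
     (if \<exists>l<\<infinity>. ((\<lambda>\<alpha>. emeasure (M \<alpha>) (E \<inter> space (M \<alpha>))) \<longlongrightarrow> l) at_top
      then Lim at_top (\<lambda>\<alpha>. emeasure (M \<alpha>) (E \<inter> space (M \<alpha>))) else \<infinity>)"

definition loc_measure :: "('i::order \<Rightarrow> 'x measure) \<Rightarrow> 'x measure" where
  "loc_measure M = measure_of (loc_space M) (loc_sets M) (loc_emeasure M)"


text \<open>\<^const>\<open>measure_of\<close> silently returns the zero measure when its arguments do not form a
  measure space; \<open>emeasure_loc_measure\<close> shows that they do.\<close>

lemma eventually_at_top_directed:
  assumes "\<forall>\<alpha> \<beta>::'i::order. \<exists>\<gamma>. \<alpha> \<le> \<gamma> \<and> \<beta> \<le> \<gamma>"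
  shows "eventually P (at_top::'i filter) \<longleftrightarrow> (\<exists>N. \<forall>n\<ge>N. P n)"
  unfolding at_top_def
proof (subst eventually_INF_base)
  fix a b :: 'i
  obtain c where "a \<le> c" "b \<le> c" using assms by blast
  then show "\<exists>x\<in>UNIV. principal {x..} \<le> inf (principal {a..}) (principal {b::'i..})"
    by (intro bexI[of _ c]) auto
qed (auto simp: eventually_principal)

lemma loc_emeasure_SUP:
  fixes M :: "'i::order \<Rightarrow> 'x measure"
  assumes d: "\<forall>\<alpha> \<beta>::'i. \<exists>\<gamma>. \<alpha> \<le> \<gamma> \<and> \<beta> \<le> \<gamma>" and L: "locally_measure_system M"
    and E: "E \<in> loc_sets M"
  shows "loc_emeasure M E = (SUP \<alpha>. emeasure (M \<alpha>) (E \<inter> space (M \<alpha>)))"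
    and "\<alpha> \<le> \<beta> \<Longrightarrow> emeasure (M \<alpha>) (E \<inter> space (M \<alpha>)) \<le> emeasure (M \<beta>) (E \<inter> space (M \<beta>))"
proof -
  let ?f = "\<lambda>\<alpha>. emeasure (M \<alpha>) (E \<inter> space (M \<alpha>))"
  have m: "?f \<alpha> \<le> ?f \<beta>" if "\<alpha> \<le> \<beta>" for \<alpha> \<beta>
  proof -
    have "E \<inter> space (M \<alpha>) \<in> sets (M \<alpha>)" "E \<inter> space (M \<beta>) \<in> sets (M \<beta>)" using E by (auto simp: loc_sets_def)
    moreover have "space (M \<alpha>) \<subseteq> space (M \<beta>)" "sets (M \<alpha>) \<subseteq> sets (M \<beta>)"
      and "\<And>E. E \<in> sets (M \<alpha>) \<Longrightarrow> emeasure (M \<alpha>) E = emeasure (M \<beta>) E"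
      using L that unfolding locally_measure_system_def by blast+
    ultimately show ?thesis
      using emeasure_mono[of "E \<inter> space (M \<alpha>)" "E \<inter> space (M \<beta>)" "M \<beta>"] by auto
  qed
  show "\<alpha> \<le> \<beta> \<Longrightarrow> ?f \<alpha> \<le> ?f \<beta>" by (rule m)
  have lim: "(?f \<longlongrightarrow> (SUP \<alpha>. ?f \<alpha>)) at_top"
  proof (rule order_tendstoI)
    fix a assume "a < (SUP \<alpha>. ?f \<alpha>)"
    then obtain N where "a < ?f N" by (auto simp: less_SUP_iff)
    then have "\<forall>x\<ge>N. a < ?f x" using m by (blast intro: less_le_trans)
    then show "\<forall>\<^sub>F x in at_top. a < ?f x"
      unfolding eventually_at_top_directed[OF d] by (rule exI)
  next
    fix a assume "(SUP \<alpha>. ?f \<alpha>) < a"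
    then have "?f x < a" for x by (rule le_less_trans[OF SUP_upper[OF UNIV_I]])
    then show "\<forall>\<^sub>F x in at_top. ?f x < a" by simp
  qed
  have nb: "(at_top::'i filter) \<noteq> bot"
    using eventually_at_top_directed[OF d, of "\<lambda>_. False"] by (auto simp: trivial_limit_def)
  have "Lim at_top ?f = (SUP \<alpha>. ?f \<alpha>)" by (rule tendsto_Lim[OF nb lim])
  moreover have "(SUP \<alpha>. ?f \<alpha>) = \<infinity>" if "\<not> (\<exists>l<\<infinity>. (?f \<longlongrightarrow> l) at_top)"
  proof (rule ccontr)
    assume "(SUP \<alpha>. ?f \<alpha>) \<noteq> \<infinity>"
    then have "(SUP \<alpha>. ?f \<alpha>) < \<infinity>" by (metis infinity_ennreal_def less_top)
    then show False using lim that by blast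
  qed
  ultimately show "loc_emeasure M E = (SUP \<alpha>. ?f \<alpha>)"
    unfolding loc_emeasure_def by presburger
qed

lemma measure_space_loc:
  fixes M :: "'i::order \<Rightarrow> 'x measure"
  assumes d: "\<forall>\<alpha> \<beta>::'i. \<exists>\<gamma>. \<alpha> \<le> \<gamma> \<and> \<beta> \<le> \<gamma>" and L: "locally_measure_system M"
  shows "measure_space (loc_space M) (loc_sets M) (loc_emeasure M)"
  unfolding measure_space_def
proof safe
  show "sigma_algebra (loc_space M) (loc_sets M)"
    unfolding sigma_algebra_iff2
  proof safe
    fix s x assume "s \<in> loc_sets M" "x \<in> s" then show "x \<in> loc_space M" by (auto simp: loc_sets_def)
  next
    fix s assume s: "s \<in> loc_sets M"
    have "(loc_space M - s) \<inter> space (M \<alpha>) = space (M \<alpha>) - (s \<inter> space (M \<alpha>))" for \<alpha>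
      by (auto simp: loc_space_def)
    then show "loc_space M - s \<in> loc_sets M" using s by (auto simp: loc_sets_def)
  next
    fix A :: "nat \<Rightarrow> 'x set" assume A: "range A \<subseteq> loc_sets M"
    have "(\<Union>i. A i) \<inter> space (M \<alpha>) \<in> sets (M \<alpha>)" for \<alpha>
    proof -
      have "(\<Union>i. A i) \<inter> space (M \<alpha>) = (\<Union>i. A i \<inter> space (M \<alpha>))" by auto
      moreover have "(\<Union>i. A i \<inter> space (M \<alpha>)) \<in> sets (M \<alpha>)"
        using A by (intro sets.countable_UN) (auto simp: loc_sets_def)
      ultimately show ?thesis by metis
    qed
    then show "(\<Union>i. A i) \<in> loc_sets M" using A by (auto simp: loc_sets_def image_subset_iff)
  qed (auto simp: loc_sets_def)
  show "positive (loc_sets M) (loc_emeasure M)"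
    unfolding positive_def using loc_emeasure_SUP(1)[OF d L, of "{}"] by (auto simp: loc_sets_def)
  show "countably_additive (loc_sets M) (loc_emeasure M)"
  proof (rule countably_additiveI)
    fix A :: "nat \<Rightarrow> 'x set"
    assume A: "range A \<subseteq> loc_sets M" "disjoint_family A" "(\<Union>i. A i) \<in> loc_sets M"
    have Ai: "A i \<in> loc_sets M" for i using A by auto
    let ?f = "\<lambda>i \<alpha>. emeasure (M \<alpha>) (A i \<inter> space (M \<alpha>))"
    have "(\<Sum>i. loc_emeasure M (A i)) = (\<Sum>i. SUP \<alpha>. ?f i \<alpha>)"
      using loc_emeasure_SUP(1)[OF d L Ai] by simp
    also have "\<dots> = (SUP \<alpha>. \<Sum>i. ?f i \<alpha>)"
    proof (rule ennreal_suminf_SUP_eq_directed[where f = "\<lambda>\<alpha> i. ?f i \<alpha>" and I = UNIV])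
      fix N :: "nat set" and i j :: 'i
      obtain k where k: "i \<le> k" "j \<le> k" using d by blast
      show "\<exists>k\<in>UNIV. \<forall>n\<in>N. ?f n i \<le> ?f n k \<and> ?f n j \<le> ?f n k"
        by (intro bexI[of _ k] ballI conjI loc_emeasure_SUP(2)[OF d L Ai] k UNIV_I)
    qed
    also have "\<dots> = (SUP \<alpha>. emeasure (M \<alpha>) ((\<Union>i. A i) \<inter> space (M \<alpha>)))"
    proof (rule SUP_cong[OF refl])
      fix \<alpha>
      have "(\<Union>i. A i) \<inter> space (M \<alpha>) = (\<Union>i. A i \<inter> space (M \<alpha>))" by auto
      moreover have "disjoint_family (\<lambda>i. A i \<inter> space (M \<alpha>))"
        using A(2) by (auto simp: disjoint_family_on_def)
      moreover have "range (\<lambda>i. A i \<inter> space (M \<alpha>)) \<subseteq> sets (M \<alpha>)"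
        using Ai by (auto simp: loc_sets_def)
      ultimately show "(\<Sum>i. ?f i \<alpha>) = emeasure (M \<alpha>) ((\<Union>i. A i) \<inter> space (M \<alpha>))"
        by (metis suminf_emeasure)
    qed
    finally show "(\<Sum>i. loc_emeasure M (A i)) = loc_emeasure M (\<Union>i. A i)"
      using loc_emeasure_SUP(1)[OF d L A(3)] by simp
  qed
qed

lemma emeasure_loc_measure:
  fixes M :: "'i::order \<Rightarrow> 'x measure"
  assumes d: "\<forall>\<alpha> \<beta>::'i. \<exists>\<gamma>. \<alpha> \<le> \<gamma> \<and> \<beta> \<le> \<gamma>" and L: "locally_measure_system M"
  shows "space (loc_measure M) = loc_space M"
    and "sets (loc_measure M) = loc_sets M"
    and "E \<in> loc_sets M \<Longrightarrow> emeasure (loc_measure M) E = loc_emeasure M E"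
proof -
  have ms: "measure_space (loc_space M) (loc_sets M) (loc_emeasure M)"
    by (rule measure_space_loc[OF d L])
  then have sa: "sigma_algebra (loc_space M) (loc_sets M)"
    by (simp add: measure_space_def)
  have sub: "loc_sets M \<subseteq> Pow (loc_space M)" by (auto simp: loc_sets_def)
  show "space (loc_measure M) = loc_space M"
    unfolding loc_measure_def by (rule space_measure_of[OF sub])
  show "sets (loc_measure M) = loc_sets M"
    unfolding loc_measure_def using sub sa by (simp add: sigma_algebra.sigma_sets_eq)
  show "E \<in> loc_sets M \<Longrightarrow> emeasure (loc_measure M) E = loc_emeasure M E"
    unfolding loc_measure_def using ms sa
    by (intro emeasure_measure_of_sigma) (auto simp: measure_space_def)
qed


section \<open>Direct integrals\<close>

text \<open>Fibres: \<open>K p\<close> is the Hilbert space at \<open>p\<close>, with the subspaces \<open>E p \<alpha>\<close>.  Maps on the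
  locally measure space are extensional functions.\<close>

definition fibre_maps :: "('i \<Rightarrow> 'x measure) \<Rightarrow> ('x \<Rightarrow> 'i \<Rightarrow> 'h set) \<Rightarrow> ('x \<Rightarrow> 'h) set" where
  "fibre_maps M E = (\<Pi>\<^sub>E p\<in>loc_space M. dom_of (E p))"

definition at_level :: "('i \<Rightarrow> 'x measure) \<Rightarrow> ('x \<Rightarrow> 'h ip_space) \<Rightarrow> ('x \<Rightarrow> 'i \<Rightarrow> 'h set)
    \<Rightarrow> 'i \<Rightarrow> ('x \<Rightarrow> 'h) \<Rightarrow> bool" where
  "at_level M K E \<alpha> u \<longleftrightarrow>
     (AE p in M \<alpha>. u p \<in> E p \<alpha>) \<and>
     {p \<in> loc_space M. u p \<noteq> \<zero>\<^bsub>K p\<^esub>} \<subseteq> space (M \<alpha>)"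

text \<open>Here \<open>D\<close> consists of honest maps; the identification of maps that agree almost everywhere
  is made in \<open>integral_space\<close> below.\<close>

definition loc_direct_integral :: "('i::order \<Rightarrow> 'x measure) \<Rightarrow> ('x \<Rightarrow> 'h ip_space)
    \<Rightarrow> ('x \<Rightarrow> 'i \<Rightarrow> 'h set) \<Rightarrow> ('x \<Rightarrow> 'h) set \<Rightarrow> bool" where
  "loc_direct_integral M K E D \<longleftrightarrow>
     D \<subseteq> fibre_maps M E \<and>
     (\<lambda>p\<in>loc_space M. \<zero>\<^bsub>K p\<^esub>) \<in> D \<and>
     (\<forall>u\<in>D. \<forall>v\<in>D. (\<lambda>p\<in>loc_space M. u p \<oplus>\<^bsub>K p\<^esub> v p) \<in> D) \<and>
     (\<forall>c. \<forall>u\<in>D. (\<lambda>p\<in>loc_space M. c \<odot>\<^bsub>K p\<^esub> u p) \<in> D) \<and>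
     (\<forall>u\<in>D. \<exists>\<alpha>. at_level M K E \<alpha> u) \<and>
     (\<forall>u\<in>D. \<forall>v\<in>D. integrable (loc_measure M) (\<lambda>p. ip (K p) (u p) (v p))) \<and>
     (\<forall>v\<in>fibre_maps M E.
        (\<exists>\<alpha>. (\<forall>p\<in>space (M \<alpha>). v p \<in> E p \<alpha>) \<and>
             (\<forall>p\<in>loc_space M - space (M \<alpha>). v p = \<zero>\<^bsub>K p\<^esub>)) \<longrightarrow>
        (\<forall>u\<in>D. integrable (loc_measure M) (\<lambda>p. ip (K p) (u p) (v p))) \<longrightarrow>
        v \<in> D)"

definition ae_class :: "('i::order \<Rightarrow> 'x measure) \<Rightarrow> ('x \<Rightarrow> 'h) set \<Rightarrow> ('x \<Rightarrow> 'h)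
    \<Rightarrow> ('x \<Rightarrow> 'h) set" where
  "ae_class M D u = {v \<in> D. AE p in loc_measure M. v p = u p}"

text \<open>The quotient of \<open>D\<close> by equality almost everywhere.  For two maps supported in
  \<open>space (M \<alpha>)\<close> the integral against \<open>loc_measure M\<close> is the integral over \<open>space (M \<alpha>)\<close>
  against \<open>M \<alpha>\<close>.  The completion is not needed, see \<^const>\<open>loc_bounded_ops\<close>.\<close>

definition integral_space :: "('i::order \<Rightarrow> 'x measure) \<Rightarrow> ('x \<Rightarrow> 'h ip_space)
    \<Rightarrow> ('x \<Rightarrow> 'h) set \<Rightarrow> ('x \<Rightarrow> 'h) set ip_space" where
  "integral_space M K D =
     \<lparr>carrier = ae_class M D ` D,
      mult = undefined, one = undefined,
      zero = ae_class M D (\<lambda>p\<in>loc_space M. \<zero>\<^bsub>K p\<^esub>),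
      add = (\<lambda>U V. {w \<in> D. \<exists>u\<in>U. \<exists>v\<in>V. AE p in loc_measure M. w p = u p \<oplus>\<^bsub>K p\<^esub> v p}),
      smult = (\<lambda>c U. {w \<in> D. \<exists>u\<in>U. AE p in loc_measure M. w p = c \<odot>\<^bsub>K p\<^esub> u p}),
      ip = (\<lambda>U V. LINT p|loc_measure M. ip (K p) ((SOME u. u \<in> U) p) ((SOME v. v \<in> V) p))\<rparr>"

definition integral_level :: "('i::order \<Rightarrow> 'x measure) \<Rightarrow> ('x \<Rightarrow> 'h ip_space)
    \<Rightarrow> ('x \<Rightarrow> 'i \<Rightarrow> 'h set) \<Rightarrow> ('x \<Rightarrow> 'h) set \<Rightarrow> 'i \<Rightarrow> ('x \<Rightarrow> 'h) set set" where
  "integral_level M K E D \<alpha> = ae_class M D ` {u \<in> D. at_level M K E \<alpha> u}"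

text \<open>Direct integral of Hilbert spaces in the sense of Kadison and Ringrose: \<open>ev x\<close> is the map
  \<open>p \<mapsto> x(p)\<close> attached to \<open>x\<close>.\<close>

definition hilbert_direct_integral :: "'x measure \<Rightarrow> ('x \<Rightarrow> 'h ip_space) \<Rightarrow> 'a ip_space
    \<Rightarrow> ('a \<Rightarrow> 'x \<Rightarrow> 'h) \<Rightarrow> bool" where
  "hilbert_direct_integral N K W ev \<longleftrightarrow>
     (\<forall>p\<in>space N. separable_hilbert_space (K p)) \<and>
     separable_hilbert_space W \<and>
     (\<forall>x\<in>carrier W. \<forall>p\<in>space N. ev x p \<in> carrier (K p)) \<and>
     (\<forall>x\<in>carrier W. \<forall>y\<in>carrier W.
        integrable N (\<lambda>p. ip (K p) (ev x p) (ev y p)) \<and>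
        ip W x y = (LINT p|N. ip (K p) (ev x p) (ev y p))) \<and>
     (\<forall>v. (\<forall>p\<in>space N. v p \<in> carrier (K p)) \<longrightarrow>
          (\<forall>y\<in>carrier W. integrable N (\<lambda>p. ip (K p) (v p) (ev y p))) \<longrightarrow>
          (\<exists>x\<in>carrier W. AE p in N. ev x p = v p))"

text \<open>Restriction of maps to \<open>space (M \<alpha>)\<close> makes the level \<open>\<alpha>\<close> the direct integral of the
  \<open>E p \<alpha>\<close>.  Members of a class lie in \<open>E p \<alpha>\<close> only for almost every \<open>p\<close>, hence the choice of
  a version \<open>ev U\<close> of the restriction.\<close>

definition levels_are_direct_integrals :: "('i::order \<Rightarrow> 'x measure) \<Rightarrow> ('x \<Rightarrow> 'h ip_space)
    \<Rightarrow> ('x \<Rightarrow> 'i \<Rightarrow> 'h set) \<Rightarrow> ('x \<Rightarrow> 'h) set \<Rightarrow> bool" where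
  "levels_are_direct_integrals M K E D \<longleftrightarrow>
     (\<forall>\<alpha>. \<exists>ev.
        (\<forall>U\<in>integral_level M K E D \<alpha>. \<forall>u\<in>U. AE p in M \<alpha>. ev U p = u p) \<and>
        hilbert_direct_integral (M \<alpha>) (\<lambda>p. K p\<lparr>carrier := E p \<alpha>\<rparr>)
          (integral_space M K D\<lparr>carrier := integral_level M K E D \<alpha>\<rparr>) ev)"

definition decomposable_ops :: "('i::order \<Rightarrow> 'x measure) \<Rightarrow> ('x \<Rightarrow> 'h ip_space)
    \<Rightarrow> ('x \<Rightarrow> 'i \<Rightarrow> 'h set) \<Rightarrow> ('x \<Rightarrow> 'h) set \<Rightarrow> (('x \<Rightarrow> 'h) set \<Rightarrow> ('x \<Rightarrow> 'h) set) set" where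
  "decomposable_ops M K E D =
     {T \<in> loc_bounded_ops (integral_space M K D) (integral_level M K E D).
        \<exists>S. (\<forall>p\<in>loc_space M. S p \<in> loc_bounded_ops (K p) (E p)) \<and>
            (\<forall>U\<in>carrier (integral_space M K D). \<forall>u\<in>U. \<forall>w\<in>T U.
               AE p in loc_measure M. w p = S p (u p))}"

definition diagonalizable_ops :: "('i::order \<Rightarrow> 'x measure) \<Rightarrow> ('x \<Rightarrow> 'h ip_space)
    \<Rightarrow> ('x \<Rightarrow> 'i \<Rightarrow> 'h set) \<Rightarrow> ('x \<Rightarrow> 'h) set \<Rightarrow> (('x \<Rightarrow> 'h) set \<Rightarrow> ('x \<Rightarrow> 'h) set) set" where
  "diagonalizable_ops M K E D =
     {T \<in> decomposable_ops M K E D.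
        \<exists>f \<in> borel_measurable (loc_measure M).
            \<forall>U\<in>carrier (integral_space M K D). \<forall>u\<in>U. \<forall>w\<in>T U.
               AE p in loc_measure M. w p = f p \<odot>\<^bsub>K p\<^esub> u p}"

end

theory Submission
  imports Defs
begin

text \<open>Both algebras are described level by level. On the Hilbert space direct integral of level \<open>\<alpha>\<close>
  consider the operators that decompose into fibres commuting with prescribed contractions: the
  projections onto the \<open>E p \<gamma>\<close>, \<open>\<gamma> \<le> \<alpha>\<close>, for the decomposable algebra, and all contractions, which
  leaves only scalars, for the diagonalizable one. Such operators form von Neumann algebras that are
  compatible with restriction to lower levels, and an algebra determined by its restrictions to the
  levels in this way is a locally von Neumann algebra. Conversely, the fibres obtained on the single
  levels agree where two levels overlap, outside a null set; by the assumption on the index set or on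
  the measure these null sets can be united, so the fibres glue.

  The delicate point is strong closedness. A strong limit of decomposable operators commutes with
  multiplication by indicator functions, which bounds it pointwise and hence makes it decomposable.
  But the subspaces \<open>E p \<gamma>\<close> are arbitrary for \<open>p\<close> outside the \<open>\<gamma>\<close>-th space, so the field of
  projections \<open>Q p\<close> need not be measurable. Its commutation with the limit is tested against linear
  functionals on nonmeasurable functions that are dominated by the upper integral (Hahn-Banach). Such a
  functional \<open>I\<close> turns \<open>w \<mapsto> I (\<langle>w p, Q p (x p)\<rangle>)\<close> into the inner product with a vector \<open>z\<close>, and
  strong approximation at \<open>x\<close> and at \<open>z\<close> is enough.\<close>

section \<open>Hilbert spaces on explicit carriers\<close>

text \<open>The commutator to be killed is <Q T x, y> - <T Q x, y>, where Q x need not be a vector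
  of the direct integral. Passing to the adjoint rewrites the second term as <Q x, T^* y>, in which
  Q x is paired only with a genuine vector; a linear functional I turns this into <z, T^* y> = <T z,
  y>. For an approximant R, whose fibres commute with Q, the same computation gives I <Q R x, y> =
  <R z, y>. Hence the value of I at the commutator is controlled by (T - R) x and (T - R) z. The
  upper integral itself cannot take the place of I: it is only subadditive, and Riesz needs
  linearity. But I has to agree with it at the one function under test, because a nonnegative
  function vanishes almost everywhere once its upper integral is 0. Separability enters wherever
  fibres are constructed or compared: this is done along a dense sequence, since only countably many
  null sets can be discarded together.\<close>

definition vsub :: "'a ip_space \<Rightarrow> 'a \<Rightarrow> 'a \<Rightarrow> 'a" where
  "vsub V x y = x \<oplus>\<^bsub>V\<^esub> (-1) \<odot>\<^bsub>V\<^esub> y"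

text \<open>Subtraction in the library goes through the additive inverse, which refers to the
  carrier. \<open>vsub\<close> does not, so computations pass unchanged between a space and its
  levels.\<close>

lemma vsub_carrier_update [simp]: "vsub (V\<lparr>carrier := S\<rparr>) = vsub V"
  by (simp add: vsub_def fun_eq_iff)

lemma ip_norm_carrier_update [simp]: "ip_norm (V\<lparr>carrier := S\<rparr>) = ip_norm V"
  by (simp add: ip_norm_def fun_eq_iff)

context inner_product_space
begin

lemma add_in [simp, intro]: "x \<in> carrier V \<Longrightarrow> y \<in> carrier V \<Longrightarrow> x \<oplus>\<^bsub>V\<^esub> y \<in> carrier V"
  by (rule M.a_closed)

lemma smult_in [simp, intro]: "x \<in> carrier V \<Longrightarrow> c \<odot>\<^bsub>V\<^esub> x \<in> carrier V"
  using smult_closed[of c x] by (simp add: complex_ring_def)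

lemma zero_in [simp, intro]: "\<zero>\<^bsub>V\<^esub> \<in> carrier V"
  by (rule M.zero_closed)

lemma vsub_in [simp, intro]: "x \<in> carrier V \<Longrightarrow> y \<in> carrier V \<Longrightarrow> vsub V x y \<in> carrier V"
  by (simp add: vsub_def)

lemma ip_add_right:
  assumes "x \<in> carrier V" "y \<in> carrier V" "z \<in> carrier V"
  shows "ip V x (y \<oplus>\<^bsub>V\<^esub> z) = ip V x y + ip V x z"
  using assms by (simp add: ip_commute[of x] ip_add_left)

lemma ip_smult_right:
  assumes "x \<in> carrier V" "y \<in> carrier V"
  shows "ip V x (c \<odot>\<^bsub>V\<^esub> y) = cnj c * ip V x y"
  using assms by (simp add: ip_commute[of x] ip_smult_left)

lemma zero_smult: "x \<in> carrier V \<Longrightarrow> 0 \<odot>\<^bsub>V\<^esub> x = \<zero>\<^bsub>V\<^esub>"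
  using smult_l_null[of x] by (simp add: complex_ring_def)

lemma ip_zero_left [simp]: "x \<in> carrier V \<Longrightarrow> ip V \<zero>\<^bsub>V\<^esub> x = 0"
  using ip_smult_left[of x x 0] by (simp add: zero_smult)

lemma ip_zero_right [simp]: "x \<in> carrier V \<Longrightarrow> ip V x \<zero>\<^bsub>V\<^esub> = 0"
  by (simp add: ip_commute[of x])

lemma ip_vsub_left:
  assumes "x \<in> carrier V" "y \<in> carrier V" "z \<in> carrier V"
  shows "ip V (vsub V x y) z = ip V x z - ip V y z"
  using assms by (simp add: vsub_def ip_add_left ip_smult_left)

lemma ip_vsub_right:
  assumes "x \<in> carrier V" "y \<in> carrier V" "z \<in> carrier V"
  shows "ip V x (vsub V y z) = ip V x y - ip V x z"
  using assms by (simp add: vsub_def ip_add_right ip_smult_right)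

lemmas ip_expand = ip_add_left ip_add_right ip_smult_left ip_smult_right ip_vsub_left ip_vsub_right

lemma vsub_eq_zeroD:
  assumes "x \<in> carrier V" "y \<in> carrier V" "vsub V x y = \<zero>\<^bsub>V\<^esub>"
  shows "x = y"
proof -
  have "y \<oplus>\<^bsub>V\<^esub> (-1) \<odot>\<^bsub>V\<^esub> y = \<zero>\<^bsub>V\<^esub>"
    using smult_l_distr[of 1 "-1" y] smult_one[of y] assms zero_smult[of y] by (simp add: complex_ring_def)
  then have "x \<oplus>\<^bsub>V\<^esub> (-1) \<odot>\<^bsub>V\<^esub> y = y \<oplus>\<^bsub>V\<^esub> (-1) \<odot>\<^bsub>V\<^esub> y"
    using assms by (simp add: vsub_def)
  then show ?thesis using assms by simp
qed

text \<open>Vector identities are reduced to complex arithmetic by pairing with an arbitrary vector.\<close>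

lemma vec_eqI:
  assumes "x \<in> carrier V" "y \<in> carrier V" "\<And>z. z \<in> carrier V \<Longrightarrow> ip V x z = ip V y z"
  shows "x = y"
proof (rule vsub_eq_zeroD[OF assms(1,2)], rule ccontr)
  assume "vsub V x y \<noteq> \<zero>\<^bsub>V\<^esub>"
  then have "Re (ip V (vsub V x y) (vsub V x y)) > 0" using assms by (intro ip_pos) auto
  then show False using assms by (simp add: ip_vsub_left)
qed

lemma vec_eqI':
  assumes "x \<in> carrier V" "y \<in> carrier V" "\<And>z. z \<in> carrier V \<Longrightarrow> ip V z x = ip V z y"
  shows "x = y"
  by (rule vec_eqI) (use assms ip_commute in \<open>metis+\<close>)

lemma minus_eq_vsub: "x \<in> carrier V \<Longrightarrow> y \<in> carrier V \<Longrightarrow> x \<ominus>\<^bsub>V\<^esub> y = vsub V x y"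
proof -
  assume x: "x \<in> carrier V" and y: "y \<in> carrier V"
  have "(-1) \<odot>\<^bsub>V\<^esub> y \<oplus>\<^bsub>V\<^esub> y = \<zero>\<^bsub>V\<^esub>" by (rule vec_eqI) (use y in \<open>auto simp: ip_expand\<close>)
  then have "\<ominus>\<^bsub>V\<^esub> y = (-1) \<odot>\<^bsub>V\<^esub> y" using y by (intro M.minus_equality) auto
  then show ?thesis by (simp add: a_minus_def vsub_def)
qed

lemma ip_self_ge0: "x \<in> carrier V \<Longrightarrow> Re (ip V x x) \<ge> 0"
  using ip_pos[of x] by (cases "x = \<zero>\<^bsub>V\<^esub>") auto

lemma norm_nonneg [simp]: "x \<in> carrier V \<Longrightarrow> ip_norm V x \<ge> 0"
  by (simp add: ip_norm_def ip_self_ge0)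

lemma Re_ip_self: "x \<in> carrier V \<Longrightarrow> Re (ip V x x) = (ip_norm V x)\<^sup>2"
  by (simp add: ip_norm_def ip_self_ge0)

lemma ip_self: "x \<in> carrier V \<Longrightarrow> ip V x x = of_real ((ip_norm V x)\<^sup>2)"
  using ip_commute[of x x] by (simp add: complex_eq_iff Re_ip_self)

lemma norm_zero [simp]: "ip_norm V \<zero>\<^bsub>V\<^esub> = 0"
  by (simp add: ip_norm_def)

lemma norm_eq_0_iff: "x \<in> carrier V \<Longrightarrow> ip_norm V x = 0 \<longleftrightarrow> x = \<zero>\<^bsub>V\<^esub>"
  using ip_pos[of x] by (cases "x = \<zero>\<^bsub>V\<^esub>") (auto simp: ip_norm_def)

lemma norm_smult: "x \<in> carrier V \<Longrightarrow> ip_norm V (c \<odot>\<^bsub>V\<^esub> x) = cmod c * ip_norm V x"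
proof -
  assume x: "x \<in> carrier V"
  have "ip V (c \<odot>\<^bsub>V\<^esub> x) (c \<odot>\<^bsub>V\<^esub> x) = of_real ((cmod c)\<^sup>2) * ip V x x"
    using x by (simp add: ip_expand complex_norm_square del: of_real_power)
  then have "(ip_norm V (c \<odot>\<^bsub>V\<^esub> x))\<^sup>2 = (cmod c * ip_norm V x)\<^sup>2"
    using x by (simp add: Re_ip_self[symmetric] power_mult_distrib)
  then show ?thesis using x by (simp add: power2_eq_iff_nonneg)
qed

lemma norm_add_sq:
  assumes "x \<in> carrier V" "y \<in> carrier V"
  shows "(ip_norm V (x \<oplus>\<^bsub>V\<^esub> y))\<^sup>2 = (ip_norm V x)\<^sup>2 + (ip_norm V y)\<^sup>2 + 2 * Re (ip V x y)"
proof -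
  have "Re (ip V y x) = Re (ip V x y)" using assms by (simp add: ip_commute[of y x])
  then show ?thesis
    using assms by (simp add: Re_ip_self[symmetric] ip_expand)
qed

lemma norm_vsub_sq:
  assumes "x \<in> carrier V" "y \<in> carrier V"
  shows "(ip_norm V (vsub V x y))\<^sup>2 = (ip_norm V x)\<^sup>2 + (ip_norm V y)\<^sup>2 - 2 * Re (ip V x y)"
  using assms norm_add_sq[of x "(-1) \<odot>\<^bsub>V\<^esub> y"] by (simp add: vsub_def norm_smult ip_expand)

lemma Cauchy_Schwarz:
  assumes x: "x \<in> carrier V" and y: "y \<in> carrier V"
  shows "cmod (ip V x y) \<le> ip_norm V x * ip_norm V y"
proof (cases "ip_norm V y = 0")
  case True
  then show ?thesis using assms by (simp add: norm_eq_0_iff)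
next
  case False
  define c where "c = ip V x y / of_real ((ip_norm V y)\<^sup>2)"
  have "0 \<le> Re (ip V (vsub V x (c \<odot>\<^bsub>V\<^esub> y)) (vsub V x (c \<odot>\<^bsub>V\<^esub> y)))"
    using assms by (intro ip_self_ge0) auto
  also have "ip V (vsub V x (c \<odot>\<^bsub>V\<^esub> y)) (vsub V x (c \<odot>\<^bsub>V\<^esub> y)) =
     ip V x x - cnj c * ip V x y - c * (cnj (ip V x y) - cnj c * ip V y y)"
    using assms by (simp add: ip_expand ip_commute[of y x] algebra_simps)
  also have "\<dots> = ip V x x - of_real ((cmod (ip V x y))\<^sup>2 / (ip_norm V y)\<^sup>2)"
    using False y by (simp add: c_def ip_self[OF y] complex_norm_square field_simps del: of_real_power)
  finally have "(cmod (ip V x y))\<^sup>2 / (ip_norm V y)\<^sup>2 \<le> (ip_norm V x)\<^sup>2"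
    using x by (simp add: Re_ip_self)
  then have "(cmod (ip V x y))\<^sup>2 \<le> (ip_norm V x * ip_norm V y)\<^sup>2"
    using False by (simp add: divide_simps power_mult_distrib split: if_splits)
  then show ?thesis using assms by (simp add: power2_le_iff_abs_le)
qed

lemma Re_ip_le:
  assumes x: "x \<in> carrier V" and y: "y \<in> carrier V"
  shows "\<bar>Re (ip V x y)\<bar> \<le> ip_norm V x * ip_norm V y"
  using Cauchy_Schwarz[OF assms] abs_Re_le_cmod order_trans by blast

lemma norm_triangle:
  assumes x: "x \<in> carrier V" and y: "y \<in> carrier V"
  shows "ip_norm V (x \<oplus>\<^bsub>V\<^esub> y) \<le> ip_norm V x + ip_norm V y"
proof -
  have "(ip_norm V (x \<oplus>\<^bsub>V\<^esub> y))\<^sup>2 \<le> (ip_norm V x + ip_norm V y)\<^sup>2"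
    using norm_add_sq[OF assms] Re_ip_le[OF assms] by (simp add: power2_sum)
  then show ?thesis using assms by (simp add: power2_le_iff_abs_le)
qed

lemma norm_vsub_commute:
  assumes "x \<in> carrier V" "y \<in> carrier V"
  shows "ip_norm V (vsub V x y) = ip_norm V (vsub V y x)"
proof -
  have "(ip_norm V (vsub V x y))\<^sup>2 = (ip_norm V (vsub V y x))\<^sup>2"
    using assms by (simp add: norm_vsub_sq ip_commute[of y x])
  then show ?thesis using assms by (simp add: power2_eq_iff_nonneg)
qed

lemma norm_vsub_triangle:
  assumes "x \<in> carrier V" "y \<in> carrier V" "z \<in> carrier V"
  shows "ip_norm V (vsub V x z) \<le> ip_norm V (vsub V x y) + ip_norm V (vsub V y z)"
proof -
  have "vsub V x z = vsub V x y \<oplus>\<^bsub>V\<^esub> vsub V y z"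
    by (rule vec_eqI) (use assms in \<open>auto simp: ip_expand\<close>)
  then show ?thesis using assms by (simp add: norm_triangle)
qed

lemma norm_le_vsub:
  assumes "x \<in> carrier V" "y \<in> carrier V"
  shows "ip_norm V x \<le> ip_norm V y + ip_norm V (vsub V x y)"
proof -
  have "x = y \<oplus>\<^bsub>V\<^esub> vsub V x y" by (rule vec_eqI) (use assms in \<open>auto simp: ip_expand\<close>)
  then show ?thesis using assms norm_triangle[of y "vsub V x y"] by simp
qed

lemma norm_vsub_eq_0_iff:
  "x \<in> carrier V \<Longrightarrow> y \<in> carrier V \<Longrightarrow> ip_norm V (vsub V x y) = 0 \<longleftrightarrow> x = y"
  using vsub_eq_zeroD[of x y] by (auto simp: norm_eq_0_iff) (rule vec_eqI, auto simp: ip_expand)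

lemma ip_dist_eq: "x \<in> carrier V \<Longrightarrow> y \<in> carrier V \<Longrightarrow> ip_dist V x y = ip_norm V (vsub V x y)"
  by (simp add: ip_dist_def minus_eq_vsub)

lemma Metric_space_subset:
  assumes "S \<subseteq> carrier V"
  shows "Metric_space S (ip_dist V)"
proof
  fix x y show "0 \<le> ip_dist V x y"
    by (cases "x \<in> carrier V \<and> y \<in> carrier V") (auto simp: ip_dist_eq, auto simp: ip_dist_def)
  show "ip_dist V x y = ip_dist V y x"
    by (cases "x \<in> carrier V \<and> y \<in> carrier V")
       (auto simp: ip_dist_eq norm_vsub_commute, auto simp: ip_dist_def)
next
  fix x y assume "x \<in> S" "y \<in> S"
  then show "ip_dist V x y = 0 \<longleftrightarrow> x = y" using assms by (auto simp: ip_dist_eq norm_vsub_eq_0_iff subset_iff)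
next
  fix x y z assume "x \<in> S" "y \<in> S" "z \<in> S"
  then show "ip_dist V x z \<le> ip_dist V x y + ip_dist V y z"
    using assms by (auto simp: ip_dist_eq subset_iff intro!: norm_vsub_triangle)
qed

text \<open>The right-hand side refers to the carrier only through \<open>S\<close>. Completeness of
  \<open>S\<close> inside \<open>V\<close> thus becomes completeness of the space with carrier
  \<open>S\<close>, although \<open>ip_dist\<close> itself depends on the carrier.\<close>

lemma mcomplete_iff:
  assumes S: "S \<subseteq> carrier V"
  shows "Metric_space.mcomplete S (ip_dist V) \<longleftrightarrow>
    (\<forall>f. (\<forall>n. f n \<in> S) \<longrightarrow>
         (\<forall>\<epsilon>>0. \<exists>N. \<forall>m n. N \<le> m \<longrightarrow> N \<le> n \<longrightarrow> ip_norm V (vsub V (f m) (f n)) < \<epsilon>) \<longrightarrow>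
         (\<exists>z\<in>S. (\<lambda>n::nat. ip_norm V (vsub V (f n) z)) \<longlonglongrightarrow> 0))"
proof -
  interpret Metric_space S "ip_dist V" by (rule Metric_space_subset[OF S])
  have *: "ip_dist V x y = ip_norm V (vsub V x y)" if "x \<in> S" "y \<in> S" for x y
    using S that by (intro ip_dist_eq) auto
  have C: "MCauchy f \<longleftrightarrow> (\<forall>n. f n \<in> S) \<and>
         (\<forall>\<epsilon>>0. \<exists>N. \<forall>m n. N \<le> m \<longrightarrow> N \<le> n \<longrightarrow> ip_norm V (vsub V (f m) (f n)) < \<epsilon>)" for f
    unfolding MCauchy_def image_subset_iff by (auto simp: *)
  have L: "limitin mtopology f z sequentially \<longleftrightarrow> z \<in> S \<and> (\<lambda>n. ip_norm V (vsub V (f n) z)) \<longlonglongrightarrow> 0"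
    if "\<forall>n. f n \<in> S" for f z
    unfolding limitin_metric_dist_null using that by (auto simp: * cong: conj_cong)
  show ?thesis unfolding mcomplete_def C by (auto simp: L; blast)
qed

lemma inner_product_space_submodule:
  assumes "submodule S complex_ring V"
  shows "inner_product_space (V\<lparr>carrier := S\<rparr>)"
proof -
  have S: "S \<subseteq> carrier V" using submoduleE(1)[OF assms] .
  have m: "module complex_ring (V\<lparr>carrier := S\<rparr>)"
    using submodule.submodule_is_module[OF assms] module_axioms by auto
  show ?thesis
    by (intro inner_product_space.intro m inner_product_space_axioms.intro)
      (use S in \<open>auto simp: subset_iff ip_add_left ip_smult_left ip_pos intro: ip_commute\<close>)
qed

end

lemma hilbert_space_submodule:
  assumes "inner_product_space V" "submodule S complex_ring V"
    "Metric_space.mcomplete S (ip_dist V)"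
  shows "hilbert_space (V\<lparr>carrier := S\<rparr>)"
proof -
  interpret inner_product_space V by fact
  interpret S: inner_product_space "V\<lparr>carrier := S\<rparr>" by (rule inner_product_space_submodule[OF assms(2)])
  have S: "S \<subseteq> carrier V" using submoduleE(1)[OF assms(2)] .
  show ?thesis
    unfolding hilbert_space_def using assms(3) S.inner_product_space_axioms
    by (simp add: mcomplete_iff[OF S] S.mcomplete_iff)
qed

section \<open>Completeness, Riesz representation and orthogonal projection\<close>

locale hilbert = inner_product_space +
  assumes complete: "Metric_space.mcomplete (carrier V) (ip_dist V)"

lemma hilbert_space_iff: "hilbert_space V \<longleftrightarrow> hilbert V"
  by (simp add: hilbert_space_def hilbert_def hilbert_axioms_def)

context hilbert
begin

lemma convergent:
  assumes "\<And>n. f n \<in> carrier V"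
    "\<And>\<epsilon>. \<epsilon> > 0 \<Longrightarrow> \<exists>N. \<forall>m n. N \<le> m \<longrightarrow> N \<le> n \<longrightarrow> ip_norm V (vsub V (f m) (f n)) < \<epsilon>"
  obtains z where "z \<in> carrier V" "(\<lambda>n::nat. ip_norm V (vsub V (f n) z)) \<longlonglongrightarrow> 0"
  using complete assms unfolding mcomplete_iff[OF subset_refl] by blast

text \<open>The Riesz representation of a real functional whose graph \<open>P\<close> is only stable under sums and
  rational multiples: the representing vector is the limit of a minimising sequence of
  \<open>\<parallel>a\<parallel>\<^sup>2 - 2 s\<close>.\<close>

lemma riesz_rational:
  assumes P: "\<And>a s. (a, s) \<in> P \<Longrightarrow> a \<in> carrier V" and ne: "P \<noteq> {}"
    and add: "\<And>a s b t. (a, s) \<in> P \<Longrightarrow> (b, t) \<in> P \<Longrightarrow> (a \<oplus>\<^bsub>V\<^esub> b, s + t) \<in> P"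
    and scale: "\<And>a s q. (a, s) \<in> P \<Longrightarrow> (of_real (of_rat q) \<odot>\<^bsub>V\<^esub> a, of_rat q * s) \<in> P"
    and bound: "\<And>a s. (a, s) \<in> P \<Longrightarrow> 2 * s \<le> (ip_norm V a)\<^sup>2 + B"
  shows "\<exists>z\<in>carrier V. (\<forall>a s. (a, s) \<in> P \<longrightarrow> s = Re (ip V a z)) \<and>
    (\<forall>\<epsilon>>0. \<exists>a s. (a, s) \<in> P \<and> ip_norm V (vsub V a z) < \<epsilon>)"
proof -
  \<comment> \<open>If s = Re <a, z>, then J is the squared distance from a to z minus the squared
    norm of z, so a minimising sequence has to approach the representing vector.\<close>
  define J where "J = (\<lambda>(a, s). (ip_norm V a)\<^sup>2 - 2 * s)"
  define m where "m = Inf (J ` P)"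
  have bdd: "bdd_below (J ` P)" by (rule bdd_belowI[of _ "- B"]) (use bound in \<open>force simp: J_def\<close>)
  have mle: "m \<le> J p" if "p \<in> P" for p unfolding m_def using bdd that by (intro cInf_lower) auto
  have "\<exists>p\<in>P. J p < m + 1 / real (Suc k)" for k
    using cInf_less_iff[of "J ` P" "m + 1 / real (Suc k)"] ne bdd by (auto simp: m_def)
  then obtain p where p: "p k \<in> P" "J (p k) < m + 1 / real (Suc k)" for k by metis
  define a where "a = (\<lambda>k. fst (p k))"
  define s where "s = (\<lambda>k. snd (p k))"
  have as: "(a k, s k) \<in> P" for k using p(1)[of k] by (simp add: a_def s_def)
  have aV [simp]: "a k \<in> carrier V" for k using P[OF as] .
  have Jas: "(ip_norm V (a k))\<^sup>2 - 2 * s k < m + 1 / real (Suc k)" for k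
    using p(2)[of k] by (simp add: J_def a_def s_def split_beta)
  \<comment> \<open>Parallelogram law: J is at least \<open>m\<close> at the midpoint, which is
    again in the graph because 1/2 is rational.\<close>
  have close: "(ip_norm V (vsub V (a k) (a l)))\<^sup>2 \<le> 2 / real (Suc k) + 2 / real (Suc l)" for k l
  proof -
    have "(of_real (of_rat (1/2)) \<odot>\<^bsub>V\<^esub> (a k \<oplus>\<^bsub>V\<^esub> a l), of_rat (1/2) * (s k + s l)) \<in> P"
      by (intro scale add as)
    from mle[OF this] have "4 * m \<le> (ip_norm V (a k \<oplus>\<^bsub>V\<^esub> a l))\<^sup>2 - 4 * (s k + s l)"
      by (simp add: J_def norm_smult of_rat_divide power_divide field_simps norm_divide)
    moreover have "(ip_norm V (vsub V (a k) (a l)))\<^sup>2 =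
      2 * (ip_norm V (a k))\<^sup>2 + 2 * (ip_norm V (a l))\<^sup>2 - (ip_norm V (a k \<oplus>\<^bsub>V\<^esub> a l))\<^sup>2"
      by (simp add: norm_vsub_sq norm_add_sq)
    moreover have "2 * (1 / real (Suc k)) = 2 / real (Suc k)" "2 * (1 / real (Suc l)) = 2 / real (Suc l)"
      by auto
    ultimately show ?thesis using Jas[of k] Jas[of l] by (smt (verit))
  qed
  obtain z where z: "z \<in> carrier V" and lim: "(\<lambda>n. ip_norm V (vsub V (a n) z)) \<longlonglongrightarrow> 0"
  proof (rule convergent[of a])
    fix \<epsilon> :: real assume e: "\<epsilon> > 0"
    then obtain N where N: "inverse (real (Suc N)) < \<epsilon>\<^sup>2 / 4"
      using reals_Archimedean[of "\<epsilon>\<^sup>2 / 4"] by auto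
    have "ip_norm V (vsub V (a k) (a l)) < \<epsilon>" if "N \<le> k" "N \<le> l" for k l
    proof -
      have le: "2 / real (Suc j) \<le> 2 * inverse (real (Suc N))" if "N \<le> j" for j
        using that by (simp add: field_simps)
      have "(ip_norm V (vsub V (a k) (a l)))\<^sup>2 < \<epsilon>\<^sup>2"
        using close[of k l] N le[OF that(1)] le[OF that(2)] by linarith
      then show ?thesis using e by (simp add: power2_less_imp_less)
    qed
    then show "\<exists>N. \<forall>k l. N \<le> k \<longrightarrow> N \<le> l \<longrightarrow> ip_norm V (vsub V (a k) (a l)) < \<epsilon>" by blast
  qed auto
  show ?thesis
  proof (intro bexI[of _ z] conjI allI impI)
    show "z \<in> carrier V" by fact
    fix h t assume ht: "(h, t) \<in> P"
    then have h: "h \<in> carrier V" by (rule P)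
    define H where "H = (ip_norm V h)\<^sup>2"
    have limip: "(\<lambda>k. Re (ip V (a k) h)) \<longlonglongrightarrow> Re (ip V z h)"
    proof -
      have "(\<lambda>k. Re (ip V (a k) h) - Re (ip V z h)) \<longlonglongrightarrow> 0"
      proof (rule Lim_null_comparison)
        show "\<forall>\<^sub>F k in sequentially. norm (Re (ip V (a k) h) - Re (ip V z h)) \<le> ip_norm V (vsub V (a k) z) * ip_norm V h"
          using Re_ip_le[of "vsub V (a _) z" h] z h by (auto simp: ip_vsub_left)
        show "(\<lambda>k. ip_norm V (vsub V (a k) z) * ip_norm V h) \<longlonglongrightarrow> 0"
          using tendsto_mult_right[OF lim, of "ip_norm V h"] by simp
      qed
      then show ?thesis by (simp add: LIM_zero_iff)
    qed
    \<comment> \<open>Minimality in the direction \<open>h\<close>: the inequality at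
      \<open>a k\<close> plus q times \<open>h\<close> has the error 1/(k+1), which disappears in
      the limit.\<close>
    have var: "0 \<le> (of_rat q)\<^sup>2 * H + 2 * of_rat q * (Re (ip V z h) - t)" for q
    proof -
      have "0 \<le> (of_rat q)\<^sup>2 * H + 2 * of_rat q * (Re (ip V (a k) h) - t) + 1 / real (Suc k)" for k
      proof -
        have "(a k \<oplus>\<^bsub>V\<^esub> of_real (of_rat q) \<odot>\<^bsub>V\<^esub> h, s k + of_rat q * t) \<in> P"
          by (intro scale add as ht)
        from mle[OF this] Jas[of k] show ?thesis
          using h by (simp add: J_def norm_add_sq norm_smult ip_expand H_def power_mult_distrib algebra_simps
            flip: of_rat_power)
      qed
      moreover have "(\<lambda>k. (of_rat q)\<^sup>2 * H + 2 * of_rat q * (Re (ip V (a k) h) - t) + 1 / real (Suc k))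
         \<longlonglongrightarrow> (of_rat q)\<^sup>2 * H + 2 * of_rat q * (Re (ip V z h) - t) + 0"
        by (intro tendsto_intros limip LIMSEQ_Suc[OF lim_1_over_n])
      ultimately show ?thesis by (simp add: LIMSEQ_le_const)
    qed
    \<comment> \<open>Taking q = r or q = -r and dividing by r > 0 isolates the linear term; letting
      r tend to 0 then forces it to vanish.\<close>
    have d: "0 \<le> 1 / real (Suc j) * H + 2 * \<sigma> * (Re (ip V z h) - t)" if "\<sigma> = 1 \<or> \<sigma> = -1" for j \<sigma>
    proof -
      define r where "r = 1 / real (Suc j)"
      have r: "r > 0" by (simp add: r_def)
      have "of_rat ((if \<sigma> = 1 then 1 else -1) * (1 / of_nat (Suc j))) = \<sigma> * r"
        using that by (auto simp: of_rat_divide of_rat_minus of_rat_add r_def)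
      then have "0 \<le> (\<sigma> * r)\<^sup>2 * H + 2 * (\<sigma> * r) * (Re (ip V z h) - t)" using var by metis
      also have "\<dots> = r * (r * H + 2 * \<sigma> * (Re (ip V z h) - t))"
        using that by (auto simp: power2_eq_square algebra_simps)
      finally show ?thesis using r unfolding r_def[symmetric] by (simp add: zero_le_mult_iff)
    qed
    have "0 \<le> 2 * \<sigma> * (Re (ip V z h) - t)" if "\<sigma> = 1 \<or> \<sigma> = -1" for \<sigma>
    proof -
      have "(\<lambda>j. 1 / real (Suc j) * H + 2 * \<sigma> * (Re (ip V z h) - t)) \<longlonglongrightarrow> 0 * H + 2 * \<sigma> * (Re (ip V z h) - t)"
        by (intro tendsto_intros LIMSEQ_Suc[OF lim_1_over_n])
      with d[OF that] show ?thesis by (simp add: LIMSEQ_le_const)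
    qed
    from this[of 1] this[of "-1"] have "t = Re (ip V z h)" by simp
    then show "t = Re (ip V h z)" using z h by (simp add: ip_commute[of h z])
  next
    fix \<epsilon> :: real assume "\<epsilon> > 0"
    then have "\<forall>\<^sub>F k in sequentially. ip_norm V (vsub V (a k) z) < \<epsilon>" by (rule order_tendstoD(2)[OF lim])
    then obtain k where k: "ip_norm V (vsub V (a k) z) < \<epsilon>" unfolding eventually_sequentially by auto
    show "\<exists>a s. (a, s) \<in> P \<and> ip_norm V (vsub V a z) < \<epsilon>" using as[of k] k by blast
  qed
qed

text \<open>Since \<open>z\<close> is itself approximated by vectors of the graph, the bound on the
  functional can be tested near \<open>z\<close>, where its value is close to the square of the
  norm.\<close>

lemma norm_le_of_dense:
  assumes z: "z \<in> carrier V" and P: "\<And>a s. (a, s) \<in> P \<Longrightarrow> a \<in> carrier V"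
    and rep: "\<And>a s. (a, s) \<in> P \<Longrightarrow> s = Re (ip V a z)"
    and dense: "\<And>\<epsilon>. \<epsilon> > 0 \<Longrightarrow> \<exists>a s. (a, s) \<in> P \<and> ip_norm V (vsub V a z) < \<epsilon>"
    and C: "C \<ge> 0" "\<And>a s. (a, s) \<in> P \<Longrightarrow> s \<le> C * ip_norm V a"
  shows "ip_norm V z \<le> C"
proof (rule ccontr)
  assume n: "\<not> ip_norm V z \<le> C"
  define Z where "Z = ip_norm V z"
  have Z: "Z > C" "Z > 0" using n C by (auto simp: Z_def)
  \<comment> \<open>With this \<open>e\<close> the error e (C + Z) is exactly half of the gap Z (Z -
    C) that it would have to cover.\<close>
  define e where "e = Z * (Z - C) / (2 * (C + Z))"
  have e: "e > 0" using Z C by (simp add: e_def)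
  obtain a s where a: "(a, s) \<in> P" "ip_norm V (vsub V a z) < e" using dense[OF e] by auto
  have aV: "a \<in> carrier V" using P a by auto
  have "Z\<^sup>2 - Re (ip V a z) = - Re (ip V (vsub V a z) z)"
    using aV z by (simp add: ip_vsub_left Z_def Re_ip_self)
  also have "\<dots> \<le> e * Z"
    using Re_ip_le[OF vsub_in[OF aV z] z] mult_right_mono[OF less_imp_le[OF a(2)] less_imp_le[OF Z(2)]]
    unfolding Z_def by linarith
  finally have "Z\<^sup>2 \<le> C * ip_norm V a + e * Z" using C(2)[OF a(1)] rep[OF a(1)] by simp
  also have "\<dots> \<le> C * (Z + e) + e * Z"
    using norm_le_vsub[OF aV z] a(2) C e by (intro add_mono mult_left_mono) (auto simp: Z_def)
  finally have "Z * (Z - C) \<le> e * (C + Z)" by (simp add: power2_eq_square algebra_simps)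
  moreover have "e * (C + Z) = Z * (Z - C) / 2" using Z C(1) unfolding e_def by (simp add: divide_simps)
  ultimately show False using Z by (simp add: mult_less_0_iff)
qed

text \<open>The real part is represented by \<open>riesz_rational\<close>; its values at \<i> times
  x recover the imaginary part.\<close>

lemma riesz:
  assumes add: "\<And>x y. x \<in> carrier V \<Longrightarrow> y \<in> carrier V \<Longrightarrow> \<phi> (x \<oplus>\<^bsub>V\<^esub> y) = \<phi> x + \<phi> y"
    and smult: "\<And>c x. x \<in> carrier V \<Longrightarrow> \<phi> (c \<odot>\<^bsub>V\<^esub> x) = c * \<phi> x"
    and bound: "\<And>x. x \<in> carrier V \<Longrightarrow> cmod (\<phi> x) \<le> C * ip_norm V x"
  obtains z where "z \<in> carrier V" "\<And>x. x \<in> carrier V \<Longrightarrow> \<phi> x = ip V x z"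
proof -
  define P where "P = {(x, Re (\<phi> x)) |x. x \<in> carrier V}"
  have "2 * s \<le> (ip_norm V a)\<^sup>2 + C\<^sup>2" if "(a, s) \<in> P" for a s
  proof -
    have "2 * s \<le> 2 * (C * ip_norm V a)"
      using that bound[of a] abs_Re_le_cmod[of "\<phi> a"] by (auto simp: P_def)
    also have "\<dots> \<le> (ip_norm V a)\<^sup>2 + C\<^sup>2"
      using sum_squares_bound[of C "ip_norm V a"] by (simp add: algebra_simps)
    finally show ?thesis .
  qed
  then have "\<exists>z\<in>carrier V. (\<forall>a s. (a, s) \<in> P \<longrightarrow> s = Re (ip V a z)) \<and>
    (\<forall>\<epsilon>>0. \<exists>a s. (a, s) \<in> P \<and> ip_norm V (vsub V a z) < \<epsilon>)"
    by (intro riesz_rational) (auto simp: P_def add smult)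
  then obtain z where z: "z \<in> carrier V" "\<And>a s. (a, s) \<in> P \<Longrightarrow> s = Re (ip V a z)"
    by blast
  have R: "Re (\<phi> x) = Re (ip V x z)" if "x \<in> carrier V" for x
    using z(2)[of x "Re (\<phi> x)"] that by (auto simp: P_def)
  have "\<phi> x = ip V x z" if "x \<in> carrier V" for x
    using R[OF that] R[of "\<i> \<odot>\<^bsub>V\<^esub> x"] that z(1) by (simp add: smult complex_eq_iff ip_smult_left)
  then show thesis using z that by blast
qed

end

text \<open>Completeness is asked of \<open>S\<close> only, since \<open>V\<close> will also be a
  union of levels. The projection of \<open>x\<close> is the Riesz vector of the functional
  \<open>w \<mapsto> ip V w x\<close> on \<open>S\<close>.\<close>

lemma projection_exists:
  assumes V: "inner_product_space V" and S: "S \<subseteq> carrier V" and H: "hilbert_space (V\<lparr>carrier := S\<rparr>)"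
    and x: "x \<in> carrier V"
  obtains y where "y \<in> S" "\<And>w. w \<in> S \<Longrightarrow> ip V (vsub V x y) w = 0" "ip_norm V y \<le> ip_norm V x"
proof -
  interpret V: inner_product_space V by fact
  interpret S: hilbert "V\<lparr>carrier := S\<rparr>" using H by (simp add: hilbert_space_iff)
  have SV: "s \<in> S \<Longrightarrow> s \<in> carrier V" for s using S by auto
  obtain y where y: "y \<in> S" "\<And>w. w \<in> S \<Longrightarrow> ip V w x = ip V w y"
    by (rule S.riesz[of "\<lambda>w. ip V w x" "ip_norm V x"])
      (use x in \<open>auto simp: SV V.ip_add_left V.ip_smult_left mult.commute intro: V.Cauchy_Schwarz\<close>)
  have *: "ip V (vsub V x y) w = 0" if "w \<in> S" for w
    using y(2)[OF that] y(1) that x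
    by (simp add: SV V.ip_vsub_right V.ip_commute[of "vsub V x y" w])
  have "(ip_norm V y)\<^sup>2 = Re (ip V y x)" using y by (simp add: V.Re_ip_self[symmetric] SV)
  also have "\<dots> \<le> ip_norm V y * ip_norm V x"
    using V.Re_ip_le[of y x] y x by (simp add: SV)
  finally have "ip_norm V y \<le> ip_norm V x"
    using y x V.norm_nonneg[of x] V.norm_nonneg[OF SV[OF y(1)]]
    by (cases "ip_norm V y = 0") (auto simp: power2_eq_square mult_le_cancel_left)
  with * y show thesis using that by blast
qed

section \<open>Bounded operators and adjoints\<close>

lemma linear_op_carrier_update [simp]: "linear_op (V\<lparr>carrier := S\<rparr>) = linear_op V"
  by (simp add: linear_op_def fun_eq_iff)

lemma bounded_on_carrier_update [simp]: "bounded_on (V\<lparr>carrier := S\<rparr>) = bounded_on V"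
  by (simp add: bounded_on_def fun_eq_iff)

lemma bounded_ops_carrier_update [simp]: "bounded_ops (V\<lparr>carrier := S\<rparr>) = bounded_ops V"
  by (simp add: bounded_ops_def fun_eq_iff)

lemma adjoint_op_carrier_update [simp]: "adjoint_op (V\<lparr>carrier := S\<rparr>) = adjoint_op V"
  by (simp add: adjoint_op_def fun_eq_iff)

lemma linear_opD:
  assumes "linear_op V D T" "x \<in> D"
  shows "y \<in> D \<Longrightarrow> T (x \<oplus>\<^bsub>V\<^esub> y) = T x \<oplus>\<^bsub>V\<^esub> T y" and "T (c \<odot>\<^bsub>V\<^esub> x) = c \<odot>\<^bsub>V\<^esub> T x"
  using assms by (auto simp: linear_op_def)

lemma bounded_opsD:
  assumes "T \<in> bounded_ops V D"
  shows "T \<in> D \<rightarrow>\<^sub>E D" "\<And>x. x \<in> D \<Longrightarrow> T x \<in> D" "linear_op V D T"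
    "\<And>x y. x \<in> D \<Longrightarrow> y \<in> D \<Longrightarrow> T (x \<oplus>\<^bsub>V\<^esub> y) = T x \<oplus>\<^bsub>V\<^esub> T y"
    "\<And>c x. x \<in> D \<Longrightarrow> T (c \<odot>\<^bsub>V\<^esub> x) = c \<odot>\<^bsub>V\<^esub> T x"
    and bounded_ops_vsub: "\<And>x y. x \<in> D \<Longrightarrow> y \<in> D \<Longrightarrow> (-1) \<odot>\<^bsub>V\<^esub> y \<in> D \<Longrightarrow> T (vsub V x y) = vsub V (T x) (T y)"
  using assms by (auto simp: bounded_ops_def linear_op_def vsub_def)

context inner_product_space
begin

lemma bounded_ops_bound:
  assumes "T \<in> bounded_ops V D" "D \<subseteq> carrier V"
  obtains C where "C \<ge> 0" "\<And>x. x \<in> D \<Longrightarrow> ip_norm V (T x) \<le> C * ip_norm V x"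
proof -
  obtain C where C: "\<And>x. x \<in> D \<Longrightarrow> ip_norm V (T x) \<le> C * ip_norm V x"
    using assms by (auto simp: bounded_ops_def bounded_on_def)
  have "ip_norm V (T x) \<le> max 0 C * ip_norm V x" if "x \<in> D" for x
    using C[OF that] assms(2) that by (meson mult_right_mono max.cobounded2 norm_nonneg order_trans subsetD)
  then show thesis using that[of "max 0 C"] by auto
qed

lemma bounded_opsI:
  assumes "T \<in> D \<rightarrow>\<^sub>E D"
    "\<And>x y. x \<in> D \<Longrightarrow> y \<in> D \<Longrightarrow> T (x \<oplus>\<^bsub>V\<^esub> y) = T x \<oplus>\<^bsub>V\<^esub> T y"
    "\<And>c x. x \<in> D \<Longrightarrow> T (c \<odot>\<^bsub>V\<^esub> x) = c \<odot>\<^bsub>V\<^esub> T x"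
    "\<And>x. x \<in> D \<Longrightarrow> ip_norm V (T x) \<le> C * ip_norm V x"
  shows "T \<in> bounded_ops V D"
  using assms by (auto simp: bounded_ops_def linear_op_def bounded_on_def intro!: exI[of _ C])

lemma adjoint_opI:
  assumes S: "S \<in> carrier V \<rightarrow>\<^sub>E carrier V"
    and "\<And>x y. x \<in> carrier V \<Longrightarrow> y \<in> carrier V \<Longrightarrow> ip V (T x) y = ip V x (S y)"
  shows "adjoint_op V (carrier V) T = S"
  unfolding adjoint_op_def
proof (rule the_equality)
  show "S \<in> carrier V \<rightarrow>\<^sub>E carrier V \<and> (\<forall>x\<in>carrier V. \<forall>y\<in>carrier V. ip V (T x) y = ip V x (S y))"
    using assms by auto
next
  fix S' assume S': "S' \<in> carrier V \<rightarrow>\<^sub>E carrier V \<and> (\<forall>x\<in>carrier V. \<forall>y\<in>carrier V. ip V (T x) y = ip V x (S' y))"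
  show "S' = S"
  proof (rule PiE_ext)
    fix y assume y: "y \<in> carrier V"
    have "ip V z (S' y) = ip V z (S y)" if "z \<in> carrier V" for z
      using S' assms(2)[OF that y] that y by metis
    then show "S' y = S y" using S S' y by (intro vec_eqI') auto
  qed (use S S' in auto)
qed

end

context hilbert
begin

text \<open>Riesz gives the values of the adjoint; its bound comes from testing the defining
  identity at x = S y.\<close>

lemma adjoint_exists:
  assumes T: "\<And>x. x \<in> carrier V \<Longrightarrow> T x \<in> carrier V" "linear_op V (carrier V) T"
    and C: "C \<ge> 0" "\<And>x. x \<in> carrier V \<Longrightarrow> ip_norm V (T x) \<le> C * ip_norm V x"
  obtains S where "S \<in> bounded_ops V (carrier V)"
    "\<And>x y. x \<in> carrier V \<Longrightarrow> y \<in> carrier V \<Longrightarrow> ip V (T x) y = ip V x (S y)"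
    "\<And>y. y \<in> carrier V \<Longrightarrow> ip_norm V (S y) \<le> C * ip_norm V y"
proof -
  have "\<exists>z\<in>carrier V. \<forall>x\<in>carrier V. ip V (T x) y = ip V x z" if y: "y \<in> carrier V" for y
  proof -
    have "cmod (ip V (T x) y) \<le> (C * ip_norm V y) * ip_norm V x" if x: "x \<in> carrier V" for x
      using Cauchy_Schwarz[OF T(1)[OF x] y] mult_right_mono[OF C(2)[OF x] norm_nonneg[OF y]]
      by (simp add: mult.assoc mult.commute[of "ip_norm V y"])
    then obtain z where "z \<in> carrier V" "\<And>x. x \<in> carrier V \<Longrightarrow> ip V (T x) y = ip V x z"
      by (rule riesz[rotated 2]) (use y T in \<open>auto simp: linear_opD ip_expand\<close>)
    then show ?thesis by blast
  qed
  then obtain S0 where S0: "\<And>y. y \<in> carrier V \<Longrightarrow> S0 y \<in> carrier V"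
      "\<And>x y. y \<in> carrier V \<Longrightarrow> x \<in> carrier V \<Longrightarrow> ip V (T x) y = ip V x (S0 y)"
    by metis
  define S where "S = restrict S0 (carrier V)"
  have S: "\<And>y. y \<in> carrier V \<Longrightarrow> S y \<in> carrier V"
      "\<And>x y. y \<in> carrier V \<Longrightarrow> x \<in> carrier V \<Longrightarrow> ip V x (S y) = ip V (T x) y"
    by (auto simp: S_def S0)
  have b: "ip_norm V (S y) \<le> C * ip_norm V y" if y: "y \<in> carrier V" for y
  proof (cases "ip_norm V (S y) = 0")
    case False
    have "ip_norm V (S y) * ip_norm V (S y) = Re (ip V (T (S y)) y)"
      using arg_cong[OF S(2)[OF y S(1)[OF y]], of Re] S(1)[OF y] by (simp add: Re_ip_self power2_eq_square)
    also have "\<dots> \<le> ip_norm V (T (S y)) * ip_norm V y" using Re_ip_le[of "T (S y)" y] S y T by auto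
    also have "\<dots> \<le> (C * ip_norm V (S y)) * ip_norm V y" using C S y by (intro mult_right_mono) auto
    finally show ?thesis using False norm_nonneg[OF S(1)[OF y]]
      by (simp add: mult.assoc mult.left_commute[of C] mult_le_cancel_left)
  qed (use C y in auto)
  have "S \<in> bounded_ops V (carrier V)"
  proof (rule bounded_opsI[OF _ _ _ b])
    show "S \<in> carrier V \<rightarrow>\<^sub>E carrier V" using S by (auto simp: S_def)
    show "S (x \<oplus>\<^bsub>V\<^esub> y) = S x \<oplus>\<^bsub>V\<^esub> S y" if "x \<in> carrier V" "y \<in> carrier V" for x y
      by (rule vec_eqI') (use that S T in \<open>auto simp: ip_add_right\<close>)
    show "S (c \<odot>\<^bsub>V\<^esub> x) = c \<odot>\<^bsub>V\<^esub> S x" if "x \<in> carrier V" for c x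
      by (rule vec_eqI') (use that S T in \<open>auto simp: ip_smult_right\<close>)
  qed
  with b S show thesis using that by metis
qed

lemma adjoint_bounded:
  assumes T: "T \<in> bounded_ops V (carrier V)"
  shows "adjoint_op V (carrier V) T \<in> bounded_ops V (carrier V)"
    "\<And>x y. x \<in> carrier V \<Longrightarrow> y \<in> carrier V \<Longrightarrow> ip V (T x) y = ip V x (adjoint_op V (carrier V) T y)"
proof -
  obtain C where "C \<ge> 0" "\<And>x. x \<in> carrier V \<Longrightarrow> ip_norm V (T x) \<le> C * ip_norm V x"
    using bounded_ops_bound[OF T] by blast
  with bounded_opsD[OF T] obtain S where S: "S \<in> bounded_ops V (carrier V)"
    "\<And>x y. x \<in> carrier V \<Longrightarrow> y \<in> carrier V \<Longrightarrow> ip V (T x) y = ip V x (S y)"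
    using adjoint_exists[of T C] by metis
  have "adjoint_op V (carrier V) T = S" by (rule adjoint_opI) (use S bounded_opsD[OF S(1)] in auto)
  with S show "adjoint_op V (carrier V) T \<in> bounded_ops V (carrier V)"
    "\<And>x y. x \<in> carrier V \<Longrightarrow> y \<in> carrier V \<Longrightarrow> ip V (T x) y = ip V x (adjoint_op V (carrier V) T y)"
    by auto
qed

section \<open>Total sequences and extension from rational combinations\<close>

definition total :: "(nat \<Rightarrow> 'a) \<Rightarrow> bool" where
  "total x \<longleftrightarrow> (\<forall>n. x n \<in> carrier V) \<and>
     (\<forall>v\<in>carrier V. (\<forall>n. ip V v (x n) = 0) \<longrightarrow> v = \<zero>\<^bsub>V\<^esub>)"

lemma total_eqI:
  assumes "total x" "u \<in> carrier V" "v \<in> carrier V" "\<And>n. ip V u (x n) = ip V v (x n)"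
  shows "u = v"
  by (rule vsub_eq_zeroD) (use assms in \<open>auto simp: total_def ip_vsub_left\<close>)

text \<open>Totality determines a vector by its pairings with the sequence, so the agreement is
  transferred to the adjoints and back instead of being extended by density.\<close>

lemma bounded_ops_eq_on_total:
  assumes x: "total x" and A: "A \<in> bounded_ops V (carrier V)" and B: "B \<in> bounded_ops V (carrier V)"
    and eq: "\<And>n. A (x n) = B (x n)" and v: "v \<in> carrier V"
  shows "A v = B v"
proof (rule vec_eqI)
  note A' = bounded_opsD[OF A] and B' = bounded_opsD[OF B]
  show "A v \<in> carrier V" "B v \<in> carrier V" using A' B' v by auto
  fix z assume z: "z \<in> carrier V"
  let ?A = "adjoint_op V (carrier V) A" and ?B = "adjoint_op V (carrier V) B"
  note aA = adjoint_bounded[OF A] and aB = adjoint_bounded[OF B]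
  have xV: "x n \<in> carrier V" for n using x by (simp add: total_def)
  have Az: "?A z \<in> carrier V" "?B z \<in> carrier V" using aA aB z by (auto dest: bounded_opsD)
  have "?A z = ?B z"
  proof (rule total_eqI[OF x])
    fix n
    have "ip V (x n) (?A z) = ip V (x n) (?B z)"
      using aA(2)[of "x n" z] aB(2)[of "x n" z] eq[of n] xV z by simp
    then show "ip V (?A z) (x n) = ip V (?B z) (x n)" using Az xV by (metis ip_commute)
  qed (use Az in auto)
  then show "ip V (A v) z = ip V (B v) z" using aA(2)[of v z] aB(2)[of v z] v z by simp
qed

end

text \<open>Coefficients are complex numbers with rational parts and combinations are indexed by
  lists. There are only countably many of them, so estimates valid almost everywhere for each one
  hold for all outside a common null set.\<close>

definition lincomb :: "'a ip_space \<Rightarrow> (nat \<Rightarrow> 'a) \<Rightarrow> (nat \<times> rat \<times> rat) list \<Rightarrow> 'a" where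
  "lincomb V x l = foldr (\<lambda>(n, a, b) v. Complex (of_rat a) (of_rat b) \<odot>\<^bsub>V\<^esub> x n \<oplus>\<^bsub>V\<^esub> v) l \<zero>\<^bsub>V\<^esub>"

lemma lincomb_simps [simp]:
  "lincomb V x [] = \<zero>\<^bsub>V\<^esub>"
  "lincomb V x ((n, a, b) # l) = Complex (of_rat a) (of_rat b) \<odot>\<^bsub>V\<^esub> x n \<oplus>\<^bsub>V\<^esub> lincomb V x l"
  by (simp_all add: lincomb_def)

context inner_product_space
begin

lemma lincomb_in [simp]: "(\<And>n. x n \<in> carrier V) \<Longrightarrow> lincomb V x l \<in> carrier V"
  by (induction l) auto

lemma lincomb_append:
  "(\<And>n. x n \<in> carrier V) \<Longrightarrow> lincomb V x (l @ l') = lincomb V x l \<oplus>\<^bsub>V\<^esub> lincomb V x l'"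
  by (induction l) (auto simp: M.a_assoc)

lemma lincomb_scale:
  assumes x: "\<And>n. x n \<in> carrier V"
  shows "lincomb V x (map (\<lambda>(n, a, b). (n, q * a, q * b)) l) = of_real (of_rat q) \<odot>\<^bsub>V\<^esub> lincomb V x l"
proof (induction l)
  case Nil
  show ?case by (rule vec_eqI) (auto simp: ip_expand)
next
  case (Cons p l)
  obtain n a b where p: "p = (n, a, b)" by (cases p)
  have "Complex (of_rat (q * a)) (of_rat (q * b)) = of_real (of_rat q) * Complex (of_rat a) (of_rat b)"
    by (simp add: complex_eq_iff of_rat_mult)
  then show ?case unfolding p using x Cons
    by (intro vec_eqI) (auto simp: ip_expand algebra_simps)
qed

end

text \<open>The bound makes the real part of \<open>ip V (lincomb V y l) \<eta>\<close> a bounded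
  functional of \<open>lincomb V x l\<close>. Its Riesz vector is the value at \<eta> of an operator
  \<open>B\<close>, and the extension is the adjoint of \<open>B\<close>. This avoids showing that
  the map on combinations is well defined and extending it by density.\<close>

lemma (in hilbert) bounded_extension:
  assumes x: "total x" and y: "\<And>n. y n \<in> carrier V" and C: "C \<ge> 0"
    and bound: "\<And>l. ip_norm V (lincomb V y l) \<le> C * ip_norm V (lincomb V x l)"
  obtains R where "R \<in> bounded_ops V (carrier V)" "\<And>n. R (x n) = y n"
    "\<And>v. v \<in> carrier V \<Longrightarrow> ip_norm V (R v) \<le> C * ip_norm V v"
proof -
  have xV: "x n \<in> carrier V" for n using x by (simp add: total_def)
  have "\<exists>z\<in>carrier V. (\<forall>n. ip V (y n) \<eta> = ip V (x n) z) \<and> ip_norm V z \<le> C * ip_norm V \<eta>"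
    if h: "\<eta> \<in> carrier V" for \<eta>
  proof -
    \<comment> \<open>A graph rather than a function, since different lists may give the same
      combination.\<close>
    define P where "P = range (\<lambda>l. (lincomb V x l, Re (ip V (lincomb V y l) \<eta>)))"
    have le: "s \<le> (C * ip_norm V \<eta>) * ip_norm V a" if "(a, s) \<in> P" for a s
    proof -
      obtain l where l: "a = lincomb V x l" "s = Re (ip V (lincomb V y l) \<eta>)" using \<open>(a, s) \<in> P\<close> by (auto simp: P_def)
      have "s \<le> ip_norm V (lincomb V y l) * ip_norm V \<eta>"
        using Re_ip_le[of "lincomb V y l" \<eta>] y h by (simp add: l)
      also have "\<dots> \<le> (C * ip_norm V a) * ip_norm V \<eta>"
        using bound[of l] h by (intro mult_right_mono) (auto simp: l)
      finally show ?thesis by (simp add: ac_simps)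
    qed
    have P1: "a \<in> carrier V" if "(a, s) \<in> P" for a s using that xV by (auto simp: P_def)
    have P2: "(a \<oplus>\<^bsub>V\<^esub> b, s + t) \<in> P" if "(a, s) \<in> P" "(b, t) \<in> P" for a s b t
    proof -
      obtain l k where "a = lincomb V x l" "s = Re (ip V (lincomb V y l) \<eta>)"
        "b = lincomb V x k" "t = Re (ip V (lincomb V y k) \<eta>)"
        using \<open>(a, s) \<in> P\<close> \<open>(b, t) \<in> P\<close> by (auto simp: P_def)
      then show ?thesis unfolding P_def
        by (intro image_eqI[of _ _ "l @ k"]) (use h y xV in \<open>auto simp: lincomb_append ip_add_left\<close>)
    qed
    have P3: "(of_real (of_rat q) \<odot>\<^bsub>V\<^esub> a, of_rat q * s) \<in> P" if "(a, s) \<in> P" for a s q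
    proof -
      obtain l where "a = lincomb V x l" "s = Re (ip V (lincomb V y l) \<eta>)" using \<open>(a, s) \<in> P\<close> by (auto simp: P_def)
      then show ?thesis unfolding P_def
        by (intro image_eqI[of _ _ "map (\<lambda>(n, a, b). (n, q * a, q * b)) l"])
          (use h y xV in \<open>auto simp: lincomb_scale ip_smult_left\<close>)
    qed
    have P4: "2 * s \<le> (ip_norm V a)\<^sup>2 + (C * ip_norm V \<eta>)\<^sup>2" if "(a, s) \<in> P" for a s
      using le[OF that] sum_squares_bound[of "C * ip_norm V \<eta>" "ip_norm V a"] by simp
    have ne: "P \<noteq> {}" by (auto simp: P_def)
    obtain z where z1: "z \<in> carrier V" and zP: "(\<forall>a s. (a, s) \<in> P \<longrightarrow> s = Re (ip V a z)) \<and>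
      (\<forall>\<epsilon>>0. \<exists>a s. (a, s) \<in> P \<and> ip_norm V (vsub V a z) < \<epsilon>)"
      using riesz_rational[OF P1 ne P2 P3 P4] by (rule bexE)
    note z = z1 zP[THEN conjunct1, rule_format] zP[THEN conjunct2, rule_format]
    have "ip_norm V z \<le> C * ip_norm V \<eta>"
      by (rule norm_le_of_dense[OF z(1) P1 z(2,3) _ le]) (use C h in auto)
    moreover have "ip V (y n) \<eta> = ip V (x n) z" for n
    proof -
      \<comment> \<open>The coefficients 1 and \<i> turn the real identity on the graph into the
        complex one.\<close>
      have *: "(c \<odot>\<^bsub>V\<^esub> x n, Re (ip V (c \<odot>\<^bsub>V\<^esub> y n) \<eta>)) \<in> P" if "c = Complex (of_rat a) (of_rat b)" for c a b
        unfolding P_def by (rule image_eqI[of _ _ "[(n, a, b)]"]) (use xV y that in auto)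
      have "1 = Complex (of_rat 1) (of_rat 0)" "\<i> = Complex (of_rat 0) (of_rat 1)"
        by (simp_all add: complex_eq_iff)
      from z(2)[OF *[OF this(1)]] z(2)[OF *[OF this(2)]]
      show ?thesis using xV y h z(1) by (simp add: complex_eq_iff ip_smult_left)
    qed
    ultimately show ?thesis using z(1) by blast
  qed
  then obtain B where B: "\<And>\<eta>. \<eta> \<in> carrier V \<Longrightarrow> B \<eta> \<in> carrier V"
      "\<And>n \<eta>. \<eta> \<in> carrier V \<Longrightarrow> ip V (y n) \<eta> = ip V (x n) (B \<eta>)"
      "\<And>\<eta>. \<eta> \<in> carrier V \<Longrightarrow> ip_norm V (B \<eta>) \<le> C * ip_norm V \<eta>"
    by metis
  have B2: "ip V (B \<eta>) (x n) = ip V \<eta> (y n)" if "\<eta> \<in> carrier V" for n \<eta>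
    using B that xV y by (metis ip_commute)
  have "linear_op V (carrier V) B" unfolding linear_op_def
    by (intro conjI ballI allI; rule total_eqI[OF x]) (auto simp: B B2 ip_expand xV y)
  then obtain R where R: "R \<in> bounded_ops V (carrier V)"
    "\<And>x y. x \<in> carrier V \<Longrightarrow> y \<in> carrier V \<Longrightarrow> ip V (B x) y = ip V x (R y)"
    "\<And>y. y \<in> carrier V \<Longrightarrow> ip_norm V (R y) \<le> C * ip_norm V y"
    using adjoint_exists[of B C] B C by metis
  have "R (x n) = y n" for n
  proof (rule vec_eqI')
    show "R (x n) \<in> carrier V" using bounded_opsD(2)[OF R(1)] xV by blast
    show "ip V z (R (x n)) = ip V z (y n)" if "z \<in> carrier V" for z
      using R(2)[OF that xV] B2[OF that] by simp
  qed (rule y)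
  then show thesis using that[OF R(1) _ R(3)] by simp
qed

section \<open>Closedness for the strong operator topology\<close>

text \<open>Adherence of \<open>T\<close> to \<open>A\<close> in the strong operator topology,
  spelled out on basic neighbourhoods.\<close>

definition sot_limit :: "'a ip_space \<Rightarrow> 'a set \<Rightarrow> ('a \<Rightarrow> 'a) set \<Rightarrow> ('a \<Rightarrow> 'a) \<Rightarrow> bool" where
  "sot_limit V D A T \<longleftrightarrow> (\<forall>X \<epsilon>. finite X \<longrightarrow> X \<subseteq> D \<longrightarrow> \<epsilon> > 0 \<longrightarrow>
     (\<exists>S\<in>A. \<forall>x\<in>X. ip_norm V (vsub V (T x) (S x)) < \<epsilon>))"

lemma sot_limit_carrier_update [simp]: "sot_limit (V\<lparr>carrier := S\<rparr>) = sot_limit V"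
  by (simp add: sot_limit_def fun_eq_iff)

lemma sot_limitD:
  "sot_limit V D A T \<Longrightarrow> finite X \<Longrightarrow> X \<subseteq> D \<Longrightarrow> \<epsilon> > 0 \<Longrightarrow>
     \<exists>S\<in>A. \<forall>x\<in>X. ip_norm V (vsub V (T x) (S x)) < \<epsilon>"
  by (auto simp: sot_limit_def)

text \<open>A finite intersection of preimages of balls is an open neighbourhood in the product
  topology, so points of the closure are limits in the sense of \<open>sot_limit\<close>.\<close>

lemma closedin_strong_op:
  assumes V: "inner_product_space V" and D: "D \<subseteq> carrier V" and B: "B \<subseteq> D \<rightarrow>\<^sub>E D" and A: "A \<subseteq> B"
    and lim: "\<And>T. T \<in> B \<Longrightarrow> sot_limit V D A T \<Longrightarrow> T \<in> A"
  shows "closedin (strong_op_topology V D B) A"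
proof -
  interpret V: inner_product_space V by fact
  interpret Metric_space D "ip_dist V" by (rule V.Metric_space_subset[OF D])
  let ?P = "product_topology (\<lambda>_. mtopology) D"
  have tP: "topspace ?P = D \<rightarrow>\<^sub>E D" by simp
  have top: "topspace (strong_op_topology V D B) = B" using B by (auto simp: strong_op_topology_def)
  have "T \<in> A" if T: "T \<in> strong_op_topology V D B closure_of A" for T
  proof -
    have TB: "T \<in> B" using T top by (auto simp: in_closure_of)
    have TD: "T x \<in> D" if "x \<in> D" for x using TB B that by blast
    have "sot_limit V D A T" unfolding sot_limit_def
    proof (intro allI impI)
      fix X :: "'a set" and \<epsilon> :: real assume X: "finite X" "X \<subseteq> D" and e: "\<epsilon> > 0"
      \<comment> \<open>Intersecting with the whole space keeps the set open when \<open>X\<close>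
        is empty.\<close>
      define U where "U = (\<Inter>x\<in>X. {f \<in> topspace ?P. f x \<in> mball (T x) \<epsilon>}) \<inter> topspace ?P"
      have "openin ?P {f \<in> topspace ?P. f x \<in> mball (T x) \<epsilon>}" if x: "x \<in> X" for x
      proof -
        have "continuous_map ?P mtopology (\<lambda>f. f x)"
          using X x by (intro continuous_map_product_projection) auto
        then show ?thesis by (rule openin_continuous_map_preimage) simp
      qed
      then have "openin ?P U" unfolding U_def by (intro openin_INT X) auto
      then have "openin (strong_op_topology V D B) (U \<inter> B)"
        unfolding strong_op_topology_def by (auto simp: openin_subtopology)
      moreover have "T \<in> U \<inter> B" using TB B TD X e by (auto simp: U_def)
      ultimately obtain S where S: "S \<in> A" "S \<in> U" using T by (auto simp: in_closure_of)
      have "ip_norm V (vsub V (T x) (S x)) < \<epsilon>" if "x \<in> X" for x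
        using S that TD[of x] X D by (auto simp: U_def V.ip_dist_eq subset_iff)
      then show "\<exists>S\<in>A. \<forall>x\<in>X. ip_norm V (vsub V (T x) (S x)) < \<epsilon>" using S by blast
    qed
    then show ?thesis using lim TB by blast
  qed
  then show ?thesis using A top by (auto simp flip: closure_of_subset_eq)
qed

section \<open>Algebras of locally bounded operators\<close>

lemma unital_star_subalgebraD:
  assumes "unital_star_subalgebra V D B A"
  shows "\<And>T. T \<in> A \<Longrightarrow> T \<in> B" "(\<lambda>x\<in>D. x) \<in> A"
    "\<And>S T. S \<in> A \<Longrightarrow> T \<in> A \<Longrightarrow> (\<lambda>x\<in>D. S x \<oplus>\<^bsub>V\<^esub> T x) \<in> A"
    "\<And>c T. T \<in> A \<Longrightarrow> (\<lambda>x\<in>D. c \<odot>\<^bsub>V\<^esub> T x) \<in> A"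
    "\<And>S T. S \<in> A \<Longrightarrow> T \<in> A \<Longrightarrow> compose D S T \<in> A"
    "\<And>T. T \<in> A \<Longrightarrow> adjoint_op V D T \<in> A"
  using assms unfolding unital_star_subalgebra_def by blast+

lemma loc_bounded_opsD:
  assumes "T \<in> loc_bounded_ops V F"
  shows "T \<in> dom_of F \<rightarrow>\<^sub>E dom_of F" "linear_op V (dom_of F) T"
    "\<And>x. x \<in> F \<alpha> \<Longrightarrow> T x \<in> F \<alpha>"
    "\<And>x y. x \<in> dom_of F \<Longrightarrow> (\<And>y. y \<in> F \<alpha> \<Longrightarrow> ip V x y = 0) \<Longrightarrow> y \<in> F \<alpha> \<Longrightarrow> ip V (T x) y = 0"
    "bounded_on V (F \<alpha>) T"
  using assms unfolding loc_bounded_ops_def orth_in_def by blast+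

lemma loc_bounded_ops_restrict:
  assumes "T \<in> loc_bounded_ops V F"
    "\<And>x y. x \<in> F \<alpha> \<Longrightarrow> y \<in> F \<alpha> \<Longrightarrow> x \<oplus>\<^bsub>V\<^esub> y \<in> F \<alpha>" "\<And>c x. x \<in> F \<alpha> \<Longrightarrow> c \<odot>\<^bsub>V\<^esub> x \<in> F \<alpha>"
  shows "restrict T (F \<alpha>) \<in> bounded_ops V (F \<alpha>)"
  using loc_bounded_opsD(2)[OF assms(1)] loc_bounded_opsD(3,5)[OF assms(1), where \<alpha> = \<alpha>] assms(2,3)
  unfolding bounded_ops_def bounded_on_def linear_op_def by auto

lemma loc_bounded_opsI:
  assumes "T \<in> dom_of F \<rightarrow>\<^sub>E dom_of F"
    "\<And>x y. x \<in> dom_of F \<Longrightarrow> y \<in> dom_of F \<Longrightarrow> T (x \<oplus>\<^bsub>V\<^esub> y) = T x \<oplus>\<^bsub>V\<^esub> T y"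
    "\<And>c x. x \<in> dom_of F \<Longrightarrow> T (c \<odot>\<^bsub>V\<^esub> x) = c \<odot>\<^bsub>V\<^esub> T x"
    "\<And>\<alpha> x. x \<in> F \<alpha> \<Longrightarrow> T x \<in> F \<alpha>"
    "\<And>\<alpha> x y. x \<in> dom_of F \<Longrightarrow> (\<And>y. y \<in> F \<alpha> \<Longrightarrow> ip V x y = 0) \<Longrightarrow> y \<in> F \<alpha> \<Longrightarrow> ip V (T x) y = 0"
    "\<And>\<alpha>. bounded_on V (F \<alpha>) T"
  shows "T \<in> loc_bounded_ops V F"
proof -
  have "T ` orth_in V (dom_of F) (F \<alpha>) \<subseteq> orth_in V (dom_of F) (F \<alpha>)" for \<alpha>
  proof
    fix z assume "z \<in> T ` orth_in V (dom_of F) (F \<alpha>)"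
    then obtain x where x: "x \<in> dom_of F" "\<And>y. y \<in> F \<alpha> \<Longrightarrow> ip V x y = 0" "z = T x"
      by (auto simp: orth_in_def)
    show "z \<in> orth_in V (dom_of F) (F \<alpha>)"
      unfolding orth_in_def x(3) using PiE_mem[OF assms(1) x(1)] assms(5)[OF x(1,2)] by blast
  qed
  moreover have "T ` F \<alpha> \<subseteq> F \<alpha>" for \<alpha> using assms(4) by blast
  moreover have "linear_op V (dom_of F) T" unfolding linear_op_def using assms(2,3) by blast
  ultimately show ?thesis unfolding loc_bounded_ops_def using assms(1,6) by simp
qed

text \<open>Only the levels are complete. This covers a fibre inside its ambient Hilbert space as
  well as the union of the levels of the direct integral, which is not completed.\<close>

locale directed_levels = inner_product_space V for V :: "'a ip_space" +
  fixes F :: "'i::order \<Rightarrow> 'a set"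
  assumes directed: "\<forall>\<alpha> \<beta>::'i. \<exists>\<gamma>. \<alpha> \<le> \<gamma> \<and> \<beta> \<le> \<gamma>"
    and mono: "\<alpha> \<le> \<beta> \<Longrightarrow> F \<alpha> \<subseteq> F \<beta>"
    and sub: "F \<alpha> \<subseteq> carrier V"
    and hilb: "hilbert_space (V\<lparr>carrier := F \<alpha>\<rparr>)"
begin

lemma level_hilbert: "hilbert (V\<lparr>carrier := F \<alpha>\<rparr>)"
  using hilb by (simp add: hilbert_space_iff)

lemma level_closed [simp]:
  "x \<in> F \<alpha> \<Longrightarrow> y \<in> F \<alpha> \<Longrightarrow> x \<oplus>\<^bsub>V\<^esub> y \<in> F \<alpha>" "x \<in> F \<alpha> \<Longrightarrow> c \<odot>\<^bsub>V\<^esub> x \<in> F \<alpha>"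
  "x \<in> F \<alpha> \<Longrightarrow> y \<in> F \<alpha> \<Longrightarrow> vsub V x y \<in> F \<alpha>"
proof -
  interpret hilbert "V\<lparr>carrier := F \<alpha>\<rparr>" by (rule level_hilbert)
  show "x \<in> F \<alpha> \<Longrightarrow> y \<in> F \<alpha> \<Longrightarrow> x \<oplus>\<^bsub>V\<^esub> y \<in> F \<alpha>" "x \<in> F \<alpha> \<Longrightarrow> c \<odot>\<^bsub>V\<^esub> x \<in> F \<alpha>"
    "x \<in> F \<alpha> \<Longrightarrow> y \<in> F \<alpha> \<Longrightarrow> vsub V x y \<in> F \<alpha>"
    using add_in smult_in vsub_in by auto
qed

lemma level_carrier [simp]: "x \<in> F \<alpha> \<Longrightarrow> x \<in> carrier V"
  using sub by auto

lemma dom_carrier: "dom_of F \<subseteq> carrier V"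
  using sub by auto

lemma common_level:
  assumes "finite X" "X \<subseteq> dom_of F"
  obtains \<gamma> where "\<delta> \<le> \<gamma>" "X \<subseteq> F \<gamma>"
proof -
  have "\<exists>\<gamma>\<ge>\<delta>. X \<subseteq> F \<gamma>" using assms
  proof (induction X)
    case (insert x X)
    then obtain \<gamma> \<beta> where "\<delta> \<le> \<gamma>" "X \<subseteq> F \<gamma>" "x \<in> F \<beta>" by auto
    moreover obtain \<epsilon> where "\<gamma> \<le> \<epsilon>" "\<beta> \<le> \<epsilon>" using directed by blast
    ultimately show ?case using mono[of \<gamma> \<epsilon>] mono[of \<beta> \<epsilon>] by (meson insert_subset order_trans subsetD)
  qed auto
  then show thesis using that by blast
qed

lemma common_level2:
  assumes "x \<in> dom_of F" "y \<in> dom_of F"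
  obtains \<gamma> where "x \<in> F \<gamma>" "y \<in> F \<gamma>"
  using common_level[of "{x, y}"] assms by auto

lemma level_above:
  assumes "x \<in> dom_of F"
  obtains \<beta> where "\<alpha> \<le> \<beta>" "x \<in> F \<beta>"
  using common_level[of "{x}" \<alpha>] assms by auto

lemma dom_closed:
  "x \<in> dom_of F \<Longrightarrow> y \<in> dom_of F \<Longrightarrow> x \<oplus>\<^bsub>V\<^esub> y \<in> dom_of F" "x \<in> dom_of F \<Longrightarrow> c \<odot>\<^bsub>V\<^esub> x \<in> dom_of F"
proof -
  assume x: "x \<in> dom_of F"
  then obtain \<gamma> where "x \<in> F \<gamma>" by auto
  then show "c \<odot>\<^bsub>V\<^esub> x \<in> dom_of F" using level_closed(2) by blast
  assume "y \<in> dom_of F"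
  with x obtain \<gamma> where "x \<in> F \<gamma>" "y \<in> F \<gamma>" by (rule common_level2)
  then show "x \<oplus>\<^bsub>V\<^esub> y \<in> dom_of F" using level_closed(1) by blast
qed

lemma restrict_bounded: "T \<in> loc_bounded_ops V F \<Longrightarrow> restrict T (F \<alpha>) \<in> bounded_ops V (F \<alpha>)"
  by (rule loc_bounded_ops_restrict) auto

text \<open>A pairing with a vector of \<open>F \<alpha>\<close> sees only the projection of
  \<open>x\<close> to \<open>F \<alpha>\<close>, because \<open>T\<close> keeps the orthogonal
  complement orthogonal. The adjoint of the restriction therefore works for all \<open>x\<close> of
  the domain, and this is what makes the adjoints of different levels agree.\<close>

lemma adjoint_level:
  assumes T: "T \<in> loc_bounded_ops V F"
  obtains S where "S \<in> bounded_ops V (F \<alpha>)"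
    "\<And>x y. x \<in> dom_of F \<Longrightarrow> y \<in> F \<alpha> \<Longrightarrow> ip V (T x) y = ip V x (S y)"
    "S = adjoint_op V (F \<alpha>) (restrict T (F \<alpha>))"
proof -
  interpret L: hilbert "V\<lparr>carrier := F \<alpha>\<rparr>" by (rule level_hilbert)
  note D = loc_bounded_opsD[OF T]
  define S where "S = adjoint_op V (F \<alpha>) (restrict T (F \<alpha>))"
  have S: "S \<in> bounded_ops V (F \<alpha>)" "\<And>x y. x \<in> F \<alpha> \<Longrightarrow> y \<in> F \<alpha> \<Longrightarrow> ip V (T x) y = ip V x (S y)"
    using L.adjoint_bounded[of "restrict T (F \<alpha>)"] restrict_bounded[OF T, of \<alpha>] by (auto simp: S_def)
  have "ip V (T x) y = ip V x (S y)" if x: "x \<in> dom_of F" and y: "y \<in> F \<alpha>" for x y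
  proof -
    have xV: "x \<in> carrier V" using x by auto
    obtain p where p: "p \<in> F \<alpha>" "\<And>w. w \<in> F \<alpha> \<Longrightarrow> ip V (vsub V x p) w = 0"
      using projection_exists[OF inner_product_space_axioms sub hilb xV] by blast
    have pD: "p \<in> dom_of F" using p(1) by auto
    have r: "vsub V x p \<in> dom_of F" unfolding vsub_def by (intro dom_closed x pD)
    have TxV: "T x \<in> carrier V" "T p \<in> F \<alpha>" "S y \<in> F \<alpha>"
      using subsetD[OF dom_carrier PiE_mem[OF D(1) x]] D(3)[OF p(1)] bounded_opsD(2)[OF S(1) y] by auto
    have "T (vsub V x p) = vsub V (T x) (T p)"
      using linear_opD(1)[OF D(2) x dom_closed(2)[OF pD]] linear_opD(2)[OF D(2) pD] by (simp add: vsub_def)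
    then have "ip V (vsub V (T x) (T p)) y = 0" using D(4)[OF r p(2) y] by simp
    then have "ip V (T x) y = ip V (T p) y" using TxV y by (simp add: ip_vsub_left)
    also have "\<dots> = ip V p (S y)" using S p y by simp
    also have "\<dots> = ip V x (S y)" using p(2)[OF TxV(3)] xV p(1) TxV(3) by (simp add: ip_vsub_left)
    finally show ?thesis .
  qed
  with S show thesis using that S_def by blast
qed

text \<open>Each level adjoint represents pairings on the whole domain, so any two coincide where
  both are defined and they fit together to one operator.\<close>

lemma adjoint_loc_bounded:
  assumes T: "T \<in> loc_bounded_ops V F"
  shows "adjoint_op V (dom_of F) T \<in> loc_bounded_ops V F"
    and "\<And>x y. x \<in> dom_of F \<Longrightarrow> y \<in> dom_of F \<Longrightarrow> ip V (T x) y = ip V x (adjoint_op V (dom_of F) T y)"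
    and "restrict (adjoint_op V (dom_of F) T) (F \<alpha>) = adjoint_op V (F \<alpha>) (restrict T (F \<alpha>))"
proof -
  note D = loc_bounded_opsD[OF T]
  define S where "S = (\<lambda>\<alpha>. adjoint_op V (F \<alpha>) (restrict T (F \<alpha>)))"
  have S: "S \<alpha> \<in> bounded_ops V (F \<alpha>)"
    "\<And>x y. x \<in> dom_of F \<Longrightarrow> y \<in> F \<alpha> \<Longrightarrow> ip V (T x) y = ip V x (S \<alpha> y)" for \<alpha>
    by (rule adjoint_level[OF T, of \<alpha>], simp add: S_def)+
  have SF: "S \<alpha> y \<in> F \<alpha>" if "y \<in> F \<alpha>" for y \<alpha> using bounded_opsD(2)[OF S(1) that] .
  have eq: "S \<alpha> y = S \<beta> y" if "y \<in> F \<alpha>" "y \<in> F \<beta>" for \<alpha> \<beta> y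
  proof -
    have "S \<alpha> y \<in> dom_of F" "S \<beta> y \<in> dom_of F" using SF[OF that(1)] SF[OF that(2)] by blast+
    then obtain \<gamma> where g: "S \<alpha> y \<in> F \<gamma>" "S \<beta> y \<in> F \<gamma>" by (rule common_level2)
    interpret L: hilbert "V\<lparr>carrier := F \<gamma>\<rparr>" by (rule level_hilbert)
    have "ip V z (S \<alpha> y) = ip V z (S \<beta> y)" if "z \<in> F \<gamma>" for z
    proof -
      have "z \<in> dom_of F" using that by blast
      then show ?thesis using S(2)[of z y] \<open>y \<in> F \<alpha>\<close> \<open>y \<in> F \<beta>\<close> by metis
    qed
    then show ?thesis using L.vec_eqI'[of "S \<alpha> y" "S \<beta> y"] g by simp
  qed
  \<comment> \<open>The choice of the level is immaterial by \<open>eq\<close>.\<close>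
  define R where "R = (\<lambda>y\<in>dom_of F. S (SOME \<alpha>. y \<in> F \<alpha>) y)"
  have RS: "R y = S \<alpha> y" if "y \<in> F \<alpha>" for \<alpha> y
    using that eq[OF that someI[of "\<lambda>\<alpha>. y \<in> F \<alpha>", OF that]] by (auto simp: R_def)
  have Rin: "R y \<in> F \<alpha>" if "y \<in> F \<alpha>" for \<alpha> y using RS[OF that] SF[OF that] by simp
  have Rext: "R \<in> dom_of F \<rightarrow>\<^sub>E dom_of F"
  proof (rule PiE_I)
    show "R y \<in> dom_of F" if "y \<in> dom_of F" for y using Rin that by blast
  qed (simp add: R_def)
  have Radj: "ip V (T x) y = ip V x (R y)" if "x \<in> dom_of F" "y \<in> dom_of F" for x y
    using that S(2)[of x y] RS[of y] by auto
  have "adjoint_op V (dom_of F) T = R"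
    unfolding adjoint_op_def
  proof (rule the_equality)
    show "R \<in> dom_of F \<rightarrow>\<^sub>E dom_of F \<and> (\<forall>x\<in>dom_of F. \<forall>y\<in>dom_of F. ip V (T x) y = ip V x (R y))"
      using Rext Radj by blast
  next
    fix S' assume S': "S' \<in> dom_of F \<rightarrow>\<^sub>E dom_of F \<and> (\<forall>x\<in>dom_of F. \<forall>y\<in>dom_of F. ip V (T x) y = ip V x (S' y))"
    have S1: "S' \<in> dom_of F \<rightarrow>\<^sub>E dom_of F"
      and S2: "\<And>x y. x \<in> dom_of F \<Longrightarrow> y \<in> dom_of F \<Longrightarrow> ip V (T x) y = ip V x (S' y)"
      using S' by (blast, blast)
    show "S' = R"
    proof (rule PiE_ext[OF S1 Rext])
      fix y assume y: "y \<in> dom_of F"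
      have "S' y \<in> dom_of F" "R y \<in> dom_of F" using PiE_mem[OF S1 y] PiE_mem[OF Rext y] .
      then obtain \<gamma> where g: "S' y \<in> F \<gamma>" "R y \<in> F \<gamma>" by (rule common_level2)
      interpret L: hilbert "V\<lparr>carrier := F \<gamma>\<rparr>" by (rule level_hilbert)
      have "ip V z (S' y) = ip V z (R y)" if "z \<in> F \<gamma>" for z
      proof -
        have "z \<in> dom_of F" using that by blast
        then show ?thesis using S2[OF _ y] Radj[OF _ y] by metis
      qed
      then show "S' y = R y" using L.vec_eqI'[of "S' y" "R y"] g by simp
    qed
  qed
  moreover have "R \<in> loc_bounded_ops V F"
  proof (rule loc_bounded_opsI[OF Rext _ _ Rin])
    fix x y assume xy: "x \<in> dom_of F" "y \<in> dom_of F"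
    then obtain \<gamma> where g: "x \<in> F \<gamma>" "y \<in> F \<gamma>" by (rule common_level2)
    then show "R (x \<oplus>\<^bsub>V\<^esub> y) = R x \<oplus>\<^bsub>V\<^esub> R y"
      using bounded_opsD(4)[OF S(1) g] by (simp add: RS[where \<alpha> = \<gamma>])
  next
    fix c x assume "x \<in> dom_of F"
    then obtain \<gamma> where "x \<in> F \<gamma>" by auto
    then show "R (c \<odot>\<^bsub>V\<^esub> x) = c \<odot>\<^bsub>V\<^esub> R x"
      using bounded_opsD(5)[OF S(1)] by (simp add: RS[where \<alpha> = \<gamma>])
  next
    fix \<alpha> x y assume x: "x \<in> dom_of F" and o: "\<And>y. y \<in> F \<alpha> \<Longrightarrow> ip V x y = 0" and y: "y \<in> F \<alpha>"
    have TyF: "T y \<in> F \<alpha>" using D(3) y by blast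
    have RxV: "R x \<in> carrier V" "x \<in> carrier V"
      using subsetD[OF dom_carrier PiE_mem[OF Rext x]] subsetD[OF dom_carrier x] by auto
    \<comment> \<open>The adjoint keeps the complement of a level because \<open>T\<close> keeps the
      level.\<close>
    have "ip V (T y) x = 0" using o[OF TyF] ip_commute[of "T y" x] TyF RxV by simp
    then have "ip V y (R x) = 0" using Radj[of y x] x y by auto
    then show "ip V (R x) y = 0" using ip_commute[of "R x" y] RxV y by simp
  next
    fix \<alpha>
    have "bounded_on V (F \<alpha>) (S \<alpha>)" using S(1)[of \<alpha>] by (auto simp: bounded_ops_def)
    then show "bounded_on V (F \<alpha>) R" by (simp add: bounded_on_def RS[where \<alpha> = \<alpha>])
  qed
  moreover have "restrict R (F \<alpha>) = S \<alpha>"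
    using PiE_arb[OF bounded_opsD(1)[OF S(1)], of _ \<alpha>] RS[where \<alpha> = \<alpha>] by (intro ext) (simp add: restrict_def)
  ultimately show "adjoint_op V (dom_of F) T \<in> loc_bounded_ops V F"
    "\<And>x y. x \<in> dom_of F \<Longrightarrow> y \<in> dom_of F \<Longrightarrow> ip V (T x) y = ip V x (adjoint_op V (dom_of F) T y)"
    "restrict (adjoint_op V (dom_of F) T) (F \<alpha>) = adjoint_op V (F \<alpha>) (restrict T (F \<alpha>))"
    using Radj by (simp_all add: S_def del: UN_iff)
qed

text \<open>By \<open>A\<close>, an element of the algebra amounts to a coherent family of elements
  of the \<open>N \<alpha>\<close>, so all conditions can be checked on the levels. Turning a family
  into an operator uses that \<open>N \<beta>\<close> contains adjoints: these supply the invariance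
  of the orthogonal complements.\<close>

theorem locally_von_neumann_algebraI:
  assumes alg: "\<And>\<alpha>. unital_star_subalgebra V (F \<alpha>) (bounded_ops V (F \<alpha>)) (N \<alpha>)"
    and closed: "\<And>\<alpha> T. T \<in> bounded_ops V (F \<alpha>) \<Longrightarrow> sot_limit V (F \<alpha>) (N \<alpha>) T \<Longrightarrow> T \<in> N \<alpha>"
    and restr: "\<And>\<alpha> \<beta> T. \<alpha> \<le> \<beta> \<Longrightarrow> T \<in> N \<beta> \<Longrightarrow> restrict T (F \<alpha>) \<in> N \<alpha>"
    and A: "\<And>T. T \<in> A \<longleftrightarrow> T \<in> loc_bounded_ops V F \<and> (\<forall>\<alpha>. restrict T (F \<alpha>) \<in> N \<alpha>)"
  shows "locally_von_neumann_algebra V F A"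
proof -
  let ?D = "dom_of F"
  note algD = unital_star_subalgebraD[OF alg]
  note NB = algD(1)
  have AL: "T \<in> loc_bounded_ops V F" if "T \<in> A" for T using that A[of T] by simp
  have AN: "restrict T (F \<alpha>) \<in> N \<alpha>" if "T \<in> A" for T \<alpha> using that A[of T] by simp
  have AD: "S x \<in> F \<alpha>" if "S \<in> A" "x \<in> F \<alpha>" for S x \<alpha>
    using loc_bounded_opsD(3)[OF AL[OF that(1)] that(2)] .
  have glue: "\<exists>T\<in>loc_bounded_ops V F. \<forall>\<alpha>. restrict T (F \<alpha>) = t \<alpha>"
    if t: "\<And>\<alpha>. t \<alpha> \<in> N \<alpha>" "\<And>\<alpha> \<beta>. \<alpha> \<le> \<beta> \<Longrightarrow> restrict (t \<beta>) (F \<alpha>) = t \<alpha>" for t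
  proof -
    have eq: "t \<alpha> x = t \<beta> x" if x: "x \<in> F \<alpha>" "x \<in> F \<beta>" for \<alpha> \<beta> x
    proof -
      obtain \<gamma> where "\<alpha> \<le> \<gamma>" "\<beta> \<le> \<gamma>" using directed by blast
      then show ?thesis
        using fun_cong[OF t(2)[of \<alpha> \<gamma>], of x] fun_cong[OF t(2)[of \<beta> \<gamma>], of x] x by simp
    qed
    define T where "T = (\<lambda>x\<in>?D. t (SOME \<alpha>. x \<in> F \<alpha>) x)"
    have Tt: "T x = t \<alpha> x" if "x \<in> F \<alpha>" for \<alpha> x
      using that eq[OF that someI[of "\<lambda>\<alpha>. x \<in> F \<alpha>", OF that]] by (auto simp: T_def)
    note tB = bounded_opsD[OF NB[OF t(1)]]
    have TF: "T x \<in> F \<alpha>" if "x \<in> F \<alpha>" for \<alpha> x using Tt[OF that] tB(2)[OF that] by simp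
    have "T \<in> loc_bounded_ops V F"
    proof (rule loc_bounded_opsI)
      show "T \<in> ?D \<rightarrow>\<^sub>E ?D"
      proof (rule PiE_I)
        show "T y \<in> ?D" if "y \<in> ?D" for y using TF that by blast
      qed (simp add: T_def)
    next
      fix x y assume "x \<in> ?D" "y \<in> ?D"
      then obtain \<gamma> where "x \<in> F \<gamma>" "y \<in> F \<gamma>" by (rule common_level2)
      then show "T (x \<oplus>\<^bsub>V\<^esub> y) = T x \<oplus>\<^bsub>V\<^esub> T y" using tB(4) by (simp add: Tt[where \<alpha> = \<gamma>])
    next
      fix c x assume "x \<in> ?D"
      then obtain \<gamma> where "x \<in> F \<gamma>" by auto
      then show "T (c \<odot>\<^bsub>V\<^esub> x) = c \<odot>\<^bsub>V\<^esub> T x" using tB(5) by (simp add: Tt[where \<alpha> = \<gamma>])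
    next
      fix \<alpha> x y assume x: "x \<in> ?D" and o: "\<And>y. y \<in> F \<alpha> \<Longrightarrow> ip V x y = 0" and y: "y \<in> F \<alpha>"
      obtain \<beta> where b: "\<alpha> \<le> \<beta>" "x \<in> F \<beta>" by (rule level_above[OF x])
      interpret L: hilbert "V\<lparr>carrier := F \<beta>\<rparr>" by (rule level_hilbert)
      let ?s = "adjoint_op V (F \<beta>) (t \<beta>)"
      \<comment> \<open>By \<open>restr\<close> the adjoint maps \<open>F \<alpha>\<close> into
        itself, hence \<open>t \<beta>\<close> keeps vectors orthogonal to \<open>F \<alpha>\<close>
        orthogonal to it.\<close>
      have s: "?s \<in> N \<beta>" by (rule algD(6)[OF t(1)])
      have sy: "?s y \<in> F \<alpha>" using bounded_opsD(2)[OF NB[OF restr[OF b(1) s]] y] y by simp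
      have "ip V (t \<beta> x) y = ip V x (?s y)"
        using L.adjoint_bounded(2)[of "t \<beta>" x y] NB[OF t(1)] b mono[OF b(1)] y by auto
      then show "ip V (T x) y = 0" using o[OF sy] b by (simp add: Tt[where \<alpha> = \<beta>])
    next
      fix \<alpha>
      have "bounded_on V (F \<alpha>) (t \<alpha>)" using NB[OF t(1)] by (auto simp: bounded_ops_def)
      then show "bounded_on V (F \<alpha>) T" by (simp add: bounded_on_def Tt[where \<alpha> = \<alpha>])
    qed (rule TF)
    moreover have "restrict T (F \<alpha>) = t \<alpha>" for \<alpha>
      using PiE_arb[OF tB(1), of _ \<alpha>] Tt[where \<alpha> = \<alpha>] by (intro ext) (simp add: restrict_def)
    ultimately show ?thesis by (intro bexI[of _ T] allI)
  qed
  \<comment> \<open>A strong limit on the domain is a strong limit on each level, where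
    \<open>closed\<close> applies. Closedness for the seminorms is later reduced to this fact as
    well.\<close>
  have limA: "T \<in> A" if T: "T \<in> loc_bounded_ops V F" and l: "sot_limit V ?D A T" for T
    unfolding A
  proof (intro conjI allI T closed restrict_bounded)
    fix \<alpha>
    show "sot_limit V (F \<alpha>) (N \<alpha>) (restrict T (F \<alpha>))" unfolding sot_limit_def
    proof (intro allI impI)
      fix X :: "'a set" and \<epsilon> :: real assume X: "finite X" "X \<subseteq> F \<alpha>" "\<epsilon> > 0"
      then obtain S where S: "S \<in> A" "\<forall>x\<in>X. ip_norm V (vsub V (T x) (S x)) < \<epsilon>"
        using sot_limitD[OF l, of X \<epsilon>] by blast
      show "\<exists>S\<in>N \<alpha>. \<forall>x\<in>X. ip_norm V (vsub V (restrict T (F \<alpha>) x) (S x)) < \<epsilon>"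
        by (rule bexI[OF _ AN[OF S(1)]]) (use S(2) X(2) in auto)
    qed
  qed
  \<comment> \<open>From here to \<open>Lcomp\<close>, the locally bounded operators themselves are
    shown to be closed under the operations; membership in \<open>A\<close> then concerns only the
    levels.\<close>
  have Lid: "(\<lambda>x\<in>?D. x) \<in> loc_bounded_ops V F"
  proof (rule loc_bounded_opsI)
    show "(\<lambda>x\<in>?D. x) (x \<oplus>\<^bsub>V\<^esub> y) = (\<lambda>x\<in>?D. x) x \<oplus>\<^bsub>V\<^esub> (\<lambda>x\<in>?D. x) y" if "x \<in> ?D" "y \<in> ?D" for x y
      using that dom_closed(1)[OF that] by (simp del: UN_iff Union_iff)
    show "(\<lambda>x\<in>?D. x) (c \<odot>\<^bsub>V\<^esub> x) = c \<odot>\<^bsub>V\<^esub> (\<lambda>x\<in>?D. x) x" if "x \<in> ?D" for c x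
      using that dom_closed(2)[OF that] by (simp del: UN_iff Union_iff)
  qed (auto simp: bounded_on_def intro!: exI[of _ 1])
  have Ladd: "(\<lambda>x\<in>?D. S x \<oplus>\<^bsub>V\<^esub> T x) \<in> loc_bounded_ops V F"
    if S: "S \<in> loc_bounded_ops V F" and T: "T \<in> loc_bounded_ops V F" for S T
  proof (rule loc_bounded_opsI)
    note DS = loc_bounded_opsD[OF S] and DT = loc_bounded_opsD[OF T]
    have V: "S x \<in> carrier V" "T x \<in> carrier V" if "x \<in> ?D" for x
      using DS(1) DT(1) that dom_carrier by blast+
    show "(\<lambda>x\<in>?D. S x \<oplus>\<^bsub>V\<^esub> T x) \<in> ?D \<rightarrow>\<^sub>E ?D"
      using dom_closed(1)[OF PiE_mem[OF DS(1)] PiE_mem[OF DT(1)]] by (intro PiE_I) (simp_all del: UN_iff Union_iff)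
    show "(\<lambda>x\<in>?D. S x \<oplus>\<^bsub>V\<^esub> T x) (x \<oplus>\<^bsub>V\<^esub> y) = (\<lambda>x\<in>?D. S x \<oplus>\<^bsub>V\<^esub> T x) x \<oplus>\<^bsub>V\<^esub> (\<lambda>x\<in>?D. S x \<oplus>\<^bsub>V\<^esub> T x) y"
      if "x \<in> ?D" "y \<in> ?D" for x y
      using that V[of x] V[of y] linear_opD(1)[OF DS(2), of x y] linear_opD(1)[OF DT(2), of x y]
      by (simp add: dom_closed M.a_ac del: UN_iff Union_iff)
    show "(\<lambda>x\<in>?D. S x \<oplus>\<^bsub>V\<^esub> T x) (c \<odot>\<^bsub>V\<^esub> x) = c \<odot>\<^bsub>V\<^esub> (\<lambda>x\<in>?D. S x \<oplus>\<^bsub>V\<^esub> T x) x"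
      if "x \<in> ?D" for c x
      using that V[of x] linear_opD(2)[OF DS(2) that] linear_opD(2)[OF DT(2) that]
      by (auto simp add: dom_closed simp del: UN_iff Union_iff intro!: vec_eqI) (auto simp: ip_expand algebra_simps)
    show "(\<lambda>x\<in>?D. S x \<oplus>\<^bsub>V\<^esub> T x) x \<in> F \<alpha>" if "x \<in> F \<alpha>" for x \<alpha>
      using that DS(3) DT(3) by auto
    show "ip V ((\<lambda>x\<in>?D. S x \<oplus>\<^bsub>V\<^esub> T x) x) y = 0"
      if "x \<in> ?D" "\<And>y. y \<in> F \<alpha> \<Longrightarrow> ip V x y = 0" "y \<in> F \<alpha>" for x y \<alpha>
      using DS(4)[OF that] DT(4)[OF that] that(1,3) V[OF that(1)] by (simp add: ip_expand del: UN_iff Union_iff)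
    fix \<alpha>
    obtain B C where BC: "\<And>x. x \<in> F \<alpha> \<Longrightarrow> ip_norm V (S x) \<le> B * ip_norm V x"
      "\<And>x. x \<in> F \<alpha> \<Longrightarrow> ip_norm V (T x) \<le> C * ip_norm V x"
      using DS(5)[of \<alpha>] DT(5)[of \<alpha>] by (auto simp: bounded_on_def)
    have "ip_norm V (S x \<oplus>\<^bsub>V\<^esub> T x) \<le> (B + C) * ip_norm V x" if x: "x \<in> F \<alpha>" for x
    proof -
      have "x \<in> ?D" using x by auto
      then show ?thesis
        using norm_triangle[of "S x" "T x"] V[of x] BC[OF x] by (simp add: distrib_right)
    qed
    then show "bounded_on V (F \<alpha>) (\<lambda>x\<in>?D. S x \<oplus>\<^bsub>V\<^esub> T x)"
      unfolding bounded_on_def by (intro exI[of _ "B + C"]) auto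
  qed
  have Lsmult: "(\<lambda>x\<in>?D. c \<odot>\<^bsub>V\<^esub> T x) \<in> loc_bounded_ops V F" if T: "T \<in> loc_bounded_ops V F" for c T
  proof (rule loc_bounded_opsI)
    note DT = loc_bounded_opsD[OF T]
    have V: "T x \<in> carrier V" if "x \<in> ?D" for x
      using DT(1) that dom_carrier by blast
    show "(\<lambda>x\<in>?D. c \<odot>\<^bsub>V\<^esub> T x) \<in> ?D \<rightarrow>\<^sub>E ?D"
      using dom_closed(2)[OF PiE_mem[OF DT(1)]] by (intro PiE_I) (simp_all del: UN_iff Union_iff)
    show "(\<lambda>x\<in>?D. c \<odot>\<^bsub>V\<^esub> T x) (x \<oplus>\<^bsub>V\<^esub> y) = (\<lambda>x\<in>?D. c \<odot>\<^bsub>V\<^esub> T x) x \<oplus>\<^bsub>V\<^esub> (\<lambda>x\<in>?D. c \<odot>\<^bsub>V\<^esub> T x) y"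
      if "x \<in> ?D" "y \<in> ?D" for x y
      using that V[of x] V[of y] linear_opD(1)[OF DT(2), of x y]
      by (auto simp add: dom_closed simp del: UN_iff Union_iff intro!: vec_eqI) (auto simp: ip_expand algebra_simps)
    show "(\<lambda>x\<in>?D. c \<odot>\<^bsub>V\<^esub> T x) (d \<odot>\<^bsub>V\<^esub> x) = d \<odot>\<^bsub>V\<^esub> (\<lambda>x\<in>?D. c \<odot>\<^bsub>V\<^esub> T x) x"
      if "x \<in> ?D" for d x
      using that V[of x] linear_opD(2)[OF DT(2) that]
      by (auto simp add: dom_closed simp del: UN_iff Union_iff intro!: vec_eqI) (auto simp: ip_expand algebra_simps)
    show "(\<lambda>x\<in>?D. c \<odot>\<^bsub>V\<^esub> T x) x \<in> F \<alpha>" if "x \<in> F \<alpha>" for x \<alpha>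
      using that DT(3) by auto
    show "ip V ((\<lambda>x\<in>?D. c \<odot>\<^bsub>V\<^esub> T x) x) y = 0"
      if "x \<in> ?D" "\<And>y. y \<in> F \<alpha> \<Longrightarrow> ip V x y = 0" "y \<in> F \<alpha>" for x y \<alpha>
      using DT(4)[OF that] that(1,3) V[OF that(1)] by (simp add: ip_expand del: UN_iff Union_iff)
    fix \<alpha>
    obtain C where BC: "\<And>x. x \<in> F \<alpha> \<Longrightarrow> ip_norm V (T x) \<le> C * ip_norm V x"
      using DT(5)[of \<alpha>] by (auto simp: bounded_on_def)
    have "ip_norm V (c \<odot>\<^bsub>V\<^esub> T x) \<le> (cmod c * C) * ip_norm V x" if x: "x \<in> F \<alpha>" for x
    proof -
      have "x \<in> ?D" using x by blast
      then show ?thesis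
        using V mult_left_mono[OF BC[OF x], of "cmod c"] by (simp add: norm_smult mult.assoc del: Union_iff UN_iff)
    qed
    then show "bounded_on V (F \<alpha>) (\<lambda>x\<in>?D. c \<odot>\<^bsub>V\<^esub> T x)"
      unfolding bounded_on_def by (intro exI[of _ "cmod c * C"]) auto
  qed
  have Lcomp: "compose ?D S T \<in> loc_bounded_ops V F"
    if S: "S \<in> loc_bounded_ops V F" and T: "T \<in> loc_bounded_ops V F" for S T
  proof (rule loc_bounded_opsI)
    note DS = loc_bounded_opsD[OF S] and DT = loc_bounded_opsD[OF T]
    have TD: "T x \<in> ?D" if "x \<in> ?D" for x using DT(1) that by blast
    show "compose ?D S T \<in> ?D \<rightarrow>\<^sub>E ?D"
      using PiE_mem[OF DS(1) TD] by (intro PiE_I) (simp_all add: compose_def del: UN_iff Union_iff)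
    show "compose ?D S T (x \<oplus>\<^bsub>V\<^esub> y) = compose ?D S T x \<oplus>\<^bsub>V\<^esub> compose ?D S T y"
      if "x \<in> ?D" "y \<in> ?D" for x y
      using that TD linear_opD(1)[OF DT(2)] linear_opD(1)[OF DS(2)] by (simp add: compose_def dom_closed del: UN_iff Union_iff)
    show "compose ?D S T (c \<odot>\<^bsub>V\<^esub> x) = c \<odot>\<^bsub>V\<^esub> compose ?D S T x" if "x \<in> ?D" for c x
      using that TD linear_opD(2)[OF DT(2)] linear_opD(2)[OF DS(2)] by (simp add: compose_def dom_closed del: UN_iff Union_iff)
    show "compose ?D S T x \<in> F \<alpha>" if "x \<in> F \<alpha>" for x \<alpha>
      using that DS(3) DT(3) by (auto simp: compose_def)
    show "ip V (compose ?D S T x) y = 0"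
      if "x \<in> ?D" "\<And>y. y \<in> F \<alpha> \<Longrightarrow> ip V x y = 0" "y \<in> F \<alpha>" for x y \<alpha>
      using DS(4)[OF TD[OF that(1)] DT(4)[OF that(1,2)] that(3)] that(1) by (simp add: compose_def del: UN_iff Union_iff)
    fix \<alpha>
    obtain B where B: "B \<ge> 0" "\<And>x. x \<in> F \<alpha> \<Longrightarrow> ip_norm V (S x) \<le> B * ip_norm V x"
      using bounded_ops_bound[OF restrict_bounded[OF S, of \<alpha>] sub] by auto
    obtain C where C: "\<And>x. x \<in> F \<alpha> \<Longrightarrow> ip_norm V (T x) \<le> C * ip_norm V x"
      using DT(5)[of \<alpha>] by (auto simp: bounded_on_def)
    have "ip_norm V (S (T x)) \<le> (B * C) * ip_norm V x" if x: "x \<in> F \<alpha>" for x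
      using B(2)[OF DT(3)[OF x]] mult_left_mono[OF C[OF x] B(1)] by (simp add: mult.assoc)
    then show "bounded_on V (F \<alpha>) (compose ?D S T)"
      unfolding bounded_on_def by (intro exI[of _ "B * C"]) (auto simp: compose_def)
  qed
  have star: "unital_star_subalgebra V ?D (loc_bounded_ops V F) A"
    unfolding unital_star_subalgebra_def
  proof (intro conjI ballI allI)

    have rD: "restrict (restrict f ?D) (F \<alpha>) = restrict f (F \<alpha>)" for f :: "'a \<Rightarrow> 'a" and \<alpha>
      by (auto simp: fun_eq_iff)
    show "A \<subseteq> loc_bounded_ops V F" using AL by (rule subsetI)
    show "(\<lambda>x\<in>?D. x) \<in> A" using Lid algD(2) by (simp only: A rD) simp
    fix T assume T: "T \<in> A"
    note TL = AL[OF T] and TN = AN[OF T]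
    show "(\<lambda>x\<in>?D. c \<odot>\<^bsub>V\<^esub> T x) \<in> A" for c
    proof -
      have "(\<lambda>x\<in>F \<alpha>. c \<odot>\<^bsub>V\<^esub> restrict T (F \<alpha>) x) \<in> N \<alpha>" for \<alpha> by (rule algD(4)[OF TN])
      then show ?thesis unfolding A rD using Lsmult[OF TL] by (simp cong: restrict_cong)
    qed
    show "adjoint_op V ?D T \<in> A"
      unfolding A adjoint_loc_bounded(3)[OF TL] using adjoint_loc_bounded(1)[OF TL] algD(6)[OF TN] by simp
    fix S assume S: "S \<in> A"
    note SL = AL[OF S] and SN = AN[OF S]
    have "(\<lambda>x\<in>F \<alpha>. restrict S (F \<alpha>) x \<oplus>\<^bsub>V\<^esub> restrict T (F \<alpha>) x) \<in> N \<alpha>" for \<alpha> by (rule algD(3)[OF SN TN])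
    then show "(\<lambda>x\<in>?D. S x \<oplus>\<^bsub>V\<^esub> T x) \<in> A" unfolding A rD using Ladd[OF SL TL] by (simp cong: restrict_cong)
    have "compose (F \<alpha>) (restrict S (F \<alpha>)) (restrict T (F \<alpha>)) \<in> N \<alpha>" for \<alpha> by (rule algD(5)[OF SN TN])
    moreover have "compose (F \<alpha>) (restrict S (F \<alpha>)) (restrict T (F \<alpha>)) = restrict (compose ?D S T) (F \<alpha>)" for \<alpha>
      using AD[OF T] by (auto simp: compose_def fun_eq_iff)
    ultimately show "compose ?D S T \<in> A" using Lcomp[OF SL TL] by (simp add: A)
  qed
  have cstar: "locally_Cstar_subalgebra V F A"
    unfolding locally_Cstar_subalgebra_def
  proof (intro conjI star ballI impI)
    fix T assume T: "T \<in> loc_bounded_ops V F"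
      and app: "\<forall>\<alpha>. \<forall>\<epsilon>>0. \<exists>S\<in>A. \<forall>x\<in>F \<alpha>. ip_norm V (T x \<ominus>\<^bsub>V\<^esub> S x) \<le> \<epsilon> * ip_norm V x"
    show "T \<in> A"
    proof (rule limA[OF T], unfold sot_limit_def, intro allI impI)
      fix X :: "'a set" and \<epsilon> :: real assume X: "finite X" "X \<subseteq> ?D" "\<epsilon> > 0"
      obtain \<gamma> where g: "X \<subseteq> F \<gamma>" using common_level[OF X(1,2)] by blast
      \<comment> \<open>The summand 1 makes \<open>m\<close> positive and strictly larger than each
        of the norms, so the relative error \<epsilon>/m suffices on all of
        \<open>X\<close>.\<close>
      define m where "m = 1 + (\<Sum>x\<in>X. ip_norm V x)"
      have nn: "ip_norm V x \<ge> 0" if "x \<in> X" for x using that g by auto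
      have m: "m > 0" unfolding m_def using sum_nonneg[of X "ip_norm V"] nn by simp
      have le: "ip_norm V x < m" if "x \<in> X" for x
        unfolding m_def using member_le_sum[of x X "ip_norm V"] that nn X(1) by auto
      obtain S where S: "S \<in> A" "\<forall>x\<in>F \<gamma>. ip_norm V (T x \<ominus>\<^bsub>V\<^esub> S x) \<le> (\<epsilon> / m) * ip_norm V x"
        using app m X(3) by (meson divide_pos_pos)
      have "ip_norm V (vsub V (T x) (S x)) < \<epsilon>" if x: "x \<in> X" for x
      proof -
        have xF: "x \<in> F \<gamma>" using g x by auto
        have "T x \<in> carrier V" "S x \<in> carrier V" using loc_bounded_opsD(3)[OF T xF] AD[OF S(1) xF] by auto
        then have "ip_norm V (vsub V (T x) (S x)) \<le> (\<epsilon> / m) * ip_norm V x"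
          using bspec[OF S(2) xF] by (simp only: minus_eq_vsub)
        also have "\<dots> < (\<epsilon> / m) * m" using le[OF x] X(3) m by (intro mult_strict_left_mono) auto
        finally show ?thesis using m by simp
      qed
      then show "\<exists>S\<in>A. \<forall>x\<in>X. ip_norm V (vsub V (T x) (S x)) < \<epsilon>" using S(1) by blast
    qed
  qed
  have vN: "von_neumann_algebra V (F \<alpha>) (N \<alpha>)" for \<alpha>
    unfolding von_neumann_algebra_def
    by (intro conjI alg closedin_strong_op inner_product_space_axioms sub closed)
      (simp_all add: subset_iff NB bounded_opsD(1))
  have proj: "projective_limit_of_vN V F A"
    unfolding projective_limit_of_vN_def
  proof (intro exI[of _ N] conjI allI impI ballI vN restr)
    show "bij_betw (\<lambda>T \<alpha>. restrict T (F \<alpha>)) A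
      {t. (\<forall>\<alpha>. t \<alpha> \<in> N \<alpha>) \<and> (\<forall>\<alpha> \<beta>. \<alpha> \<le> \<beta> \<longrightarrow> restrict (t \<beta>) (F \<alpha>) = t \<alpha>)}"
      unfolding bij_betw_def
    proof
      show "inj_on (\<lambda>T \<alpha>. restrict T (F \<alpha>)) A"
      proof (rule inj_onI)
        fix S T assume S: "S \<in> A" and T: "T \<in> A" and eq: "(\<lambda>\<alpha>. restrict S (F \<alpha>)) = (\<lambda>\<alpha>. restrict T (F \<alpha>))"
        show "S = T"
        proof (rule PiE_ext)
          show "S \<in> ?D \<rightarrow>\<^sub>E ?D" "T \<in> ?D \<rightarrow>\<^sub>E ?D"
            using loc_bounded_opsD(1)[OF AL[OF S]] loc_bounded_opsD(1)[OF AL[OF T]] .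
          fix x assume "x \<in> ?D"
          then obtain \<alpha> where "x \<in> F \<alpha>" by auto
          then show "S x = T x" using fun_cong[OF fun_cong[OF eq, of \<alpha>], of x] by simp
        qed
      qed
      show "(\<lambda>T \<alpha>. restrict T (F \<alpha>)) ` A =
        {t. (\<forall>\<alpha>. t \<alpha> \<in> N \<alpha>) \<and> (\<forall>\<alpha> \<beta>. \<alpha> \<le> \<beta> \<longrightarrow> restrict (t \<beta>) (F \<alpha>) = t \<alpha>)}" (is "?L = ?R")
      proof
        show "?L \<subseteq> ?R"
        proof
          fix t assume "t \<in> ?L"
          then obtain T where T: "T \<in> A" "t = (\<lambda>\<alpha>. restrict T (F \<alpha>))" by auto
          have "restrict (t \<beta>) (F \<alpha>) = t \<alpha>" if "\<alpha> \<le> \<beta>" for \<alpha> \<beta>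
            using mono[OF that] by (simp add: T(2) restrict_restrict Int_absorb1)
          then show "t \<in> ?R" using AN[OF T(1)] by (simp add: T(2))
        qed
        show "?R \<subseteq> ?L"
        proof
          fix t assume t: "t \<in> ?R"
          then have "\<exists>T\<in>loc_bounded_ops V F. \<forall>\<alpha>. restrict T (F \<alpha>) = t \<alpha>" by (intro glue) auto
          then obtain T where T: "T \<in> loc_bounded_ops V F" "\<And>\<alpha>. restrict T (F \<alpha>) = t \<alpha>" by blast
          have "T \<in> A" unfolding A T(2) using T(1) t by simp
          moreover have "t = (\<lambda>\<alpha>. restrict T (F \<alpha>))" using T(2) by simp
          ultimately show "t \<in> ?L" by (intro image_eqI[of _ _ T])
        qed
      qed
    qed
  qed
  have "loc_bounded_ops V F \<subseteq> ?D \<rightarrow>\<^sub>E ?D" by (auto dest: loc_bounded_opsD(1))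
  then have "closedin (strong_op_topology V ?D (loc_bounded_ops V F)) A"
    by (rule closedin_strong_op[OF inner_product_space_axioms dom_carrier]) (rule subsetI, erule AL, rule limA)
  with cstar proj show ?thesis unfolding locally_von_neumann_algebra_def by simp
qed

end

section \<open>Dominated functionals on nonmeasurable functions\<close>

definition sublinear_on :: "('x \<Rightarrow> real) set \<Rightarrow> (('x \<Rightarrow> real) \<Rightarrow> real) \<Rightarrow> bool" where
  "sublinear_on W q \<longleftrightarrow>
     (\<forall>f\<in>W. \<forall>g\<in>W. q (\<lambda>x. f x + g x) \<le> q f + q g) \<and>
     (\<forall>f\<in>W. \<forall>t>0. q (\<lambda>x. t * f x) \<le> t * q f)"

locale function_subspace =
  fixes W :: "('x \<Rightarrow> real) set"
  assumes W_add: "f \<in> W \<Longrightarrow> g \<in> W \<Longrightarrow> (\<lambda>x. f x + g x) \<in> W"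
    and W_scale: "f \<in> W \<Longrightarrow> (\<lambda>x. c * f x) \<in> W"
    and W_zero: "(\<lambda>x. 0) \<in> W"
begin

lemma W_neg: "f \<in> W \<Longrightarrow> (\<lambda>x. - f x) \<in> W"
  using W_scale[of f "-1"] by simp

lemma sublinear_onD:
  assumes "sublinear_on W q" "f \<in> W"
  shows "g \<in> W \<Longrightarrow> q (\<lambda>x. f x + g x) \<le> q f + q g" "t > 0 \<Longrightarrow> q (\<lambda>x. t * f x) \<le> t * q f"
  using assms by (auto simp: sublinear_on_def)

lemma sublinear_scale:
  assumes q: "sublinear_on W q" and f: "f \<in> W" and t: "t > 0"
  shows "q (\<lambda>x. t * f x) = t * q f"
proof (rule antisym)
  show "q (\<lambda>x. t * f x) \<le> t * q f" by (rule sublinear_onD(2)[OF q f t])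
  have "q (\<lambda>x. 1 / t * (t * f x)) \<le> 1 / t * q (\<lambda>x. t * f x)"
    by (rule sublinear_onD(2)[OF q W_scale[OF f]]) (use t in auto)
  then show "t * q f \<le> q (\<lambda>x. t * f x)" using t by (simp add: field_simps)
qed

lemma sublinear_zero: "sublinear_on W q \<Longrightarrow> q (\<lambda>x. 0) = 0"
  using sublinear_scale[OF _ W_zero, of q 2] by simp

lemma sublinear_neg: "sublinear_on W q \<Longrightarrow> f \<in> W \<Longrightarrow> - q (\<lambda>x. - f x) \<le> q f"
  using sublinear_onD(1)[of q f "\<lambda>x. - f x"] W_neg[of f] by (simp add: sublinear_zero)

text \<open>The new functional is the infimum of q (k + t h) - t (q h) over t \<ge> 0. A minimal
  \<open>q\<close> must coincide with it, and the inequality at -h then makes \<open>q\<close> odd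
  at \<open>h\<close>. The value 0 off \<open>W\<close> keeps the functionals comparable on all
  functions.\<close>

lemma sublinear_reduce:
  assumes q: "sublinear_on W q" and h: "h \<in> W"
  obtains r where "sublinear_on W r" "\<And>f. f \<in> W \<Longrightarrow> r f \<le> q f" "r (\<lambda>x. - h x) \<le> - q h"
    "\<And>f. f \<notin> W \<Longrightarrow> r f = 0"
proof -
  define R where "R = (\<lambda>k. (\<lambda>t. q (\<lambda>x. k x + t * h x) - t * q h) ` {0..})"
  define r where "r = (\<lambda>k. if k \<in> W then Inf (R k) else 0)"
  have Wkh: "(\<lambda>x. k x + t * h x) \<in> W" if "k \<in> W" for k t
    using W_add[OF that W_scale[OF h, of t]] .
  have bdd: "bdd_below (R k)" if k: "k \<in> W" for k
  proof (rule bdd_belowI)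
    fix y assume "y \<in> R k"
    then obtain t where t: "t \<ge> 0" "y = q (\<lambda>x. k x + t * h x) - t * q h" by (auto simp: R_def)
    have "q (\<lambda>x. (k x + t * h x) + - k x) \<le> q (\<lambda>x. k x + t * h x) + q (\<lambda>x. - k x)"
      by (rule sublinear_onD(1)[OF q Wkh[OF k] W_neg[OF k]])
    moreover have "(\<lambda>x. (k x + t * h x) + - k x) = (\<lambda>x. t * h x)" by auto
    moreover have "q (\<lambda>x. t * h x) = t * q h"
      using t(1) sublinear_scale[OF q h, of t] sublinear_zero[OF q] by (cases "t = 0") auto
    ultimately show "- q (\<lambda>x. - k x) \<le> y" by (simp add: t(2))
  qed
  have le: "r k \<le> q (\<lambda>x. k x + t * h x) - t * q h" if "k \<in> W" "t \<ge> 0" for k t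
    unfolding r_def using that bdd[OF that(1)] by (auto simp: R_def intro!: cInf_lower)
  have ge: "m \<le> r k" if "k \<in> W" "\<And>t. t \<ge> 0 \<Longrightarrow> m \<le> q (\<lambda>x. k x + t * h x) - t * q h" for k m
    unfolding r_def using that by (auto simp: R_def intro!: cInf_greatest)
  have "sublinear_on W r" unfolding sublinear_on_def
  proof (intro conjI ballI allI impI)
    fix f g assume f: "f \<in> W" and g: "g \<in> W"
    \<comment> \<open>The parameters of the two infima add up: t for \<open>f\<close> and s for
      \<open>g\<close> give t + s for the sum.\<close>
    have "r (\<lambda>x. f x + g x) - (q (\<lambda>x. g x + s * h x) - s * q h) \<le> r f" if s: "s \<ge> 0" for s
    proof (rule ge[OF f])
      fix t :: real assume t: "t \<ge> 0"
      have "r (\<lambda>x. f x + g x) \<le> q (\<lambda>x. (f x + g x) + (t + s) * h x) - (t + s) * q h"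
        by (rule le[OF W_add[OF f g]]) (use s t in auto)
      also have "(\<lambda>x. (f x + g x) + (t + s) * h x) = (\<lambda>x. (f x + t * h x) + (g x + s * h x))"
        by (auto simp: algebra_simps)
      also have "q \<dots> \<le> q (\<lambda>x. f x + t * h x) + q (\<lambda>x. g x + s * h x)"
        by (rule sublinear_onD(1)[OF q Wkh[OF f] Wkh[OF g]])
      finally show "r (\<lambda>x. f x + g x) - (q (\<lambda>x. g x + s * h x) - s * q h) \<le> q (\<lambda>x. f x + t * h x) - t * q h"
        by (simp add: algebra_simps)
    qed
    then have "r (\<lambda>x. f x + g x) - r f \<le> r g" by (intro ge[OF g]) (smt (verit))
    then show "r (\<lambda>x. f x + g x) \<le> r f + r g" by simp
  next
    fix f and c :: real assume f: "f \<in> W" and c: "c > 0"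
    have "1 / c * r (\<lambda>x. c * f x) \<le> r f"
    proof (rule ge[OF f])
      fix t :: real assume t: "t \<ge> 0"
      have "r (\<lambda>x. c * f x) \<le> q (\<lambda>x. c * f x + (c * t) * h x) - (c * t) * q h"
        by (rule le[OF W_scale[OF f]]) (use c t in auto)
      also have "(\<lambda>x. c * f x + (c * t) * h x) = (\<lambda>x. c * (f x + t * h x))"
        by (auto simp: algebra_simps)
      also have "q \<dots> \<le> c * q (\<lambda>x. f x + t * h x)"
        by (rule sublinear_onD(2)[OF q Wkh[OF f] c])
      finally show "1 / c * r (\<lambda>x. c * f x) \<le> q (\<lambda>x. f x + t * h x) - t * q h"
        using c by (simp add: field_simps)
    qed
    then show "r (\<lambda>x. c * f x) \<le> c * r f" using c by (simp add: field_simps)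
  qed
  moreover have "r f \<le> q f" if "f \<in> W" for f using le[OF that, of 0] by simp
  moreover have "r (\<lambda>x. - h x) \<le> - q h"
    using le[OF W_neg[OF h], of 1] by (simp add: sublinear_zero[OF q])
  moreover have "r f = 0" if "f \<notin> W" for f using that by (simp add: r_def)
  ultimately show thesis using that by blast
qed

text \<open>A sublinear functional that is minimal below \<open>p\<close> is linear.\<close>

lemma Hahn_Banach:
  assumes p: "sublinear_on W p" and h: "h \<in> W"
  obtains I where "\<And>f. f \<in> W \<Longrightarrow> I f \<le> p f" "I h = p h"
    "\<And>f g. f \<in> W \<Longrightarrow> g \<in> W \<Longrightarrow> I (\<lambda>x. f x + g x) = I f + I g"
    "\<And>c f. f \<in> W \<Longrightarrow> I (\<lambda>x. c * f x) = c * I f"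
proof -
  \<comment> \<open>Together with oddness, the condition at -h yields q h \<ge> p h for the minimal
    element. Values off \<open>W\<close> are fixed at 0 because the order compares functionals at
    every function.\<close>
  define A where "A = {q. sublinear_on W q \<and> (\<forall>f\<in>W. q f \<le> p f) \<and> q (\<lambda>x. - h x) \<le> - p h \<and> (\<forall>f. f \<notin> W \<longrightarrow> q f = 0)}"
  let ?P = "\<lambda>a b :: ('x \<Rightarrow> real) \<Rightarrow> real. b \<le> a"
  have "\<exists>m\<in>A. \<forall>a\<in>A. ?P m a \<longrightarrow> a = m"
  proof (rule predicate_Zorn)
    show "partial_order_on A (relation_of ?P A)"
      by (rule partial_order_on_relation_ofI) auto
  next
    fix C assume C: "C \<in> Chains (relation_of ?P A)"
    then have CA: "C \<subseteq> A" by (rule Chains_relation_of)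
    have tot: "a \<le> b \<or> b \<le> a" if "a \<in> C" "b \<in> C" for a b
      using C that by (auto simp: Chains_def relation_of_def)
    show "\<exists>u\<in>A. \<forall>a\<in>C. u \<le> a"
    proof (cases "C = {}")
      case True
      obtain r where "sublinear_on W r" "\<And>f. f \<in> W \<Longrightarrow> r f \<le> p f" "r (\<lambda>x. - h x) \<le> - p h"
        "\<And>f. f \<notin> W \<Longrightarrow> r f = 0"
        using sublinear_reduce[OF p h] by blast
      then have "r \<in> A" by (auto simp: A_def)
      then show ?thesis using True by auto
    next
      case ne: False
      define u where "u = (\<lambda>f. INF q\<in>C. q f)"
      have bdd: "bdd_below ((\<lambda>q. q f) ` C)" for f
      proof (cases "f \<in> W")
        case True
        show ?thesis
        proof (rule bdd_belowI2[of _ "- p (\<lambda>x. - f x)"])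
          fix q assume "q \<in> C"
          then have "sublinear_on W q" "q (\<lambda>x. - f x) \<le> p (\<lambda>x. - f x)"
            using CA W_neg[OF True] by (auto simp: A_def)
          then show "- p (\<lambda>x. - f x) \<le> q f" using sublinear_neg[of q f] True by linarith
        qed
      next
        case False
        then show ?thesis using CA by (intro bdd_belowI2[of _ 0]) (auto simp: A_def)
      qed
      have le: "u f \<le> q f" if "q \<in> C" for q f
        unfolding u_def using bdd that by (rule cINF_lower)
      have ge: "m \<le> u f" if "\<And>q. q \<in> C \<Longrightarrow> m \<le> q f" for m f
        unfolding u_def using ne that by (rule cINF_greatest)
      obtain q0 where q0: "q0 \<in> C" "q0 \<in> A" using ne CA by blast
      have "sublinear_on W u" unfolding sublinear_on_def
      proof (intro conjI ballI allI impI)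
        fix f g assume f: "f \<in> W" and g: "g \<in> W"
        \<comment> \<open>Two members of a chain are comparable, and the smaller one bounds both
          terms.\<close>
        have *: "u (\<lambda>x. f x + g x) \<le> a f + b g" if a: "a \<in> C" and b: "b \<in> C" for a b
        proof -
          obtain c where c: "c \<in> C" "c \<le> a" "c \<le> b" using tot[OF a b] a b by blast
          have "u (\<lambda>x. f x + g x) \<le> c (\<lambda>x. f x + g x)" by (rule le[OF c(1)])
          also have "\<dots> \<le> c f + c g" using c(1) CA sublinear_onD(1)[of c, OF _ f g] by (auto simp: A_def)
          also have "\<dots> \<le> a f + b g" using c(2,3) by (intro add_mono) (auto simp: le_fun_def)
          finally show ?thesis .
        qed
        have "u (\<lambda>x. f x + g x) - a f \<le> u g" if a: "a \<in> C" for a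
          by (rule ge) (use *[OF a] in \<open>simp add: algebra_simps\<close>)
        then have "u (\<lambda>x. f x + g x) - u g \<le> u f" by (intro ge) (simp add: algebra_simps)
        then show "u (\<lambda>x. f x + g x) \<le> u f + u g" by simp
      next
        fix f and t :: real assume f: "f \<in> W" and t: "t > 0"
        have "1 / t * u (\<lambda>x. t * f x) \<le> u f"
        proof (rule ge)
          fix q assume q: "q \<in> C"
          have "u (\<lambda>x. t * f x) \<le> q (\<lambda>x. t * f x)" by (rule le[OF q])
          also have "\<dots> \<le> t * q f" using q CA sublinear_onD(2)[of q, OF _ f t] by (auto simp: A_def)
          finally show "1 / t * u (\<lambda>x. t * f x) \<le> q f" using t by (simp add: field_simps)
        qed
        then show "u (\<lambda>x. t * f x) \<le> t * u f" using t by (simp add: field_simps)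
      qed
      moreover have "u f \<le> p f" if "f \<in> W" for f
        using le[OF q0(1), of f] q0(2) that by (auto simp: A_def intro: order_trans)
      moreover have "u (\<lambda>x. - h x) \<le> - p h"
        using le[OF q0(1), of "\<lambda>x. - h x"] q0(2) by (auto simp: A_def)
      moreover have "u f = 0" if "f \<notin> W" for f
      proof (rule antisym)
        show "u f \<le> 0" using le[OF q0(1), of f] q0(2) that by (auto simp: A_def)
        show "0 \<le> u f" using CA that by (intro ge) (auto simp: A_def)
      qed
      ultimately have "u \<in> A" by (auto simp: A_def)
      then show ?thesis using le by (auto simp: le_fun_def intro!: bexI[of _ u])
    qed
  qed
  then obtain q where q: "q \<in> A" and min: "\<And>a. a \<in> A \<Longrightarrow> a \<le> q \<Longrightarrow> a = q" by blast
  have sq: "sublinear_on W q" and qp: "\<And>f. f \<in> W \<Longrightarrow> q f \<le> p f" and qh: "q (\<lambda>x. - h x) \<le> - p h"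
    and qW: "\<And>f. f \<notin> W \<Longrightarrow> q f = 0"
    using q by (auto simp: A_def)
  have neg: "q (\<lambda>x. - f x) = - q f" if f: "f \<in> W" for f
  proof -
    obtain r where r: "sublinear_on W r" "\<And>f. f \<in> W \<Longrightarrow> r f \<le> q f" "r (\<lambda>x. - f x) \<le> - q f"
      "\<And>f. f \<notin> W \<Longrightarrow> r f = 0"
      using sublinear_reduce[OF sq f] by blast
    have "r \<in> A" unfolding A_def using r qp qh W_neg[OF h] by (auto intro: order_trans)
    moreover have "r \<le> q" unfolding le_fun_def
    proof
      fix f show "r f \<le> q f" using r(2,4) qW by (cases "f \<in> W") auto
    qed
    ultimately have "r = q" by (rule min)
    then have "q (\<lambda>x. - f x) \<le> - q f" using r(3) by simp
    then show ?thesis using sublinear_neg[OF sq f] by linarith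
  qed
  have add: "q (\<lambda>x. f x + g x) = q f + q g" if f: "f \<in> W" and g: "g \<in> W" for f g
  proof (rule antisym)
    show "q (\<lambda>x. f x + g x) \<le> q f + q g" by (rule sublinear_onD(1)[OF sq f g])
    have "q (\<lambda>x. - f x + - g x) \<le> q (\<lambda>x. - f x) + q (\<lambda>x. - g x)"
      by (rule sublinear_onD(1)[OF sq W_neg[OF f] W_neg[OF g]])
    moreover have "(\<lambda>x. - f x + - g x) = (\<lambda>x. - (f x + g x))" by auto
    ultimately show "q f + q g \<le> q (\<lambda>x. f x + g x)" using neg[OF f] neg[OF g] neg[OF W_add[OF f g]] by simp
  qed
  have "q h = p h" using neg[OF h] qh qp[OF h] by simp
  moreover have "q (\<lambda>x. c * f x) = c * q f" if f: "f \<in> W" for c f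
  proof -
    consider "c > 0" | "c = 0" | "- c > 0" by linarith
    then show ?thesis
    proof cases
      case 3
      then show ?thesis using sublinear_scale[OF sq W_neg[OF f], of "- c"] neg[OF f] by simp
    qed (use sublinear_scale[OF sq f] sublinear_zero[OF sq] in auto)
  qed
  ultimately show thesis using that[of q] qp add by blast
qed

end

text \<open>Integrable bounds give finite upper and lower integrals without any measurability of
  \<open>k\<close>; the functionals that test nonmeasurable fields act on this space.\<close>

definition dominated_functions :: "'x measure \<Rightarrow> ('x \<Rightarrow> real) set" where
  "dominated_functions M = {k. \<exists>g. integrable M g \<and> (AE x in M. \<bar>k x\<bar> \<le> g x)}"

lemma dominated_functions_subspace: "function_subspace (dominated_functions M)"
proof
  fix f g :: "'a \<Rightarrow> real" assume "f \<in> dominated_functions M" "g \<in> dominated_functions M"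
  then obtain F G where FG: "integrable M F" "AE x in M. \<bar>f x\<bar> \<le> F x"
    "integrable M G" "AE x in M. \<bar>g x\<bar> \<le> G x" by (auto simp: dominated_functions_def)
  then have "integrable M (\<lambda>x. F x + G x)" "AE x in M. \<bar>f x + g x\<bar> \<le> F x + G x" by auto
  then show "(\<lambda>x. f x + g x) \<in> dominated_functions M" unfolding dominated_functions_def by blast
next
  fix f :: "'a \<Rightarrow> real" and c assume "f \<in> dominated_functions M"
  then obtain F where F: "integrable M F" "AE x in M. \<bar>f x\<bar> \<le> F x"
    by (auto simp: dominated_functions_def)
  have "integrable M (\<lambda>x. \<bar>c\<bar> * F x)" using F by simp
  moreover have "AE x in M. \<bar>c * f x\<bar> \<le> \<bar>c\<bar> * F x"
    using F(2) by eventually_elim (auto simp: abs_mult intro: mult_left_mono)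
  ultimately show "(\<lambda>x. c * f x) \<in> dominated_functions M" unfolding dominated_functions_def by blast
next
  show "(\<lambda>x. 0) \<in> dominated_functions M"
    unfolding dominated_functions_def by (intro CollectI exI[of _ "\<lambda>x. 0"]) simp
qed

text \<open>The functional extends the integral and attains the upper integral of \<open>h\<close> at \<open>h\<close>.\<close>

lemma upper_integral_functional:
  assumes h: "h \<in> dominated_functions M"
  shows "\<exists>I.
    (\<forall>f\<in>dominated_functions M. \<forall>g\<in>dominated_functions M. I (\<lambda>x. f x + g x) = I f + I g) \<and>
    (\<forall>f\<in>dominated_functions M. \<forall>c. I (\<lambda>x. c * f x) = c * I f) \<and>
    (\<forall>k\<in>dominated_functions M. \<forall>g. integrable M g \<longrightarrow> (AE x in M. k x \<le> g x) \<longrightarrow> I k \<le> (LINT x|M. g x)) \<and>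
    (\<forall>\<epsilon>>0. \<exists>g. integrable M g \<and> (AE x in M. h x \<le> g x) \<and> (LINT x|M. g x) < I h + \<epsilon>)"
proof -
  let ?W = "dominated_functions M"
  interpret function_subspace ?W by (rule dominated_functions_subspace)
  define G :: "('a \<Rightarrow> real) \<Rightarrow> ('a \<Rightarrow> real) set"
    where "G = (\<lambda>k. {g. integrable M g \<and> (AE x in M. k x \<le> g x)})"
  \<comment> \<open>The upper integral: sublinear on dominated functions, but in general not
    additive on nonmeasurable ones.\<close>
  define U where "U = (\<lambda>k. Inf ((\<lambda>g. LINT x|M. g x) ` G k))"
  have bdd: "bdd_below ((\<lambda>g. LINT x|M. g x) ` G k)" if k: "k \<in> ?W" for k
  proof -
    obtain F where F: "integrable M F" "AE x in M. \<bar>k x\<bar> \<le> F x"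
      using k by (auto simp: dominated_functions_def)
    show ?thesis
    proof (rule bdd_belowI2[of _ "LINT x|M. - F x"])
      fix g assume g: "g \<in> G k"
      then have "AE x in M. k x \<le> g x" by (simp add: G_def)
      with F(2) have "AE x in M. - F x \<le> g x" by eventually_elim auto
      then show "(LINT x|M. - F x) \<le> (LINT x|M. g x)"
        using F g by (intro integral_mono_AE) (auto simp: G_def)
    qed
  qed
  have le: "U k \<le> (LINT x|M. g x)" if "k \<in> ?W" "g \<in> G k" for k g
    unfolding U_def using bdd[OF that(1)] that(2) by (rule cINF_lower)
  have ne: "G k \<noteq> {}" if k: "k \<in> ?W" for k
  proof -
    obtain F where F: "integrable M F" "AE x in M. \<bar>k x\<bar> \<le> F x"
      using k by (auto simp: dominated_functions_def)
    from F(2) have "AE x in M. k x \<le> F x" by eventually_elim auto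
    then show ?thesis using F(1) by (auto simp: G_def)
  qed
  have ge: "m \<le> U k" if "k \<in> ?W" "\<And>g. g \<in> G k \<Longrightarrow> m \<le> (LINT x|M. g x)" for m k
    unfolding U_def using ne[OF that(1)] that(2) by (rule cINF_greatest)
  have "sublinear_on ?W U" unfolding sublinear_on_def
  proof (intro conjI ballI allI impI)
    fix f g assume f: "f \<in> ?W" and g: "g \<in> ?W"
    have *: "U (\<lambda>x. f x + g x) \<le> (LINT x|M. a x) + (LINT x|M. b x)" if a: "a \<in> G f" and b: "b \<in> G g" for a b
    proof -
      have "integrable M a" "integrable M b" "AE x in M. f x \<le> a x" "AE x in M. g x \<le> b x"
        using a b by (auto simp: G_def)
      then have "(\<lambda>x. a x + b x) \<in> G (\<lambda>x. f x + g x)" "(LINT x|M. a x + b x) = (LINT x|M. a x) + (LINT x|M. b x)"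
        by (auto simp: G_def intro: add_mono)
      then show ?thesis using le[OF W_add[OF f g], of "\<lambda>x. a x + b x"] by simp
    qed
    have "U (\<lambda>x. f x + g x) - (LINT x|M. a x) \<le> U g" if a: "a \<in> G f" for a
      by (rule ge[OF g]) (use *[OF a] in \<open>simp add: algebra_simps\<close>)
    then have "U (\<lambda>x. f x + g x) - U g \<le> U f" by (intro ge[OF f]) (simp add: algebra_simps)
    then show "U (\<lambda>x. f x + g x) \<le> U f + U g" by simp
  next
    fix f and t :: real assume f: "f \<in> ?W" and t: "t > 0"
    have "1 / t * U (\<lambda>x. t * f x) \<le> U f"
    proof (rule ge[OF f])
      fix g assume g: "g \<in> G f"
      then have "integrable M g" "AE x in M. f x \<le> g x" by (auto simp: G_def)
      then have "(\<lambda>x. t * g x) \<in> G (\<lambda>x. t * f x)" using t by (auto simp: G_def)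
      from le[OF W_scale[OF f] this] show "1 / t * U (\<lambda>x. t * f x) \<le> (LINT x|M. g x)"
        using t by (simp add: field_simps)
    qed
    then show "U (\<lambda>x. t * f x) \<le> t * U f" using t by (simp add: field_simps)
  qed
  from Hahn_Banach[OF this h] obtain I where I: "\<And>f. f \<in> ?W \<Longrightarrow> I f \<le> U f" "I h = U h"
    "\<And>f g. f \<in> ?W \<Longrightarrow> g \<in> ?W \<Longrightarrow> I (\<lambda>x. f x + g x) = I f + I g"
    "\<And>c f. f \<in> ?W \<Longrightarrow> I (\<lambda>x. c * f x) = c * I f" by blast
  have I3: "I k \<le> (LINT x|M. g x)" if "k \<in> ?W" "integrable M g" "AE x in M. k x \<le> g x" for k g
    using I(1)[OF that(1)] le[OF that(1), of g] that by (auto simp: G_def)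
  have I4: "\<exists>g. integrable M g \<and> (AE x in M. h x \<le> g x) \<and> (LINT x|M. g x) < I h + \<epsilon>" if "\<epsilon> > 0" for \<epsilon>
  proof (rule ccontr)
    assume "\<not> ?thesis"
    then have "I h + \<epsilon> \<le> U h" by (intro ge[OF h]) (auto simp: G_def not_less)
    then show False using I(2) that by simp
  qed
  show ?thesis
    by (intro exI[of _ I] conjI ballI allI impI) (simp_all add: I(3,4) I3 I4)
qed

text \<open>The infimum of countably many majorants is measurable with integral 0, so it vanishes
  almost everywhere, and with it \<open>h\<close> below. This takes the place of integrating
  \<open>h\<close>, which may be nonmeasurable.\<close>

lemma AE_eq_0_of_small_majorants:
  fixes h :: "'x \<Rightarrow> real"
  assumes nonneg: "AE x in M. h x \<ge> 0"
    and small: "\<And>\<epsilon>. \<epsilon> > 0 \<Longrightarrow> \<exists>g. integrable M g \<and> (AE x in M. h x \<le> g x) \<and> (LINT x|M. g x) < \<epsilon>"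
  shows "AE x in M. h x = 0"
proof -
  have "\<exists>g. integrable M g \<and> (AE x in M. h x \<le> g x) \<and> (LINT x|M. g x) < 1 / real (Suc n)" for n
    by (rule small) simp
  then obtain g where g: "integrable M (g n)" "AE x in M. h x \<le> g n x" "(LINT x|M. g n x) < 1 / real (Suc n)" for n
    by metis
  have [measurable]: "g n \<in> borel_measurable M" for n using g(1)[of n] by auto
  have all: "AE x in M. \<forall>n. h x \<le> g n x" using g(2) by (simp add: AE_all_countable)
  have "(\<integral>\<^sup>+x. (INF n. ennreal (g n x)) \<partial>M) \<le> ennreal (1 / real (Suc n))" for n
  proof -
    have "(\<integral>\<^sup>+x. (INF n. ennreal (g n x)) \<partial>M) \<le> (\<integral>\<^sup>+x. ennreal (g n x) \<partial>M)"
      by (intro nn_integral_mono) (auto intro: INF_lower)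
    also have "\<dots> = ennreal (LINT x|M. g n x)"
    proof (rule nn_integral_eq_integral[OF g(1)])
      show "AE x in M. 0 \<le> g n x" using all nonneg
      proof eventually_elim
        case (elim x)
        then show ?case using order_trans[of 0 "h x" "g n x"] by simp
      qed
    qed
    also have "\<dots> \<le> ennreal (1 / real (Suc n))" using g(3)[of n] by (intro ennreal_leI) simp
    finally show ?thesis .
  qed
  then have "(\<integral>\<^sup>+x. (INF n. ennreal (g n x)) \<partial>M) \<le> 0"
  proof (intro tendsto_lowerbound[of "\<lambda>n. ennreal (1 / real (Suc n))" 0 sequentially])
    have "(\<lambda>n. ennreal (1 / real (Suc n))) \<longlonglongrightarrow> ennreal 0"
      by (intro tendsto_ennrealI LIMSEQ_Suc[OF lim_1_over_n])
    then show "(\<lambda>n. ennreal (1 / real (Suc n))) \<longlonglongrightarrow> 0" by simp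
  qed auto
  then have "AE x in M. (INF n. ennreal (g n x)) = 0"
    by (subst (asm) le_zero_eq, subst (asm) nn_integral_0_iff_AE) auto
  with all nonneg show ?thesis
  proof eventually_elim
    case (elim x)
    have "ennreal (h x) \<le> (INF n. ennreal (g n x))" using elim by (intro INF_greatest ennreal_leI) auto
    then show ?case using elim by simp
  qed
qed

section \<open>Commutants\<close>

definition commutant_ops :: "'a ip_space \<Rightarrow> ('a \<Rightarrow> 'a) set \<Rightarrow> ('a \<Rightarrow> 'a) set" where
  "commutant_ops V \<Q> =
     {T \<in> bounded_ops V (carrier V). \<forall>Q\<in>\<Q>. \<forall>x\<in>carrier V. T (Q x) = Q (T x)}"

text \<open>Selfadjoint refers to the set, which contains the adjoints of its members; this makes
  the commutant a star algebra. Contractivity provides integrable bounds for fields of such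
  operators.\<close>

definition selfadjoint_contractions :: "'a ip_space \<Rightarrow> ('a \<Rightarrow> 'a) set \<Rightarrow> bool" where
  "selfadjoint_contractions V \<Q> \<longleftrightarrow> \<Q> \<subseteq> bounded_ops V (carrier V) \<and>
     (\<forall>Q\<in>\<Q>. adjoint_op V (carrier V) Q \<in> \<Q> \<and> (\<forall>x\<in>carrier V. ip_norm V (Q x) \<le> ip_norm V x))"

context hilbert
begin

lemma bounded_ops_id: "(\<lambda>x\<in>carrier V. x) \<in> bounded_ops V (carrier V)"
  by (rule bounded_opsI[where C = 1]) auto

lemma bounded_ops_add:
  assumes S: "S \<in> bounded_ops V (carrier V)" and T: "T \<in> bounded_ops V (carrier V)"
  shows "(\<lambda>x\<in>carrier V. S x \<oplus>\<^bsub>V\<^esub> T x) \<in> bounded_ops V (carrier V)"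
proof -
  note S' = bounded_opsD[OF S] and T' = bounded_opsD[OF T]
  obtain B where B: "\<And>x. x \<in> carrier V \<Longrightarrow> ip_norm V (S x) \<le> B * ip_norm V x"
    using bounded_ops_bound[OF S subset_refl] by blast
  obtain C where C: "\<And>x. x \<in> carrier V \<Longrightarrow> ip_norm V (T x) \<le> C * ip_norm V x"
    using bounded_ops_bound[OF T subset_refl] by blast
  have "ip_norm V (S x \<oplus>\<^bsub>V\<^esub> T x) \<le> (B + C) * ip_norm V x" if "x \<in> carrier V" for x
    using norm_triangle[OF S'(2)[OF that] T'(2)[OF that]] B[OF that] C[OF that] by (simp add: distrib_right)
  moreover have "S x \<oplus>\<^bsub>V\<^esub> S y \<oplus>\<^bsub>V\<^esub> (T x \<oplus>\<^bsub>V\<^esub> T y) = S x \<oplus>\<^bsub>V\<^esub> T x \<oplus>\<^bsub>V\<^esub> (S y \<oplus>\<^bsub>V\<^esub> T y)"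
    if "x \<in> carrier V" "y \<in> carrier V" for x y
    by (rule vec_eqI) (simp_all add: that S'(2) T'(2) ip_expand)
  moreover have "c \<odot>\<^bsub>V\<^esub> S x \<oplus>\<^bsub>V\<^esub> c \<odot>\<^bsub>V\<^esub> T x = c \<odot>\<^bsub>V\<^esub> (S x \<oplus>\<^bsub>V\<^esub> T x)" if "x \<in> carrier V" for c x
    by (rule vec_eqI) (simp_all add: that S'(2) T'(2) ip_expand algebra_simps)
  ultimately show ?thesis
    by (intro bounded_opsI[where C = "B + C"]) (simp_all add: S'(2,4,5) T'(2,4,5))
qed

lemma bounded_ops_smult:
  assumes T: "T \<in> bounded_ops V (carrier V)"
  shows "(\<lambda>x\<in>carrier V. c \<odot>\<^bsub>V\<^esub> T x) \<in> bounded_ops V (carrier V)"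
proof -
  note T' = bounded_opsD[OF T]
  obtain C where C: "\<And>x. x \<in> carrier V \<Longrightarrow> ip_norm V (T x) \<le> C * ip_norm V x"
    using bounded_ops_bound[OF T subset_refl] by blast
  have "ip_norm V (c \<odot>\<^bsub>V\<^esub> T x) \<le> (cmod c * C) * ip_norm V x" if "x \<in> carrier V" for x
    using T'(2)[OF that] mult_left_mono[OF C[OF that], of "cmod c"] by (simp add: norm_smult mult.assoc)
  moreover have "c \<odot>\<^bsub>V\<^esub> (T x \<oplus>\<^bsub>V\<^esub> T y) = c \<odot>\<^bsub>V\<^esub> T x \<oplus>\<^bsub>V\<^esub> c \<odot>\<^bsub>V\<^esub> T y"
    if "x \<in> carrier V" "y \<in> carrier V" for x y
    by (rule vec_eqI) (simp_all add: that T'(2) ip_expand algebra_simps)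
  moreover have "c \<odot>\<^bsub>V\<^esub> (d \<odot>\<^bsub>V\<^esub> T x) = d \<odot>\<^bsub>V\<^esub> (c \<odot>\<^bsub>V\<^esub> T x)" if "x \<in> carrier V" for d x
    by (rule vec_eqI) (simp_all add: that T'(2) ip_expand)
  ultimately show ?thesis
    by (intro bounded_opsI[where C = "cmod c * C"]) (simp_all add: T'(2,4,5))
qed

lemma bounded_ops_compose:
  assumes S: "S \<in> bounded_ops V (carrier V)" and T: "T \<in> bounded_ops V (carrier V)"
  shows "compose (carrier V) S T \<in> bounded_ops V (carrier V)"
proof -
  note S' = bounded_opsD[OF S] and T' = bounded_opsD[OF T]
  obtain B where B: "B \<ge> 0" "\<And>x. x \<in> carrier V \<Longrightarrow> ip_norm V (S x) \<le> B * ip_norm V x"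
    using bounded_ops_bound[OF S subset_refl] by blast
  obtain C where C: "\<And>x. x \<in> carrier V \<Longrightarrow> ip_norm V (T x) \<le> C * ip_norm V x"
    using bounded_ops_bound[OF T subset_refl] by blast
  have "ip_norm V (S (T x)) \<le> (B * C) * ip_norm V x" if "x \<in> carrier V" for x
    using B(2)[OF T'(2)[OF that]] mult_left_mono[OF C[OF that] B(1)] by (simp add: mult.assoc)
  then show ?thesis
    by (intro bounded_opsI[where C = "B * C"]) (simp_all add: compose_def S'(2,4,5) T'(2,4,5))
qed

lemma adjoint_left:
  assumes T: "T \<in> bounded_ops V (carrier V)" and x: "x \<in> carrier V" and y: "y \<in> carrier V"
  shows "ip V (adjoint_op V (carrier V) T x) y = ip V x (T y)"
proof -
  have "ip V (adjoint_op V (carrier V) T x) y = cnj (ip V y (adjoint_op V (carrier V) T x))"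
    by (rule ip_commute[OF bounded_opsD(2)[OF adjoint_bounded(1)[OF T] x] y])
  also have "\<dots> = cnj (ip V (T y) x)" by (simp only: adjoint_bounded(2)[OF T y x])
  also have "\<dots> = ip V x (T y)" by (rule ip_commute[OF x bounded_opsD(2)[OF T y], symmetric])
  finally show ?thesis .
qed

lemma adjoint_norm_le:
  assumes T: "T \<in> bounded_ops V (carrier V)" and C: "C \<ge> 0"
    and b: "\<And>x. x \<in> carrier V \<Longrightarrow> ip_norm V (T x) \<le> C * ip_norm V x" and y: "y \<in> carrier V"
  shows "ip_norm V (adjoint_op V (carrier V) T y) \<le> C * ip_norm V y"
proof -
  obtain S where S: "S \<in> bounded_ops V (carrier V)"
    "\<And>x y. x \<in> carrier V \<Longrightarrow> y \<in> carrier V \<Longrightarrow> ip V (T x) y = ip V x (S y)"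
    "\<And>y. y \<in> carrier V \<Longrightarrow> ip_norm V (S y) \<le> C * ip_norm V y"
    using adjoint_exists[OF bounded_opsD(2,3)[OF T] C b] by blast
  have "adjoint_op V (carrier V) T = S" by (rule adjoint_opI[OF bounded_opsD(1)[OF S(1)] S(2)])
  then show ?thesis using S(3)[OF y] by simp
qed

lemma commutant_star_subalgebra:
  assumes Q: "selfadjoint_contractions V \<Q>"
  shows "unital_star_subalgebra V (carrier V) (bounded_ops V (carrier V)) (commutant_ops V \<Q>)"
proof -
  have QB: "q \<in> bounded_ops V (carrier V)" and Qa: "adjoint_op V (carrier V) q \<in> \<Q>" if "q \<in> \<Q>" for q
    using Q that by (auto simp: selfadjoint_contractions_def)
  note QD = bounded_opsD[OF QB]
  show ?thesis
    unfolding unital_star_subalgebra_def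
  proof (intro conjI ballI allI)
    show "commutant_ops V \<Q> \<subseteq> bounded_ops V (carrier V)" by (auto simp: commutant_ops_def)
    show "(\<lambda>x\<in>carrier V. x) \<in> commutant_ops V \<Q>"
      using QD(2) by (auto simp: commutant_ops_def bounded_ops_id)
    fix T assume "T \<in> commutant_ops V \<Q>"
    then have T: "T \<in> bounded_ops V (carrier V)"
      and Tc: "\<And>q x. q \<in> \<Q> \<Longrightarrow> x \<in> carrier V \<Longrightarrow> T (q x) = q (T x)"
      by (auto simp: commutant_ops_def)
    note TD = bounded_opsD[OF T]
    show "(\<lambda>x\<in>carrier V. c \<odot>\<^bsub>V\<^esub> T x) \<in> commutant_ops V \<Q>" for c
      using bounded_ops_smult[OF T] TD(2) QD(2,5) Tc by (simp add: commutant_ops_def)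
    have "adjoint_op V (carrier V) T (q x) = q (adjoint_op V (carrier V) T x)"
      if q: "q \<in> \<Q>" and x: "x \<in> carrier V" for q x
    proof (rule vec_eqI)
      note aT = adjoint_bounded[OF T]
      have in1: "q x \<in> carrier V" "adjoint_op V (carrier V) T x \<in> carrier V"
        using QD(2)[OF q x] bounded_opsD(2)[OF aT(1) x] by auto
      then show "adjoint_op V (carrier V) T (q x) \<in> carrier V" "q (adjoint_op V (carrier V) T x) \<in> carrier V"
        using QD(2)[OF q] bounded_opsD(2)[OF aT(1)] by auto
      fix y assume y: "y \<in> carrier V"
      let ?q = "adjoint_op V (carrier V) q"
      have qy: "?q y \<in> carrier V" using QD(2)[OF Qa[OF q] y] .
      have "ip V (adjoint_op V (carrier V) T (q x)) y = ip V (q x) (T y)" by (rule adjoint_left[OF T in1(1) y])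
      also have "\<dots> = ip V x (?q (T y))" by (rule adjoint_bounded(2)[OF QB[OF q] x TD(2)[OF y]])
      also have "\<dots> = ip V x (T (?q y))" by (simp add: Tc[OF Qa[OF q] y])
      also have "\<dots> = ip V (adjoint_op V (carrier V) T x) (?q y)" by (rule adjoint_left[OF T x qy, symmetric])
      also have "\<dots> = ip V (q (adjoint_op V (carrier V) T x)) y"
        by (rule adjoint_bounded(2)[OF QB[OF q] in1(2) y, symmetric])
      finally show "ip V (adjoint_op V (carrier V) T (q x)) y = ip V (q (adjoint_op V (carrier V) T x)) y" .
    qed
    then show "adjoint_op V (carrier V) T \<in> commutant_ops V \<Q>"
      using adjoint_bounded(1)[OF T] by (simp add: commutant_ops_def)
    fix S assume "S \<in> commutant_ops V \<Q>"
    then have S: "S \<in> bounded_ops V (carrier V)"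
      and Sc: "\<And>q x. q \<in> \<Q> \<Longrightarrow> x \<in> carrier V \<Longrightarrow> S (q x) = q (S x)"
      by (auto simp: commutant_ops_def)
    note SD = bounded_opsD[OF S]
    show "(\<lambda>x\<in>carrier V. S x \<oplus>\<^bsub>V\<^esub> T x) \<in> commutant_ops V \<Q>"
      using bounded_ops_add[OF S T] TD(2) SD(2) QD(2,4) Tc Sc by (simp add: commutant_ops_def)
    show "compose (carrier V) S T \<in> commutant_ops V \<Q>"
      using bounded_ops_compose[OF S T] TD(2) QD(2) Tc Sc by (simp add: commutant_ops_def compose_def)
  qed
qed

section \<open>Orthogonal projections and reducing subspaces\<close>

definition proj :: "'a set \<Rightarrow> 'a \<Rightarrow> 'a" where
  "proj G = (\<lambda>x\<in>carrier V. SOME y. y \<in> G \<and> (\<forall>w\<in>G. ip V (vsub V x y) w = 0))"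

context
  fixes G
  assumes G: "G \<subseteq> carrier V" and hG: "hilbert_space (V\<lparr>carrier := G\<rparr>)"
begin

interpretation G: hilbert "V\<lparr>carrier := G\<rparr>"
  using hG by (simp add: hilbert_space_iff)

lemma projection_ex:
  assumes x: "x \<in> carrier V"
  shows "\<exists>y. y \<in> G \<and> (\<forall>w\<in>G. ip V (vsub V x y) w = 0) \<and> ip_norm V y \<le> ip_norm V x"
proof (rule projection_exists[OF inner_product_space_axioms G hG x])
  fix y assume "y \<in> G" "\<And>w. w \<in> G \<Longrightarrow> ip V (vsub V x y) w = 0" "ip_norm V y \<le> ip_norm V x"
  then show ?thesis by blast
qed

lemma proj_props:
  assumes x: "x \<in> carrier V"
  shows "proj G x \<in> G" "\<And>w. w \<in> G \<Longrightarrow> ip V (vsub V x (proj G x)) w = 0"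
proof -
  have "\<exists>y. y \<in> G \<and> (\<forall>w\<in>G. ip V (vsub V x y) w = 0)" using projection_ex[OF x] by auto
  from someI_ex[OF this] have "proj G x \<in> G \<and> (\<forall>w\<in>G. ip V (vsub V x (proj G x)) w = 0)"
    using x by (simp add: proj_def)
  then show "proj G x \<in> G" "\<And>w. w \<in> G \<Longrightarrow> ip V (vsub V x (proj G x)) w = 0" by auto
qed

lemma proj_eqI:
  assumes x: "x \<in> carrier V" and y: "y \<in> G" and o: "\<And>w. w \<in> G \<Longrightarrow> ip V (vsub V x y) w = 0"
  shows "proj G x = y"
proof -
  note p = proj_props[OF x]
  have "proj G x \<in> carrier V" "y \<in> carrier V" using p y G by auto
  then have "ip V (proj G x) w = ip V y w" if "w \<in> G" for w
    using p(2)[OF that] o[OF that] x subsetD[OF G that] by (simp add: ip_vsub_left)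
  then show ?thesis using G.vec_eqI[of "proj G x" y] p(1) y by simp
qed

lemma proj_bounded: "proj G \<in> bounded_ops V (carrier V)"
  and proj_contractive: "x \<in> carrier V \<Longrightarrow> ip_norm V (proj G x) \<le> ip_norm V x"
  and proj_selfadjoint: "adjoint_op V (carrier V) (proj G) = proj G"
proof -
  have pV: "proj G x \<in> carrier V" if "x \<in> carrier V" for x using proj_props(1)[OF that] G by auto
  have le: "ip_norm V (proj G x) \<le> ip_norm V x" if x: "x \<in> carrier V" for x
  proof -
    obtain y where y: "y \<in> G" "\<forall>w\<in>G. ip V (vsub V x y) w = 0" "ip_norm V y \<le> ip_norm V x"
      using projection_ex[OF x] by auto
    have "proj G x = y" by (rule proj_eqI[OF x y(1)]) (use y(2) in simp)
    then show ?thesis using y(3) by simp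
  qed
  then show "x \<in> carrier V \<Longrightarrow> ip_norm V (proj G x) \<le> ip_norm V x" .
  have o: "ip V x w = ip V (proj G x) w" if "x \<in> carrier V" "w \<in> G" for x w
    using proj_props(2)[OF that] that(1) subsetD[OF G that(2)] pV[OF that(1)] by (simp add: ip_vsub_left)
  show B: "proj G \<in> bounded_ops V (carrier V)"
  proof (rule bounded_opsI[where C = 1])
    show "proj G \<in> carrier V \<rightarrow>\<^sub>E carrier V" using pV by (auto simp: proj_def)
  next
    fix x y assume x: "x \<in> carrier V" and y: "y \<in> carrier V"
    show "proj G (x \<oplus>\<^bsub>V\<^esub> y) = proj G x \<oplus>\<^bsub>V\<^esub> proj G y"
    proof (rule proj_eqI)
      show "proj G x \<oplus>\<^bsub>V\<^esub> proj G y \<in> G" using G.add_in[of "proj G x" "proj G y"] proj_props(1)[OF x] proj_props(1)[OF y] by simp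
      fix w assume w: "w \<in> G"
      then show "ip V (vsub V (x \<oplus>\<^bsub>V\<^esub> y) (proj G x \<oplus>\<^bsub>V\<^esub> proj G y)) w = 0"
        using x y pV[OF x] pV[OF y] subsetD[OF G w] o[OF x w] o[OF y w] by (simp add: ip_expand)
    qed (use x y in auto)
  next
    fix c x assume x: "x \<in> carrier V"
    show "proj G (c \<odot>\<^bsub>V\<^esub> x) = c \<odot>\<^bsub>V\<^esub> proj G x"
    proof (rule proj_eqI)
      show "c \<odot>\<^bsub>V\<^esub> proj G x \<in> G" using G.smult_in[of "proj G x"] proj_props(1)[OF x] by simp
      fix w assume w: "w \<in> G"
      then show "ip V (vsub V (c \<odot>\<^bsub>V\<^esub> x) (c \<odot>\<^bsub>V\<^esub> proj G x)) w = 0"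
        using x pV[OF x] subsetD[OF G w] o[OF x w] by (simp add: ip_expand)
    qed (use x in auto)
  qed (use le in auto)
  show "adjoint_op V (carrier V) (proj G) = proj G"
  proof (rule adjoint_opI[OF bounded_opsD(1)[OF B]])
    fix x y assume x: "x \<in> carrier V" and y: "y \<in> carrier V"
    have "ip V (proj G x) y = cnj (ip V y (proj G x))" by (rule ip_commute[OF pV[OF x] y])
    also have "\<dots> = cnj (ip V (proj G y) (proj G x))" using o[OF y proj_props(1)[OF x]] by simp
    also have "\<dots> = ip V (proj G x) (proj G y)" by (rule ip_commute[OF pV[OF x] pV[OF y], symmetric])
    also have "\<dots> = ip V x (proj G y)" using o[OF x proj_props(1)[OF y]] by simp
    finally show "ip V (proj G x) y = ip V x (proj G y)" .
  qed
qed

text \<open>For a level \<open>G\<close>, the right-hand side is what \<open>loc_bounded_ops\<close>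
  demands: the subspace reduces the operator. As a commutation condition this demand can be handled
  by commutants.\<close>

lemma commutes_proj_iff:
  assumes T: "T \<in> bounded_ops V (carrier V)"
  shows "(\<forall>x\<in>carrier V. T (proj G x) = proj G (T x)) \<longleftrightarrow>
    (\<forall>x\<in>G. T x \<in> G) \<and> (\<forall>x\<in>carrier V. (\<forall>y\<in>G. ip V x y = 0) \<longrightarrow> (\<forall>y\<in>G. ip V (T x) y = 0))"
proof (intro iffI conjI ballI impI)
  note TD = bounded_opsD[OF T]
  assume c: "\<forall>x\<in>carrier V. T (proj G x) = proj G (T x)"
  show "T x \<in> G" if "x \<in> G" for x
  proof -
    have xV: "x \<in> carrier V" using that G by auto
    have "proj G x = x" by (rule proj_eqI[OF xV that]) (use xV G in \<open>simp add: ip_vsub_left subset_iff\<close>)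
    then show ?thesis using bspec[OF c xV] proj_props(1)[OF TD(2)[OF xV]] by simp
  qed
  fix x y assume x: "x \<in> carrier V" and o: "\<forall>y\<in>G. ip V x y = 0" and y: "y \<in> G"
  have zG: "\<zero>\<^bsub>V\<^esub> \<in> G" using G.zero_in by simp
  have "proj G x = \<zero>\<^bsub>V\<^esub>"
    by (rule proj_eqI[OF x zG]) (use o x G in \<open>simp add: ip_vsub_left subset_iff\<close>)
  then have "proj G (T x) = T \<zero>\<^bsub>V\<^esub>" using bspec[OF c x] by simp
  also have "T \<zero>\<^bsub>V\<^esub> = \<zero>\<^bsub>V\<^esub>" using TD(5)[OF zero_in, of 0] TD(2)[OF zero_in] by (simp add: zero_smult)
  finally have "proj G (T x) = \<zero>\<^bsub>V\<^esub>" .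
  then show "ip V (T x) y = 0"
    using proj_props(2)[OF TD(2)[OF x] y] TD(2)[OF x] subsetD[OF G y] by (simp add: ip_vsub_left)
next
  note TD = bounded_opsD[OF T]
  fix x assume r: "(\<forall>x\<in>G. T x \<in> G) \<and> (\<forall>x\<in>carrier V. (\<forall>y\<in>G. ip V x y = 0) \<longrightarrow> (\<forall>y\<in>G. ip V (T x) y = 0))"
    and x: "x \<in> carrier V"
  note p = proj_props[OF x]
  have pV: "proj G x \<in> carrier V" using p(1) G by auto
  have "proj G (T x) = T (proj G x)"
  proof (rule proj_eqI)
    show "T (proj G x) \<in> G" using r p(1) by blast
    fix w assume w: "w \<in> G"
    have "ip V (T (vsub V x (proj G x))) w = 0"
      using bspec[OF conjunct2[OF r] vsub_in[OF x pV]] p(2) w by simp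
    then show "ip V (vsub V (T x) (T (proj G x))) w = 0"
      using bounded_ops_vsub[OF T x pV] pV by simp
  qed (rule TD(2)[OF x])
  then show "T (proj G x) = proj G (T x)" by simp
qed

end

section \<open>The commutant of all contractions\<close>

definition contractions :: "('a \<Rightarrow> 'a) set" where
  "contractions = {Q \<in> bounded_ops V (carrier V). \<forall>x\<in>carrier V. ip_norm V (Q x) \<le> ip_norm V x}"

lemma selfadjoint_contractions_contractions: "selfadjoint_contractions V contractions"
  unfolding selfadjoint_contractions_def contractions_def
  using adjoint_bounded(1) adjoint_norm_le[where C = 1] by auto

lemma selfadjoint_contractions_proj:
  assumes "\<And>G. G \<in> \<G> \<Longrightarrow> G \<subseteq> carrier V \<and> hilbert_space (V\<lparr>carrier := G\<rparr>)"
  shows "selfadjoint_contractions V (proj ` \<G>)"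
  unfolding selfadjoint_contractions_def
  using assms by (auto simp: proj_bounded proj_contractive proj_selfadjoint)

text \<open>Commute \<open>T\<close> with the rank one operator Q that takes a unit vector e to v: T
  v = T (Q e) = Q (T e), which is v times <T e, e>, a factor independent of v.\<close>

lemma commutant_contractionsD:
  assumes T: "T \<in> commutant_ops V contractions"
  obtains c where "\<And>x. x \<in> carrier V \<Longrightarrow> T x = c \<odot>\<^bsub>V\<^esub> x"
proof (cases "carrier V = {\<zero>\<^bsub>V\<^esub>}")
  have TB: "T \<in> bounded_ops V (carrier V)" using T by (simp add: commutant_ops_def)
  note TD = bounded_opsD[OF TB]
  {
    case True
    then have "T x = 0 \<odot>\<^bsub>V\<^esub> x" if "x \<in> carrier V" for x
      using TD(2)[OF that] that by (auto simp: zero_smult)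
    then show thesis by (rule that)
  next
    case False
    then obtain e0 where e0: "e0 \<in> carrier V" "e0 \<noteq> \<zero>\<^bsub>V\<^esub>" using zero_in by blast
    then have n0: "ip_norm V e0 > 0" using norm_nonneg[OF e0(1)] norm_eq_0_iff[OF e0(1)] by linarith
    define e where "e = of_real (1 / ip_norm V e0) \<odot>\<^bsub>V\<^esub> e0"
    have e: "e \<in> carrier V" "ip_norm V e = 1" using e0 n0 by (auto simp: e_def norm_smult norm_divide)
    have ee: "ip V e e = 1" using ip_self[OF e(1)] e(2) by simp
    \<comment> \<open>Norm at most 1 keeps the rank one operator \<open>Q\<close> a contraction; the
      other vectors are reached by scaling.\<close>
    have unit: "T v = ip V (T e) e \<odot>\<^bsub>V\<^esub> v" if v: "v \<in> carrier V" and n: "ip_norm V v \<le> 1" for v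
    proof -
      define Q where "Q = (\<lambda>x\<in>carrier V. ip V x e \<odot>\<^bsub>V\<^esub> v)"
      have le: "ip_norm V (Q x) \<le> ip_norm V x" if x: "x \<in> carrier V" for x
      proof -
        have "ip_norm V (Q x) = cmod (ip V x e) * ip_norm V v" using x v by (simp add: Q_def norm_smult)
        also have "\<dots> \<le> (ip_norm V x * 1) * 1"
          using Cauchy_Schwarz[OF x e(1)] e(2) n x v by (intro mult_mono) auto
        finally show ?thesis by simp
      qed
      have "Q \<in> bounded_ops V (carrier V)"
        by (rule bounded_opsI[where C = 1])
          (use le v e in \<open>auto simp: Q_def ip_expand intro!: vec_eqI, simp_all add: algebra_simps\<close>)
      then have "Q \<in> contractions" using le by (simp add: contractions_def)
      then have "T (Q e) = Q (T e)" using T e by (simp add: commutant_ops_def)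
      moreover have "Q e = v" unfolding Q_def using v e ee by (auto intro!: vec_eqI simp: ip_expand)
      ultimately show ?thesis using TD(2)[OF e(1)] by (simp add: Q_def)
    qed
    have "T x = ip V (T e) e \<odot>\<^bsub>V\<^esub> x" if x: "x \<in> carrier V" for x
    proof (cases "ip_norm V x = 0")
      case True
      then show ?thesis using unit[OF x] by simp
    next
      case nz: False
      define r where "r = complex_of_real (ip_norm V x)"
      have r: "r \<noteq> 0" using nz by (simp add: r_def)
      have "ip_norm V ((1 / r) \<odot>\<^bsub>V\<^esub> x) \<le> 1" using x nz by (simp add: norm_smult r_def norm_divide)
      then have "T ((1 / r) \<odot>\<^bsub>V\<^esub> x) = ip V (T e) e \<odot>\<^bsub>V\<^esub> ((1 / r) \<odot>\<^bsub>V\<^esub> x)" using unit x by auto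
      then have eq: "(1 / r) \<odot>\<^bsub>V\<^esub> T x = ip V (T e) e \<odot>\<^bsub>V\<^esub> ((1 / r) \<odot>\<^bsub>V\<^esub> x)" using TD(5)[OF x] by simp
      show ?thesis
      proof (rule vec_eqI)
        fix z assume z: "z \<in> carrier V"
        have "ip V ((1 / r) \<odot>\<^bsub>V\<^esub> T x) z = ip V (ip V (T e) e \<odot>\<^bsub>V\<^esub> ((1 / r) \<odot>\<^bsub>V\<^esub> x)) z" using eq by simp
        then show "ip V (T x) z = ip V (ip V (T e) e \<odot>\<^bsub>V\<^esub> x) z"
          using z x TD(2)[OF x] r by (simp add: ip_smult_left field_simps)
      qed (use x TD(2)[OF x] in auto)
    qed
    then show thesis by (rule that)
  }
qed

lemma scalar_in_commutant:
  assumes T: "T \<in> bounded_ops V (carrier V)" and c: "\<And>x. x \<in> carrier V \<Longrightarrow> T x = c \<odot>\<^bsub>V\<^esub> x"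
  shows "T \<in> commutant_ops V contractions"
  using T bounded_opsD(2,5)[of _ V "carrier V"] by (auto simp: commutant_ops_def contractions_def c)

end

section \<open>Decomposable operators on direct integrals\<close>

text \<open>The versions \<open>ev x\<close> of a vector are determined only almost everywhere.
  Completeness of the measure lets measurability and integrability pass to everything that agrees
  with them almost everywhere.\<close>

lemma (in complete_measure) borel_measurable_AE_eq:
  fixes f g :: "'a \<Rightarrow> 'b::topological_space"
  assumes g: "g \<in> borel_measurable M" and eq: "AE x in M. f x = g x"
  shows "f \<in> borel_measurable M"
proof (rule measurableI)
  fix A :: "'b set" assume A: "A \<in> sets borel"
  have a: "g -` A \<inter> space M \<in> sets M" using g A by (rule measurable_sets)
  have "AE x in M. x \<in> g -` A \<inter> space M \<longleftrightarrow> x \<in> f -` A \<inter> space M"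
    using eq by eventually_elim simp
  from in_sets_AE[OF this a] show "f -` A \<inter> space M \<in> sets M" by simp
qed simp

lemma (in complete_measure) integrable_AE_eq:
  fixes f g :: "'a \<Rightarrow> 'b::{banach, second_countable_topology}"
  assumes g: "integrable M g" and eq: "AE x in M. f x = g x"
  shows "integrable M f"
proof (rule integrable_cong_AE_imp[OF g])
  show "f \<in> borel_measurable M" by (rule borel_measurable_AE_eq[OF borel_measurable_integrable[OF g] eq])
  show "AE x in M. g x = f x" using eq by eventually_elim simp
qed

lemma (in complete_measure) integral_AE_eq:
  fixes f g :: "'a \<Rightarrow> 'b::{banach, second_countable_topology}"
  assumes g: "integrable M g" and eq: "AE x in M. f x = g x"
  shows "(LINT x|M. f x) = (LINT x|M. g x)"
  by (rule integral_cong_AE[OF borel_measurable_AE_eq[OF borel_measurable_integrable[OF g] eq]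
    borel_measurable_integrable[OF g] eq])

lemma (in inner_product_space) one_smult [simp]: "x \<in> carrier V \<Longrightarrow> 1 \<odot>\<^bsub>V\<^esub> x = x"
  by (rule vec_eqI) (auto simp: ip_expand)

lemma (in inner_product_space) add_zero_smult:
  "x \<in> carrier V \<Longrightarrow> y \<in> carrier V \<Longrightarrow> x \<oplus>\<^bsub>V\<^esub> 0 \<odot>\<^bsub>V\<^esub> y = x"
  by (rule vec_eqI) (auto simp: ip_expand)

section \<open>Linearity and density in a direct integral of Hilbert spaces\<close>

locale direct_integral = complete_measure N for N :: "'x measure" +
  fixes K :: "'x \<Rightarrow> 'h ip_space" and W :: "'a ip_space" and ev :: "'a \<Rightarrow> 'x \<Rightarrow> 'h"
  assumes di: "hilbert_direct_integral N K W ev"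
begin

sublocale W: hilbert W
  using di by (simp add: hilbert_direct_integral_def separable_hilbert_space_def hilbert_space_iff)

lemma fibre_hilbert: "p \<in> space N \<Longrightarrow> hilbert (K p)"
  using di by (simp add: hilbert_direct_integral_def separable_hilbert_space_def hilbert_space_iff)

lemma fibre_ips: "p \<in> space N \<Longrightarrow> inner_product_space (K p)"
  using fibre_hilbert by (simp add: hilbert_def)

lemma ev_in: "x \<in> carrier W \<Longrightarrow> p \<in> space N \<Longrightarrow> ev x p \<in> carrier (K p)"
  using di by (simp add: hilbert_direct_integral_def)

lemma ip_integrable:
  "x \<in> carrier W \<Longrightarrow> y \<in> carrier W \<Longrightarrow> integrable N (\<lambda>p. ip (K p) (ev x p) (ev y p))"
  using di by (simp add: hilbert_direct_integral_def)

lemma ip_W: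
  "x \<in> carrier W \<Longrightarrow> y \<in> carrier W \<Longrightarrow> (LINT p|N. ip (K p) (ev x p) (ev y p)) = ip W x y"
  using di by (simp add: hilbert_direct_integral_def)

lemma realise:
  assumes "\<And>p. p \<in> space N \<Longrightarrow> v p \<in> carrier (K p)"
    "\<And>y. y \<in> carrier W \<Longrightarrow> integrable N (\<lambda>p. ip (K p) (v p) (ev y p))"
  shows "\<exists>x\<in>carrier W. AE p in N. ev x p = v p"
proof -
  have "\<forall>v. (\<forall>p\<in>space N. v p \<in> carrier (K p)) \<longrightarrow>
          (\<forall>y\<in>carrier W. integrable N (\<lambda>p. ip (K p) (v p) (ev y p))) \<longrightarrow>
          (\<exists>x\<in>carrier W. AE p in N. ev x p = v p)"
    using di by (simp add: hilbert_direct_integral_def)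
  then show ?thesis using assms by simp
qed

text \<open>The definition of a direct integral speaks of inner products, and linearity is extracted
  from them: the integral of the squared norm of the difference expands into nine inner products of
  \<open>W\<close>, and the same expansion inside \<open>W\<close> is the squared norm of 0.\<close>

lemma ev_lincomb2:
  assumes x: "x \<in> carrier W" and y: "y \<in> carrier W"
  shows "AE p in N. ev (a \<odot>\<^bsub>W\<^esub> x \<oplus>\<^bsub>W\<^esub> b \<odot>\<^bsub>W\<^esub> y) p = a \<odot>\<^bsub>K p\<^esub> ev x p \<oplus>\<^bsub>K p\<^esub> b \<odot>\<^bsub>K p\<^esub> ev y p"
proof -
  define z where "z = a \<odot>\<^bsub>W\<^esub> x \<oplus>\<^bsub>W\<^esub> b \<odot>\<^bsub>W\<^esub> y"
  have z: "z \<in> carrier W" using x y by (simp add: z_def)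
  define c where "c = (\<lambda>p. a \<odot>\<^bsub>K p\<^esub> ev x p \<oplus>\<^bsub>K p\<^esub> b \<odot>\<^bsub>K p\<^esub> ev y p)"
  \<comment> \<open>The polynomial of the expansion, evaluated once at the pointwise and once at the
    global inner products.\<close>
  define E where "E = (\<lambda>zz zx zy xz xx xy yz yx yy. zz - cnj a * zx - cnj b * zy
     - a * (xz - cnj a * xx - cnj b * xy) - b * (yz - cnj a * yx - cnj b * yy) :: complex)"
  define i where "i = (\<lambda>u v p. ip (K p) (ev u p) (ev v p))"
  define f where "f = (\<lambda>p. E (i z z p) (i z x p) (i z y p) (i x z p) (i x x p) (i x y p) (i y z p) (i y x p) (i y y p))"
  have fd: "ip (K p) (vsub (K p) (ev z p) (c p)) (vsub (K p) (ev z p) (c p)) = f p" and cK: "c p \<in> carrier (K p)"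
    if p: "p \<in> space N" for p
  proof -
    interpret Kp: inner_product_space "K p" by (rule fibre_ips[OF p])
    show "ip (K p) (vsub (K p) (ev z p) (c p)) (vsub (K p) (ev z p) (c p)) = f p"
      using ev_in[OF x p] ev_in[OF y p] ev_in[OF z p]
      by (simp add: f_def E_def i_def c_def Kp.ip_expand algebra_simps)
    show "c p \<in> carrier (K p)" using ev_in[OF x p] ev_in[OF y p] by (simp add: c_def)
  qed
  have int: "integrable N (i u v)" if "u \<in> {x, y, z}" "v \<in> {x, y, z}" for u v
    using that x y z by (auto simp: i_def intro: ip_integrable)
  have intW: "(LINT p|N. i u v p) = ip W u v" if "u \<in> {x, y, z}" "v \<in> {x, y, z}" for u v
    using that x y z by (auto simp: i_def intro: ip_W)
  have fint: "integrable N f" unfolding f_def E_def using int by auto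
  have "(LINT p|N. f p) = E (ip W z z) (ip W z x) (ip W z y) (ip W x z) (ip W x x) (ip W x y) (ip W y z) (ip W y x) (ip W y y)"
    unfolding f_def E_def using int by (simp add: intW)
  also have "\<dots> = 0" using x y by (simp add: E_def z_def W.ip_expand algebra_simps)
  finally have "(LINT p|N. Re (f p)) = 0" using fint by simp
  moreover have Re_f: "Re (f p) = (ip_norm (K p) (vsub (K p) (ev z p) (c p)))\<^sup>2" if p: "p \<in> space N" for p
  proof -
    interpret Kp: inner_product_space "K p" by (rule fibre_ips[OF p])
    show ?thesis using fd[OF p] cK[OF p] ev_in[OF z p] Kp.Re_ip_self by (metis Kp.vsub_in)
  qed
  moreover have "AE p in N. 0 \<le> Re (f p)" using AE_space by eventually_elim (simp add: Re_f)
  ultimately have "AE p in N. Re (f p) = 0"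
    using integral_nonneg_eq_0_iff_AE[of N "\<lambda>p. Re (f p)"] fint by simp
  with AE_space have "AE p in N. ev z p = c p"
  proof eventually_elim
    case (elim p)
    interpret Kp: inner_product_space "K p" by (rule fibre_ips[OF elim(1)])
    have "ip_norm (K p) (vsub (K p) (ev z p) (c p)) = 0" using elim Re_f by simp
    then show ?case using Kp.norm_vsub_eq_0_iff[OF ev_in[OF z elim(1)] cK[OF elim(1)]] by simp
  qed
  then show ?thesis by (simp add: z_def c_def)
qed

lemma ev_add:
  assumes x: "x \<in> carrier W" and y: "y \<in> carrier W"
  shows "AE p in N. ev (x \<oplus>\<^bsub>W\<^esub> y) p = ev x p \<oplus>\<^bsub>K p\<^esub> ev y p"
  using ev_lincomb2[OF x y, of 1 1] AE_space
proof eventually_elim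
  case (elim p)
  interpret Kp: inner_product_space "K p" by (rule fibre_ips[OF elim(2)])
  show ?case using elim x y ev_in by simp
qed

lemma ev_vsub:
  assumes x: "x \<in> carrier W" and y: "y \<in> carrier W"
  shows "AE p in N. ev (vsub W x y) p = vsub (K p) (ev x p) (ev y p)"
  using ev_lincomb2[OF x y, of 1 "-1"] AE_space
proof eventually_elim
  case (elim p)
  interpret Kp: inner_product_space "K p" by (rule fibre_ips[OF elim(2)])
  show ?case using elim x y ev_in by (simp add: vsub_def)
qed

lemma ev_smult:
  assumes x: "x \<in> carrier W"
  shows "AE p in N. ev (c \<odot>\<^bsub>W\<^esub> x) p = c \<odot>\<^bsub>K p\<^esub> ev x p"
  using ev_lincomb2[OF x x, of c 0] AE_space
proof eventually_elim
  case (elim p)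
  interpret Kp: inner_product_space "K p" by (rule fibre_ips[OF elim(2)])
  show ?case using elim x ev_in by (simp add: W.add_zero_smult Kp.add_zero_smult)
qed

lemma sqnorm_integrable: "x \<in> carrier W \<Longrightarrow> integrable N (\<lambda>p. (ip_norm (K p) (ev x p))\<^sup>2)"
  and sqnorm: "x \<in> carrier W \<Longrightarrow> (LINT p|N. (ip_norm (K p) (ev x p))\<^sup>2) = (ip_norm W x)\<^sup>2"
proof -
  assume x: "x \<in> carrier W"
  have eq: "(ip_norm (K p) (ev x p))\<^sup>2 = Re (ip (K p) (ev x p) (ev x p))" if p: "p \<in> space N" for p
    using inner_product_space.Re_ip_self[OF fibre_ips[OF p] ev_in[OF x p]] by simp
  show "integrable N (\<lambda>p. (ip_norm (K p) (ev x p))\<^sup>2)"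
    using integrable_Re[OF ip_integrable[OF x x]] by (subst Bochner_Integration.integrable_cong[OF refl eq]) auto
  have "(LINT p|N. (ip_norm (K p) (ev x p))\<^sup>2) = (LINT p|N. Re (ip (K p) (ev x p) (ev x p)))"
    by (rule Bochner_Integration.integral_cong[OF refl eq])
  also have "\<dots> = Re (ip W x x)" using ip_integrable[OF x x] ip_W[OF x x] by simp
  finally show "(LINT p|N. (ip_norm (K p) (ev x p))\<^sup>2) = (ip_norm W x)\<^sup>2" by (simp add: W.Re_ip_self x)
qed

lemma sqdist_integrable:
    "x \<in> carrier W \<Longrightarrow> y \<in> carrier W \<Longrightarrow> integrable N (\<lambda>p. (ip_norm (K p) (vsub (K p) (ev x p) (ev y p)))\<^sup>2)"
  and sqdist: "x \<in> carrier W \<Longrightarrow> y \<in> carrier W \<Longrightarrow>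
    (LINT p|N. (ip_norm (K p) (vsub (K p) (ev x p) (ev y p)))\<^sup>2) = (ip_norm W (vsub W x y))\<^sup>2"
proof -
  assume x: "x \<in> carrier W" and y: "y \<in> carrier W"
  have v: "vsub W x y \<in> carrier W" using x y by simp
  have eq: "AE p in N. (ip_norm (K p) (vsub (K p) (ev x p) (ev y p)))\<^sup>2 = (ip_norm (K p) (ev (vsub W x y) p))\<^sup>2"
    using ev_vsub[OF x y] by eventually_elim simp
  show "integrable N (\<lambda>p. (ip_norm (K p) (vsub (K p) (ev x p) (ev y p)))\<^sup>2)"
    by (rule integrable_AE_eq[OF sqnorm_integrable[OF v] eq])
  show "(LINT p|N. (ip_norm (K p) (vsub (K p) (ev x p) (ev y p)))\<^sup>2) = (ip_norm W (vsub W x y))\<^sup>2"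
    using integral_AE_eq[OF sqnorm_integrable[OF v] eq] sqnorm[OF v] by simp
qed

lemma ev_inj:
  assumes x: "x \<in> carrier W" and y: "y \<in> carrier W" and eq: "AE p in N. ev x p = ev y p"
  shows "x = y"
proof (rule W.vec_eqI[OF x y])
  fix z assume z: "z \<in> carrier W"
  have "AE p in N. ip (K p) (ev x p) (ev z p) = ip (K p) (ev y p) (ev z p)"
    using eq by eventually_elim simp
  then show "ip W x z = ip W y z"
    using integral_AE_eq[OF ip_integrable[OF y z]] ip_W[OF x z] ip_W[OF y z] by simp
qed

lemma dense_sequence_exists:
  "\<exists>dense_seq. (\<forall>n. dense_seq n \<in> carrier W) \<and>
     (\<forall>y\<in>carrier W. \<forall>\<epsilon>>0. \<exists>n::nat. ip_norm W (vsub W y (dense_seq n)) < \<epsilon>)"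
proof -
  interpret M: Metric_space "carrier W" "ip_dist W" by (rule W.Metric_space_subset) simp
  have "separable_space M.mtopology"
    using di by (simp add: hilbert_direct_integral_def separable_hilbert_space_def)
  then obtain C where C: "countable C" "C \<subseteq> carrier W" "M.mtopology closure_of C = carrier W"
    unfolding separable_space_def by auto
  have near: "\<exists>c\<in>C. ip_norm W (vsub W y c) < \<epsilon>" if y: "y \<in> carrier W" and e: "\<epsilon> > 0" for y \<epsilon>
  proof -
    have "y \<in> M.mtopology closure_of C" using C(3) y by simp
    then obtain c where "c \<in> C" "c \<in> M.mball y \<epsilon>" using e unfolding M.metric_closure_of by auto
    then show ?thesis using C(2) y by (auto simp: W.ip_dist_eq intro!: bexI[of _ c])
  qed
  have ne: "C \<noteq> {}" using near[OF W.zero_in, of 1] by auto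
  show ?thesis
  proof (intro exI[of _ "from_nat_into C"] conjI allI ballI impI)
    show "from_nat_into C n \<in> carrier W" for n using from_nat_into[OF ne, of n] C(2) by auto
    fix y and \<epsilon> :: real assume "y \<in> carrier W" "\<epsilon> > 0"
    then obtain c where c: "c \<in> C" "ip_norm W (vsub W y c) < \<epsilon>" using near by blast
    then show "\<exists>n. ip_norm W (vsub W y (from_nat_into C n)) < \<epsilon>"
      using from_nat_into_surj[OF C(1) c(1)] by metis
  qed
qed

definition dense_seq :: "nat \<Rightarrow> 'a" where
  "dense_seq = (SOME dense_seq. (\<forall>n. dense_seq n \<in> carrier W) \<and>
     (\<forall>y\<in>carrier W. \<forall>\<epsilon>>0. \<exists>n::nat. ip_norm W (vsub W y (dense_seq n)) < \<epsilon>))"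

lemma dense_seq_in: "dense_seq n \<in> carrier W"
  and dense_seq_approx: "y \<in> carrier W \<Longrightarrow> \<epsilon> > 0 \<Longrightarrow> \<exists>n. ip_norm W (vsub W y (dense_seq n)) < \<epsilon>"
  using someI_ex[OF dense_sequence_exists] unfolding dense_seq_def by auto

text \<open>Meant for a squared pointwise error \<open>h\<close> at \<open>y\<close> of an identity
  that holds along the dense sequence. Close members of the sequence then give majorants of small
  integral, even if \<open>h\<close> is not measurable.\<close>

lemma AE_eq_0_by_density:
  assumes h: "AE p in N. h p \<ge> 0" and C: "C \<ge> (0::real)" and y: "y \<in> carrier W"
    and le: "\<And>n. AE p in N. h p \<le> C * (ip_norm (K p) (vsub (K p) (ev y p) (ev (dense_seq n) p)))\<^sup>2"
  shows "AE p in N. h p = 0"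
proof (rule AE_eq_0_of_small_majorants[OF h])
  fix \<epsilon> :: real assume e: "\<epsilon> > 0"
  \<comment> \<open>C + 1 in place of C covers C = 0 and makes the final inequality strict.\<close>
  define \<delta> where "\<delta> = sqrt (\<epsilon> / (C + 1))"
  have d: "\<delta> > 0" using e C by (simp add: \<delta>_def)
  obtain n where n: "ip_norm W (vsub W y (dense_seq n)) < \<delta>" using dense_seq_approx[OF y d] by blast
  let ?g = "\<lambda>p. C * (ip_norm (K p) (vsub (K p) (ev y p) (ev (dense_seq n) p)))\<^sup>2"
  have "(LINT p|N. ?g p) = C * (ip_norm W (vsub W y (dense_seq n)))\<^sup>2"
    using sqdist[OF y dense_seq_in[of n]] by simp
  also have "\<dots> \<le> C * \<delta>\<^sup>2"
    using n C y dense_seq_in by (intro mult_left_mono power_mono) auto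
  also have "\<dots> = C * (\<epsilon> / (C + 1))" using e C by (simp add: \<delta>_def)
  also have "\<dots> < \<epsilon>" using e C by (simp add: field_simps)
  finally show "\<exists>g. integrable N g \<and> (AE p in N. h p \<le> g p) \<and> (LINT p|N. g p) < \<epsilon>"
    using le[of n] sqdist_integrable[OF y dense_seq_in[of n]] by (intro exI[of _ ?g]) simp
qed

text \<open>A field of unit vectors orthogonal to the dense sequence would be an element of the
  direct integral orthogonal to itself.\<close>

lemma AE_total: "AE p in N. hilbert.total (K p) (\<lambda>n. ev (dense_seq n) p)"
proof -
  \<comment> \<open>Norm 1 makes the field bounded, for the density estimate, and nonzero, for the
    final contradiction.\<close>
  let ?bad = "\<lambda>p v. v \<in> carrier (K p) \<and> ip_norm (K p) v = 1 \<and> (\<forall>n. ip (K p) v (ev (dense_seq n) p) = 0)"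
  have ex: "\<exists>v. ?bad p v" if p: "p \<in> space N" and nt: "\<not> hilbert.total (K p) (\<lambda>n. ev (dense_seq n) p)" for p
  proof -
    interpret Kp: hilbert "K p" by (rule fibre_hilbert[OF p])
    obtain v where v: "v \<in> carrier (K p)" "\<forall>n. ip (K p) v (ev (dense_seq n) p) = 0" "v \<noteq> \<zero>\<^bsub>K p\<^esub>"
      using nt ev_in[OF dense_seq_in p] unfolding Kp.total_def by blast
    have "ip_norm (K p) v \<noteq> 0" using v Kp.norm_eq_0_iff by simp
    then have "?bad p (of_real (1 / ip_norm (K p) v) \<odot>\<^bsub>K p\<^esub> v)"
      using v(1,2) Kp.norm_nonneg[OF v(1)] ev_in[OF dense_seq_in p] by (simp add: Kp.norm_smult Kp.ip_smult_left norm_divide)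
    then show ?thesis by blast
  qed
  define v where "v = (\<lambda>p. if \<exists>v. ?bad p v then SOME v. ?bad p v else \<zero>\<^bsub>K p\<^esub>)"
  have vbad: "?bad p (v p)" if "\<exists>v. ?bad p v" for p
    using someI_ex[OF that] that by (simp add: v_def)
  have v0: "v p = \<zero>\<^bsub>K p\<^esub>" if "\<not> (\<exists>v. ?bad p v)" for p
    unfolding v_def by (rule if_not_P[OF that])
  have vK: "v p \<in> carrier (K p)" and vn: "ip_norm (K p) (v p) \<le> 1"
    and vo: "ip (K p) (v p) (ev (dense_seq n) p) = 0" if p: "p \<in> space N" for p n
  proof -
    interpret Kp: hilbert "K p" by (rule fibre_hilbert[OF p])
    show "v p \<in> carrier (K p)" "ip_norm (K p) (v p) \<le> 1" "ip (K p) (v p) (ev (dense_seq n) p) = 0"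
      using vbad[of p] v0[of p] ev_in[OF dense_seq_in p] by (cases "\<exists>v. ?bad p v"; force)+
  qed
  have z: "AE p in N. ip (K p) (v p) (ev y p) = 0" if y: "y \<in> carrier W" for y
  proof -
    have "AE p in N. (cmod (ip (K p) (v p) (ev y p)))\<^sup>2 = 0"
    proof (rule AE_eq_0_by_density[OF _ _ y, where C = 1])
      fix n
      show "AE p in N. (cmod (ip (K p) (v p) (ev y p)))\<^sup>2 \<le> 1 * (ip_norm (K p) (vsub (K p) (ev y p) (ev (dense_seq n) p)))\<^sup>2"
        using AE_space
      proof eventually_elim
        case (elim p)
        interpret Kp: hilbert "K p" by (rule fibre_hilbert[OF elim])
        let ?d = "vsub (K p) (ev y p) (ev (dense_seq n) p)"
        have d: "?d \<in> carrier (K p)" using ev_in[OF y elim] ev_in[OF dense_seq_in elim] by simp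
        have "ip (K p) (v p) (ev y p) = ip (K p) (v p) ?d"
          using vo[OF elim, of n] vK[OF elim] ev_in[OF y elim] ev_in[OF dense_seq_in elim] by (simp add: Kp.ip_vsub_right)
        then have "cmod (ip (K p) (v p) (ev y p)) \<le> ip_norm (K p) (v p) * ip_norm (K p) ?d"
          using Kp.Cauchy_Schwarz[OF vK[OF elim] d] by simp
        also have "\<dots> \<le> 1 * ip_norm (K p) ?d" using vn[OF elim] Kp.norm_nonneg[OF d] by (rule mult_right_mono)
        finally show ?case by (simp add: power_mono)
      qed
    qed auto
    then show ?thesis by eventually_elim simp
  qed
  \<comment> \<open>All pairings of \<open>v\<close> vanish almost everywhere and are therefore
    integrable, so \<open>realise\<close> applies although \<open>v\<close> was chosen without
    regard to measurability.\<close>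
  have "\<exists>x\<in>carrier W. AE p in N. ev x p = v p"
  proof (rule realise[OF vK])
    fix y assume "y \<in> carrier W"
    then show "integrable N (\<lambda>p. ip (K p) (v p) (ev y p))"
      using integrable_AE_eq[of "\<lambda>p. 0::complex", OF _ z] by simp
  qed
  then obtain x where x: "x \<in> carrier W" "AE p in N. ev x p = v p" by blast
  from x(2) z[OF x(1)] AE_space show ?thesis
  proof eventually_elim
    case (elim p)
    show ?case
    proof (rule ccontr)
      assume "\<not> ?thesis"
      then have "?bad p (v p)" using vbad ex elim(3) by blast
      moreover have "ip (K p) (v p) (v p) = of_real ((ip_norm (K p) (v p))\<^sup>2)"
        by (rule inner_product_space.ip_self[OF fibre_ips[OF elim(3)] vK[OF elim(3)]])
      ultimately show False using elim by simp
    qed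
  qed
qed

section \<open>Decomposable operators as a star algebra\<close>

definition decomposes :: "('a \<Rightarrow> 'a) \<Rightarrow> ('x \<Rightarrow> 'h \<Rightarrow> 'h) \<Rightarrow> bool" where
  "decomposes T S \<longleftrightarrow> (\<forall>x\<in>carrier W. AE p in N. ev (T x) p = S p (ev x p))"

definition decomposable_over :: "('x \<Rightarrow> ('h \<Rightarrow> 'h) set) \<Rightarrow> ('a \<Rightarrow> 'a) set" where
  "decomposable_over A = {T \<in> bounded_ops W (carrier W).
     \<exists>S. (\<forall>p\<in>space N. S p \<in> A p) \<and> decomposes T S}"

lemma decomposesD: "decomposes T S \<Longrightarrow> x \<in> carrier W \<Longrightarrow> AE p in N. ev (T x) p = S p (ev x p)"
  by (simp add: decomposes_def)

lemma decomposable_overI: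
  "T \<in> bounded_ops W (carrier W) \<Longrightarrow> decomposes T S \<Longrightarrow> (\<And>p. p \<in> space N \<Longrightarrow> S p \<in> A p) \<Longrightarrow>
    T \<in> decomposable_over A"
  unfolding decomposable_over_def by auto

text \<open>The fibre adjoints applied to \<open>ev y\<close> have the same pairings with
  \<open>ev x\<close> as \<open>ev y\<close> has with \<open>ev (T x)\<close>. These are integrable,
  so \<open>realise\<close> yields a vector, and its inner products identify it as the value of the
  adjoint of \<open>T\<close>.\<close>

lemma decomposes_adjoint:
  assumes T: "T \<in> bounded_ops W (carrier W)" and S: "\<And>p. p \<in> space N \<Longrightarrow> S p \<in> bounded_ops (K p) (carrier (K p))"
    and d: "decomposes T S"
  shows "decomposes (adjoint_op W (carrier W) T) (\<lambda>p. adjoint_op (K p) (carrier (K p)) (S p))"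
  unfolding decomposes_def
proof
  fix y assume y: "y \<in> carrier W"
  define v where "v = (\<lambda>p. adjoint_op (K p) (carrier (K p)) (S p) (ev y p))"
  have vK: "v p \<in> carrier (K p)" if p: "p \<in> space N" for p
    unfolding v_def
    by (rule bounded_opsD(2)[OF hilbert.adjoint_bounded(1)[OF fibre_hilbert[OF p] S[OF p]] ev_in[OF y p]])
  have eq: "AE p in N. ip (K p) (v p) (ev x p) = ip (K p) (ev y p) (ev (T x) p)" if x: "x \<in> carrier W" for x
    using decomposesD[OF d x] AE_space
  proof eventually_elim
    case (elim p)
    show ?case unfolding v_def elim(1)
      by (rule hilbert.adjoint_left[OF fibre_hilbert[OF elim(2)] S[OF elim(2)] ev_in[OF y elim(2)] ev_in[OF x elim(2)]])
  qed
  note Tin = bounded_opsD(2)[OF T]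
  have "\<exists>z\<in>carrier W. AE p in N. ev z p = v p"
    by (rule realise[OF vK], assumption) (rule integrable_AE_eq[OF ip_integrable[OF y Tin] eq])
  then obtain z where z: "z \<in> carrier W" "AE p in N. ev z p = v p" by blast
  have "z = adjoint_op W (carrier W) T y"
  proof (rule W.vec_eqI[OF z(1)])
    show "adjoint_op W (carrier W) T y \<in> carrier W"
      by (rule bounded_opsD(2)[OF W.adjoint_bounded(1)[OF T] y])
    fix x assume x: "x \<in> carrier W"
    have e2: "AE p in N. ip (K p) (ev z p) (ev x p) = ip (K p) (ev y p) (ev (T x) p)"
      using z(2) eq[OF x] by eventually_elim simp
    have "ip W z x = ip W y (T x)"
      using integral_AE_eq[OF ip_integrable[OF y Tin[OF x]] e2] ip_W[OF z(1) x] ip_W[OF y Tin[OF x]] by simp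
    then show "ip W z x = ip W (adjoint_op W (carrier W) T y) x" using W.adjoint_left[OF T y x] by simp
  qed
  then show "AE p in N. ev (adjoint_op W (carrier W) T y) p = adjoint_op (K p) (carrier (K p)) (S p) (ev y p)"
    using z(2) by (simp add: v_def)
qed

lemma decomposable_star_subalgebra:
  assumes A: "\<And>p. p \<in> space N \<Longrightarrow>
    unital_star_subalgebra (K p) (carrier (K p)) (bounded_ops (K p) (carrier (K p))) (A p)"
  shows "unital_star_subalgebra W (carrier W) (bounded_ops W (carrier W)) (decomposable_over A)"
  unfolding unital_star_subalgebra_def
proof (intro conjI ballI allI)
  note AD = unital_star_subalgebraD[OF A]
  show "decomposable_over A \<subseteq> bounded_ops W (carrier W)" by (auto simp: decomposable_over_def)
  have "decomposes (\<lambda>x\<in>carrier W. x) (\<lambda>p. \<lambda>x\<in>carrier (K p). x)"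
    unfolding decomposes_def
  proof
    fix x assume x: "x \<in> carrier W"
    show "AE p in N. ev ((\<lambda>x\<in>carrier W. x) x) p = (\<lambda>x\<in>carrier (K p). x) (ev x p)"
      using AE_space by eventually_elim (simp add: x ev_in)
  qed
  then show "(\<lambda>x\<in>carrier W. x) \<in> decomposable_over A"
    by (rule decomposable_overI[OF W.bounded_ops_id]) (rule AD(2))
  fix T assume "T \<in> decomposable_over A"
  then obtain T' where T: "T \<in> bounded_ops W (carrier W)" and T': "\<And>p. p \<in> space N \<Longrightarrow> T' p \<in> A p"
    and dT: "decomposes T T'" by (auto simp: decomposable_over_def)
  note Tin = bounded_opsD(2)[OF T]
  show "(\<lambda>x\<in>carrier W. c \<odot>\<^bsub>W\<^esub> T x) \<in> decomposable_over A" for c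
  proof -
    have "decomposes (\<lambda>x\<in>carrier W. c \<odot>\<^bsub>W\<^esub> T x) (\<lambda>p. \<lambda>x\<in>carrier (K p). c \<odot>\<^bsub>K p\<^esub> T' p x)"
      unfolding decomposes_def
    proof
      fix x assume x: "x \<in> carrier W"
      show "AE p in N. ev ((\<lambda>x\<in>carrier W. c \<odot>\<^bsub>W\<^esub> T x) x) p = (\<lambda>x\<in>carrier (K p). c \<odot>\<^bsub>K p\<^esub> T' p x) (ev x p)"
        using AE_space decomposesD[OF dT x] ev_smult[OF Tin[OF x], of c] by eventually_elim (simp add: x ev_in)
    qed
    then show ?thesis by (rule decomposable_overI[OF W.bounded_ops_smult[OF T]]) (rule AD(4)[OF _ T'])
  qed
  show "adjoint_op W (carrier W) T \<in> decomposable_over A"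
    by (rule decomposable_overI[OF W.adjoint_bounded(1)[OF T] decomposes_adjoint[OF T AD(1)[OF _ T'] dT]])
      (assumption | rule AD(6)[OF _ T'])+
  fix S assume "S \<in> decomposable_over A"
  then obtain S' where S: "S \<in> bounded_ops W (carrier W)" and S': "\<And>p. p \<in> space N \<Longrightarrow> S' p \<in> A p"
    and dS: "decomposes S S'" by (auto simp: decomposable_over_def)
  note Sin = bounded_opsD(2)[OF S]
  have "decomposes (\<lambda>x\<in>carrier W. S x \<oplus>\<^bsub>W\<^esub> T x) (\<lambda>p. \<lambda>x\<in>carrier (K p). S' p x \<oplus>\<^bsub>K p\<^esub> T' p x)"
    unfolding decomposes_def
  proof
    fix x assume x: "x \<in> carrier W"
    show "AE p in N. ev ((\<lambda>x\<in>carrier W. S x \<oplus>\<^bsub>W\<^esub> T x) x) p = (\<lambda>x\<in>carrier (K p). S' p x \<oplus>\<^bsub>K p\<^esub> T' p x) (ev x p)"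
      using AE_space decomposesD[OF dT x] decomposesD[OF dS x] ev_add[OF Sin[OF x] Tin[OF x]]
      by eventually_elim (simp add: x ev_in)
  qed
  then show "(\<lambda>x\<in>carrier W. S x \<oplus>\<^bsub>W\<^esub> T x) \<in> decomposable_over A"
    by (rule decomposable_overI[OF W.bounded_ops_add[OF S T]]) (rule AD(3)[OF _ S' T'])
  have "decomposes (compose (carrier W) S T) (\<lambda>p. compose (carrier (K p)) (S' p) (T' p))"
    unfolding decomposes_def
  proof
    fix x assume x: "x \<in> carrier W"
    show "AE p in N. ev (compose (carrier W) S T x) p = compose (carrier (K p)) (S' p) (T' p) (ev x p)"
      using AE_space decomposesD[OF dT x] decomposesD[OF dS Tin[OF x]]
      by eventually_elim (simp add: x ev_in compose_def)
  qed
  then show "compose (carrier W) S T \<in> decomposable_over A"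
    by (rule decomposable_overI[OF W.bounded_ops_compose[OF S T]]) (rule AD(5)[OF _ S' T'])
qed

section \<open>Strong closedness of algebras of decomposable operators\<close>

text \<open>By \<open>realise\<close>, multiplication by indicator functions acts on the direct
  integral; it is the device that cuts pointwise statements out of global ones.\<close>

lemma indicator_element:
  assumes x: "x \<in> carrier W" and B: "B \<in> sets N"
  shows "\<exists>x'\<in>carrier W. AE p in N. ev x' p = (if p \<in> B then ev x p else \<zero>\<^bsub>K p\<^esub>)"
proof (rule realise)
  fix p assume p: "p \<in> space N"
  interpret Kp: hilbert "K p" by (rule fibre_hilbert[OF p])
  show "(if p \<in> B then ev x p else \<zero>\<^bsub>K p\<^esub>) \<in> carrier (K p)" using ev_in[OF x p] by simp
next
  fix y assume y: "y \<in> carrier W"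
  have "integrable N (\<lambda>p. indicator B p *\<^sub>R ip (K p) (ev x p) (ev y p))"
    by (rule integrable_mult_indicator[OF B ip_integrable[OF x y]])
  moreover have "AE p in N. ip (K p) (if p \<in> B then ev x p else \<zero>\<^bsub>K p\<^esub>) (ev y p) =
      indicator B p *\<^sub>R ip (K p) (ev x p) (ev y p)"
    using AE_space
  proof eventually_elim
    case (elim p)
    interpret Kp: hilbert "K p" by (rule fibre_hilbert[OF elim])
    show ?case using ev_in[OF y elim] by simp
  qed
  ultimately show "integrable N (\<lambda>p. ip (K p) (if p \<in> B then ev x p else \<zero>\<^bsub>K p\<^esub>) (ev y p))"
    by (rule integrable_AE_eq)
qed

text \<open>Fibres send 0 to 0, so cutting to \<open>B\<close> before or after a decomposable
  operator gives the same result.\<close>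

lemma decomposable_indicator:
  assumes T: "T \<in> bounded_ops W (carrier W)" and S: "\<And>p. p \<in> space N \<Longrightarrow> S p \<in> bounded_ops (K p) (carrier (K p))"
    and d: "decomposes T S" and x: "x \<in> carrier W" and x': "x' \<in> carrier W"
    and eq: "AE p in N. ev x' p = (if p \<in> B then ev x p else \<zero>\<^bsub>K p\<^esub>)"
  shows "AE p in N. ev (T x') p = (if p \<in> B then ev (T x) p else \<zero>\<^bsub>K p\<^esub>)"
  using AE_space decomposesD[OF d x] decomposesD[OF d x'] eq
proof eventually_elim
  case (elim p)
  interpret Kp: hilbert "K p" by (rule fibre_hilbert[OF elim(1)])
  have "S p \<zero>\<^bsub>K p\<^esub> = \<zero>\<^bsub>K p\<^esub>"
    using bounded_opsD(5)[OF S[OF elim(1)] Kp.zero_in, of 0] bounded_opsD(2)[OF S[OF elim(1)] Kp.zero_in]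
    by (simp add: Kp.zero_smult)
  then show ?case using elim by simp
qed

lemma norm_le_pointwise:
  assumes x: "x \<in> carrier W" and y: "y \<in> carrier W"
    and le: "AE p in N. (ip_norm (K p) (ev x p))\<^sup>2 \<le> (ip_norm (K p) (ev y p))\<^sup>2"
  shows "ip_norm W x \<le> ip_norm W y"
proof -
  have "(ip_norm W x)\<^sup>2 \<le> (ip_norm W y)\<^sup>2"
    unfolding sqnorm[OF x, symmetric] sqnorm[OF y, symmetric]
    by (rule integral_mono_AE[OF sqnorm_integrable[OF x] sqnorm_integrable[OF y] le])
  then show ?thesis using W.norm_nonneg[OF y] by (rule power2_le_imp_le)
qed

text \<open>Cutting to \<open>B\<close> is contractive. Approximating \<open>T\<close> by one
  decomposable operator at both \<open>x\<close> and \<open>x'\<close> therefore compares the cut of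
  T x with T x' up to 2 \<epsilon>.\<close>

lemma sot_limit_indicator:
  assumes T: "T \<in> bounded_ops W (carrier W)" and l: "sot_limit W (carrier W) (decomposable_over A) T"
    and A: "\<And>p. p \<in> space N \<Longrightarrow> A p \<subseteq> bounded_ops (K p) (carrier (K p))"
    and x: "x \<in> carrier W" and x': "x' \<in> carrier W"
    and eq: "AE p in N. ev x' p = (if p \<in> B then ev x p else \<zero>\<^bsub>K p\<^esub>)" and B: "B \<in> sets N"
  shows "AE p in N. ev (T x') p = (if p \<in> B then ev (T x) p else \<zero>\<^bsub>K p\<^esub>)"
proof -
  note Tin = bounded_opsD(2)[OF T]
  obtain r where r: "r \<in> carrier W" "AE p in N. ev r p = (if p \<in> B then ev (T x) p else \<zero>\<^bsub>K p\<^esub>)"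
    using indicator_element[OF Tin[OF x] B] by auto
  have small: "ip_norm W (vsub W r (T x')) \<le> 2 * \<epsilon>" if e: "\<epsilon> > 0" for \<epsilon>
  proof -
    have "\<exists>R\<in>decomposable_over A. \<forall>z\<in>{x, x'}. ip_norm W (vsub W (T z) (R z)) < \<epsilon>"
      by (rule sot_limitD[OF l]) (use x x' e in auto)
    then obtain R where R: "R \<in> decomposable_over A" "ip_norm W (vsub W (T x) (R x)) < \<epsilon>"
      "ip_norm W (vsub W (T x') (R x')) < \<epsilon>" by auto
    obtain S where RB: "R \<in> bounded_ops W (carrier W)" and dS: "decomposes R S"
      and S: "\<forall>p\<in>space N. S p \<in> A p" using R(1) by (auto simp: decomposable_over_def)
    have SB: "S p \<in> bounded_ops (K p) (carrier (K p))" if "p \<in> space N" for p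
      using S A[OF that] that by auto
    note Rin = bounded_opsD(2)[OF RB]
    have e2: "AE p in N. ev (R x') p = (if p \<in> B then ev (R x) p else \<zero>\<^bsub>K p\<^esub>)"
      by (rule decomposable_indicator[OF RB SB dS x x' eq])
    have "ip_norm W (vsub W r (R x')) \<le> ip_norm W (vsub W (T x) (R x))"
    proof (rule norm_le_pointwise)
      show "AE p in N. (ip_norm (K p) (ev (vsub W r (R x')) p))\<^sup>2 \<le> (ip_norm (K p) (ev (vsub W (T x) (R x)) p))\<^sup>2"
        using AE_space e2 r(2) ev_vsub[OF r(1) Rin[OF x']] ev_vsub[OF Tin[OF x] Rin[OF x]]
      proof eventually_elim
        case (elim p)
        interpret Kp: hilbert "K p" by (rule fibre_hilbert[OF elim(1)])
        have "vsub (K p) \<zero>\<^bsub>K p\<^esub> \<zero>\<^bsub>K p\<^esub> = \<zero>\<^bsub>K p\<^esub>" by (rule Kp.vec_eqI) (auto simp: Kp.ip_expand)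
        then show ?case using elim by simp
      qed
    qed (use r(1) Rin Tin x x' in auto)
    moreover have "ip_norm W (vsub W (R x') (T x')) < \<epsilon>"
      using R(3) W.norm_vsub_commute[OF Rin[OF x'] Tin[OF x']] by simp
    moreover have "ip_norm W (vsub W r (T x')) \<le> ip_norm W (vsub W r (R x')) + ip_norm W (vsub W (R x') (T x'))"
      by (rule W.norm_vsub_triangle[OF r(1) Rin[OF x'] Tin[OF x']])
    ultimately show ?thesis using R(2) by linarith
  qed
  have "ip_norm W (vsub W r (T x')) = 0"
  proof (rule ccontr)
    assume "ip_norm W (vsub W r (T x')) \<noteq> 0"
    then have "ip_norm W (vsub W r (T x')) > 0" using W.norm_nonneg[OF W.vsub_in[OF r(1) Tin[OF x']]] by linarith
    then show False using small[of "ip_norm W (vsub W r (T x')) / 4"] by simp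
  qed
  then have "r = T x'" using W.norm_vsub_eq_0_iff[OF r(1) Tin[OF x']] by simp
  then show ?thesis using r(2) by simp
qed

text \<open>If the bound failed on a set of positive measure, the norm bound of \<open>T\<close>
  would be violated at the part of \<open>x\<close> supported on that set.\<close>

lemma sot_limit_pointwise_bound:
  assumes T: "T \<in> bounded_ops W (carrier W)" and l: "sot_limit W (carrier W) (decomposable_over A) T"
    and A: "\<And>p. p \<in> space N \<Longrightarrow> A p \<subseteq> bounded_ops (K p) (carrier (K p))"
    and C: "C \<ge> 0" "\<And>x. x \<in> carrier W \<Longrightarrow> ip_norm W (T x) \<le> C * ip_norm W x"
    and x: "x \<in> carrier W"
  shows "AE p in N. ip_norm (K p) (ev (T x) p) \<le> C * ip_norm (K p) (ev x p)"
proof -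
  note Tin = bounded_opsD(2)[OF T]
  let ?n = "\<lambda>u p. (ip_norm (K p) (ev u p))\<^sup>2"
  note [measurable] = borel_measurable_integrable[OF sqnorm_integrable[OF x]]
    borel_measurable_integrable[OF sqnorm_integrable[OF Tin[OF x]]]
  define B where "B = {p \<in> space N. ?n (T x) p > C\<^sup>2 * ?n x p}"
  have B: "B \<in> sets N" unfolding B_def by measurable
  obtain x' where x': "x' \<in> carrier W" "AE p in N. ev x' p = (if p \<in> B then ev x p else \<zero>\<^bsub>K p\<^esub>)"
    using indicator_element[OF x B] by auto
  have e2: "AE p in N. ev (T x') p = (if p \<in> B then ev (T x) p else \<zero>\<^bsub>K p\<^esub>)"
    by (rule sot_limit_indicator[OF T l A x x' B])
  let ?f = "\<lambda>p. ?n (T x') p - C\<^sup>2 * ?n x' p"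
  have fi: "integrable N ?f"
    using sqnorm_integrable[OF Tin[OF x'(1)]] sqnorm_integrable[OF x'(1)] by simp
  \<comment> \<open>On \<open>B\<close> the integrand is positive by the definition of
    \<open>B\<close>, off \<open>B\<close> it is 0, while its integral is at most 0 by the global
    bound.\<close>
  have key: "AE p in N. (p \<in> B \<longrightarrow> ?f p = ?n (T x) p - C\<^sup>2 * ?n x p) \<and> (p \<notin> B \<longrightarrow> ?f p = 0)"
    using AE_space e2 x'(2)
  proof eventually_elim
    case (elim p)
    interpret Kp: hilbert "K p" by (rule fibre_hilbert[OF elim(1)])
    show ?case using elim by simp
  qed
  have "(LINT p|N. ?f p) = (ip_norm W (T x'))\<^sup>2 - C\<^sup>2 * (ip_norm W x')\<^sup>2"
    using sqnorm_integrable[OF Tin[OF x'(1)]] sqnorm_integrable[OF x'(1)] sqnorm[OF Tin[OF x'(1)]] sqnorm[OF x'(1)]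
    by simp
  also have "\<dots> \<le> 0"
    using power_mono[OF C(2)[OF x'(1)] W.norm_nonneg[OF Tin[OF x'(1)]], of 2] by (simp add: power_mult_distrib)
  finally have le0: "(LINT p|N. ?f p) \<le> 0" .
  have nn: "AE p in N. 0 \<le> ?f p" using key by eventually_elim (auto simp: B_def)
  have "(LINT p|N. ?f p) = 0" using le0 integral_nonneg_AE[OF nn] by simp
  then have "AE p in N. ?f p = 0" using integral_nonneg_eq_0_iff_AE[OF fi nn] by simp
  with AE_space key show ?thesis
  proof eventually_elim
    case (elim p)
    interpret Kp: hilbert "K p" by (rule fibre_hilbert[OF elim(1)])
    have "?n (T x) p \<le> C\<^sup>2 * ?n x p"
    proof (rule ccontr)
      assume n: "\<not> ?thesis"
      then have "p \<in> B" using elim(1) by (simp add: B_def)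
      then show False using elim(2,3) n by simp
    qed
    then have "(ip_norm (K p) (ev (T x) p))\<^sup>2 \<le> (C * ip_norm (K p) (ev x p))\<^sup>2" by (simp add: power_mult_distrib)
    then show ?case by (rule power2_le_imp_le) (simp add: C(1) ev_in[OF x elim(1)])
  qed
qed

section \<open>Fibres from a pointwise bound\<close>

lemma ev_lincomb:
  assumes x: "\<And>n. x n \<in> carrier W"
  shows "AE p in N. ev (lincomb W x l) p = lincomb (K p) (\<lambda>n. ev (x n) p) l"
proof (induction l)
  case Nil
  have "AE p in N. ev (0 \<odot>\<^bsub>W\<^esub> x 0) p = 0 \<odot>\<^bsub>K p\<^esub> ev (x 0) p" by (rule ev_smult[OF x])
  with AE_space show ?case
  proof eventually_elim
    case (elim p)
    interpret Kp: hilbert "K p" by (rule fibre_hilbert[OF elim(1)])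
    show ?case using elim(2) ev_in[OF x elim(1), of 0] W.zero_smult[OF x, of 0] by (simp add: Kp.zero_smult)
  qed
next
  case (Cons a l)
  obtain n q r where a: "a = (n, q, r)" by (cases a)
  let ?c = "Complex (of_rat q) (of_rat r)"
  have "AE p in N. ev (?c \<odot>\<^bsub>W\<^esub> x n \<oplus>\<^bsub>W\<^esub> lincomb W x l) p = ev (?c \<odot>\<^bsub>W\<^esub> x n) p \<oplus>\<^bsub>K p\<^esub> ev (lincomb W x l) p"
    by (rule ev_add) (use x in auto)
  with ev_smult[OF x[of n], of ?c] Cons.IH show ?case
    by eventually_elim (simp add: a)
qed

text \<open>Outside one null set the bound holds for all rational combinations of the dense sequence
  at once, and there \<open>bounded_extension\<close> produces the fibre. Agreement at an arbitrary
  vector follows by density.\<close>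

lemma decomposes_of_pointwise_bound:
  assumes T: "T \<in> bounded_ops W (carrier W)" and C: "C \<ge> 0"
    and bound: "\<And>x. x \<in> carrier W \<Longrightarrow> AE p in N. ip_norm (K p) (ev (T x) p) \<le> C * ip_norm (K p) (ev x p)"
  shows "\<exists>S. decomposes T S \<and> (\<forall>p\<in>space N. S p \<in> bounded_ops (K p) (carrier (K p)))"
proof -
  note Tin = bounded_opsD(2)[OF T]
  let ?x = "\<lambda>p n. ev (dense_seq n) p" and ?y = "\<lambda>p n. ev (T (dense_seq n)) p"
  have Tl: "T (lincomb W dense_seq l) = lincomb W (\<lambda>n. T (dense_seq n)) l" for l
  proof (induction l)
    case Nil
    show ?case using bounded_opsD(5)[OF T W.zero_in, of 0] Tin[OF W.zero_in] by (simp add: W.zero_smult)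
  next
    case (Cons a l)
    obtain n q r where a: "a = (n, q, r)" by (cases a)
    show ?case using Cons dense_seq_in bounded_opsD(4,5)[OF T] by (simp add: a)
  qed
  have good: "AE p in N. \<forall>l. ip_norm (K p) (lincomb (K p) (?y p) l) \<le> C * ip_norm (K p) (lincomb (K p) (?x p) l)"
  proof -
    have "AE p in N. ip_norm (K p) (lincomb (K p) (?y p) l) \<le> C * ip_norm (K p) (lincomb (K p) (?x p) l)" for l
    proof -
      have "AE p in N. ev (lincomb W dense_seq l) p = lincomb (K p) (?x p) l" by (rule ev_lincomb[OF dense_seq_in])
      moreover have "AE p in N. ev (lincomb W (\<lambda>n. T (dense_seq n)) l) p = lincomb (K p) (?y p) l"
        by (rule ev_lincomb[OF Tin[OF dense_seq_in]])
      moreover have "AE p in N. ip_norm (K p) (ev (T (lincomb W dense_seq l)) p) \<le> C * ip_norm (K p) (ev (lincomb W dense_seq l) p)"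
        by (rule bound) (simp add: dense_seq_in)
      ultimately show ?thesis by eventually_elim (simp add: Tl)
    qed
    then show ?thesis by (simp add: AE_all_countable)
  qed
  let ?P = "\<lambda>p R. R \<in> bounded_ops (K p) (carrier (K p)) \<and> (\<forall>n. R (?x p n) = ?y p n) \<and>
    (\<forall>v\<in>carrier (K p). ip_norm (K p) (R v) \<le> C * ip_norm (K p) v)"
  have exR: "AE p in N. \<exists>R. ?P p R"
    using AE_space AE_total good
  proof eventually_elim
    case (elim p)
    interpret Kp: hilbert "K p" by (rule fibre_hilbert[OF elim(1)])
    show ?case
    proof (rule Kp.bounded_extension[OF elim(2)])
      show "?y p n \<in> carrier (K p)" for n by (rule ev_in[OF Tin[OF dense_seq_in] elim(1)])
      show "ip_norm (K p) (lincomb (K p) (?y p) l) \<le> C * ip_norm (K p) (lincomb (K p) (?x p) l)" for l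
        using elim(3) by simp
      fix R assume "R \<in> bounded_ops (K p) (carrier (K p))" "\<And>n. R (?x p n) = ?y p n"
        "\<And>v. v \<in> carrier (K p) \<Longrightarrow> ip_norm (K p) (R v) \<le> C * ip_norm (K p) v"
      then have "?P p R" by simp
      then show "\<exists>R. ?P p R" by (rule exI[of _ R])
    qed (rule C)
  qed
  \<comment> \<open>The identity on the exceptional null set keeps every fibre bounded.\<close>
  define S where "S = (\<lambda>p. if \<exists>R. ?P p R then SOME R. ?P p R else (\<lambda>v\<in>carrier (K p). v))"
  have S1: "?P p (S p)" if "\<exists>R. ?P p R" for p
    using someI_ex[OF that] unfolding S_def if_P[OF that] .
  have S2: "S p = (\<lambda>v\<in>carrier (K p). v)" if "\<not> (\<exists>R. ?P p R)" for p
    unfolding S_def by (rule if_not_P[OF that])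
  have SB: "S p \<in> bounded_ops (K p) (carrier (K p))" if p: "p \<in> space N" for p
  proof (cases "\<exists>R. ?P p R")
    case True
    then show ?thesis using S1 by blast
  next
    case False
    show ?thesis unfolding S2[OF False] by (rule hilbert.bounded_ops_id[OF fibre_hilbert[OF p]])
  qed
  have "decomposes T S" unfolding decomposes_def
  proof
    fix u assume u: "u \<in> carrier W"
    let ?h = "\<lambda>p. (ip_norm (K p) (vsub (K p) (ev (T u) p) (S p (ev u p))))\<^sup>2"
    \<comment> \<open>Both T u and the fibre value at u differ from the common value at a member of
      the dense sequence by at most C \<delta>; the square of the total 2 C \<delta> explains the
      constant.\<close>
    have "AE p in N. ?h p = 0"
    proof (rule AE_eq_0_by_density[OF _ _ u, where C = "4 * C\<^sup>2"])
      fix n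
      have d: "vsub W u (dense_seq n) \<in> carrier W" using u dense_seq_in by simp
      show "AE p in N. ?h p \<le> 4 * C\<^sup>2 * (ip_norm (K p) (vsub (K p) (ev u p) (ev (dense_seq n) p)))\<^sup>2"
        using AE_space exR bound[OF d] ev_vsub[OF u dense_seq_in[of n]] ev_vsub[OF Tin[OF u] Tin[OF dense_seq_in[of n]]]
      proof eventually_elim
        case (elim p)
        interpret Kp: hilbert "K p" by (rule fibre_hilbert[OF elim(1)])
        note P = S1[OF elim(2)]
        note SD = bounded_opsD[OF SB[OF elim(1)]]
        have up: "ev u p \<in> carrier (K p)" and xp: "ev (dense_seq n) p \<in> carrier (K p)"
          and Tup: "ev (T u) p \<in> carrier (K p)" and Txp: "ev (T (dense_seq n)) p \<in> carrier (K p)"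
          using ev_in[OF _ elim(1)] u dense_seq_in Tin by auto
        define \<delta> where "\<delta> = ip_norm (K p) (vsub (K p) (ev u p) (ev (dense_seq n) p))"
        have d0: "\<delta> \<ge> 0" using up xp by (simp add: \<delta>_def)
        have "T (vsub W u (dense_seq n)) = vsub W (T u) (T (dense_seq n))"
          by (rule bounded_ops_vsub[OF T u dense_seq_in]) (simp add: dense_seq_in)
        then have 1: "ip_norm (K p) (vsub (K p) (ev (T u) p) (ev (T (dense_seq n)) p)) \<le> C * \<delta>"
          using elim(3,4,5) by (simp add: \<delta>_def)
        have Sx: "S p (ev (dense_seq n) p) = ev (T (dense_seq n)) p" using P by blast
        have "vsub (K p) (ev (T (dense_seq n)) p) (S p (ev u p)) = S p (vsub (K p) (ev (dense_seq n) p) (ev u p))"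
          using bounded_ops_vsub[OF SB[OF elim(1)] xp up] up Sx by simp
        then have 2: "ip_norm (K p) (vsub (K p) (ev (T (dense_seq n)) p) (S p (ev u p))) \<le> C * \<delta>"
          using bspec[OF conjunct2[OF conjunct2[OF P]] Kp.vsub_in[OF xp up]] Kp.norm_vsub_commute[OF xp up]
          by (simp add: \<delta>_def)
        have "ip_norm (K p) (vsub (K p) (ev (T u) p) (S p (ev u p))) \<le> 2 * C * \<delta>"
          using Kp.norm_vsub_triangle[OF Tup Txp SD(2)[OF up]] 1 2 by linarith
        then have "?h p \<le> (2 * C * \<delta>)\<^sup>2"
          using Kp.norm_nonneg[OF Kp.vsub_in[OF Tup SD(2)[OF up]]] by (rule power_mono)
        then show ?case by (simp add: \<delta>_def power_mult_distrib)
      qed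
    qed (use C in auto)
    with AE_space show "AE p in N. ev (T u) p = S p (ev u p)"
    proof eventually_elim
      case (elim p)
      interpret Kp: hilbert "K p" by (rule fibre_hilbert[OF elim(1)])
      have "ev u p \<in> carrier (K p)" "ev (T u) p \<in> carrier (K p)"
        using ev_in[OF _ elim(1)] u Tin by auto
      then show ?case using elim(2) Kp.norm_vsub_eq_0_iff bounded_opsD(2)[OF SB[OF elim(1)]] by simp
    qed
  qed
  then show ?thesis using SB by (intro exI[of _ S] conjI ballI)
qed

text \<open>The field \<open>Q\<close> need not be measurable, so its commutation with the operators of the algebra is
  tested against the functionals of \<open>upper_integral_functional\<close>. For \<open>x\<close> in the direct integral,
  such a functional \<open>I\<close> yields by Riesz a vector \<open>z\<close> that plays the role of \<open>Q x\<close>.\<close>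

lemma sot_limit_commutator_small:
  assumes T: "T \<in> bounded_ops W (carrier W)" and l: "sot_limit W (carrier W) \<A> T"
    and TS: "decomposes T S" "\<And>p. p \<in> space N \<Longrightarrow> S p \<in> bounded_ops (K p) (carrier (K p))"
    and \<A>: "\<And>R. R \<in> \<A> \<Longrightarrow> R \<in> bounded_ops W (carrier W) \<and>
      (\<exists>S'. decomposes R S' \<and> (\<forall>p\<in>space N. S' p \<in> bounded_ops (K p) (carrier (K p)) \<and>
         (\<forall>v\<in>carrier (K p). S' p (Q p v) = Q p (S' p v))))"
    and Q: "\<And>p. p \<in> space N \<Longrightarrow> Q p \<in> bounded_ops (K p) (carrier (K p))"
    and Qc: "\<And>p v. p \<in> space N \<Longrightarrow> v \<in> carrier (K p) \<Longrightarrow> ip_norm (K p) (Q p v) \<le> ip_norm (K p) v"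
    and x: "x \<in> carrier W" and y: "y \<in> carrier W"
    and h: "h = (\<lambda>p. Re (ip (K p) (Q p (S p (ev x p))) (ev y p)) - Re (ip (K p) (S p (Q p (ev x p))) (ev y p)))"
    and e: "\<epsilon> > 0"
  shows "\<exists>g. integrable N g \<and> (AE p in N. h p \<le> g p) \<and> (LINT p|N. g p) < \<epsilon>"
proof -
  let ?D = "dominated_functions N"
  interpret D: function_subspace ?D by (rule dominated_functions_subspace)
  note Tin = bounded_opsD(2)[OF T]
  note Qin = bounded_opsD(2)[OF Q]
  let ?n = "\<lambda>u p. (ip_norm (K p) (ev u p))\<^sup>2"
  \<comment> \<open>Pairings are dominated through a b \<le> (a^2 + b^2)/2, because squared norms
    are the functions whose integrals are known.\<close>
  define m where "m = (\<lambda>u v p. (?n u p + ?n v p) / 2)"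
  have mi: "integrable N (m u v)" and mI: "(LINT p|N. m u v p) = ((ip_norm W u)\<^sup>2 + (ip_norm W v)\<^sup>2) / 2"
    if "u \<in> carrier W" "v \<in> carrier W" for u v
    unfolding m_def using sqnorm_integrable[OF that(1)] sqnorm_integrable[OF that(2)] sqnorm[OF that(1)] sqnorm[OF that(2)]
    by simp_all
  have pm: "a * b \<le> (a\<^sup>2 + b\<^sup>2) / 2" for a b :: real using sum_squares_bound[of a b] by simp
  have Kbound: "\<bar>Re (ip (K p) v w)\<bar> \<le> (a\<^sup>2 + b\<^sup>2) / 2"
    if p: "p \<in> space N" and v: "v \<in> carrier (K p)" and w: "w \<in> carrier (K p)"
      and a: "ip_norm (K p) v \<le> a" and b: "ip_norm (K p) w \<le> b" for p v w a b
  proof -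
    interpret Kp: hilbert "K p" by (rule fibre_hilbert[OF p])
    have "\<bar>Re (ip (K p) v w)\<bar> \<le> ip_norm (K p) v * ip_norm (K p) w" by (rule Kp.Re_ip_le[OF v w])
    also have "\<dots> \<le> a * b" using a b Kp.norm_nonneg[OF v] Kp.norm_nonneg[OF w] by (intro mult_mono) auto
    also have "\<dots> \<le> (a\<^sup>2 + b\<^sup>2) / 2" by (rule pm)
    finally show ?thesis .
  qed
  \<comment> \<open>\<open>a\<close> tests the field Q x against a vector, \<open>b\<close> tests Q
    at a vector against \<open>y\<close>. Both may be nonmeasurable but are dominated.\<close>
  define a where "a = (\<lambda>w p. Re (ip (K p) (ev w p) (Q p (ev x p))))"
  define b where "b = (\<lambda>u p. Re (ip (K p) (Q p (ev u p)) (ev y p)))"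
  have am: "\<bar>a w p\<bar> \<le> m w x p" if p: "p \<in> space N" and w: "w \<in> carrier W" for w p
    unfolding a_def m_def
    by (rule Kbound[OF p ev_in[OF w p] Qin[OF p ev_in[OF x p]] order_refl Qc[OF p ev_in[OF x p]]])
  have bm: "\<bar>b u p\<bar> \<le> m u y p" if p: "p \<in> space N" and u: "u \<in> carrier W" for u p
    unfolding b_def m_def
    by (rule Kbound[OF p Qin[OF p ev_in[OF u p]] ev_in[OF y p] Qc[OF p ev_in[OF u p]] order_refl])
  have aD: "a w \<in> ?D" if w: "w \<in> carrier W" for w
    unfolding dominated_functions_def
    using mi[OF w x] AE_I2[of N "\<lambda>p. \<bar>a w p\<bar> \<le> m w x p"] am[OF _ w] by blast
  have bD: "b u \<in> ?D" if u: "u \<in> carrier W" for u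
    unfolding dominated_functions_def
    using mi[OF u y] AE_I2[of N "\<lambda>p. \<bar>b u p\<bar> \<le> m u y p"] bm[OF _ u] by blast
  \<comment> \<open>The operator is moved to \<open>y\<close> by its adjoint, so that Q x is paired
    only with values of a vector of the direct integral.\<close>
  have swap: "AE p in N. Re (ip (K p) (S' p (Q p (ev x p))) (ev y p)) = a (adjoint_op W (carrier W) R y) p"
    if R: "R \<in> bounded_ops W (carrier W)" and d: "decomposes R S'"
      and S': "\<And>p. p \<in> space N \<Longrightarrow> S' p \<in> bounded_ops (K p) (carrier (K p))" for R S'
  proof -
    have "decomposes (adjoint_op W (carrier W) R) (\<lambda>p. adjoint_op (K p) (carrier (K p)) (S' p))"
      by (rule decomposes_adjoint[OF R S' d])
    from AE_space decomposesD[OF this y] show ?thesis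
  proof eventually_elim
    case (elim p)
    interpret Kp: hilbert "K p" by (rule fibre_hilbert[OF elim(1)])
    have Qx: "Q p (ev x p) \<in> carrier (K p)" by (rule Qin[OF elim(1) ev_in[OF x elim(1)]])
    have Sy: "adjoint_op (K p) (carrier (K p)) (S' p) (ev y p) \<in> carrier (K p)"
      by (rule bounded_opsD(2)[OF Kp.adjoint_bounded(1)[OF S'[OF elim(1)]] ev_in[OF y elim(1)]])
    have "ip (K p) (S' p (Q p (ev x p))) (ev y p) = ip (K p) (Q p (ev x p)) (adjoint_op (K p) (carrier (K p)) (S' p) (ev y p))"
      by (rule Kp.adjoint_bounded(2)[OF S'[OF elim(1)] Qx ev_in[OF y elim(1)]])
    then show ?case using elim(2) Kp.ip_commute[OF Qx Sy] by (simp add: a_def)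
  qed
  qed
  let ?Ty = "adjoint_op W (carrier W) T y"
  have Ty: "?Ty \<in> carrier W" by (rule bounded_opsD(2)[OF W.adjoint_bounded(1)[OF T] y])
  have h_eq: "AE p in N. h p = b (T x) p + - 1 * a ?Ty p"
  proof -
    have "AE p in N. Re (ip (K p) (S p (Q p (ev x p))) (ev y p)) = a ?Ty p" by (rule swap[OF T TS])
    with decomposesD[OF TS(1) x] show ?thesis unfolding h by eventually_elim (simp add: b_def)
  qed
  have abD: "(\<lambda>p. b (T x) p + - 1 * a ?Ty p) \<in> ?D"
    by (rule D.W_add[OF bD[OF Tin[OF x]] D.W_scale[OF aD[OF Ty]]])
  have hD: "h \<in> ?D"
  proof -
    obtain g where "integrable N g" "AE p in N. \<bar>b (T x) p + - 1 * a ?Ty p\<bar> \<le> g p"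
      using abD by (auto simp: dominated_functions_def)
    moreover from this(2) h_eq have "AE p in N. \<bar>h p\<bar> \<le> g p" by eventually_elim simp
    ultimately show ?thesis by (auto simp: dominated_functions_def)
  qed
  obtain I where I:
    "(\<forall>f\<in>?D. \<forall>g\<in>?D. I (\<lambda>x. f x + g x) = I f + I g) \<and>
     (\<forall>f\<in>?D. \<forall>c. I (\<lambda>x. c * f x) = c * I f) \<and>
     (\<forall>k\<in>?D. \<forall>g. integrable N g \<longrightarrow> (AE x in N. k x \<le> g x) \<longrightarrow> I k \<le> (LINT x|N. g x)) \<and>
     (\<forall>\<epsilon>>0. \<exists>g. integrable N g \<and> (AE x in N. h x \<le> g x) \<and> (LINT x|N. g x) < I h + \<epsilon>)"
    using upper_integral_functional[OF hD] by (rule exE)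
  have I_add: "I (\<lambda>x. f x + g x) = I f + I g" if "f \<in> ?D" "g \<in> ?D" for f g using I that by simp
  have I_scale: "I (\<lambda>x. c * f x) = c * I f" if "f \<in> ?D" for c f using I that by simp
  have I_le: "I k \<le> (LINT x|N. g x)" if "k \<in> ?D" "integrable N g" "AE x in N. k x \<le> g x" for k g
    using I that by simp
  have I_h: "\<exists>g. integrable N g \<and> (AE x in N. h x \<le> g x) \<and> (LINT x|N. g x) < I h + \<epsilon>" if "\<epsilon> > 0" for \<epsilon>
    using I that by simp
  \<comment> \<open>\<open>I\<close> is bounded by integrals of majorants from one side only;
    applied to a difference this compares two dominated functions up to an integral.\<close>
  have I_mono: "I k \<le> I k' + (LINT p|N. g p)"
    if k: "k \<in> ?D" and k': "k' \<in> ?D" and g: "integrable N g" "AE p in N. k p \<le> k' p + g p" for k k' g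
  proof -
    have "I (\<lambda>p. k p + - 1 * k' p) \<le> (LINT p|N. g p)"
    proof (rule I_le[OF D.W_add[OF k D.W_scale[OF k']] g(1)])
      show "AE p in N. k p + - 1 * k' p \<le> g p" using g(2) by eventually_elim simp
    qed
    then show ?thesis using I_add[OF k D.W_scale[OF k'], of "- 1"] I_scale[OF k', of "- 1"] by simp
  qed
  have I_cong: "I k = I k'" if k: "k \<in> ?D" and k': "k' \<in> ?D" and eq: "AE p in N. k p = k' p" for k k'
  proof (rule antisym)
    have "AE p in N. k p \<le> k' p + 0" "AE p in N. k' p \<le> k p + 0"
      using eq by (eventually_elim, simp)+
    then show "I k \<le> I k'" "I k' \<le> I k"
      using I_mono[OF k k', of "\<lambda>p. 0"] I_mono[OF k' k, of "\<lambda>p. 0"] by simp_all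
  qed
  define P where "P = (\<lambda>w. (w, I (a w))) ` carrier W"
  have "\<exists>z\<in>carrier W. (\<forall>w s. (w, s) \<in> P \<longrightarrow> s = Re (ip W w z)) \<and>
    (\<forall>\<epsilon>>0. \<exists>w s. (w, s) \<in> P \<and> ip_norm W (vsub W w z) < \<epsilon>)"
  proof (rule W.riesz_rational)
    show "w \<in> carrier W" if "(w, s) \<in> P" for w s using that by (auto simp: P_def)
    show "P \<noteq> {}" using x by (auto simp: P_def)
    show "(u \<oplus>\<^bsub>W\<^esub> w, s + t) \<in> P" if "(u, s) \<in> P" "(w, t) \<in> P" for u s w t
    proof -
      have u: "u \<in> carrier W" "s = I (a u)" and w: "w \<in> carrier W" "t = I (a w)" using that by (auto simp: P_def)
      have "AE p in N. a (u \<oplus>\<^bsub>W\<^esub> w) p = a u p + a w p"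
        using AE_space ev_add[OF u(1) w(1)]
      proof eventually_elim
        case (elim p)
        interpret Kp: hilbert "K p" by (rule fibre_hilbert[OF elim(1)])
        show ?case using elim ev_in[OF u(1) elim(1)] ev_in[OF w(1) elim(1)] Qin[OF elim(1) ev_in[OF x elim(1)]]
          by (simp add: a_def Kp.ip_add_left)
      qed
      then have "I (a (u \<oplus>\<^bsub>W\<^esub> w)) = I (\<lambda>p. a u p + a w p)"
        by (rule I_cong[OF aD[OF W.add_in[OF u(1) w(1)]] D.W_add[OF aD[OF u(1)] aD[OF w(1)]]])
      also have "\<dots> = s + t" using I_add[OF aD[OF u(1)] aD[OF w(1)]] u(2) w(2) by simp
      finally show ?thesis using W.add_in[OF u(1) w(1)] by (auto simp: P_def)
    qed
    show "(of_real (of_rat q) \<odot>\<^bsub>W\<^esub> w, of_rat q * s) \<in> P" if "(w, s) \<in> P" for w s q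
    proof -
      have w: "w \<in> carrier W" "s = I (a w)" using that by (auto simp: P_def)
      let ?c = "of_rat q :: real"
      have "AE p in N. a (of_real ?c \<odot>\<^bsub>W\<^esub> w) p = ?c * a w p"
        using AE_space ev_smult[OF w(1), of "of_real ?c"]
      proof eventually_elim
        case (elim p)
        interpret Kp: hilbert "K p" by (rule fibre_hilbert[OF elim(1)])
        show ?case using elim ev_in[OF w(1) elim(1)] Qin[OF elim(1) ev_in[OF x elim(1)]]
          by (simp add: a_def Kp.ip_smult_left)
      qed
      then have "I (a (of_real ?c \<odot>\<^bsub>W\<^esub> w)) = I (\<lambda>p. ?c * a w p)"
        by (rule I_cong[OF aD[OF W.smult_in[OF w(1)]] D.W_scale[OF aD[OF w(1)]]])
      also have "\<dots> = ?c * s" using I_scale[OF aD[OF w(1)]] w(2) by simp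
      finally show ?thesis using W.smult_in[OF w(1)] by (auto simp: P_def)
    qed
    show "2 * s \<le> (ip_norm W w)\<^sup>2 + (ip_norm W x)\<^sup>2" if "(w, s) \<in> P" for w s
    proof -
      have w: "w \<in> carrier W" "s = I (a w)" using that by (auto simp: P_def)
      have "AE p in N. a w p \<le> m w x p" using AE_space by eventually_elim (use am[OF _ w(1)] in force)
      then show ?thesis using I_le[OF aD[OF w(1)] mi[OF w(1) x]] mI[OF w(1) x] w(2) by simp
    qed
  qed
  then obtain z where z: "z \<in> carrier W" and zP: "\<forall>w s. (w, s) \<in> P \<longrightarrow> s = Re (ip W w z)" by auto
  have Ia: "I (a w) = Re (ip W w z)" if "w \<in> carrier W" for w using zP that by (auto simp: P_def)
  have "I h \<le> 0"
  proof (rule ccontr)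
    assume "\<not> I h \<le> 0"
    then have Ih: "I h > 0" by simp
    define Y where "Y = ip_norm W y"
    have Y: "Y \<ge> 0" using y by (simp add: Y_def)
    \<comment> \<open>Chosen so that the final estimate \<delta> (1 + Y)^2 / 2 equals half of I
      h.\<close>
    define \<delta> where "\<delta> = I h / (1 + Y)\<^sup>2"
    have d: "\<delta> > 0" unfolding \<delta>_def using Ih Y by (intro divide_pos_pos) auto
    have "\<exists>R\<in>\<A>. \<forall>u\<in>{x, z}. ip_norm W (vsub W (T u) (R u)) < \<delta>"
      by (rule sot_limitD[OF l]) (use x z d in auto)
    then obtain R where R: "R \<in> \<A>" "ip_norm W (vsub W (T x) (R x)) < \<delta>" "ip_norm W (vsub W (T z) (R z)) < \<delta>" by auto
    from \<A>[OF R(1)] obtain S' where RB: "R \<in> bounded_ops W (carrier W)" and dS: "decomposes R S'"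
      and S'0: "\<forall>p\<in>space N. S' p \<in> bounded_ops (K p) (carrier (K p)) \<and>
         (\<forall>v\<in>carrier (K p). S' p (Q p v) = Q p (S' p v))" by auto
    have S'B: "S' p \<in> bounded_ops (K p) (carrier (K p))" if "p \<in> space N" for p using S'0 that by simp
    have S'Q: "S' p (Q p v) = Q p (S' p v)" if "p \<in> space N" "v \<in> carrier (K p)" for p v
      using S'0 that by simp
    note Rin = bounded_opsD(2)[OF RB]
    let ?Ry = "adjoint_op W (carrier W) R y"
    have Ry: "?Ry \<in> carrier W" by (rule bounded_opsD(2)[OF W.adjoint_bounded(1)[OF RB] y])
    have sw: "AE p in N. Re (ip (K p) (S' p (Q p (ev x p))) (ev y p)) = a ?Ry p" by (rule swap[OF RB dS S'B])
    \<comment> \<open>Here commutation of the fibres of \<open>R\<close> with Q enters: it turns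
      \<open>b (R x)\<close> into a value of \<open>a\<close>, which the Riesz vector
      \<open>z\<close> evaluates.\<close>
    have "AE p in N. b (R x) p = a ?Ry p"
      using AE_space decomposesD[OF dS x] sw
    proof eventually_elim
      case (elim p)
      then show ?case using S'Q[OF elim(1) ev_in[OF x elim(1)]] by (simp add: b_def)
    qed
    then have bR: "I (b (R x)) = Re (ip W y (R z))"
      using I_cong[OF bD[OF Rin[OF x]] aD[OF Ry]] Ia[OF Ry] W.adjoint_left[OF RB y z] by simp
    have aT: "I (a ?Ty) = Re (ip W y (T z))" using Ia[OF Ty] W.adjoint_left[OF T y z] by simp
    have "I h = I (\<lambda>p. b (T x) p + - 1 * a ?Ty p)" by (rule I_cong[OF hD abD h_eq])
    then have Ih_eq: "I h = I (b (T x)) - I (a ?Ty)"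
      using I_add[OF bD[OF Tin[OF x]] D.W_scale[OF aD[OF Ty]], of "- 1"] I_scale[OF aD[OF Ty], of "- 1"] by simp
    \<comment> \<open>Scaling the two factors by 1/sqrt \<delta> and sqrt \<delta> balances the
      product bound: both squared norms become of order \<delta>.\<close>
    define s where "s = of_real (1 / sqrt \<delta>) \<odot>\<^bsub>W\<^esub> vsub W (T x) (R x)"
    define y' where "y' = of_real (sqrt \<delta>) \<odot>\<^bsub>W\<^esub> y"
    have v: "vsub W (T x) (R x) \<in> carrier W" using Tin[OF x] Rin[OF x] by simp
    have s: "s \<in> carrier W" and y': "y' \<in> carrier W" using v y by (auto simp: s_def y'_def)
    have "AE p in N. b (T x) p \<le> b (R x) p + m s y' p"
      using AE_space ev_vsub[OF Tin[OF x] Rin[OF x]] ev_smult[OF v, of "of_real (1 / sqrt \<delta>)"]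
        ev_smult[OF y, of "of_real (sqrt \<delta>)"]
    proof eventually_elim
      case (elim p)
      interpret Kp: hilbert "K p" by (rule fibre_hilbert[OF elim(1)])
      let ?d = "vsub (K p) (ev (T x) p) (ev (R x) p)"
      have in1: "ev (T x) p \<in> carrier (K p)" "ev (R x) p \<in> carrier (K p)" "ev y p \<in> carrier (K p)"
        using ev_in[OF _ elim(1)] Tin[OF x] Rin[OF x] y by auto
      then have dK: "?d \<in> carrier (K p)" by simp
      have "b (T x) p - b (R x) p = Re (ip (K p) (Q p ?d) (ev y p))"
        using bounded_ops_vsub[OF Q[OF elim(1)] in1(1,2)] in1 Qin[OF elim(1)] by (simp add: b_def Kp.ip_vsub_left)
      also have "\<dots> \<le> ip_norm (K p) (Q p ?d) * ip_norm (K p) (ev y p)"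
        using Kp.Re_ip_le[OF Qin[OF elim(1) dK] in1(3)] by simp
      also have "\<dots> \<le> ip_norm (K p) ?d * ip_norm (K p) (ev y p)"
        using Qc[OF elim(1) dK] Kp.norm_nonneg[OF in1(3)] by (rule mult_right_mono)
      also have "\<dots> = (1 / sqrt \<delta> * ip_norm (K p) ?d) * (sqrt \<delta> * ip_norm (K p) (ev y p))" using d by simp
      also have "\<dots> \<le> ((1 / sqrt \<delta> * ip_norm (K p) ?d)\<^sup>2 + (sqrt \<delta> * ip_norm (K p) (ev y p))\<^sup>2) / 2" by (rule pm)
      also have "\<dots> = m s y' p"
        using elim(2,3,4) dK in1(3) d by (simp add: m_def s_def y'_def Kp.norm_smult norm_divide)
      finally show ?case by simp
    qed
    then have "I (b (T x)) \<le> I (b (R x)) + (LINT p|N. m s y' p)"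
      by (rule I_mono[OF bD[OF Tin[OF x]] bD[OF Rin[OF x]] mi[OF s y']])
    moreover have "(LINT p|N. m s y' p) \<le> (\<delta> + \<delta> * Y\<^sup>2) / 2"
    proof -
      have "(ip_norm W s)\<^sup>2 = (ip_norm W (vsub W (T x) (R x)))\<^sup>2 / \<delta>"
        using v d by (simp add: s_def W.norm_smult norm_divide power_mult_distrib power_divide)
      also have "\<dots> \<le> \<delta>\<^sup>2 / \<delta>"
        using R(2) d W.norm_nonneg[OF v] by (intro divide_right_mono power_mono) auto
      also have "\<dots> = \<delta>" using d by (simp add: power2_eq_square)
      finally have "(ip_norm W s)\<^sup>2 \<le> \<delta>" .
      moreover have "(ip_norm W y')\<^sup>2 = \<delta> * Y\<^sup>2"
        using y d by (simp add: y'_def W.norm_smult power_mult_distrib Y_def)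
      ultimately show ?thesis using mI[OF s y'] by simp
    qed
    moreover have "Re (ip W y (R z)) - Re (ip W y (T z)) \<le> Y * \<delta>"
    proof -
      have "Re (ip W y (R z)) - Re (ip W y (T z)) = Re (ip W y (vsub W (R z) (T z)))"
        using y Rin[OF z] Tin[OF z] by (simp add: W.ip_vsub_right)
      also have "\<dots> \<le> Y * ip_norm W (vsub W (R z) (T z))"
        using W.Re_ip_le[of y "vsub W (R z) (T z)"] y Rin[OF z] Tin[OF z] by (simp add: Y_def)
      also have "\<dots> \<le> Y * \<delta>"
        using R(3) W.norm_vsub_commute[OF Tin[OF z] Rin[OF z]] Y by (intro mult_left_mono) auto
      finally show ?thesis .
    qed
    ultimately have "I h \<le> (\<delta> + \<delta> * Y\<^sup>2) / 2 + Y * \<delta>" using Ih_eq bR aT by linarith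
    also have "\<dots> = \<delta> * (1 + Y)\<^sup>2 / 2" by (simp add: power2_sum algebra_simps)
    also have "\<dots> = I h / 2" using Y by (simp add: \<delta>_def)
    finally show False using Ih by simp
  qed
  moreover obtain g where "integrable N g" "AE p in N. h p \<le> g p" "(LINT p|N. g p) < I h + \<epsilon>"
    using I_h[OF e] by auto
  ultimately show ?thesis by (intro exI[of _ g]) auto
qed

text \<open>The commutator is a complex function of unknown phase, whereas small majorants detect
  nonnegative real functions. Multiplying Q by a unimodular constant where the resulting real part
  is positive, and by 0 elsewhere, gives another contraction field with the same commutation
  property, and the real part of its commutator is that positive part.\<close>

lemma sot_limit_commutes:
  assumes T: "T \<in> bounded_ops W (carrier W)" and l: "sot_limit W (carrier W) \<A> T"
    and TS: "decomposes T S" "\<And>p. p \<in> space N \<Longrightarrow> S p \<in> bounded_ops (K p) (carrier (K p))"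
    and \<A>: "\<And>R. R \<in> \<A> \<Longrightarrow> R \<in> bounded_ops W (carrier W) \<and>
      (\<exists>S'. decomposes R S' \<and> (\<forall>p\<in>space N. S' p \<in> bounded_ops (K p) (carrier (K p)) \<and>
         (\<forall>v\<in>carrier (K p). S' p (Q p v) = Q p (S' p v))))"
    and Q: "\<And>p. p \<in> space N \<Longrightarrow> Q p \<in> bounded_ops (K p) (carrier (K p))"
    and Qc: "\<And>p v. p \<in> space N \<Longrightarrow> v \<in> carrier (K p) \<Longrightarrow> ip_norm (K p) (Q p v) \<le> ip_norm (K p) v"
  shows "AE p in N. \<forall>v\<in>carrier (K p). S p (Q p v) = Q p (S p v)"
proof -
  note Qin = bounded_opsD(2)[OF Q] and Sin = bounded_opsD(2)[OF TS(2)]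
  define k where "k = (\<lambda>x y p. ip (K p) (Q p (S p (ev x p))) (ev y p) - ip (K p) (S p (Q p (ev x p))) (ev y p))"
  have k_le: "AE p in N. Re (\<sigma> * k x y p) \<le> 0" if x: "x \<in> carrier W" and y: "y \<in> carrier W" and s: "cmod \<sigma> = 1" for x y \<sigma>
  proof -
    \<comment> \<open>This choice may be nonmeasurable, which is admissible because the preceding
      lemma allows arbitrary contraction fields.\<close>
    define c where "c = (\<lambda>p. if Re (\<sigma> * k x y p) > 0 then \<sigma> else 0)"
    define Q' where "Q' = (\<lambda>p. \<lambda>v\<in>carrier (K p). c p \<odot>\<^bsub>K p\<^esub> Q p v)"
    have Q'B: "Q' p \<in> bounded_ops (K p) (carrier (K p))" if p: "p \<in> space N" for p
      unfolding Q'_def by (rule hilbert.bounded_ops_smult[OF fibre_hilbert[OF p] Q[OF p]])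
    have Q'c: "ip_norm (K p) (Q' p v) \<le> ip_norm (K p) v" if p: "p \<in> space N" and v: "v \<in> carrier (K p)" for p v
    proof -
      interpret Kp: hilbert "K p" by (rule fibre_hilbert[OF p])
      show ?thesis using Qc[OF p v] Qin[OF p v] v s by (simp add: Q'_def c_def Kp.norm_smult)
    qed
    have \<A>': "R \<in> bounded_ops W (carrier W) \<and>
      (\<exists>S'. decomposes R S' \<and> (\<forall>p\<in>space N. S' p \<in> bounded_ops (K p) (carrier (K p)) \<and>
         (\<forall>v\<in>carrier (K p). S' p (Q' p v) = Q' p (S' p v))))" if "R \<in> \<A>" for R
    proof -
      from \<A>[OF that] obtain S' where RB: "R \<in> bounded_ops W (carrier W)" and dS: "decomposes R S'"
        and S'0: "\<forall>p\<in>space N. S' p \<in> bounded_ops (K p) (carrier (K p)) \<and>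
           (\<forall>v\<in>carrier (K p). S' p (Q p v) = Q p (S' p v))" by auto
      have S'1: "S' p (Q' p v) = Q' p (S' p v)" if p: "p \<in> space N" and v: "v \<in> carrier (K p)" for p v
      proof -
        have S'p: "S' p \<in> bounded_ops (K p) (carrier (K p))" "S' p (Q p v) = Q p (S' p v)" using S'0 p v by auto
        show ?thesis using bounded_opsD(2)[OF S'p(1) v] bounded_opsD(5)[OF S'p(1) Qin[OF p v]] S'p(2) v
          by (simp add: Q'_def)
      qed
      show ?thesis by (intro conjI RB exI[of _ S'] dS ballI S'1) (use S'0 in auto)
    qed
    define h where "h = (\<lambda>p. Re (ip (K p) (Q' p (S p (ev x p))) (ev y p)) - Re (ip (K p) (S p (Q' p (ev x p))) (ev y p)))"
    have hk: "h p = (if Re (\<sigma> * k x y p) > 0 then Re (\<sigma> * k x y p) else 0)" if p: "p \<in> space N" for p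
    proof -
      interpret Kp: hilbert "K p" by (rule fibre_hilbert[OF p])
      have in1: "ev x p \<in> carrier (K p)" "ev y p \<in> carrier (K p)" using ev_in[OF x p] ev_in[OF y p] .
      note in2 = Sin[OF p in1(1)] Qin[OF p in1(1)]
      note in3 = Qin[OF p in2(1)] Sin[OF p in2(2)]
      have "h p = Re (c p * k x y p)"
        using in1 in2 in3 bounded_opsD(5)[OF TS(2)[OF p] in2(2)]
        by (simp add: h_def k_def Q'_def Kp.ip_smult_left algebra_simps)
      then show ?thesis by (simp add: c_def)
    qed
    have "AE p in N. h p = 0"
    proof (rule AE_eq_0_of_small_majorants)
      show "AE p in N. h p \<ge> 0" using AE_space by eventually_elim (simp add: hk)
      show "\<exists>g. integrable N g \<and> (AE p in N. h p \<le> g p) \<and> (LINT p|N. g p) < \<epsilon>" if e: "\<epsilon> > 0" for \<epsilon>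
        by (rule sot_limit_commutator_small[OF T l TS \<A>' Q'B Q'c x y h_def e])
    qed
    with AE_space show ?thesis
    proof eventually_elim
      case (elim p)
      then show ?case using hk[of p] by (cases "Re (\<sigma> * k x y p) > 0") auto
    qed
  qed
  have k0: "AE p in N. k x y p = 0" if x: "x \<in> carrier W" and y: "y \<in> carrier W" for x y
  proof -
    \<comment> \<open>Four phases bound the real and the imaginary part from both sides.\<close>
    have "AE p in N. Re (1 * k x y p) \<le> 0" "AE p in N. Re (-1 * k x y p) \<le> 0"
      "AE p in N. Re (\<i> * k x y p) \<le> 0" "AE p in N. Re (-\<i> * k x y p) \<le> 0"
      by (rule k_le[OF x y], simp)+
    then show ?thesis
    proof eventually_elim
      case (elim p)
      then show ?case by (simp add: complex_eq_iff)
    qed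
  qed
  \<comment> \<open>Countably many pairs of the dense sequence share one null set; totality then
    extends the identity to the whole fibre.\<close>
  have "AE p in N. \<forall>n m. k (dense_seq n) (dense_seq m) p = 0"
    by (simp add: AE_all_countable k0 dense_seq_in)
  with AE_space AE_total show ?thesis
  proof eventually_elim
    case (elim p)
    interpret Kp: hilbert "K p" by (rule fibre_hilbert[OF elim(1)])
    note Qp = Q[OF elim(1)] and Sp = TS(2)[OF elim(1)]
    have xp: "ev (dense_seq n) p \<in> carrier (K p)" for n by (rule ev_in[OF dense_seq_in elim(1)])
    have eq: "compose (carrier (K p)) (S p) (Q p) (ev (dense_seq n) p) = compose (carrier (K p)) (Q p) (S p) (ev (dense_seq n) p)" for n
    proof (rule Kp.total_eqI[OF elim(2)])
      show "compose (carrier (K p)) (S p) (Q p) (ev (dense_seq n) p) \<in> carrier (K p)"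
        "compose (carrier (K p)) (Q p) (S p) (ev (dense_seq n) p) \<in> carrier (K p)"
        using xp bounded_opsD(2)[OF Qp] bounded_opsD(2)[OF Sp] by (auto simp: compose_def)
      show "ip (K p) (compose (carrier (K p)) (S p) (Q p) (ev (dense_seq n) p)) (ev (dense_seq m) p) =
        ip (K p) (compose (carrier (K p)) (Q p) (S p) (ev (dense_seq n) p)) (ev (dense_seq m) p)" for m
        using elim(3) xp by (simp add: compose_def k_def)
    qed
    show ?case
    proof
      fix v assume v: "v \<in> carrier (K p)"
      have "compose (carrier (K p)) (S p) (Q p) v = compose (carrier (K p)) (Q p) (S p) v"
        by (rule Kp.bounded_ops_eq_on_total[OF elim(2) Kp.bounded_ops_compose[OF Sp Qp] Kp.bounded_ops_compose[OF Qp Sp] eq v])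
      then show "S p (Q p v) = Q p (S p v)" using v by (simp add: compose_def)
    qed
  qed
qed

text \<open>If the limit operator failed to commute with some member of \<open>\<Q> p\<close> for many \<open>p\<close>, then choosing
  such a member at each \<open>p\<close> would give a field to which \<open>sot_limit_commutes\<close> applies.\<close>

theorem decomposable_over_commutant_closed:
  assumes \<Q>: "\<And>p. p \<in> space N \<Longrightarrow> selfadjoint_contractions (K p) (\<Q> p)"
    and T: "T \<in> bounded_ops W (carrier W)"
    and l: "sot_limit W (carrier W) (decomposable_over (\<lambda>p. commutant_ops (K p) (\<Q> p))) T"
  shows "T \<in> decomposable_over (\<lambda>p. commutant_ops (K p) (\<Q> p))"
proof -
  let ?A = "\<lambda>p. commutant_ops (K p) (\<Q> p)"
  obtain C where C: "C \<ge> 0" "\<And>x. x \<in> carrier W \<Longrightarrow> ip_norm W (T x) \<le> C * ip_norm W x"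
    using W.bounded_ops_bound[OF T subset_refl] by blast
  have AB: "?A p \<subseteq> bounded_ops (K p) (carrier (K p))" for p by (auto simp: commutant_ops_def)
  have "\<exists>S. decomposes T S \<and> (\<forall>p\<in>space N. S p \<in> bounded_ops (K p) (carrier (K p)))"
    by (rule decomposes_of_pointwise_bound[OF T C(1)]) (rule sot_limit_pointwise_bound[OF T l AB C])
  then obtain S where dS: "decomposes T S" and S: "\<forall>p\<in>space N. S p \<in> bounded_ops (K p) (carrier (K p))" by auto
  let ?bad = "\<lambda>p q. q \<in> \<Q> p \<and> \<not> (\<forall>v\<in>carrier (K p). S p (q v) = q (S p v))"
  define Q where "Q = (\<lambda>p. if \<exists>q. ?bad p q then SOME q. ?bad p q else (\<lambda>v\<in>carrier (K p). v))"
  have Q1: "?bad p (Q p)" if "\<exists>q. ?bad p q" for p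
    using someI_ex[OF that] unfolding Q_def if_P[OF that] .
  have Q2: "Q p = (\<lambda>v\<in>carrier (K p). v)" if "\<not> (\<exists>q. ?bad p q)" for p
    unfolding Q_def by (rule if_not_P[OF that])
  have Q3: "Q p \<in> \<Q> p \<or> Q p = (\<lambda>v\<in>carrier (K p). v)" for p
    using Q1[of p] Q2[of p] by blast
  have QB: "Q p \<in> bounded_ops (K p) (carrier (K p))"
    and Qc: "v \<in> carrier (K p) \<Longrightarrow> ip_norm (K p) (Q p v) \<le> ip_norm (K p) v" if p: "p \<in> space N" for p v
    using Q3[of p] \<Q>[OF p] hilbert.bounded_ops_id[OF fibre_hilbert[OF p]]
    by (auto simp: selfadjoint_contractions_def)
  have "AE p in N. \<forall>v\<in>carrier (K p). S p (Q p v) = Q p (S p v)"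
  proof (rule sot_limit_commutes[OF T l dS _ _ QB Qc])
    show "S p \<in> bounded_ops (K p) (carrier (K p))" if "p \<in> space N" for p using S that by simp
    fix R assume "R \<in> decomposable_over ?A"
    then obtain S' where RB: "R \<in> bounded_ops W (carrier W)" and dR: "decomposes R S'"
      and S': "\<forall>p\<in>space N. S' p \<in> ?A p" by (auto simp: decomposable_over_def)
    have "S' p \<in> bounded_ops (K p) (carrier (K p)) \<and> (\<forall>v\<in>carrier (K p). S' p (Q p v) = Q p (S' p v))"
      if p: "p \<in> space N" for p
    proof -
      have A: "S' p \<in> bounded_ops (K p) (carrier (K p))"
        "\<And>q v. q \<in> \<Q> p \<Longrightarrow> v \<in> carrier (K p) \<Longrightarrow> S' p (q v) = q (S' p v)"
        using S' p by (auto simp: commutant_ops_def)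
      show ?thesis using Q3[of p] A(1) A(2)[of "Q p"] bounded_opsD(2)[OF A(1)] by auto
    qed
    then show "R \<in> bounded_ops W (carrier W) \<and>
      (\<exists>S'. decomposes R S' \<and> (\<forall>p\<in>space N. S' p \<in> bounded_ops (K p) (carrier (K p)) \<and>
         (\<forall>v\<in>carrier (K p). S' p (Q p v) = Q p (S' p v))))"
      using RB dR by (intro conjI exI[of _ S']) auto
  qed
  then have good: "AE p in N. S p \<in> ?A p"
    using AE_space
  proof eventually_elim
    case (elim p)
    have "\<not> (\<exists>q. ?bad p q)" using elim(1) Q1[of p] by blast
    then show ?case using S elim(2) by (auto simp: commutant_ops_def)
  qed
  \<comment> \<open>Membership is demanded at every point, so on the null set the fibre is replaced
    by the identity, which commutes with everything.\<close>
  define S2 where "S2 = (\<lambda>p. if S p \<in> ?A p then S p else (\<lambda>v\<in>carrier (K p). v))"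
  show ?thesis
  proof (rule decomposable_overI[OF T])
    show "decomposes T S2" unfolding decomposes_def
    proof
      fix x assume "x \<in> carrier W"
      from decomposesD[OF dS this] good show "AE p in N. ev (T x) p = S2 p (ev x p)"
        by eventually_elim (simp add: S2_def)
    qed
    show "S2 p \<in> ?A p" if p: "p \<in> space N" for p
      using unital_star_subalgebraD(2)[OF hilbert.commutant_star_subalgebra[OF fibre_hilbert[OF p] \<Q>[OF p]]]
      by (simp add: S2_def)
  qed
qed

end

section \<open>Uniqueness of fibres and unions of levels\<close>

lemma unital_star_subalgebra_carrier_update [simp]:
  "unital_star_subalgebra (V\<lparr>carrier := S\<rparr>) = unital_star_subalgebra V"
  by (simp add: unital_star_subalgebra_def fun_eq_iff)

text \<open>Both fields agree along the dense sequence outside a null set, and almost everywhere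
  that sequence is total in the fibre.\<close>

lemma (in direct_integral) decomposes_unique:
  assumes S: "\<And>p. p \<in> space N \<Longrightarrow> S p \<in> bounded_ops (K p) (carrier (K p))"
    and S': "\<And>p. p \<in> space N \<Longrightarrow> S' p \<in> bounded_ops (K p) (carrier (K p))"
    and d: "decomposes T S" and d': "decomposes T S'"
  shows "AE p in N. \<forall>v\<in>carrier (K p). S p v = S' p v"
proof -
  have "AE p in N. \<forall>n. S p (ev (dense_seq n) p) = S' p (ev (dense_seq n) p)"
  proof (simp add: AE_all_countable, rule allI)
    fix n
    show "AE p in N. S p (ev (dense_seq n) p) = S' p (ev (dense_seq n) p)"
      using decomposesD[OF d dense_seq_in[of n]] decomposesD[OF d' dense_seq_in[of n]] by eventually_elim simp
  qed
  with AE_space AE_total show ?thesis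
  proof eventually_elim
    case (elim p)
    interpret Kp: hilbert "K p" by (rule fibre_hilbert[OF elim(1)])
    show ?case using Kp.bounded_ops_eq_on_total[OF elim(2) S[OF elim(1)] S'[OF elim(1)]] elim(3) by simp
  qed
qed

text \<open>Each axiom involves at most three vectors, and these lie in a common level. In this way
  the quotient by null functions is seen to be an inner product space without computing with
  classes.\<close>

lemma inner_product_space_directed_union:
  fixes F :: "'i::order \<Rightarrow> 'a set"
  assumes d: "\<forall>\<alpha> \<beta>::'i. \<exists>\<gamma>. \<alpha> \<le> \<gamma> \<and> \<beta> \<le> \<gamma>" and m: "mono F"
    and F: "\<And>\<alpha>. inner_product_space (V\<lparr>carrier := F \<alpha>\<rparr>)" and V: "carrier V = dom_of F"
  shows "inner_product_space V"
proof -
  note Fm = inner_product_space.axioms(1)[OF F]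
  have common: "\<exists>\<gamma>. x \<in> F \<gamma> \<and> y \<in> F \<gamma> \<and> z \<in> F \<gamma>"
    if xyz: "x \<in> carrier V" "y \<in> carrier V" "z \<in> carrier V" for x y z
  proof -
    obtain a b c where "x \<in> F a" "y \<in> F b" "z \<in> F c" using xyz V by auto
    moreover obtain e where "a \<le> e" "b \<le> e" using d by blast
    moreover obtain g where "e \<le> g" "c \<le> g" using d by blast
    ultimately show ?thesis using monoD[OF m] by (meson order_trans subsetD)
  qed
  note ips = inner_product_space.add_in[OF F] inner_product_space.smult_in[OF F] inner_product_space.zero_in[OF F]
  have sub: "x \<in> F \<gamma> \<Longrightarrow> x \<in> carrier V" for x \<gamma> using V by auto
  have ab: "abelian_group V"
  proof (rule abelian_groupI)
    fix x y z assume xyz: "x \<in> carrier V" "y \<in> carrier V" "z \<in> carrier V"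
    then obtain \<gamma> where g: "x \<in> F \<gamma>" "y \<in> F \<gamma>" "z \<in> F \<gamma>" using common by blast
    interpret G: inner_product_space "V\<lparr>carrier := F \<gamma>\<rparr>" by (rule F)
    show "x \<oplus>\<^bsub>V\<^esub> y \<oplus>\<^bsub>V\<^esub> z = x \<oplus>\<^bsub>V\<^esub> (y \<oplus>\<^bsub>V\<^esub> z)" using G.M.a_assoc[of x y z] g by simp
  next
    fix x y assume xy: "x \<in> carrier V" "y \<in> carrier V"
    then obtain \<gamma> where g: "x \<in> F \<gamma>" "y \<in> F \<gamma>" using common by blast
    interpret G: inner_product_space "V\<lparr>carrier := F \<gamma>\<rparr>" by (rule F)
    show "x \<oplus>\<^bsub>V\<^esub> y \<in> carrier V" using G.add_in[of x y] g sub by simp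
    show "x \<oplus>\<^bsub>V\<^esub> y = y \<oplus>\<^bsub>V\<^esub> x" using G.M.a_comm[of x y] g by simp
  next
    interpret G: inner_product_space "V\<lparr>carrier := F undefined\<rparr>" by (rule F)
    show "\<zero>\<^bsub>V\<^esub> \<in> carrier V" using G.zero_in sub by simp
  next
    fix x assume x: "x \<in> carrier V"
    then obtain \<gamma> where g: "x \<in> F \<gamma>" using V by auto
    interpret G: inner_product_space "V\<lparr>carrier := F \<gamma>\<rparr>" by (rule F)
    show "\<zero>\<^bsub>V\<^esub> \<oplus>\<^bsub>V\<^esub> x = x" using G.M.l_zero[of x] g by simp
    have "(-1) \<odot>\<^bsub>V\<^esub> x \<in> F \<gamma>" using G.smult_in[of x] g by simp
    moreover have "(-1) \<odot>\<^bsub>V\<^esub> x \<oplus>\<^bsub>V\<^esub> x = \<zero>\<^bsub>V\<^esub>"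
    proof -
      have "(-1) \<odot>\<^bsub>V\<lparr>carrier := F \<gamma>\<rparr>\<^esub> x \<oplus>\<^bsub>V\<lparr>carrier := F \<gamma>\<rparr>\<^esub> x = \<zero>\<^bsub>V\<lparr>carrier := F \<gamma>\<rparr>\<^esub>"
      proof (rule G.vec_eqI)
        fix z assume "z \<in> carrier (V\<lparr>carrier := F \<gamma>\<rparr>)"
        then show "ip (V\<lparr>carrier := F \<gamma>\<rparr>) ((-1) \<odot>\<^bsub>V\<lparr>carrier := F \<gamma>\<rparr>\<^esub> x \<oplus>\<^bsub>V\<lparr>carrier := F \<gamma>\<rparr>\<^esub> x) z
          = ip (V\<lparr>carrier := F \<gamma>\<rparr>) \<zero>\<^bsub>V\<lparr>carrier := F \<gamma>\<rparr>\<^esub> z"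
          using G.ip_add_left[of "(-1) \<odot>\<^bsub>V\<^esub> x" x z] G.ip_smult_left[of x z "-1"] G.ip_zero_left[of z]
            G.smult_in[of x "-1"] g by simp
      qed (use G.add_in G.smult_in G.zero_in g in simp_all)
      then show ?thesis by simp
    qed
    ultimately show "\<exists>y\<in>carrier V. y \<oplus>\<^bsub>V\<^esub> x = \<zero>\<^bsub>V\<^esub>" using sub by blast
  qed
  have cr: "cring complex_ring" using Fm[of undefined] by (simp add: module_def)
  have "module complex_ring V"
  proof (rule moduleI[OF cr ab])
    fix a b x assume x: "x \<in> carrier V" and ab': "a \<in> carrier complex_ring" "b \<in> carrier complex_ring"
    then obtain \<gamma> where g: "x \<in> F \<gamma>" using V by auto
    interpret G: inner_product_space "V\<lparr>carrier := F \<gamma>\<rparr>" by (rule F)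
    show "(a \<oplus>\<^bsub>complex_ring\<^esub> b) \<odot>\<^bsub>V\<^esub> x = a \<odot>\<^bsub>V\<^esub> x \<oplus>\<^bsub>V\<^esub> b \<odot>\<^bsub>V\<^esub> x"
      using G.smult_l_distr[of a b x] ab' g by simp
    show "(a \<otimes>\<^bsub>complex_ring\<^esub> b) \<odot>\<^bsub>V\<^esub> x = a \<odot>\<^bsub>V\<^esub> (b \<odot>\<^bsub>V\<^esub> x)"
      using G.smult_assoc1[of a b x] ab' g by simp
  next
    fix a x assume x: "x \<in> carrier V"
    then obtain \<gamma> where g: "x \<in> F \<gamma>" using V by auto
    interpret G: inner_product_space "V\<lparr>carrier := F \<gamma>\<rparr>" by (rule F)
    show "a \<odot>\<^bsub>V\<^esub> x \<in> carrier V" using G.smult_in[of x a] g sub by simp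
    show "\<one>\<^bsub>complex_ring\<^esub> \<odot>\<^bsub>V\<^esub> x = x" using G.smult_one[of x] g by simp
  next
    fix a x y assume xy: "x \<in> carrier V" "y \<in> carrier V" and a: "a \<in> carrier complex_ring"
    then obtain \<gamma> where g: "x \<in> F \<gamma>" "y \<in> F \<gamma>" using common by blast
    interpret G: inner_product_space "V\<lparr>carrier := F \<gamma>\<rparr>" by (rule F)
    show "a \<odot>\<^bsub>V\<^esub> (x \<oplus>\<^bsub>V\<^esub> y) = a \<odot>\<^bsub>V\<^esub> x \<oplus>\<^bsub>V\<^esub> a \<odot>\<^bsub>V\<^esub> y"
      using G.smult_r_distr[of a x y] a g by simp
  qed
  then show ?thesis
  proof (rule inner_product_space.intro, intro inner_product_space_axioms.intro)
    fix x y z assume "x \<in> carrier V" "y \<in> carrier V" "z \<in> carrier V"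
    then obtain \<gamma> where g: "x \<in> F \<gamma>" "y \<in> F \<gamma>" "z \<in> F \<gamma>" using common by blast
    interpret G: inner_product_space "V\<lparr>carrier := F \<gamma>\<rparr>" by (rule F)
    show "ip V (x \<oplus>\<^bsub>V\<^esub> y) z = ip V x z + ip V y z" using G.ip_add_left[of x y z] g by simp
  next
    fix x z and c assume "x \<in> carrier V" "z \<in> carrier V"
    then obtain \<gamma> where g: "x \<in> F \<gamma>" "z \<in> F \<gamma>" using common by blast
    interpret G: inner_product_space "V\<lparr>carrier := F \<gamma>\<rparr>" by (rule F)
    show "ip V (c \<odot>\<^bsub>V\<^esub> x) z = c * ip V x z" using G.ip_smult_left[of x z c] g by simp
  next
    fix x y assume "x \<in> carrier V" "y \<in> carrier V"
    then obtain \<gamma> where g: "x \<in> F \<gamma>" "y \<in> F \<gamma>" using common by blast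
    interpret G: inner_product_space "V\<lparr>carrier := F \<gamma>\<rparr>" by (rule F)
    show "ip V x y = cnj (ip V y x)" using G.ip_commute[of x y] g by simp
  next
    fix x assume "x \<in> carrier V" and n: "x \<noteq> \<zero>\<^bsub>V\<^esub>"
    then obtain \<gamma> where g: "x \<in> F \<gamma>" using V by auto
    interpret G: inner_product_space "V\<lparr>carrier := F \<gamma>\<rparr>" by (rule F)
    show "Re (ip V x x) > 0" using G.ip_pos[of x] g n by simp
  qed
qed

section \<open>Locally measure spaces\<close>

locale loc_measure_system =
  fixes M :: "'i::order \<Rightarrow> 'x measure"
  assumes directed: "\<forall>\<alpha> \<beta>::'i. \<exists>\<gamma>. \<alpha> \<le> \<gamma> \<and> \<beta> \<le> \<gamma>"
    and measure: "locally_measure_system M"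
    and alternative: "countable (UNIV :: 'i set) \<or> loc_measure M = count_space (loc_space M)"
begin

abbreviation \<mu> :: "'x measure" where "\<mu> \<equiv> loc_measure M"

lemmas \<mu>_space = emeasure_loc_measure(1)[OF directed measure]
  and \<mu>_sets = emeasure_loc_measure(2)[OF directed measure]
  and \<mu>_emeasure = emeasure_loc_measure(3)[OF directed measure]

lemma system_mono:
  assumes "\<alpha> \<le> \<beta>"
  shows "space (M \<alpha>) \<subseteq> space (M \<beta>)" "sets (M \<alpha>) = {E \<inter> space (M \<alpha>) |E. E \<in> sets (M \<beta>)}"
    "sets (M \<alpha>) \<subseteq> sets (M \<beta>)" "\<And>E. E \<in> sets (M \<alpha>) \<Longrightarrow> emeasure (M \<alpha>) E = emeasure (M \<beta>) E"
  using measure assms unfolding locally_measure_system_def by blast+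

lemma upper:
  fixes \<alpha> \<beta> :: 'i
  obtains \<gamma> where "\<alpha> \<le> \<gamma>" "\<beta> \<le> \<gamma>"
  using directed by blast

lemma complete_level: "complete_measure (M \<alpha>)"
proof -
  have "completed_borel_measure (M \<alpha>)" using measure by (simp add: locally_measure_system_def)
  then obtain N where "M \<alpha> = completion N" unfolding completed_borel_measure_def by blast
  then show ?thesis by (simp add: completion.complete_measure_axioms)
qed

lemma sets_level_loc: "A \<in> sets (M \<alpha>) \<Longrightarrow> A \<in> loc_sets M"
proof -
  assume A: "A \<in> sets (M \<alpha>)"
  have "A \<inter> space (M \<beta>) \<in> sets (M \<beta>)" for \<beta>
  proof -
    obtain \<gamma> where g: "\<alpha> \<le> \<gamma>" "\<beta> \<le> \<gamma>" by (rule upper)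
    then have "A \<in> sets (M \<gamma>)" using A system_mono(3) by blast
    then show ?thesis using system_mono(2)[OF g(2)] by blast
  qed
  then show ?thesis using sets.sets_into_space[OF A] by (auto simp: loc_sets_def loc_space_def)
qed

lemma space_level_sets: "space (M \<alpha>) \<in> sets \<mu>"
  using sets_level_loc[OF sets.top] by (simp add: \<mu>_sets)

text \<open>For a set inside the \<alpha>-th space the net that defines the limit measure is
  constant from \<alpha> on.\<close>

lemma level_restrict_space: "M \<alpha> = restrict_space \<mu> (space (M \<alpha>))"
proof (rule measure_eqI)
  have eq: "A \<in> sets (restrict_space \<mu> (space (M \<alpha>))) \<longleftrightarrow> A \<in> sets (M \<alpha>)" for A
  proof
    assume "A \<in> sets (restrict_space \<mu> (space (M \<alpha>)))"
    then obtain B where "B \<in> loc_sets M" "A = space (M \<alpha>) \<inter> B"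
      by (auto simp: sets_restrict_space \<mu>_sets)
    then show "A \<in> sets (M \<alpha>)" by (simp add: loc_sets_def Int_commute)
  next
    assume A: "A \<in> sets (M \<alpha>)"
    then have "A = space (M \<alpha>) \<inter> A" using sets.sets_into_space by blast
    then show "A \<in> sets (restrict_space \<mu> (space (M \<alpha>)))"
      using sets_level_loc[OF A] by (auto simp: sets_restrict_space \<mu>_sets)
  qed
  then show "sets (M \<alpha>) = sets (restrict_space \<mu> (space (M \<alpha>)))" by blast
  fix A assume A: "A \<in> sets (M \<alpha>)"
  have As: "A \<subseteq> space (M \<alpha>)" using sets.sets_into_space[OF A] .
  have Al: "A \<in> loc_sets M" by (rule sets_level_loc[OF A])
  have "emeasure \<mu> A = (SUP \<beta>. emeasure (M \<beta>) (A \<inter> space (M \<beta>)))"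
    using \<mu>_emeasure[OF Al] loc_emeasure_SUP(1)[OF directed measure Al] by simp
  also have "\<dots> = emeasure (M \<alpha>) A"
  proof (rule antisym)
    show "(SUP \<beta>. emeasure (M \<beta>) (A \<inter> space (M \<beta>))) \<le> emeasure (M \<alpha>) A"
    proof (rule SUP_least)
      fix \<beta>
      obtain \<gamma> where g: "\<alpha> \<le> \<gamma>" "\<beta> \<le> \<gamma>" by (rule upper)
      have "emeasure (M \<beta>) (A \<inter> space (M \<beta>)) \<le> emeasure (M \<gamma>) (A \<inter> space (M \<gamma>))"
        by (rule loc_emeasure_SUP(2)[OF directed measure Al g(2)])
      also have "A \<inter> space (M \<gamma>) = A" using As system_mono(1)[OF g(1)] by blast
      also have "emeasure (M \<gamma>) A = emeasure (M \<alpha>) A" using system_mono(4)[OF g(1) A] by simp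
      finally show "emeasure (M \<beta>) (A \<inter> space (M \<beta>)) \<le> emeasure (M \<alpha>) A" .
    qed
    have "A \<inter> space (M \<alpha>) = A" using As by blast
    then show "emeasure (M \<alpha>) A \<le> (SUP \<beta>. emeasure (M \<beta>) (A \<inter> space (M \<beta>)))"
      using SUP_upper[of \<alpha> UNIV "\<lambda>\<beta>. emeasure (M \<beta>) (A \<inter> space (M \<beta>))"] by simp
  qed
  finally have eqA: "emeasure \<mu> A = emeasure (M \<alpha>) A" .
  have "emeasure (restrict_space \<mu> (space (M \<alpha>))) A = emeasure \<mu> A"
    by (rule emeasure_restrict_space[OF _ As]) (use space_level_sets in auto)
  then show "emeasure (M \<alpha>) A = emeasure (restrict_space \<mu> (space (M \<alpha>))) A" using eqA by simp
qed

lemma AE_level_iff: "(AE p in M \<alpha>. P p) \<longleftrightarrow> (AE p in \<mu>. p \<in> space (M \<alpha>) \<longrightarrow> P p)"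
proof -
  have "(AE p in restrict_space \<mu> (space (M \<alpha>)). P p) \<longleftrightarrow> (AE p in \<mu>. p \<in> space (M \<alpha>) \<longrightarrow> P p)"
    by (rule AE_restrict_space_iff) (use space_level_sets in auto)
  then show ?thesis by (simp only: level_restrict_space[symmetric])
qed

lemma integrable_level_mono:
  fixes g :: "'x \<Rightarrow> complex"
  assumes ab: "\<alpha> \<le> \<beta>" and g: "integrable (M \<beta>) g"
  shows "integrable (M \<alpha>) g"
proof -
  have i: "integrable (M \<gamma>) g \<longleftrightarrow> integrable \<mu> (\<lambda>p. indicator (space (M \<gamma>)) p *\<^sub>R g p)" for \<gamma>
  proof -
    have "integrable (restrict_space \<mu> (space (M \<gamma>))) g \<longleftrightarrow> integrable \<mu> (\<lambda>p. indicator (space (M \<gamma>)) p *\<^sub>R g p)"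
      by (rule integrable_restrict_space) (use space_level_sets in auto)
    then show ?thesis by (simp only: level_restrict_space[symmetric])
  qed
  have "integrable \<mu> (\<lambda>p. indicator (space (M \<alpha>)) p *\<^sub>R (indicator (space (M \<beta>)) p *\<^sub>R g p))"
    using g unfolding i by (rule integrable_mult_indicator[OF space_level_sets])
  moreover have "(\<lambda>p. indicator (space (M \<alpha>)) p *\<^sub>R (indicator (space (M \<beta>)) p *\<^sub>R g p)) =
      (\<lambda>p. indicator (space (M \<alpha>)) p *\<^sub>R g p)"
    using system_mono(1)[OF ab] by (auto simp: fun_eq_iff indicator_def)
  ultimately show ?thesis unfolding i by simp
qed

text \<open>Both cases of \<open>alternative\<close> make a family of null sets indexed by the
  levels harmless: a countable union of null sets is null, and for the counting measure null sets
  are empty.\<close>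

lemma AE_all_levels:
  assumes "\<And>i::'i. AE p in \<mu>. P i p"
  shows "AE p in \<mu>. \<forall>i. P i p"
  using alternative
proof
  assume c: "countable (UNIV :: 'i set)"
  show ?thesis using AE_ball_countable[OF c, where M = \<mu> and P = "\<lambda>p i. P i p"] assms by simp
next
  assume cs: "\<mu> = count_space (loc_space M)"
  have "P i p" if "p \<in> loc_space M" for i p
  proof -
    have "AE p in count_space (loc_space M). P i p" using assms[of i] unfolding cs .
    then show ?thesis using that unfolding AE_count_space by blast
  qed
  then show ?thesis by (intro AE_I2) (simp add: \<mu>_space)
qed

end

section \<open>Locally direct integrals\<close>

locale loc_integral = loc_measure_system M for M :: "'i::order \<Rightarrow> 'x measure" +
  fixes K :: "'x \<Rightarrow> 'h ip_space" and E :: "'x \<Rightarrow> 'i \<Rightarrow> 'h set" and D :: "('x \<Rightarrow> 'h) set"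
  assumes fibres: "\<forall>p\<in>loc_space M. quantized_domain (K p) (E p)"
    and integral: "loc_direct_integral M K E D"
    and levels: "levels_are_direct_integrals M K E D"
begin

abbreviation V :: "('x \<Rightarrow> 'h) set ip_space" where "V \<equiv> integral_space M K D"
abbreviation L :: "'i \<Rightarrow> ('x \<Rightarrow> 'h) set set" where "L \<equiv> integral_level M K E D"
abbreviation X :: "'i \<Rightarrow> 'x set" where "X \<alpha> \<equiv> space (M \<alpha>)"

lemma X_loc: "p \<in> X \<alpha> \<Longrightarrow> p \<in> loc_space M"
  by (auto simp: loc_space_def)

lemma X_mono: "\<alpha> \<le> \<beta> \<Longrightarrow> p \<in> X \<alpha> \<Longrightarrow> p \<in> X \<beta>"
  using system_mono(1) by blast

lemma fibre:
  assumes p: "p \<in> loc_space M"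
  shows "inner_product_space (K p)" "E p \<alpha> \<subseteq> carrier (K p)" "\<alpha> \<le> \<beta> \<Longrightarrow> E p \<alpha> \<subseteq> E p \<beta>"
    "hilbert_space (K p\<lparr>carrier := E p \<alpha>\<rparr>)"
proof -
  have q: "hilbert_space (K p)" "submodule (E p \<alpha>) complex_ring (K p)"
    "Metric_space.mcomplete (E p \<alpha>) (ip_dist (K p))" "mono (E p)"
    using fibres p by (auto simp: quantized_domain_def)
  then show i: "inner_product_space (K p)" by (simp add: hilbert_space_def)
  interpret inner_product_space "K p" by (rule i)
  show "E p \<alpha> \<subseteq> carrier (K p)" by (rule submoduleE(1)[OF q(2)])
  show "\<alpha> \<le> \<beta> \<Longrightarrow> E p \<alpha> \<subseteq> E p \<beta>" using q(4) by (rule monoD)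
  show "hilbert_space (K p\<lparr>carrier := E p \<alpha>\<rparr>)" by (rule hilbert_space_submodule[OF i q(2,3)])
qed

lemma fibre_hilb: "p \<in> loc_space M \<Longrightarrow> hilbert (K p\<lparr>carrier := E p \<alpha>\<rparr>)"
  using fibre(4) by (simp add: hilbert_space_iff)

lemma fibre_directed: "p \<in> loc_space M \<Longrightarrow> directed_levels (K p) (E p)"
  using fibre directed by (intro directed_levels.intro directed_levels_axioms.intro) auto

lemma zero_E: "p \<in> loc_space M \<Longrightarrow> \<zero>\<^bsub>K p\<^esub> \<in> E p \<alpha>"
  using inner_product_space.zero_in[OF hilbert.axioms(1)[OF fibre_hilb]] by simp

text \<open>A fixed choice of versions for each level. Two levels may choose different versions of
  the same class; \<open>EV_levels\<close> compares them.\<close>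

definition EV :: "'i \<Rightarrow> ('x \<Rightarrow> 'h) set \<Rightarrow> 'x \<Rightarrow> 'h" where
  "EV \<alpha> = (SOME ev.
     (\<forall>U\<in>L \<alpha>. \<forall>u\<in>U. AE p in M \<alpha>. ev U p = u p) \<and>
     hilbert_direct_integral (M \<alpha>) (\<lambda>p. K p\<lparr>carrier := E p \<alpha>\<rparr>) (V\<lparr>carrier := L \<alpha>\<rparr>) ev)"

lemma EV_props:
  "U \<in> L \<alpha> \<Longrightarrow> u \<in> U \<Longrightarrow> AE p in M \<alpha>. EV \<alpha> U p = u p"
  "hilbert_direct_integral (M \<alpha>) (\<lambda>p. K p\<lparr>carrier := E p \<alpha>\<rparr>) (V\<lparr>carrier := L \<alpha>\<rparr>) (EV \<alpha>)"
proof -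
  have "\<exists>ev. (\<forall>U\<in>L \<alpha>. \<forall>u\<in>U. AE p in M \<alpha>. ev U p = u p) \<and>
     hilbert_direct_integral (M \<alpha>) (\<lambda>p. K p\<lparr>carrier := E p \<alpha>\<rparr>) (V\<lparr>carrier := L \<alpha>\<rparr>) ev"
    using levels unfolding levels_are_direct_integrals_def by simp
  from someI_ex[OF this] show "U \<in> L \<alpha> \<Longrightarrow> u \<in> U \<Longrightarrow> AE p in M \<alpha>. EV \<alpha> U p = u p"
    "hilbert_direct_integral (M \<alpha>) (\<lambda>p. K p\<lparr>carrier := E p \<alpha>\<rparr>) (V\<lparr>carrier := L \<alpha>\<rparr>) (EV \<alpha>)"
    unfolding EV_def[symmetric] by auto
qed

sublocale DI: direct_integral "M \<alpha>" "\<lambda>p. K p\<lparr>carrier := E p \<alpha>\<rparr>" "V\<lparr>carrier := L \<alpha>\<rparr>" "EV \<alpha>" for \<alpha>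
  by (intro direct_integral.intro direct_integral_axioms.intro complete_level EV_props(2))

lemma carrier_V: "carrier V = ae_class M D ` D"
  by (simp add: integral_space_def)

lemma class_memD:
  assumes "U \<in> carrier V" "u \<in> U"
  shows "u \<in> D" "U = ae_class M D u"
proof -
  obtain v where v: "U = ae_class M D v" using assms(1) by (auto simp: carrier_V)
  with assms(2) have uv: "u \<in> D" "AE p in \<mu>. u p = v p" by (auto simp: ae_class_def)
  then show "u \<in> D" by simp
  have "(AE p in \<mu>. w p = v p) \<longleftrightarrow> (AE p in \<mu>. w p = u p)" for w
    using uv(2) by (intro iffI; elim AE_mp) (auto elim: eventually_mono)
  then show "U = ae_class M D u" by (auto simp: v ae_class_def)
qed

lemma class_nonempty: "U \<in> carrier V \<Longrightarrow> \<exists>u. u \<in> U"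
  by (auto simp: carrier_V ae_class_def)

lemma class_eqI:
  assumes U: "U \<in> carrier V" "u \<in> U" and W: "W \<in> carrier V" "w \<in> W" and eq: "AE p in \<mu>. u p = w p"
  shows "U = W"
proof -
  have "(AE p in \<mu>. v p = u p) \<longleftrightarrow> (AE p in \<mu>. v p = w p)" for v
    using eq by (intro iffI; elim AE_mp) (auto elim: eventually_mono)
  then show ?thesis
    by (subst class_memD(2)[OF U], subst class_memD(2)[OF W]) (simp add: ae_class_def)
qed

lemma D_fibre: "u \<in> D \<Longrightarrow> p \<in> loc_space M \<Longrightarrow> u p \<in> dom_of (E p)"
  using integral by (auto simp: loc_direct_integral_def fibre_maps_def dest!: subsetD PiE_mem)

lemma L_carrier: "L \<alpha> \<subseteq> carrier V"
  by (auto simp: integral_level_def carrier_V)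

lemma carrier_L: "carrier V = dom_of L"
proof
  have lev: "\<exists>\<alpha>. at_level M K E \<alpha> u" if "u \<in> D" for u
    using integral that by (simp add: loc_direct_integral_def)
  show "carrier V \<subseteq> dom_of L"
  proof
    fix U assume "U \<in> carrier V"
    then obtain u where u: "u \<in> D" "U = ae_class M D u" by (auto simp: carrier_V)
    then obtain \<alpha> where "at_level M K E \<alpha> u" using lev by blast
    then have "U \<in> L \<alpha>" using u by (simp add: integral_level_def)
    then show "U \<in> dom_of L" by blast
  qed
qed (use L_carrier in auto)

lemma level_rep:
  assumes U: "U \<in> L \<alpha>" and u: "u \<in> U"
  shows "AE p in \<mu>. p \<in> X \<alpha> \<longrightarrow> u p = EV \<alpha> U p" "AE p in \<mu>. p \<notin> X \<alpha> \<longrightarrow> u p = \<zero>\<^bsub>K p\<^esub>"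
proof -
  show "AE p in \<mu>. p \<in> X \<alpha> \<longrightarrow> u p = EV \<alpha> U p"
    using EV_props(1)[OF U u] unfolding AE_level_iff by eventually_elim simp
  obtain v where v: "v \<in> D" "at_level M K E \<alpha> v" "U = ae_class M D v"
    using U by (auto simp: integral_level_def)
  have "AE p in \<mu>. u p = v p" using u by (simp add: v(3) ae_class_def)
  with AE_space show "AE p in \<mu>. p \<notin> X \<alpha> \<longrightarrow> u p = \<zero>\<^bsub>K p\<^esub>"
  proof eventually_elim
    case (elim p)
    then show ?case using v(2) by (auto simp: at_level_def \<mu>_space)
  qed
qed

lemma EV_in: "U \<in> L \<alpha> \<Longrightarrow> p \<in> X \<alpha> \<Longrightarrow> EV \<alpha> U p \<in> E p \<alpha>"
  using DI.ev_in[of U \<alpha> p] by simp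

text \<open>Off the smaller space the map is zero, and zero lies in every level of the
  fibre.\<close>

lemma L_mono:
  assumes ab: "\<alpha> \<le> \<beta>"
  shows "L \<alpha> \<subseteq> L \<beta>"
proof
  fix U assume "U \<in> L \<alpha>"
  then obtain u where u: "u \<in> D" "at_level M K E \<alpha> u" "U = ae_class M D u"
    by (auto simp: integral_level_def)
  have "AE p in \<mu>. p \<in> X \<alpha> \<longrightarrow> u p \<in> E p \<alpha>"
    using u(2) by (simp add: at_level_def AE_level_iff)
  with AE_space have "AE p in M \<beta>. u p \<in> E p \<beta>" unfolding AE_level_iff
  proof eventually_elim
    case (elim p)
    then have p: "p \<in> loc_space M" by (simp add: \<mu>_space)
    show ?case
    proof
      show "u p \<in> E p \<beta>"
      proof (cases "p \<in> X \<alpha>")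
        case True
        then show ?thesis using elim fibre(3)[OF p ab] by auto
      next
        case False
        then have "u p = \<zero>\<^bsub>K p\<^esub>" using u(2) p by (auto simp: at_level_def)
        then show ?thesis using zero_E[OF p] by simp
      qed
    qed
  qed
  then have "at_level M K E \<beta> u" using u(2) system_mono(1)[OF ab] by (auto simp: at_level_def)
  then show "U \<in> L \<beta>" using u by (auto simp: integral_level_def)
qed

lemma V_directed: "directed_levels V L"
proof (intro directed_levels.intro directed_levels_axioms.intro)
  have H: "hilbert (V\<lparr>carrier := L \<alpha>\<rparr>)" for \<alpha> by (rule DI.W.hilbert_axioms)
  show "hilbert_space (V\<lparr>carrier := L \<alpha>\<rparr>)" for \<alpha> using H by (simp add: hilbert_space_iff)
  show "inner_product_space V"
    by (rule inner_product_space_directed_union[OF directed _ hilbert.axioms(1)[OF H] carrier_L])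
      (rule monoI, rule L_mono)
qed (use directed L_mono L_carrier in auto)

text \<open>Both versions agree almost everywhere with any representative of the class, and the
  representative vanishes off the smaller space.\<close>

lemma EV_levels:
  assumes ab: "\<alpha> \<le> \<beta>" and U: "U \<in> L \<alpha>"
  shows "AE p in \<mu>. p \<in> X \<alpha> \<longrightarrow> EV \<beta> U p = EV \<alpha> U p"
    "AE p in \<mu>. p \<in> X \<beta> \<longrightarrow> p \<notin> X \<alpha> \<longrightarrow> EV \<beta> U p = \<zero>\<^bsub>K p\<^esub>"
proof -
  have Ub: "U \<in> L \<beta>" using L_mono[OF ab] U by auto
  obtain u where u: "u \<in> U" using class_nonempty U L_carrier by blast
  show "AE p in \<mu>. p \<in> X \<alpha> \<longrightarrow> EV \<beta> U p = EV \<alpha> U p"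
    using level_rep(1)[OF U u] level_rep(1)[OF Ub u] by eventually_elim (use X_mono[OF ab] in auto)
  show "AE p in \<mu>. p \<in> X \<beta> \<longrightarrow> p \<notin> X \<alpha> \<longrightarrow> EV \<beta> U p = \<zero>\<^bsub>K p\<^esub>"
    using level_rep(2)[OF U u] level_rep(1)[OF Ub u] by eventually_elim auto
qed

text \<open>The image of a vector of level \<open>\<alpha>\<close> lies in level \<open>\<alpha>\<close> because direct integrals contain every
  field with integrable inner products.\<close>

lemma level_restrict:
  assumes ab: "\<alpha> \<le> \<beta>" and T: "T \<in> bounded_ops V (L \<beta>)" and d: "DI.decomposes \<beta> T S"
    and S: "\<And>p. p \<in> X \<beta> \<Longrightarrow> S p \<in> bounded_ops (K p) (E p \<beta>)"
    and Sa: "\<And>p v. p \<in> X \<alpha> \<Longrightarrow> v \<in> E p \<alpha> \<Longrightarrow> S p v \<in> E p \<alpha>"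
  shows "restrict T (L \<alpha>) \<in> bounded_ops V (L \<alpha>)"
    "DI.decomposes \<alpha> (restrict T (L \<alpha>)) (\<lambda>p. restrict (S p) (E p \<alpha>))"
    "p \<in> X \<alpha> \<Longrightarrow> restrict (S p) (E p \<alpha>) \<in> bounded_ops (K p) (E p \<alpha>)"
proof -
  interpret V: directed_levels V L by (rule V_directed)
  have Lab: "U \<in> L \<beta>" if "U \<in> L \<alpha>" for U using L_mono[OF ab] that by auto
  note TD = bounded_opsD[OF T]
  have dT: "AE p in \<mu>. p \<in> X \<beta> \<longrightarrow> EV \<beta> (T U) p = S p (EV \<beta> U p)" if "U \<in> L \<beta>" for U
    using DI.decomposesD[OF d, of U] that by (simp add: AE_level_iff)
  have TL: "T U \<in> L \<alpha>" if U: "U \<in> L \<alpha>" for U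
  proof -
    define v where "v = (\<lambda>p. S p (EV \<alpha> U p))"
    have veq: "AE p in \<mu>. p \<in> X \<alpha> \<longrightarrow> v p = EV \<beta> (T U) p"
      using dT[OF Lab[OF U]] EV_levels(1)[OF ab U]
      by eventually_elim (use X_mono[OF ab] in \<open>auto simp: v_def\<close>)
    have "\<exists>Z\<in>carrier (V\<lparr>carrier := L \<alpha>\<rparr>). AE p in M \<alpha>. EV \<alpha> Z p = v p"
    proof (rule DI.realise)
      show "v p \<in> carrier (K p\<lparr>carrier := E p \<alpha>\<rparr>)" if "p \<in> X \<alpha>" for p
        using Sa[OF that EV_in[OF U that]] by (simp add: v_def)
      fix Y assume "Y \<in> carrier (V\<lparr>carrier := L \<alpha>\<rparr>)"
      then have Y: "Y \<in> L \<alpha>" by simp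
      have "integrable (M \<beta>) (\<lambda>p. ip (K p) (EV \<beta> (T U) p) (EV \<beta> Y p))"
        using DI.ip_integrable[of "T U" \<beta> Y] TD(2)[OF Lab[OF U]] Lab[OF Y] by simp
      then have i: "integrable (M \<alpha>) (\<lambda>p. ip (K p) (EV \<beta> (T U) p) (EV \<beta> Y p))"
        by (rule integrable_level_mono[OF ab])
      have "AE p in M \<alpha>. ip (K p) (v p) (EV \<alpha> Y p) = ip (K p) (EV \<beta> (T U) p) (EV \<beta> Y p)"
        unfolding AE_level_iff using veq EV_levels(1)[OF ab Y] by eventually_elim simp
      from complete_measure.integrable_AE_eq[OF complete_level i this]
      show "integrable (M \<alpha>) (\<lambda>p. ip (K p\<lparr>carrier := E p \<alpha>\<rparr>) (v p) (EV \<alpha> Y p))" by simp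
    qed
    then obtain Z where Z: "Z \<in> L \<alpha>" "AE p in \<mu>. p \<in> X \<alpha> \<longrightarrow> EV \<alpha> Z p = v p"
      by (auto simp: AE_level_iff)
    \<comment> \<open>\<open>Z\<close> and \<open>T U\<close> are compared on level \<beta>; off the
      smaller space both vanish, since \<open>S p\<close> sends 0 to 0.\<close>
    have "AE p in M \<beta>. EV \<beta> Z p = EV \<beta> (T U) p"
      unfolding AE_level_iff
      using veq Z(2) EV_levels[OF ab Z(1)] EV_levels[OF ab U] dT[OF Lab[OF U]]
    proof eventually_elim
      case (elim p)
      show ?case
      proof
        assume p: "p \<in> X \<beta>"
        show "EV \<beta> Z p = EV \<beta> (T U) p"
        proof (cases "p \<in> X \<alpha>")
          case True
          then show ?thesis using elim p by simp
        next
          case False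
          interpret Kp: hilbert "K p\<lparr>carrier := E p \<beta>\<rparr>" by (rule fibre_hilb[OF X_loc[OF p]])
          have z: "\<zero>\<^bsub>K p\<^esub> \<in> E p \<beta>" by (rule zero_E[OF X_loc[OF p]])
          have "S p \<zero>\<^bsub>K p\<^esub> = \<zero>\<^bsub>K p\<^esub>"
            using bounded_opsD(5)[OF S[OF p] z, of 0] bounded_opsD(2)[OF S[OF p] z] Kp.zero_smult z by simp
          then show ?thesis using elim p False by simp
        qed
      qed
    qed
    then have "Z = T U"
      using DI.ev_inj[of Z \<beta> "T U"] Lab[OF Z(1)] TD(2)[OF Lab[OF U]] by simp
    then show ?thesis using Z(1) by simp
  qed
  obtain C where C: "\<And>U. U \<in> L \<beta> \<Longrightarrow> ip_norm V (T U) \<le> C * ip_norm V U"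
    using T by (auto simp: bounded_ops_def bounded_on_def)
  show "restrict T (L \<alpha>) \<in> bounded_ops V (L \<alpha>)"
    by (rule V.bounded_opsI[where C = C]) (use TL TD(4,5) C Lab in auto)
  show "DI.decomposes \<alpha> (restrict T (L \<alpha>)) (\<lambda>p. restrict (S p) (E p \<alpha>))"
    unfolding DI.decomposes_def
  proof
    fix U assume "U \<in> carrier (V\<lparr>carrier := L \<alpha>\<rparr>)"
    then have U: "U \<in> L \<alpha>" by simp
    show "AE p in M \<alpha>. EV \<alpha> (restrict T (L \<alpha>) U) p = restrict (S p) (E p \<alpha>) (EV \<alpha> U p)"
      unfolding AE_level_iff
      using dT[OF Lab[OF U]] EV_levels(1)[OF ab U] EV_levels(1)[OF ab TL[OF U]]
      by eventually_elim (use X_mono[OF ab] U EV_in[OF U] in auto)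
  qed
  assume p: "p \<in> X \<alpha>"
  note SD = bounded_opsD[OF S[OF X_mono[OF ab p]]]
  have Eab: "v \<in> E p \<beta>" if "v \<in> E p \<alpha>" for v using fibre(3)[OF X_loc[OF p] ab] that by auto
  interpret Kp: directed_levels "K p" "E p" by (rule fibre_directed[OF X_loc[OF p]])
  obtain C where C: "\<And>v. v \<in> E p \<beta> \<Longrightarrow> ip_norm (K p) (S p v) \<le> C * ip_norm (K p) v"
    using S[OF X_mono[OF ab p]] by (auto simp: bounded_ops_def bounded_on_def)
  show "restrict (S p) (E p \<alpha>) \<in> bounded_ops (K p) (E p \<alpha>)"
    by (rule Kp.bounded_opsI[where C = C]) (use Sa[OF p] SD(4,5) C Eab in auto)
qed

text \<open>Restricting \<open>S \<beta>\<close> gives a second decomposition on level \<alpha>, and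
  decompositions are unique up to null sets. These depend on the pair of levels and are united by
  \<open>AE_all_levels\<close>, once for each index.\<close>

lemma coherent_decompositions:
  assumes T: "T \<in> loc_bounded_ops V L"
    and S: "\<And>\<alpha> p. p \<in> X \<alpha> \<Longrightarrow> S \<alpha> p \<in> bounded_ops (K p) (E p \<alpha>)"
    and inv: "\<And>\<alpha> \<beta> p v. \<alpha> \<le> \<beta> \<Longrightarrow> p \<in> X \<alpha> \<Longrightarrow> v \<in> E p \<alpha> \<Longrightarrow> S \<beta> p v \<in> E p \<alpha>"
    and d: "\<And>\<alpha>. DI.decomposes \<alpha> (restrict T (L \<alpha>)) (S \<alpha>)"
  shows "AE p in \<mu>. \<forall>\<alpha> \<beta>. \<alpha> \<le> \<beta> \<longrightarrow> p \<in> X \<alpha> \<longrightarrow> (\<forall>v\<in>E p \<alpha>. S \<beta> p v = S \<alpha> p v)"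
proof -
  interpret V: directed_levels V L by (rule V_directed)
  have "AE p in \<mu>. \<alpha> \<le> \<beta> \<longrightarrow> p \<in> X \<alpha> \<longrightarrow> (\<forall>v\<in>E p \<alpha>. S \<beta> p v = S \<alpha> p v)" for \<alpha> \<beta>
  proof (cases "\<alpha> \<le> \<beta>")
    case ab: True
    have eq: "restrict (restrict T (L \<beta>)) (L \<alpha>) = restrict T (L \<alpha>)"
      using L_mono[OF ab] by (simp add: restrict_restrict Int_absorb1)
    note r = level_restrict[OF ab V.restrict_bounded[OF T] d[of \<beta>] S inv[OF ab], unfolded eq]
    have "AE p in M \<alpha>. \<forall>v\<in>carrier (K p\<lparr>carrier := E p \<alpha>\<rparr>). restrict (S \<beta> p) (E p \<alpha>) v = S \<alpha> p v"
    proof (rule DI.decomposes_unique)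
      show "restrict (S \<beta> p) (E p \<alpha>) \<in> bounded_ops (K p\<lparr>carrier := E p \<alpha>\<rparr>) (carrier (K p\<lparr>carrier := E p \<alpha>\<rparr>))"
        if "p \<in> X \<alpha>" for p using r(3)[OF _ _ _ that] that by simp
      show "S \<alpha> p \<in> bounded_ops (K p\<lparr>carrier := E p \<alpha>\<rparr>) (carrier (K p\<lparr>carrier := E p \<alpha>\<rparr>))"
        if "p \<in> X \<alpha>" for p using S[OF that] by simp
      show "DI.decomposes \<alpha> (restrict T (L \<alpha>)) (\<lambda>p. restrict (S \<beta> p) (E p \<alpha>))" using r(2) by simp
    qed (rule d)
    then show ?thesis unfolding AE_level_iff by eventually_elim simp
  qed simp
  then have "AE p in \<mu>. \<forall>\<beta>. \<alpha> \<le> \<beta> \<longrightarrow> p \<in> X \<alpha> \<longrightarrow> (\<forall>v\<in>E p \<alpha>. S \<beta> p v = S \<alpha> p v)" for \<alpha>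
    by (rule AE_all_levels)
  then show ?thesis by (rule AE_all_levels)
qed

end

lemma (in directed_levels) scalar_loc_bounded:
  "(\<lambda>v\<in>dom_of F. c \<odot>\<^bsub>V\<^esub> v) \<in> loc_bounded_ops V F"
proof (rule loc_bounded_opsI)
  have dV: "x \<in> carrier V" if "x \<in> dom_of F" for x using that dom_carrier by blast
  show "(\<lambda>v\<in>dom_of F. c \<odot>\<^bsub>V\<^esub> v) \<in> dom_of F \<rightarrow>\<^sub>E dom_of F"
    using dom_closed(2) by (intro PiE_I) (simp_all del: UN_iff Union_iff)
  show "(\<lambda>v\<in>dom_of F. c \<odot>\<^bsub>V\<^esub> v) (x \<oplus>\<^bsub>V\<^esub> y) = (\<lambda>v\<in>dom_of F. c \<odot>\<^bsub>V\<^esub> v) x \<oplus>\<^bsub>V\<^esub> (\<lambda>v\<in>dom_of F. c \<odot>\<^bsub>V\<^esub> v) y"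
    if "x \<in> dom_of F" "y \<in> dom_of F" for x y
  proof -
    have "c \<odot>\<^bsub>V\<^esub> (x \<oplus>\<^bsub>V\<^esub> y) = c \<odot>\<^bsub>V\<^esub> x \<oplus>\<^bsub>V\<^esub> c \<odot>\<^bsub>V\<^esub> y"
      by (rule vec_eqI) (simp_all add: dV[OF that(1)] dV[OF that(2)] ip_expand algebra_simps)
    then show ?thesis using that dom_closed(1)[OF that] by (simp del: UN_iff Union_iff)
  qed
  show "(\<lambda>v\<in>dom_of F. c \<odot>\<^bsub>V\<^esub> v) (d \<odot>\<^bsub>V\<^esub> x) = d \<odot>\<^bsub>V\<^esub> (\<lambda>v\<in>dom_of F. c \<odot>\<^bsub>V\<^esub> v) x" if "x \<in> dom_of F" for d x
  proof -
    have "c \<odot>\<^bsub>V\<^esub> (d \<odot>\<^bsub>V\<^esub> x) = d \<odot>\<^bsub>V\<^esub> (c \<odot>\<^bsub>V\<^esub> x)"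
      by (rule vec_eqI) (simp_all add: dV[OF that] ip_expand)
    then show ?thesis using that dom_closed(2)[OF that] by (simp del: UN_iff Union_iff)
  qed
  show "(\<lambda>v\<in>dom_of F. c \<odot>\<^bsub>V\<^esub> v) x \<in> F \<alpha>" if "x \<in> F \<alpha>" for x \<alpha> using that by auto
  show "ip V ((\<lambda>v\<in>dom_of F. c \<odot>\<^bsub>V\<^esub> v) x) y = 0"
    if x: "x \<in> dom_of F" and o: "\<And>y. y \<in> F \<alpha> \<Longrightarrow> ip V x y = 0" and y: "y \<in> F \<alpha>" for x y \<alpha>
    using x o[OF y] dV[OF x] level_carrier[OF y] by (simp add: ip_smult_left del: UN_iff Union_iff)
  show "bounded_on V (F \<alpha>) (\<lambda>v\<in>dom_of F. c \<odot>\<^bsub>V\<^esub> v)" for \<alpha>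
    unfolding bounded_on_def by (intro exI[of _ "cmod c"]) (auto simp: norm_smult)
qed

section \<open>Reduction of both algebras to commutants on the levels\<close>

context loc_integral
begin

lemma locally_von_neumann_of_commutants:
  fixes \<Q> :: "'i \<Rightarrow> 'x \<Rightarrow> ('h \<Rightarrow> 'h) set"
  assumes Q: "\<And>\<alpha> p. p \<in> X \<alpha> \<Longrightarrow> selfadjoint_contractions (K p\<lparr>carrier := E p \<alpha>\<rparr>) (\<Q> \<alpha> p)"
    and inv: "\<And>\<alpha> \<beta> p S v. \<alpha> \<le> \<beta> \<Longrightarrow> p \<in> X \<alpha> \<Longrightarrow>
      S \<in> commutant_ops (K p\<lparr>carrier := E p \<beta>\<rparr>) (\<Q> \<beta> p) \<Longrightarrow> v \<in> E p \<alpha> \<Longrightarrow> S v \<in> E p \<alpha>"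
    and res: "\<And>\<alpha> \<beta> p S. \<alpha> \<le> \<beta> \<Longrightarrow> p \<in> X \<alpha> \<Longrightarrow>
      S \<in> commutant_ops (K p\<lparr>carrier := E p \<beta>\<rparr>) (\<Q> \<beta> p) \<Longrightarrow>
      restrict S (E p \<alpha>) \<in> bounded_ops (K p) (E p \<alpha>) \<Longrightarrow>
      restrict S (E p \<alpha>) \<in> commutant_ops (K p\<lparr>carrier := E p \<alpha>\<rparr>) (\<Q> \<alpha> p)"
    and A: "\<And>T. T \<in> A \<longleftrightarrow> T \<in> loc_bounded_ops V L \<and>
      (\<forall>\<alpha>. restrict T (L \<alpha>) \<in> DI.decomposable_over \<alpha> (\<lambda>p. commutant_ops (K p\<lparr>carrier := E p \<alpha>\<rparr>) (\<Q> \<alpha> p)))"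
  shows "locally_von_neumann_algebra V L A"
proof -
  interpret V: directed_levels V L by (rule V_directed)
  show ?thesis
  proof (rule V.locally_von_neumann_algebraI[OF _ _ _ A])
    fix \<alpha>
    let ?C = "\<lambda>\<alpha> p. commutant_ops (K p\<lparr>carrier := E p \<alpha>\<rparr>) (\<Q> \<alpha> p)"
    have "unital_star_subalgebra (V\<lparr>carrier := L \<alpha>\<rparr>) (carrier (V\<lparr>carrier := L \<alpha>\<rparr>))
        (bounded_ops (V\<lparr>carrier := L \<alpha>\<rparr>) (carrier (V\<lparr>carrier := L \<alpha>\<rparr>))) (DI.decomposable_over \<alpha> (?C \<alpha>))"
      by (rule DI.decomposable_star_subalgebra)
        (rule hilbert.commutant_star_subalgebra[OF fibre_hilb[OF X_loc] Q])
    then show "unital_star_subalgebra V (L \<alpha>) (bounded_ops V (L \<alpha>)) (DI.decomposable_over \<alpha> (?C \<alpha>))" by simp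
    show "T \<in> DI.decomposable_over \<alpha> (?C \<alpha>)"
      if "T \<in> bounded_ops V (L \<alpha>)" "sot_limit V (L \<alpha>) (DI.decomposable_over \<alpha> (?C \<alpha>)) T" for T
      by (rule DI.decomposable_over_commutant_closed[OF Q]) (use that in simp_all)
    fix \<beta> T assume ab: "\<alpha> \<le> \<beta>" and T: "T \<in> DI.decomposable_over \<beta> (?C \<beta>)"
    then obtain S where TB: "T \<in> bounded_ops V (L \<beta>)" and d: "DI.decomposes \<beta> T S"
      and S: "\<forall>p\<in>X \<beta>. S p \<in> ?C \<beta> p" by (auto simp: DI.decomposable_over_def)
    have SB: "S p \<in> bounded_ops (K p) (E p \<beta>)" if "p \<in> X \<beta>" for p
      using S that by (auto simp: commutant_ops_def)
    have Si: "S p v \<in> E p \<alpha>" if p: "p \<in> X \<alpha>" and v: "v \<in> E p \<alpha>" for p v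
      by (rule inv[OF ab p _ v]) (use S X_mono[OF ab p] in simp)
    note r = level_restrict[OF ab TB d SB Si]
    show "restrict T (L \<alpha>) \<in> DI.decomposable_over \<alpha> (?C \<alpha>)"
    proof (rule DI.decomposable_overI)
      show "restrict T (L \<alpha>) \<in> bounded_ops (V\<lparr>carrier := L \<alpha>\<rparr>) (carrier (V\<lparr>carrier := L \<alpha>\<rparr>))"
        using r(1) by simp
      show "DI.decomposes \<alpha> (restrict T (L \<alpha>)) (\<lambda>p. restrict (S p) (E p \<alpha>))" using r(2) by simp
      show "restrict (S p) (E p \<alpha>) \<in> ?C \<alpha> p" if p: "p \<in> X \<alpha>" for p
      proof (rule res[OF ab p])
        show "S p \<in> ?C \<beta> p" using S X_mono[OF ab p] by simp
        show "restrict (S p) (E p \<alpha>) \<in> bounded_ops (K p) (E p \<alpha>)"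
          by (rule level_restrict(3)[OF ab TB d SB Si p])
      qed
    qed
  qed
qed

text \<open>Translates a description by representatives of classes on the whole space into the
  chosen versions on one level.\<close>

lemma decomposes_levelI:
  assumes T: "T \<in> loc_bounded_ops V L"
    and S: "\<And>U u w. U \<in> carrier V \<Longrightarrow> u \<in> U \<Longrightarrow> w \<in> T U \<Longrightarrow> AE p in \<mu>. w p = S p (u p)"
  shows "DI.decomposes \<alpha> (restrict T (L \<alpha>)) (\<lambda>p. restrict (S p) (E p \<alpha>))"
  unfolding DI.decomposes_def
proof
  fix U assume "U \<in> carrier (V\<lparr>carrier := L \<alpha>\<rparr>)"
  then have U: "U \<in> L \<alpha>" by simp
  then have UV: "U \<in> carrier V" using L_carrier by blast
  have TU: "T U \<in> L \<alpha>" by (rule loc_bounded_opsD(3)[OF T U])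
  then have TUV: "T U \<in> carrier V" using L_carrier by blast
  obtain u where u: "u \<in> U" using class_nonempty[OF UV] by blast
  obtain w where w: "w \<in> T U" using class_nonempty[OF TUV] by blast
  show "AE p in M \<alpha>. EV \<alpha> (restrict T (L \<alpha>) U) p = restrict (S p) (E p \<alpha>) (EV \<alpha> U p)"
    unfolding AE_level_iff
    using S[OF UV u w] level_rep(1)[OF U u] level_rep(1)[OF TU w]
    by eventually_elim (use U EV_in[OF U] in auto)
qed

lemma decomposes_levelD:
  assumes T: "T \<in> loc_bounded_ops V L" and U: "U \<in> L \<alpha>" and u: "u \<in> U" and w: "w \<in> T U"
    and d: "DI.decomposes \<alpha> (restrict T (L \<alpha>)) S"
  shows "AE p in \<mu>. if p \<in> X \<alpha> then u p \<in> E p \<alpha> \<and> w p = S p (u p) else u p = \<zero>\<^bsub>K p\<^esub> \<and> w p = \<zero>\<^bsub>K p\<^esub>"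
proof -
  have TU: "T U \<in> L \<alpha>" by (rule loc_bounded_opsD(3)[OF T U])
  have "AE p in \<mu>. p \<in> X \<alpha> \<longrightarrow> EV \<alpha> (T U) p = S p (EV \<alpha> U p)"
    using DI.decomposesD[OF d, of U] U by (simp add: AE_level_iff)
  with level_rep[OF U u] level_rep[OF TU w] show ?thesis
    by eventually_elim (use EV_in[OF U] in auto)
qed

section \<open>The decomposable algebra\<close>

definition level_projections :: "'i \<Rightarrow> 'x \<Rightarrow> ('h \<Rightarrow> 'h) set" where
  "level_projections \<alpha> p = hilbert.proj (K p\<lparr>carrier := E p \<alpha>\<rparr>) ` (E p ` {..\<alpha>})"

lemma level_projections_selfadjoint:
  assumes p: "p \<in> loc_space M"
  shows "selfadjoint_contractions (K p\<lparr>carrier := E p \<alpha>\<rparr>) (level_projections \<alpha> p)"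
proof -
  interpret Kp: hilbert "K p\<lparr>carrier := E p \<alpha>\<rparr>" by (rule fibre_hilb[OF p])
  show ?thesis unfolding level_projections_def
    by (rule Kp.selfadjoint_contractions_proj) (use fibre(3,4)[OF p] in auto)
qed

text \<open>All \<gamma> \<le> \<alpha> take part, also those whose space does not contain
  \<open>p\<close>, because the fibres of a decomposable operator must respect every level of the
  fibre space.\<close>

lemma level_projections_commutant:
  assumes p: "p \<in> loc_space M"
  shows "S \<in> commutant_ops (K p\<lparr>carrier := E p \<alpha>\<rparr>) (level_projections \<alpha> p) \<longleftrightarrow>
    S \<in> bounded_ops (K p) (E p \<alpha>) \<and>
    (\<forall>\<gamma>\<le>\<alpha>. (\<forall>x\<in>E p \<gamma>. S x \<in> E p \<gamma>) \<and>
       (\<forall>x\<in>E p \<alpha>. (\<forall>y\<in>E p \<gamma>. ip (K p) x y = 0) \<longrightarrow> (\<forall>y\<in>E p \<gamma>. ip (K p) (S x) y = 0)))"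
proof -
  interpret Kp: hilbert "K p\<lparr>carrier := E p \<alpha>\<rparr>" by (rule fibre_hilb[OF p])
  have "(\<forall>x\<in>E p \<alpha>. S (Kp.proj (E p \<gamma>) x) = Kp.proj (E p \<gamma>) (S x)) \<longleftrightarrow>
    (\<forall>x\<in>E p \<gamma>. S x \<in> E p \<gamma>) \<and>
       (\<forall>x\<in>E p \<alpha>. (\<forall>y\<in>E p \<gamma>. ip (K p) x y = 0) \<longrightarrow> (\<forall>y\<in>E p \<gamma>. ip (K p) (S x) y = 0))"
    if "S \<in> bounded_ops (K p) (E p \<alpha>)" "\<gamma> \<le> \<alpha>" for \<gamma>
    using Kp.commutes_proj_iff[of "E p \<gamma>" S] fibre(3)[OF p that(2)] fibre(4)[OF p] that(1) by simp
  then show ?thesis by (auto simp: commutant_ops_def level_projections_def)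
qed

text \<open>A global fibre restricts to the levels. Conversely, the fibres on the levels are glued
  at almost every point. The levels whose space contains \<open>p\<close> are cofinal, so each
  condition on the glued fibre can be read off at one of them.\<close>

lemma decomposable_iff:
  "T \<in> decomposable_ops M K E D \<longleftrightarrow> T \<in> loc_bounded_ops V L \<and>
    (\<forall>\<alpha>. restrict T (L \<alpha>) \<in> DI.decomposable_over \<alpha> (\<lambda>p. commutant_ops (K p\<lparr>carrier := E p \<alpha>\<rparr>) (level_projections \<alpha> p)))"
    (is "?lhs \<longleftrightarrow> ?rhs")
proof
  interpret V: directed_levels V L by (rule V_directed)
  assume ?lhs
  then obtain S where T: "T \<in> loc_bounded_ops V L" and S: "\<forall>p\<in>loc_space M. S p \<in> loc_bounded_ops (K p) (E p)"
    and d: "\<forall>U\<in>carrier V. \<forall>u\<in>U. \<forall>w\<in>T U. AE p in \<mu>. w p = S p (u p)"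
    by (auto simp: decomposable_ops_def)
  show ?rhs
  proof (intro conjI allI T DI.decomposable_overI)
    fix \<alpha>
    show "restrict T (L \<alpha>) \<in> bounded_ops (V\<lparr>carrier := L \<alpha>\<rparr>) (carrier (V\<lparr>carrier := L \<alpha>\<rparr>))"
      using V.restrict_bounded[OF T] by simp
    show "DI.decomposes \<alpha> (restrict T (L \<alpha>)) (\<lambda>p. restrict (S p) (E p \<alpha>))"
      by (rule decomposes_levelI[OF T]) (use d in simp)
    fix p assume "p \<in> X \<alpha>"
    then have p: "p \<in> loc_space M" by (rule X_loc)
    interpret Kp: directed_levels "K p" "E p" by (rule fibre_directed[OF p])
    have Sp: "S p \<in> loc_bounded_ops (K p) (E p)" using S p by simp
    note SD = loc_bounded_opsD[OF Sp]
    show "restrict (S p) (E p \<alpha>) \<in> commutant_ops (K p\<lparr>carrier := E p \<alpha>\<rparr>) (level_projections \<alpha> p)"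
      unfolding level_projections_commutant[OF p]
    proof (intro conjI allI impI ballI Kp.restrict_bounded[OF Sp])
      fix \<gamma> assume g: "\<gamma> \<le> \<alpha>"
      show "restrict (S p) (E p \<alpha>) x \<in> E p \<gamma>" if "x \<in> E p \<gamma>" for x
        using SD(3)[OF that] fibre(3)[OF p g] that by auto
      fix x y assume x: "x \<in> E p \<alpha>" and o: "\<forall>y\<in>E p \<gamma>. ip (K p) x y = 0" and y: "y \<in> E p \<gamma>"
      have "x \<in> dom_of (E p)" using x by blast
      then have "ip (K p) (S p x) y = 0" by (rule SD(4)[OF _ _ y]) (use o in simp)
      then show "ip (K p) (restrict (S p) (E p \<alpha>) x) y = 0" using x by simp
    qed
  qed
next
  assume r: ?rhs
  then have T: "T \<in> loc_bounded_ops V L" by simp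
  let ?C = "\<lambda>\<alpha> p. commutant_ops (K p\<lparr>carrier := E p \<alpha>\<rparr>) (level_projections \<alpha> p)"
  have "\<exists>S. DI.decomposes \<alpha> (restrict T (L \<alpha>)) S \<and> (\<forall>p\<in>X \<alpha>. S p \<in> ?C \<alpha> p)" for \<alpha>
    using r by (simp add: DI.decomposable_over_def) blast
  then obtain S where d: "\<And>\<alpha>. DI.decomposes \<alpha> (restrict T (L \<alpha>)) (S \<alpha>)"
    and SC: "\<And>\<alpha>. \<forall>p\<in>X \<alpha>. S \<alpha> p \<in> ?C \<alpha> p" by metis
  have SB: "S \<alpha> p \<in> bounded_ops (K p) (E p \<alpha>)" if "p \<in> X \<alpha>" for \<alpha> p
    using SC[of \<alpha>] that by (auto simp: commutant_ops_def)
  have red: "(\<forall>x\<in>E p \<gamma>. S \<alpha> p x \<in> E p \<gamma>) \<and>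
       (\<forall>x\<in>E p \<alpha>. (\<forall>y\<in>E p \<gamma>. ip (K p) x y = 0) \<longrightarrow> (\<forall>y\<in>E p \<gamma>. ip (K p) (S \<alpha> p x) y = 0))"
    if "p \<in> X \<alpha>" "\<gamma> \<le> \<alpha>" for \<alpha> \<gamma> p
  proof -
    have "S \<alpha> p \<in> ?C \<alpha> p" using SC[of \<alpha>] that(1) by (rule bspec)
    then show ?thesis unfolding level_projections_commutant[OF X_loc[OF that(1)]] using that(2) by simp
  qed
  let ?good = "\<lambda>p. \<forall>\<alpha> \<beta>. \<alpha> \<le> \<beta> \<longrightarrow> p \<in> X \<alpha> \<longrightarrow> (\<forall>v\<in>E p \<alpha>. S \<beta> p v = S \<alpha> p v)"
  have good: "AE p in \<mu>. ?good p"
  proof (rule coherent_decompositions[OF T SB _ d])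
    fix \<alpha> \<beta> p v assume "\<alpha> \<le> \<beta>" "p \<in> X \<alpha>" "v \<in> E p \<alpha>"
    then show "S \<beta> p v \<in> E p \<alpha>" using red[OF X_mono, of \<alpha> \<beta> p \<alpha>] by blast
  qed
  \<comment> \<open>At points where coherence fails the identity is used, so that the fibre is
    locally bounded everywhere.\<close>
  define S0 where "S0 = (\<lambda>p. if ?good p then (\<lambda>v\<in>dom_of (E p). S (SOME \<alpha>. p \<in> X \<alpha> \<and> v \<in> E p \<alpha>) p v)
     else (\<lambda>v\<in>dom_of (E p). 1 \<odot>\<^bsub>K p\<^esub> v))"
  have S0_eq: "S0 p v = S \<alpha> p v" if g: "?good p" and p: "p \<in> X \<alpha>" and v: "v \<in> E p \<alpha>" for p v \<alpha>
  proof -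
    let ?a = "SOME \<alpha>. p \<in> X \<alpha> \<and> v \<in> E p \<alpha>"
    have a: "p \<in> X ?a \<and> v \<in> E p ?a" using someI[of "\<lambda>\<alpha>. p \<in> X \<alpha> \<and> v \<in> E p \<alpha>" \<alpha>] p v by simp
    obtain \<gamma> where g2: "?a \<le> \<gamma>" "\<alpha> \<le> \<gamma>" by (rule upper)
    have "v \<in> dom_of (E p)" using v by blast
    then have "S0 p v = S ?a p v" unfolding S0_def if_P[OF g] by (rule restrict_apply')
    also have "\<dots> = S \<gamma> p v" using g[rule_format, OF g2(1) conjunct1[OF a] conjunct2[OF a]] by simp
    also have "\<dots> = S \<alpha> p v" by (rule g[rule_format, OF g2(2) p v])
    finally show ?thesis .
  qed
  \<comment> \<open>Choosing the level above \<gamma> gives access to the conditions for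
    \<open>E p \<gamma>\<close> even when \<open>p\<close> lies outside the \<gamma>-th
    space.\<close>
  have lev: "\<exists>\<alpha>\<ge>\<gamma>. p \<in> X \<alpha> \<and> v \<in> E p \<alpha> \<and> w \<in> E p \<alpha>"
    if p: "p \<in> loc_space M" and v: "v \<in> dom_of (E p)" and w: "w \<in> dom_of (E p)" for p v w \<gamma>
  proof -
    interpret Kp: directed_levels "K p" "E p" by (rule fibre_directed[OF p])
    obtain \<delta> where d: "p \<in> X \<delta>" using p by (auto simp: loc_space_def)
    obtain \<epsilon> where e: "\<gamma> \<le> \<epsilon>" "\<delta> \<le> \<epsilon>" by (rule upper)
    have fin: "finite {v, w}" "{v, w} \<subseteq> dom_of (E p)" using v w by auto
    obtain \<alpha> where "\<epsilon> \<le> \<alpha>" "{v, w} \<subseteq> E p \<alpha>" using Kp.common_level[OF fin, of \<epsilon>] by blast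
    moreover from this e d have "p \<in> X \<alpha>" using X_mono[of \<delta> \<alpha> p] by (meson order_trans)
    ultimately show ?thesis using e by (intro exI[of _ \<alpha>]) (auto intro: order_trans)
  qed
  have S0B: "S0 p \<in> loc_bounded_ops (K p) (E p)" if p: "p \<in> loc_space M" for p
  proof (cases "?good p")
    case False
    interpret Kp: directed_levels "K p" "E p" by (rule fibre_directed[OF p])
    show ?thesis unfolding S0_def if_not_P[OF False] by (rule Kp.scalar_loc_bounded)
  next
    case g: True
    note eq = S0_eq[OF g]
    have S0F: "S0 p x \<in> E p \<gamma>" if x: "x \<in> E p \<gamma>" for x \<gamma>
    proof -
      have "x \<in> dom_of (E p)" using x by blast
      then obtain \<alpha> where a: "\<gamma> \<le> \<alpha>" "p \<in> X \<alpha>" "x \<in> E p \<alpha>" using lev[OF p, of x x \<gamma>] by blast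
      then show ?thesis using red[OF a(2,1)] x by (simp add: eq[OF a(2,3)])
    qed
    interpret Kp: directed_levels "K p" "E p" by (rule fibre_directed[OF p])
    show ?thesis
    proof (rule loc_bounded_opsI)
      show "S0 p \<in> dom_of (E p) \<rightarrow>\<^sub>E dom_of (E p)"
      proof (rule PiE_I)
        show "S0 p y \<in> dom_of (E p)" if "y \<in> dom_of (E p)" for y using S0F that by blast
      next
        show "S0 p y = undefined" if "y \<notin> dom_of (E p)" for y
          unfolding S0_def if_P[OF g] using that by (simp del: UN_iff Union_iff)
      qed
    next
      fix x y assume "x \<in> dom_of (E p)" "y \<in> dom_of (E p)"
      then obtain \<alpha> where a: "p \<in> X \<alpha>" "x \<in> E p \<alpha>" "y \<in> E p \<alpha>" using lev[OF p] by blast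
      show "S0 p (x \<oplus>\<^bsub>K p\<^esub> y) = S0 p x \<oplus>\<^bsub>K p\<^esub> S0 p y"
        using bounded_opsD(4)[OF SB[OF a(1)] a(2,3)] Kp.level_closed(1)[OF a(2,3)]
        by (simp add: eq[OF a(1)] a)
    next
      fix c x assume x: "x \<in> dom_of (E p)"
      then obtain \<alpha> where a: "p \<in> X \<alpha>" "x \<in> E p \<alpha>" using lev[OF p x x] by blast
      show "S0 p (c \<odot>\<^bsub>K p\<^esub> x) = c \<odot>\<^bsub>K p\<^esub> S0 p x"
        using bounded_opsD(5)[OF SB[OF a(1)] a(2)] Kp.level_closed(2)[OF a(2)]
        by (simp add: eq[OF a(1)] a)
    next
      fix \<gamma> x y assume x: "x \<in> dom_of (E p)" and o: "\<And>y. y \<in> E p \<gamma> \<Longrightarrow> ip (K p) x y = 0" and y: "y \<in> E p \<gamma>"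
      obtain \<alpha> where a: "\<gamma> \<le> \<alpha>" "p \<in> X \<alpha>" "x \<in> E p \<alpha>" using lev[OF p x x] by blast
      show "ip (K p) (S0 p x) y = 0" using red[OF a(2,1)] a(3) o y by (simp add: eq[OF a(2,3)])
    next
      fix \<gamma>
      obtain \<delta> where "p \<in> X \<delta>" using p by (auto simp: loc_space_def)
      moreover obtain \<alpha> where a: "\<gamma> \<le> \<alpha>" "\<delta> \<le> \<alpha>" by (rule upper)
      ultimately have pa: "p \<in> X \<alpha>" using X_mono by blast
      obtain C where C: "\<And>x. x \<in> E p \<alpha> \<Longrightarrow> ip_norm (K p) (S \<alpha> p x) \<le> C * ip_norm (K p) x"
        using SB[OF pa] by (auto simp: bounded_ops_def bounded_on_def)
      show "bounded_on (K p) (E p \<gamma>) (S0 p)"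
        unfolding bounded_on_def using C eq[OF pa] fibre(3)[OF p a(1)] by (intro exI[of _ C]) auto
    qed (rule S0F)
  qed
  have "AE p in \<mu>. w p = S0 p (u p)" if U: "U \<in> carrier V" and u: "u \<in> U" and w: "w \<in> T U" for U u w
  proof -
    obtain \<alpha> where Ua: "U \<in> L \<alpha>" using U carrier_L by auto
    show ?thesis
      using decomposes_levelD[OF T Ua u w d] good AE_space
    proof eventually_elim
      case (elim p)
      then have p: "p \<in> loc_space M" by (simp add: \<mu>_space)
      show ?case
      proof (cases "p \<in> X \<alpha>")
        case True
        then show ?thesis using elim(1) S0_eq[OF elim(2) True] by simp
      next
        case False
        interpret Kp: directed_levels "K p" "E p" by (rule fibre_directed[OF p])
        have z: "\<zero>\<^bsub>K p\<^esub> \<in> dom_of (E p)" using zero_E[OF p] by blast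
        \<comment> \<open>Off the space of the level the class vanishes together with its image, so
          only the value of the glued fibre at 0 matters.\<close>
        have "S0 p \<zero>\<^bsub>K p\<^esub> = S0 p (0 \<odot>\<^bsub>K p\<^esub> \<zero>\<^bsub>K p\<^esub>)" by (simp add: Kp.zero_smult)
        also have "\<dots> = 0 \<odot>\<^bsub>K p\<^esub> S0 p \<zero>\<^bsub>K p\<^esub>" by (rule linear_opD(2)[OF loc_bounded_opsD(2)[OF S0B[OF p]] z])
        also have "\<dots> = \<zero>\<^bsub>K p\<^esub>"
          using subsetD[OF Kp.dom_carrier PiE_mem[OF loc_bounded_opsD(1)[OF S0B[OF p]] z]] by (simp add: Kp.zero_smult)
        finally show ?thesis using elim(1) False by simp
      qed
    qed
  qed
  then show ?lhs using T S0B unfolding decomposable_ops_def by (intro CollectI conjI exI[of _ S0]) auto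
qed

theorem decomposable_locally_vN: "locally_von_neumann_algebra V L (decomposable_ops M K E D)"
proof (rule locally_von_neumann_of_commutants[OF level_projections_selfadjoint[OF X_loc] _ _ decomposable_iff])
  fix \<alpha> \<beta> :: 'i and p S assume ab: "\<alpha> \<le> \<beta>" and "p \<in> X \<alpha>"
    and S: "S \<in> commutant_ops (K p\<lparr>carrier := E p \<beta>\<rparr>) (level_projections \<beta> p)"
  then have p: "p \<in> loc_space M" by (simp add: X_loc)
  note S' = S[unfolded level_projections_commutant[OF p]]
  show "S v \<in> E p \<alpha>" if "v \<in> E p \<alpha>" for v using S' ab that by blast
  assume B: "restrict S (E p \<alpha>) \<in> bounded_ops (K p) (E p \<alpha>)"
  show "restrict S (E p \<alpha>) \<in> commutant_ops (K p\<lparr>carrier := E p \<alpha>\<rparr>) (level_projections \<alpha> p)"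
    unfolding level_projections_commutant[OF p]
  proof (intro conjI allI impI ballI B)
    fix \<gamma> assume g: "\<gamma> \<le> \<alpha>"
    then have gb: "\<gamma> \<le> \<beta>" using ab by (rule order_trans)
    show "restrict S (E p \<alpha>) x \<in> E p \<gamma>" if "x \<in> E p \<gamma>" for x
      using S' gb that fibre(3)[OF p g] by auto
    fix x y assume x: "x \<in> E p \<alpha>" and o: "\<forall>y\<in>E p \<gamma>. ip (K p) x y = 0" and y: "y \<in> E p \<gamma>"
    have "x \<in> E p \<beta>" using x fibre(3)[OF p ab] by auto
    then have "ip (K p) (S x) y = 0" using S' gb o y by blast
    then show "ip (K p) (restrict S (E p \<alpha>) x) y = 0" using x by simp
  qed
qed

end

section \<open>The diagonalizable algebra\<close>

lemma (in inner_product_space) smult_zero: "c \<odot>\<^bsub>V\<^esub> \<zero>\<^bsub>V\<^esub> = \<zero>\<^bsub>V\<^esub>"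
  by (rule vec_eqI) (auto simp: ip_expand)

lemma (in inner_product_space) smult_cancel:
  assumes "x \<in> carrier V" "x \<noteq> \<zero>\<^bsub>V\<^esub>" "c \<odot>\<^bsub>V\<^esub> x = d \<odot>\<^bsub>V\<^esub> x"
  shows "c = d"
proof -
  have "c * ip V x x = d * ip V x x"
    using arg_cong[OF assms(3), of "\<lambda>y. ip V y x"] assms(1) by (simp add: ip_smult_left)
  moreover have "ip V x x \<noteq> 0" using ip_pos[OF assms(1,2)] by auto
  ultimately show ?thesis by simp
qed

context loc_integral
begin

text \<open>Scalar operators are written as a commutant so that the criterion for commutants covers
  the diagonalizable algebra too.\<close>

abbreviation scalars :: "'i \<Rightarrow> 'x \<Rightarrow> ('h \<Rightarrow> 'h) set" where
  "scalars \<alpha> p \<equiv> commutant_ops (K p\<lparr>carrier := E p \<alpha>\<rparr>) (hilbert.contractions (K p\<lparr>carrier := E p \<alpha>\<rparr>))"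

lemma scalarsD:
  assumes p: "p \<in> loc_space M" and S: "S \<in> scalars \<alpha> p"
  shows "S \<in> bounded_ops (K p) (E p \<alpha>)" "\<exists>c. \<forall>v\<in>E p \<alpha>. S v = c \<odot>\<^bsub>K p\<^esub> v"
proof -
  interpret Kp: hilbert "K p\<lparr>carrier := E p \<alpha>\<rparr>" by (rule fibre_hilb[OF p])
  show "S \<in> bounded_ops (K p) (E p \<alpha>)" using S by (simp add: commutant_ops_def)
  show "\<exists>c. \<forall>v\<in>E p \<alpha>. S v = c \<odot>\<^bsub>K p\<^esub> v"
  proof (rule Kp.commutant_contractionsD[OF S])
    fix c assume "\<And>x. x \<in> carrier (K p\<lparr>carrier := E p \<alpha>\<rparr>) \<Longrightarrow> S x = c \<odot>\<^bsub>K p\<lparr>carrier := E p \<alpha>\<rparr>\<^esub> x"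
    then show ?thesis by (intro exI[of _ c]) simp
  qed
qed

lemma scalarsI:
  assumes p: "p \<in> loc_space M" and S: "S \<in> bounded_ops (K p) (E p \<alpha>)" "\<And>v. v \<in> E p \<alpha> \<Longrightarrow> S v = c \<odot>\<^bsub>K p\<^esub> v"
  shows "S \<in> scalars \<alpha> p"
proof -
  interpret Kp: hilbert "K p\<lparr>carrier := E p \<alpha>\<rparr>" by (rule fibre_hilb[OF p])
  show ?thesis by (rule Kp.scalar_in_commutant[of _ c]) (use S in simp_all)
qed

text \<open>On each level the multiplier is a quotient of measurable functions. For countably many levels these
  quotients are glued along an enumeration; for the counting measure nothing has to be measurable.\<close>

lemma multiplier_exists:
  assumes T: "T \<in> loc_bounded_ops V L"
    and d: "\<And>\<alpha>. DI.decomposes \<alpha> (restrict T (L \<alpha>)) (S \<alpha>)"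
    and c: "\<And>\<alpha> p v. p \<in> X \<alpha> \<Longrightarrow> v \<in> E p \<alpha> \<Longrightarrow> S \<alpha> p v = c \<alpha> p \<odot>\<^bsub>K p\<^esub> v"
    and S: "\<And>\<alpha> p. p \<in> X \<alpha> \<Longrightarrow> S \<alpha> p \<in> bounded_ops (K p) (E p \<alpha>)"
  shows "\<exists>f\<in>borel_measurable \<mu>. AE p in \<mu>. \<forall>\<alpha>. p \<in> X \<alpha> \<longrightarrow> (\<exists>v\<in>E p \<alpha>. v \<noteq> \<zero>\<^bsub>K p\<^esub>) \<longrightarrow> f p = c \<alpha> p"
proof -
  interpret V: directed_levels V L by (rule V_directed)
  \<comment> \<open>The operator determines the multiplier only where the level of the fibre is
    nonzero; elsewhere the value of \<open>c\<close> is arbitrary.\<close>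
  define nz where "nz = (\<lambda>\<alpha> p. p \<in> X \<alpha> \<and> (\<exists>v\<in>E p \<alpha>. v \<noteq> \<zero>\<^bsub>K p\<^esub>))"
  have "AE p in \<mu>. \<forall>\<alpha> \<beta>. \<alpha> \<le> \<beta> \<longrightarrow> p \<in> X \<alpha> \<longrightarrow> (\<forall>v\<in>E p \<alpha>. S \<beta> p v = S \<alpha> p v)"
  proof (rule coherent_decompositions[OF T S _ d])
    fix \<alpha> \<beta> p v assume ab: "\<alpha> \<le> \<beta>" and p: "p \<in> X \<alpha>" and v: "v \<in> E p \<alpha>"
    interpret Kp: directed_levels "K p" "E p" by (rule fibre_directed[OF X_loc[OF p]])
    have "S \<beta> p v = c \<beta> p \<odot>\<^bsub>K p\<^esub> v" using c[OF X_mono[OF ab p]] fibre(3)[OF X_loc[OF p] ab] v by auto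
    then show "S \<beta> p v \<in> E p \<alpha>" using Kp.level_closed(2)[OF v] by simp
  qed
  then have coh: "AE p in \<mu>. \<forall>\<alpha> \<beta>. nz \<alpha> p \<longrightarrow> nz \<beta> p \<longrightarrow> c \<alpha> p = c \<beta> p"
  proof eventually_elim
    case (elim p)
    have up: "c \<gamma> p = c \<alpha> p" if ag: "\<alpha> \<le> \<gamma>" and n: "nz \<alpha> p" for \<alpha> \<gamma>
    proof -
      from n obtain v where p: "p \<in> X \<alpha>" and v: "v \<in> E p \<alpha>" "v \<noteq> \<zero>\<^bsub>K p\<^esub>" by (auto simp: nz_def)
      interpret Kp: directed_levels "K p" "E p" by (rule fibre_directed[OF X_loc[OF p]])
      have "S \<gamma> p v = S \<alpha> p v" using elim ag p v(1) by simp
      moreover have "S \<gamma> p v = c \<gamma> p \<odot>\<^bsub>K p\<^esub> v" using c[OF X_mono[OF ag p]] fibre(3)[OF X_loc[OF p] ag] v(1) by auto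
      ultimately show ?thesis
        using c[OF p v(1)] Kp.smult_cancel[OF Kp.level_carrier[OF v(1)] v(2)] by simp
    qed
    show ?case
    proof (intro allI impI)
      fix \<alpha> \<beta> assume "nz \<alpha> p" "nz \<beta> p"
      moreover obtain \<gamma> where "\<alpha> \<le> \<gamma>" "\<beta> \<le> \<gamma>" by (rule upper)
      ultimately show "c \<alpha> p = c \<beta> p" using up[of \<alpha> \<gamma>] up[of \<beta> \<gamma>] by simp
    qed
  qed
  show ?thesis using alternative
  proof
    assume cs: "\<mu> = count_space (loc_space M)"
    \<comment> \<open>Almost everywhere, any level with a nonzero fibre gives the same value, by
      \<open>coh\<close>.\<close>
    define f where "f = (\<lambda>p. c (SOME \<alpha>. nz \<alpha> p) p)"
    have "f \<in> borel_measurable (count_space (loc_space M))" by simp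
    then have fm: "f \<in> borel_measurable \<mu>" unfolding cs .
    show ?thesis
    proof (rule bexI[OF _ fm])
      show "AE p in \<mu>. \<forall>\<alpha>. p \<in> X \<alpha> \<longrightarrow> (\<exists>v\<in>E p \<alpha>. v \<noteq> \<zero>\<^bsub>K p\<^esub>) \<longrightarrow> f p = c \<alpha> p"
        using coh
      proof eventually_elim
        case (elim p)
        show ?case
        proof (intro allI impI)
          fix \<alpha> assume "p \<in> X \<alpha>" "\<exists>v\<in>E p \<alpha>. v \<noteq> \<zero>\<^bsub>K p\<^esub>"
          then have n: "nz \<alpha> p" by (simp add: nz_def)
          have "nz (SOME \<alpha>. nz \<alpha> p) p" using n by (rule someI)
          then show "f p = c \<alpha> p" using elim n unfolding f_def by blast
        qed
      qed
    qed
  next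
    assume "countable (UNIV :: 'i set)"
    then have ci: "countable (UNIV :: ('i \<times> nat) set)"
      using countable_SIGMA[of "UNIV :: 'i set" "\<lambda>_. UNIV :: nat set"] by (simp add: UNIV_Times_UNIV)
    define e where "e = from_nat_into (UNIV :: ('i \<times> nat) set)"
    have e_surj: "\<exists>j. e j = a" for a using from_nat_into_surj[OF ci, of a] by (simp add: e_def)
    let ?x = "\<lambda>a p. EV (fst a) (DI.dense_seq (fst a) (snd a)) p"
    let ?y = "\<lambda>a p. EV (fst a) (T (DI.dense_seq (fst a) (snd a))) p"
    have xL: "DI.dense_seq \<alpha> n \<in> L \<alpha>" for \<alpha> n using DI.dense_seq_in[of \<alpha> n] by simp
    have TxL: "T (DI.dense_seq \<alpha> n) \<in> L \<alpha>" for \<alpha> n by (rule loc_bounded_opsD(3)[OF T xL])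
    \<comment> \<open>Where a vector x has the image c x, the quotient <c x, x> / <x, x> recovers
      c.\<close>
    define den where "den = (\<lambda>a p. ip (K p) (?x a p) (?x a p))"
    define num where "num = (\<lambda>a p. ip (K p) (?y a p) (?x a p))"
    have [measurable]: "den a \<in> borel_measurable (M (fst a))" "num a \<in> borel_measurable (M (fst a))" for a
      using DI.ip_integrable[of "DI.dense_seq (fst a) (snd a)" "fst a" "DI.dense_seq (fst a) (snd a)"]
        DI.ip_integrable[of "T (DI.dense_seq (fst a) (snd a))" "fst a" "DI.dense_seq (fst a) (snd a)"] xL TxL
      by (auto simp: den_def num_def)
    define Q where "Q = (\<lambda>a. {p \<in> X (fst a). den a p \<noteq> 0})"
    have Qs: "Q a \<in> sets \<mu>" for a
    proof -
      have "Q a \<in> sets (M (fst a))" unfolding Q_def by measurable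
      then show ?thesis using sets_level_loc by (simp add: \<mu>_sets)
    qed
    define r where "r = (\<lambda>a p. if p \<in> X (fst a) then num a p / den a p else 0)"
    have rm: "r a \<in> borel_measurable \<mu>" for a
    proof -
      have "(\<lambda>p. num a p / den a p) \<in> borel_measurable (M (fst a))" by measurable
      then have "(\<lambda>p. num a p / den a p) \<in> borel_measurable (restrict_space \<mu> (X (fst a)))"
        by (simp only: level_restrict_space[symmetric])
      then show ?thesis unfolding r_def
        by (subst (asm) measurable_restrict_space_iff[where c = 0]) (use space_level_sets in auto)
    qed
    \<comment> \<open>The first pair of a level and an index whose vector is nonzero at
      \<open>p\<close>. As the least index among countably many measurable conditions it is
      measurable, so the quotients can be glued along it.\<close>
    define k where "k = (\<lambda>p. LEAST j. p \<in> Q (e j))"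
    define f where "f = (\<lambda>p. r (e (k p)) p)"
    have "k \<in> measurable \<mu> (count_space UNIV)" unfolding k_def
    proof (rule measurable_Least)
      fix j
      note [measurable] = Qs[of "e j"]
      show "Measurable.pred \<mu> (\<lambda>p. p \<in> Q (e j))" by measurable
    qed
    then have fm: "f \<in> borel_measurable \<mu>" unfolding f_def
      by (rule measurable_compose_countable[rotated]) (rule rm)
    have tot: "AE p in \<mu>. \<forall>\<alpha>. p \<in> X \<alpha> \<longrightarrow> hilbert.total (K p\<lparr>carrier := E p \<alpha>\<rparr>) (\<lambda>n. EV \<alpha> (DI.dense_seq \<alpha> n) p)"
    proof (rule AE_all_levels)
      fix \<alpha>
      show "AE p in \<mu>. p \<in> X \<alpha> \<longrightarrow> hilbert.total (K p\<lparr>carrier := E p \<alpha>\<rparr>) (\<lambda>n. EV \<alpha> (DI.dense_seq \<alpha> n) p)"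
        using DI.AE_total[of \<alpha>] by (simp add: AE_level_iff)
    qed
    have mult: "AE p in \<mu>. \<forall>\<alpha>. \<forall>n. p \<in> X \<alpha> \<longrightarrow> EV \<alpha> (T (DI.dense_seq \<alpha> n)) p = c \<alpha> p \<odot>\<^bsub>K p\<^esub> EV \<alpha> (DI.dense_seq \<alpha> n) p"
    proof (rule AE_all_levels)
      fix \<alpha>
      have "AE p in \<mu>. p \<in> X \<alpha> \<longrightarrow> EV \<alpha> (T (DI.dense_seq \<alpha> n)) p = c \<alpha> p \<odot>\<^bsub>K p\<^esub> EV \<alpha> (DI.dense_seq \<alpha> n) p" for n
      proof -
        have "AE p in \<mu>. p \<in> X \<alpha> \<longrightarrow> EV \<alpha> (T (DI.dense_seq \<alpha> n)) p = S \<alpha> p (EV \<alpha> (DI.dense_seq \<alpha> n) p)"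
          using DI.decomposesD[OF d[of \<alpha>], of "DI.dense_seq \<alpha> n"] xL by (simp add: AE_level_iff)
        then show ?thesis by eventually_elim (use c EV_in[OF xL] in simp)
      qed
      then show "AE p in \<mu>. \<forall>n. p \<in> X \<alpha> \<longrightarrow> EV \<alpha> (T (DI.dense_seq \<alpha> n)) p = c \<alpha> p \<odot>\<^bsub>K p\<^esub> EV \<alpha> (DI.dense_seq \<alpha> n) p"
        unfolding AE_all_countable by (rule allI)
    qed
    show ?thesis
    proof (rule bexI[OF _ fm])
      show "AE p in \<mu>. \<forall>\<alpha>. p \<in> X \<alpha> \<longrightarrow> (\<exists>v\<in>E p \<alpha>. v \<noteq> \<zero>\<^bsub>K p\<^esub>) \<longrightarrow> f p = c \<alpha> p"
        using coh tot mult
      proof eventually_elim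
        case (elim p)
        show ?case
        proof (intro allI impI)
          fix \<alpha> assume p: "p \<in> X \<alpha>" and v: "\<exists>v\<in>E p \<alpha>. v \<noteq> \<zero>\<^bsub>K p\<^esub>"
          then have n: "nz \<alpha> p" by (simp add: nz_def)
          interpret Kp: directed_levels "K p" "E p" by (rule fibre_directed[OF X_loc[OF p]])
          interpret Kh: hilbert "K p\<lparr>carrier := E p \<alpha>\<rparr>" by (rule fibre_hilb[OF X_loc[OF p]])
          have tp: "Kh.total (\<lambda>n. EV \<alpha> (DI.dense_seq \<alpha> n) p)" using elim(2) p by simp
          \<comment> \<open>Otherwise the whole dense sequence of level \<alpha> would vanish at
            \<open>p\<close>, against its totality in a nonzero fibre.\<close>
          have "\<exists>j. p \<in> Q (e j)"
          proof (rule ccontr)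
            assume no: "\<not> ?thesis"
            have x0: "EV \<alpha> (DI.dense_seq \<alpha> m) p = \<zero>\<^bsub>K p\<^esub>" for m
            proof (rule ccontr)
              assume "EV \<alpha> (DI.dense_seq \<alpha> m) p \<noteq> \<zero>\<^bsub>K p\<^esub>"
              then have "den (\<alpha>, m) p \<noteq> 0"
                using Kp.ip_pos[OF Kp.level_carrier[OF EV_in[OF xL p]]] by (force simp: den_def)
              then have "p \<in> Q (\<alpha>, m)" using p by (simp add: Q_def)
              moreover obtain j where "e j = (\<alpha>, m)" using e_surj by blast
              ultimately show False using no by metis
            qed
            obtain v where v: "v \<in> E p \<alpha>" "v \<noteq> \<zero>\<^bsub>K p\<^esub>" using v by blast
            have "v = \<zero>\<^bsub>K p\<^esub>" using tp v(1) x0 Kp.level_carrier[OF v(1)] by (simp add: Kh.total_def)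
            then show False using v(2) by simp
          qed
          then have Qk: "p \<in> Q (e (k p))" unfolding k_def by (rule LeastI_ex)
          obtain \<beta> m where e: "e (k p) = (\<beta>, m)" by (cases "e (k p)")
          have pb: "p \<in> X \<beta>" and den: "den (\<beta>, m) p \<noteq> 0" using Qk by (auto simp: Q_def e)
          have xE: "EV \<beta> (DI.dense_seq \<beta> m) p \<in> E p \<beta>" by (rule EV_in[OF xL pb])
          have x0: "EV \<beta> (DI.dense_seq \<beta> m) p \<noteq> \<zero>\<^bsub>K p\<^esub>"
          proof
            assume "EV \<beta> (DI.dense_seq \<beta> m) p = \<zero>\<^bsub>K p\<^esub>"
            then show False using den by (simp add: den_def)
          qed
          have "num (\<beta>, m) p = c \<beta> p * den (\<beta>, m) p"
            using elim(3) pb Kp.level_carrier[OF xE] by (simp add: num_def den_def Kp.ip_smult_left)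
          then have "f p = c \<beta> p" using pb den by (simp add: f_def e r_def)
          moreover have "nz \<beta> p" using pb xE x0 by (auto simp: nz_def)
          then have "c \<beta> p = c \<alpha> p" by (rule elim(1)[rule_format, OF _ n])
          ultimately show "f p = c \<alpha> p" by simp
        qed
      qed
    qed
  qed
qed

text \<open>Scalar fibres on the levels give one multiplier per level; the substance of the converse
  is a single measurable multiplier for all levels, which \<open>multiplier_exists\<close>
  supplies.\<close>

lemma diagonalizable_iff:
  "T \<in> diagonalizable_ops M K E D \<longleftrightarrow> T \<in> loc_bounded_ops V L \<and>
    (\<forall>\<alpha>. restrict T (L \<alpha>) \<in> DI.decomposable_over \<alpha> (scalars \<alpha>))"
    (is "?lhs \<longleftrightarrow> ?rhs")
proof
  interpret V: directed_levels V L by (rule V_directed)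
  assume l: ?lhs
  then have T: "T \<in> loc_bounded_ops V L" by (simp add: diagonalizable_ops_def decomposable_ops_def)
  obtain f where f: "\<forall>U\<in>carrier V. \<forall>u\<in>U. \<forall>w\<in>T U. AE p in \<mu>. w p = f p \<odot>\<^bsub>K p\<^esub> u p"
    using l unfolding diagonalizable_ops_def by blast
  show ?rhs
  proof (intro conjI allI T DI.decomposable_overI)
    fix \<alpha>
    show "restrict T (L \<alpha>) \<in> bounded_ops (V\<lparr>carrier := L \<alpha>\<rparr>) (carrier (V\<lparr>carrier := L \<alpha>\<rparr>))"
      using V.restrict_bounded[OF T] by simp
    show "DI.decomposes \<alpha> (restrict T (L \<alpha>)) (\<lambda>p. restrict (\<lambda>v. f p \<odot>\<^bsub>K p\<^esub> v) (E p \<alpha>))"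
      by (rule decomposes_levelI[OF T]) (use f in simp)
    fix p assume "p \<in> X \<alpha>"
    then have p: "p \<in> loc_space M" by (rule X_loc)
    interpret Kp: directed_levels "K p" "E p" by (rule fibre_directed[OF p])
    have "restrict (\<lambda>v\<in>dom_of (E p). f p \<odot>\<^bsub>K p\<^esub> v) (E p \<alpha>) \<in> bounded_ops (K p) (E p \<alpha>)"
      by (rule Kp.restrict_bounded[OF Kp.scalar_loc_bounded])
    moreover have "restrict (\<lambda>v\<in>dom_of (E p). f p \<odot>\<^bsub>K p\<^esub> v) (E p \<alpha>) = restrict (\<lambda>v. f p \<odot>\<^bsub>K p\<^esub> v) (E p \<alpha>)"
      by (auto simp: fun_eq_iff)
    ultimately have "restrict (\<lambda>v. f p \<odot>\<^bsub>K p\<^esub> v) (E p \<alpha>) \<in> bounded_ops (K p) (E p \<alpha>)" by simp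
    then show "restrict (\<lambda>v. f p \<odot>\<^bsub>K p\<^esub> v) (E p \<alpha>) \<in> scalars \<alpha> p"
      by (rule scalarsI[OF p, where c = "f p"]) simp
  qed
next
  assume r: ?rhs
  then have T: "T \<in> loc_bounded_ops V L" by simp
  have "\<exists>S. DI.decomposes \<alpha> (restrict T (L \<alpha>)) S \<and> (\<forall>p\<in>X \<alpha>. S p \<in> scalars \<alpha> p)" for \<alpha>
    using r by (simp add: DI.decomposable_over_def) blast
  then obtain S where d: "\<And>\<alpha>. DI.decomposes \<alpha> (restrict T (L \<alpha>)) (S \<alpha>)"
    and SC: "\<And>\<alpha>. \<forall>p\<in>X \<alpha>. S \<alpha> p \<in> scalars \<alpha> p" by metis
  have SB: "S \<alpha> p \<in> bounded_ops (K p) (E p \<alpha>)" if "p \<in> X \<alpha>" for \<alpha> p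
    by (rule scalarsD(1)[OF X_loc[OF that]]) (use SC[of \<alpha>] that in simp)
  define c where "c = (\<lambda>\<alpha> p. SOME c. \<forall>v\<in>E p \<alpha>. S \<alpha> p v = c \<odot>\<^bsub>K p\<^esub> v)"
  have c: "S \<alpha> p v = c \<alpha> p \<odot>\<^bsub>K p\<^esub> v" if p: "p \<in> X \<alpha>" and v: "v \<in> E p \<alpha>" for \<alpha> p v
  proof -
    have "\<exists>c. \<forall>v\<in>E p \<alpha>. S \<alpha> p v = c \<odot>\<^bsub>K p\<^esub> v"
      by (rule scalarsD(2)[OF X_loc[OF p]]) (use SC[of \<alpha>] p in simp)
    from someI_ex[OF this] show ?thesis unfolding c_def using v by (rule bspec)
  qed
  obtain f where fm: "f \<in> borel_measurable \<mu>"
    and f: "AE p in \<mu>. \<forall>\<alpha>. p \<in> X \<alpha> \<longrightarrow> (\<exists>v\<in>E p \<alpha>. v \<noteq> \<zero>\<^bsub>K p\<^esub>) \<longrightarrow> f p = c \<alpha> p"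
    using multiplier_exists[OF T d c SB] by auto
  have main: "AE p in \<mu>. w p = f p \<odot>\<^bsub>K p\<^esub> u p" if U: "U \<in> carrier V" and u: "u \<in> U" and w: "w \<in> T U" for U u w
  proof -
    obtain \<alpha> where Ua: "U \<in> L \<alpha>" using U carrier_L by auto
    show ?thesis
      using decomposes_levelD[OF T Ua u w d] f AE_space
    proof eventually_elim
      case (elim p)
      then have p: "p \<in> loc_space M" by (simp add: \<mu>_space)
      interpret Kp: directed_levels "K p" "E p" by (rule fibre_directed[OF p])
      show ?case
      \<comment> \<open>Where \<open>u p\<close> is 0 the multiplier may be undetermined, but both
        sides are 0.\<close>
      proof (cases "p \<in> X \<alpha> \<and> u p \<noteq> \<zero>\<^bsub>K p\<^esub>")
        case True
        then have "f p = c \<alpha> p" using elim(1,2) by auto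
        then show ?thesis using elim(1) True c by simp
      next
        case False
        then show ?thesis using elim(1) c[of p \<alpha> "u p"] by (auto simp: Kp.smult_zero split: if_splits)
      qed
    qed
  qed
  have "T \<in> decomposable_ops M K E D"
    unfolding decomposable_ops_def
  proof (intro CollectI conjI T exI[of _ "\<lambda>p. \<lambda>v\<in>dom_of (E p). f p \<odot>\<^bsub>K p\<^esub> v"] ballI)
    show "(\<lambda>v\<in>dom_of (E p). f p \<odot>\<^bsub>K p\<^esub> v) \<in> loc_bounded_ops (K p) (E p)" if "p \<in> loc_space M" for p
      by (rule directed_levels.scalar_loc_bounded[OF fibre_directed[OF that]])
    fix U u w assume U: "U \<in> carrier V" and u: "u \<in> U" and w: "w \<in> T U"
    from main[OF this] AE_space
    show "AE p in \<mu>. w p = (\<lambda>v\<in>dom_of (E p). f p \<odot>\<^bsub>K p\<^esub> v) (u p)"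
    proof eventually_elim
      case (elim p)
      have "u p \<in> dom_of (E p)" using D_fibre[OF class_memD(1)[OF U u]] elim(2) by (simp only: \<mu>_space)
      then show ?case using elim(1) by (simp del: UN_iff Union_iff)
    qed
  qed
  then show ?lhs using fm main unfolding diagonalizable_ops_def by (intro CollectI conjI bexI[of _ f]) auto
qed

theorem diagonalizable_locally_vN: "locally_von_neumann_algebra V L (diagonalizable_ops M K E D)"
proof (rule locally_von_neumann_of_commutants[OF _ _ _ diagonalizable_iff])
  show "selfadjoint_contractions (K p\<lparr>carrier := E p \<alpha>\<rparr>) (hilbert.contractions (K p\<lparr>carrier := E p \<alpha>\<rparr>))"
    if "p \<in> X \<alpha>" for \<alpha> p
    by (rule hilbert.selfadjoint_contractions_contractions[OF fibre_hilb[OF X_loc[OF that]]])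
  fix \<alpha> \<beta> :: 'i and p S assume ab: "\<alpha> \<le> \<beta>" and pa: "p \<in> X \<alpha>" and S: "S \<in> scalars \<beta> p"
  then have p: "p \<in> loc_space M" by (simp add: X_loc)
  interpret Kp: directed_levels "K p" "E p" by (rule fibre_directed[OF p])
  obtain c where c: "\<forall>v\<in>E p \<beta>. S v = c \<odot>\<^bsub>K p\<^esub> v" using scalarsD(2)[OF p S] by blast
  have ca: "S v = c \<odot>\<^bsub>K p\<^esub> v" if "v \<in> E p \<alpha>" for v using c Kp.mono[OF ab] that by auto
  show "S v \<in> E p \<alpha>" if "v \<in> E p \<alpha>" for v using ca[OF that] Kp.level_closed(2)[OF that] by simp
  assume "restrict S (E p \<alpha>) \<in> bounded_ops (K p) (E p \<alpha>)"
  then show "restrict S (E p \<alpha>) \<in> scalars \<alpha> p" by (rule scalarsI[OF p, where c = c]) (simp add: ca)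
qed

theorem diagonalizable_abelian: "abelian_ops (dom_of L) (diagonalizable_ops M K E D)"
  unfolding abelian_ops_def
proof (intro ballI)
  fix S T assume S: "S \<in> diagonalizable_ops M K E D" and T: "T \<in> diagonalizable_ops M K E D"
  have SL: "S \<in> loc_bounded_ops V L" and TL: "T \<in> loc_bounded_ops V L"
    using S T by (simp_all add: diagonalizable_iff)
  have Sin: "S U \<in> carrier V" if "U \<in> carrier V" for U
    using PiE_mem[OF loc_bounded_opsD(1)[OF SL]] that unfolding carrier_L .
  have Tin: "T U \<in> carrier V" if "U \<in> carrier V" for U
    using PiE_mem[OF loc_bounded_opsD(1)[OF TL]] that unfolding carrier_L .
  obtain f where f: "\<forall>U\<in>carrier V. \<forall>u\<in>U. \<forall>w\<in>S U. AE p in \<mu>. w p = f p \<odot>\<^bsub>K p\<^esub> u p"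
    using S unfolding diagonalizable_ops_def by blast
  obtain g where g: "\<forall>U\<in>carrier V. \<forall>u\<in>U. \<forall>w\<in>T U. AE p in \<mu>. w p = g p \<odot>\<^bsub>K p\<^esub> u p"
    using T unfolding diagonalizable_ops_def by blast
  have "S (T U) = T (S U)" if U: "U \<in> carrier V" for U
  proof -
    obtain u where u: "u \<in> U" using class_nonempty[OF U] by blast
    obtain s where s: "s \<in> S U" using class_nonempty[OF Sin[OF U]] by blast
    obtain t where t: "t \<in> T U" using class_nonempty[OF Tin[OF U]] by blast
    obtain a where a: "a \<in> S (T U)" using class_nonempty[OF Sin[OF Tin[OF U]]] by blast
    obtain b where b: "b \<in> T (S U)" using class_nonempty[OF Tin[OF Sin[OF U]]] by blast
    have 1: "AE p in \<mu>. s p = f p \<odot>\<^bsub>K p\<^esub> u p" using f U u s by blast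
    have 2: "AE p in \<mu>. t p = g p \<odot>\<^bsub>K p\<^esub> u p" using g U u t by blast
    have 3: "AE p in \<mu>. a p = f p \<odot>\<^bsub>K p\<^esub> t p" using f Tin[OF U] t a by blast
    have 4: "AE p in \<mu>. b p = g p \<odot>\<^bsub>K p\<^esub> s p" using g Sin[OF U] s b by blast
    have "AE p in \<mu>. a p = b p"
      using 1 2 3 4 AE_space
    proof eventually_elim
      case (elim p)
      then have p: "p \<in> loc_space M" by (simp add: \<mu>_space)
      interpret Kp: directed_levels "K p" "E p" by (rule fibre_directed[OF p])
      have "u p \<in> carrier (K p)"
        using subsetD[OF Kp.dom_carrier D_fibre[OF class_memD(1)[OF U u] p]] .
      then have "f p \<odot>\<^bsub>K p\<^esub> (g p \<odot>\<^bsub>K p\<^esub> u p) = g p \<odot>\<^bsub>K p\<^esub> (f p \<odot>\<^bsub>K p\<^esub> u p)"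
        by (intro Kp.vec_eqI) (simp_all add: Kp.ip_smult_left)
      then show ?case using elim by simp
    qed
    then show ?thesis by (rule class_eqI[OF Sin[OF Tin[OF U]] a Tin[OF Sin[OF U]] b])
  qed
  then show "compose (dom_of L) S T = compose (dom_of L) T S"
    unfolding carrier_L[symmetric] by (auto simp: compose_def fun_eq_iff)
qed

end

theorem theorem4p6:
  fixes M :: "'i::order \<Rightarrow> 'x measure"
    and K :: "'x \<Rightarrow> 'h ip_space"
    and E :: "'x \<Rightarrow> 'i \<Rightarrow> 'h set"
    and D :: "('x \<Rightarrow> 'h) set"
  assumes directed: "\<forall>\<alpha> \<beta>::'i. \<exists>\<gamma>. \<alpha> \<le> \<gamma> \<and> \<beta> \<le> \<gamma>"
    and measure: "locally_measure_system M"
    and fibres: "\<forall>p\<in>loc_space M. quantized_domain (K p) (E p)"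
    and integral: "loc_direct_integral M K E D"
    and levels: "levels_are_direct_integrals M K E D"
    and alternative:
      "countable (UNIV :: 'i set) \<or> loc_measure M = count_space (loc_space M)"
  shows "locally_von_neumann_algebra (integral_space M K D) (integral_level M K E D)
           (decomposable_ops M K E D) \<and>
         locally_von_neumann_algebra (integral_space M K D) (integral_level M K E D)
           (diagonalizable_ops M K E D) \<and>
         abelian_ops (dom_of (integral_level M K E D)) (diagonalizable_ops M K E D)"
proof -
  interpret loc_integral M K E D
    by (intro loc_integral.intro loc_measure_system.intro loc_integral_axioms.intro assms)
  show ?thesis
    using decomposable_locally_vN diagonalizable_locally_vN diagonalizable_abelian by blast
qed

end
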